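(* Assume $\chi_{\rm res}\le\chi_0<1$ (so that kernel coercivity $\operatorname{Re}a(w,w)\ge c_W\|w\|_k^2$ holds for $w\in\ker I_H$), $\gamma_h(k)>0$, and $m_\ell>0$; the last condition is ensured by $$\frac{C_a^2}{c_W}\Big(\frac{C_{\rm sd}}{c_W}\Theta_\ell\Big)^2\le\rho_{\rm stab}\frac{\gamma_h(k)}{C_FC_I^2},\qquad \frac{C_{\rm sd}}{c_W}\Theta_\ell\le C_{\rm rob}\gamma_h(k),$$ where $0<\rho_{\rm stab}<1$ and $C_{\rm rob}$ are chosen parameters. Then, for every finite-dimensional $\mathcal E\subseteq(X^0)^{\perp_k}$, $$\dim X(\mathcal E)=\dim Y(\mathcal E)=\dim V_H+\dim\mathcal E .$$ The coupled problem (find $U_\mu(\mathcal E)\in X(\mathcal E)$ with $a(U_\mu(\mathcal E),y)=F_\mu(y)$ for all $y\in Y(\mathcal E)$) is uniquely solvable, and its energy-norm inf--sup constant $$\alpha_{\mathcal E}=\inf_{0\ne v\in X(\mathcal E)}\sup_{0\ne y\in Y(\mathcal E)}\frac{|a(v,y)|}{\|v\|_k\|y\|_k}$$ satisfies the enrichment-independent bound $$\alpha_{\mathcal E}\ \ge\ \frac{\min\{m_\ell,c_W\}}{1+L_\ell^2}.$$ Consequently, $$\|u_{h,\mu}-U_\mu(\mathcal E)\|_k\le\Big(1+\frac{C_a(1+L_\ell^2)}{\min\{m_\ell,c_W\}}\Big)\inf_{v\in X(\mathcal E)}\|u_{h,\mu}-v\|_k .$$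
   Context: **Problem.** $\Omega\subset\mathbb R^2$ is a bounded polygonal Lipschitz domain whose (fixed) boundary partition consists of relatively open parts $\Gamma_D,\Gamma_N,\Gamma_R$, disjoint up to endpoints, with $|\Gamma_R|>0$; $k\ge k_{\min}>0$. $V=\{v\in H^1(\Omega;\mathbb C): v|_{\Gamma_D}=0\}$. $L^2$ inner products are linear in the first and conjugate linear in the second argument. For $v,w\in V$, $$b_k(v,w)=(\nabla v,\nabla w)_\Omega+k^2(v,w)_\Omega,\quad \|v\|_k^2=b_k(v,v),\quad a(v,w)=(\nabla v,\nabla w)_\Omega-k^2(v,w)_\Omega-\mathrm i k(v,w)_{\Gamma_R}.$$ $C_a$ is a continuity constant: $|a(v,w)|\le C_a\|v\|_k\|w\|_k$ on $V$. $X^\star$ is the continuous anti-dual of a subspace $X\subseteq V$. $F_\mu\in V^\star$ is a load, indexed by a parameter $\mu$. **Meshes and patches.** $\mathcal T_H$ and its refinement $\mathcal T_h$ are shape-regular conforming triangular meshes resolving the boundary partition; $V_H\subseteq V_h\subset V$ are the associated continuous piecewise affine spaces; $H|_T=H_T=\operatorname{diam}T$ for $T\in\mathcal T_H$; $\mathcal N_H$ is the set of all coarse vertices (including Dirichlet vertices). For a coarse entity or a union of entities $S$: $N^0(S)=S$, $N(S)=\bigcup\{T\in\mathcal T_H:\overline T\cap\overline S\ne\varnothing\}$, $N^m(S)=N(N^{m-1}(S))$; $N^\infty(T)=\Omega$; $C_{\rm patch}(m)=\max_{T}\#\{K\in\mathcal T_H:K\subseteq N^m(T)\}$. **Quasi-interpolation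 and kernel.** $I_H=E_H\Pi_H^{\rm dg}:V\to V_H$, where $\Pi_H^{\rm dg}$ is the elementwise $L^2$ projection onto discontinuous piecewise affine functions and, for coarse vertices $z$, $(E_Hq)(z)=0$ if $z\in\overline{\Gamma_D}$ and $(E_Hq)(z)=\big(\sum_{T\ni z}q|_T(z)|T|\big)/\big(\sum_{T\ni z}|T|\big)$ otherwise; $I_H$ is a projection onto $V_H$. $C_{\rm app}$ is such that $H_T^{-1}\|v-I_Hv\|_{L^2(T)}\le C_{\rm app}\|\nabla v\|_{L^2(N(T))}$, and $C_I$ (depending only on $\chi_0$ and fixed-order patch geometry) is such that $\|I_Hv\|_k\le C_I\|v\|_k$ and $\|v-I_Hv\|_k\le(1+C_I)\|v\|_k$ for $v\in V$. $W_h=\ker I_H\cap V_h$, $\chi_{\rm res}=C_{\rm app}C_{\rm patch}(1)^{1/2}\|kH\|_{L^\infty(\Omega)}$, $c_W=(1-\chi_{\rm res}^2)/(1+\chi_{\rm res}^2)$, $C_F=1+C_a/c_W$. **Fine-grid problem.** $\gamma_h(k)=\inf_{0\ne v_h\in V_h}\sup_{0\ne w_h\in V_h}|a(v_h,w_h)|/(\|v_h\|_k\|w_h\|_k)$. $u_{h,\mu}\in V_h$ solves $a(u_{h,\mu},v_h)=F_\mu(v_h)$ for all $v_h\in V_h$. **Correctors.** Ideal correctors $\mathcal Q_\infty,\mathcal Q_\infty^*:V_h\to W_h$: $a(\mathcal Q_\infty v_h,w)=a(v_h,w)$, $a(w,\mathcal Q_\infty^*v_h)=a(w,v_h)$ for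 all $w\in W_h$. Localized correctors, $\ell\in\mathbb N_0\cup\{\infty\}$: let $a_T$ be $a$ with integrals restricted to $T\in\mathcal T_H$ (Robin integral over $\Gamma_R\cap\overline T$), $W_h(N^\ell(T))=\{w\in W_h:\operatorname{supp}w\subseteq\overline{N^\ell(T)}\}$; for $v_H\in V_H$, $q_{T,\ell}v_H,q_{T,\ell}^*v_H\in W_h(N^\ell(T))$ solve $a(q_{T,\ell}v_H,w)=a_T(v_H,w)$ and $a(w,q_{T,\ell}^*v_H)=a_T(w,v_H)$ for all $w\in W_h(N^\ell(T))$; $\mathcal Q_\ell=\sum_Tq_{T,\ell}$, $\mathcal Q_\ell^*=\sum_Tq_{T,\ell}^*$ on $V_H$ (consistent with the ideal correctors for $\ell=\infty$). $T_\ell=I-\mathcal Q_\ell$, $T_\ell^*=I-\mathcal Q_\ell^*$, $X^0=T_\ell V_H$, $Y^0=T_\ell^*V_H$. **Localization defect and coarse stability.** $\mathcal D_\ell=\mathcal Q_\infty-\mathcal Q_\ell$ and $\mathcal D_\ell^*=\mathcal Q_\infty^*-\mathcal Q_\ell^*$ on $V_H$; $\delta_\ell:=\|\mathcal D_\ell\|_{\mathcal L(V_H,V_h)}=\|\mathcal D_\ell^*\|_{\mathcal L(V_H,V_h)}$, operator norms with respect to $\|\cdot\|_k$ (the two coincide, since the primal and adjoint correctors are related by complex conjugation). $\widehat\alpha_{H,\infty}=\inf_{0\ne p_H\in V_H}\sup_{0\ne q_H\in V_H}|a(T_\infty p_H,T_\infty^*q_H)|/(\|p_H\|_k\|q_H\|_k)$.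 Further $$\lambda_W=\frac{C_a}{c_W},\qquad L_\ell=C_F+\lambda_W\delta_\ell,\qquad m_\ell=\widehat\alpha_{H,\infty}-\frac{C_a^2}{c_W}\delta_\ell^2 .$$ **Computable quantity $\Theta_\ell$.** For $z\in\mathcal N_H$, $W_{h,z}=\{w\in W_h:\operatorname{supp}w\subseteq\overline{N^2(z)}\}$. $C_{\rm sd}$ is a constant (depending only on $\chi_0$, mesh shape regularity and fixed-order patch overlap) such that every $w\in W_h$ can be written $w=\sum_{z\in\mathcal N_H}w_z$, $w_z\in W_{h,z}$, with $\sum_z\|w_z\|_k^2\le C_{\rm sd}^2\|w\|_k^2$. For $G\in V_h^\star$, $\xi_z(G)\in W_{h,z}$ is defined by $b_k(\xi_z(G),w)=G(w)$ for $w\in W_{h,z}$, and $\eta(G)^2=\sum_{z\in\mathcal N_H}\|\xi_z(G)\|_k^2$. $G_\ell(v_H)(w)=\overline{a(w,T_\ell^*v_H)}$ and $\Theta_\ell=\sup_{0\ne v_H\in V_H}\eta(G_\ell(v_H))/\|v_H\|_k$. **Enriched spaces.** $(X^0)^{\perp_k}$ is the $b_k$-orthogonal complement of $X^0$ in $V_h$. $\mathscr J_\ell=I-T_\ell I_H:V_h\to W_h$ (a projection onto $W_h$ along $X^0$). For $\mathcal E\subseteq(X^0)^{\perp_k}$, $\widehat{\mathcal E}=\mathscr J_\ell\mathcal E$, $X(\mathcal E)=X^0\oplus\mathcal E=X^0\oplus\widehat{\mathcal E}$, $Y(\mathcal E)=Y^0\oplus\widehat{\mathcal E}$. *)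

theory Defs
  imports "HOL-Analysis.Analysis" "HOL-Library.Function_Algebras" "HOL-Library.Extended_Nat"
begin

type_synonym pt = "real^2"
type_synonym cfun = "real^2 \<Rightarrow> complex"

definition fscale :: "complex \<Rightarrow> cfun \<Rightarrow> cfun" where
  "fscale c f = (\<lambda>x. c * f x)"

interpretation cvs: vector_space fscale
  by unfold_locales (auto simp: fscale_def fun_eq_iff algebra_simps)

section \<open>Geometry\<close>

text \<open>
  A side is a pair of distinct endpoints. The boundary parts are the unions of the open
  segments spanned by the sides carrying the given label; a part that passes through a vertex of
  the polygon is thereby described up to finitely many points, which changes neither its closure
  nor any integral over it.
\<close>

record helmholtz_data =
  Omega :: "pt set"
  sidesD :: "(pt \<times> pt) set"
  sidesN :: "(pt \<times> pt) set"
  sidesR :: "(pt \<times> pt) set"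
  mesh_H :: "pt set set"
  mesh_h :: "pt set set"
  wavenumber :: real

definition boundary_part :: "(pt \<times> pt) set \<Rightarrow> pt set" where
  "boundary_part S = (\<Union>(a, b)\<in>S. open_segment a b)"

definition boundary_length :: "(pt \<times> pt) set \<Rightarrow> real" where
  "boundary_length S = (\<Sum>(a, b)\<in>S. dist a b)"

definition lipschitz_domain :: "pt set \<Rightarrow> bool" where
  "lipschitz_domain \<Omega> \<longleftrightarrow> open \<Omega> \<and> connected \<Omega> \<and> \<Omega> \<noteq> {} \<and>
    (\<forall>p\<in>frontier \<Omega>. \<exists>u v \<gamma> L r h.
        norm u = 1 \<and> norm v = 1 \<and> u \<bullet> v = 0 \<and> 0 < r \<and> 0 < h \<and>
        L-lipschitz_on UNIV \<gamma> \<and> \<gamma> 0 = (0::real) \<and>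
        (\<forall>s t. \<bar>s\<bar> < r \<and> \<bar>t\<bar> < h \<longrightarrow> (p + s *\<^sub>R u + t *\<^sub>R v \<in> \<Omega> \<longleftrightarrow> \<gamma> s < t)))"

definition polygonal_partition :: "helmholtz_data \<Rightarrow> bool" where
  "polygonal_partition P \<longleftrightarrow>
     lipschitz_domain (Omega P) \<and> bounded (Omega P) \<and>
     finite (sidesD P) \<and> finite (sidesN P) \<and> finite (sidesR P) \<and>
     sidesD P \<inter> sidesN P = {} \<and> sidesD P \<inter> sidesR P = {} \<and> sidesN P \<inter> sidesR P = {} \<and>
     (let S = sidesD P \<union> sidesN P \<union> sidesR P in
        (\<forall>(a, b)\<in>S. a \<noteq> b) \<and>
        frontier (Omega P) = (\<Union>(a, b)\<in>S. closed_segment a b) \<and>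
        (\<forall>(a, b)\<in>S. \<forall>(c, d)\<in>S. (a, b) \<noteq> (c, d) \<longrightarrow> open_segment a b \<inter> closed_segment c d = {})) \<and>
     boundary_length (sidesR P) > 0"

text \<open>Elements are closed triangles. The library notion \<^const>\<open>triangulation\<close> already
  requires the intersection of any two elements to be a common face (possibly empty).\<close>

definition conforming_mesh :: "helmholtz_data \<Rightarrow> pt set set \<Rightarrow> bool" where
  "conforming_mesh P \<T> \<longleftrightarrow>
     triangulation \<T> \<and> (\<forall>T\<in>\<T>. 2 simplex T) \<and> \<Union>\<T> = closure (Omega P) \<and>
     (\<forall>S\<in>{sidesD P, sidesN P, sidesR P}.
        \<exists>F. (\<forall>e\<in>F. \<exists>T\<in>\<T>. e edge_of T) \<and> closure (boundary_part S) = \<Union>F)"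

definition shape_regular :: "real \<Rightarrow> pt set set \<Rightarrow> bool" where
  "shape_regular \<kappa> \<T> \<longleftrightarrow> (\<forall>T\<in>\<T>. \<exists>x r. 0 < r \<and> cball x r \<subseteq> T \<and> diameter T \<le> \<kappa> * r)"

definition refines :: "pt set set \<Rightarrow> pt set set \<Rightarrow> bool" where
  "refines \<T>' \<T> \<longleftrightarrow> (\<forall>T'\<in>\<T>'. \<exists>T\<in>\<T>. T' \<subseteq> T)"

definition helmholtz_setting :: "real \<Rightarrow> helmholtz_data \<Rightarrow> bool" where
  "helmholtz_setting \<kappa> P \<longleftrightarrow>
     polygonal_partition P \<and> conforming_mesh P (mesh_H P) \<and> conforming_mesh P (mesh_h P) \<and>
     refines (mesh_h P) (mesh_H P) \<and> shape_regular \<kappa> (mesh_H P) \<and> shape_regular \<kappa> (mesh_h P)"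

definition coarse_vertices :: "helmholtz_data \<Rightarrow> pt set" where
  "coarse_vertices P = {z. \<exists>T\<in>mesh_H P. z extreme_point_of T}"

definition layer :: "helmholtz_data \<Rightarrow> pt set \<Rightarrow> pt set" where
  "layer P S = \<Union>{T \<in> mesh_H P. closure T \<inter> closure S \<noteq> {}}"

definition patch :: "helmholtz_data \<Rightarrow> nat \<Rightarrow> pt set \<Rightarrow> pt set" where
  "patch P m S = (layer P ^^ m) S"

definition elem_patch :: "helmholtz_data \<Rightarrow> enat \<Rightarrow> pt set \<Rightarrow> pt set" where
  "elem_patch P l T = (case l of enat m \<Rightarrow> patch P m T | \<infinity> \<Rightarrow> Omega P)"

definition C_patch :: "helmholtz_data \<Rightarrow> nat \<Rightarrow> nat" where
  "C_patch P m = Max ((\<lambda>T. card {K \<in> mesh_H P. K \<subseteq> patch P m T}) ` mesh_H P)"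

section \<open>The Sobolev space\<close>

definition L2_on :: "pt set \<Rightarrow> cfun \<Rightarrow> bool" where
  "L2_on \<Omega> v \<longleftrightarrow> set_borel_measurable lborel \<Omega> v \<and> set_integrable lborel \<Omega> (\<lambda>x. (cmod (v x))\<^sup>2)"

definition partial :: "2 \<Rightarrow> (pt \<Rightarrow> real) \<Rightarrow> pt \<Rightarrow> real" where
  "partial i \<phi> x = frechet_derivative \<phi> (at x) (axis i 1)"

definition C1_compact :: "pt set \<Rightarrow> (pt \<Rightarrow> real) \<Rightarrow> bool" where
  "C1_compact \<Omega> \<phi> \<longleftrightarrow>
     (\<forall>x. \<phi> differentiable (at x)) \<and> (\<forall>i. continuous_on UNIV (partial i \<phi>)) \<and>
     compact (closure {x. \<phi> x \<noteq> 0}) \<and> closure {x. \<phi> x \<noteq> 0} \<subseteq> \<Omega>"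

definition weak_gradient :: "pt set \<Rightarrow> cfun \<Rightarrow> (pt \<Rightarrow> complex^2) \<Rightarrow> bool" where
  "weak_gradient \<Omega> v g \<longleftrightarrow>
     (\<forall>i. L2_on \<Omega> (\<lambda>x. g x $ i)) \<and>
     (\<forall>\<phi>. C1_compact \<Omega> \<phi> \<longrightarrow> (\<forall>i.
        (LINT x:\<Omega>|lborel. v x * of_real (partial i \<phi> x)) = - (LINT x:\<Omega>|lborel. g x $ i * of_real (\<phi> x))))"

definition H1 :: "pt set \<Rightarrow> cfun set" where
  "H1 \<Omega> = {v. L2_on \<Omega> v \<and> (\<exists>g. weak_gradient \<Omega> v g)}"

text \<open>Members of \<^term>\<open>H1 \<Omega>\<close> are representatives; the weak gradient is unique up to null sets and all
  forms below depend on it only through integrals.\<close>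

definition grad :: "helmholtz_data \<Rightarrow> cfun \<Rightarrow> pt \<Rightarrow> complex^2" where
  "grad P v = (SOME g. weak_gradient (Omega P) v g)"

text \<open>
  On a bounded Lipschitz domain the trace of an \<open>H\<^sup>1\<close> function at almost every boundary point is its
  Lebesgue value from inside, i.e. the limit of averages over \<open>B(x,r) \<inter> \<Omega>\<close>
  (Evans and Gariepy, Measure Theory and Fine Properties of Functions, Section 5.3).
  For functions continuous up to the boundary it is the restriction.
\<close>

definition has_trace :: "pt set \<Rightarrow> cfun \<Rightarrow> pt \<Rightarrow> complex \<Rightarrow> bool" where
  "has_trace \<Omega> v x c \<longleftrightarrow>
     ((\<lambda>r. (LINT y:ball x r \<inter> \<Omega>|lborel. cmod (v y - c)) / measure lborel (ball x r \<inter> \<Omega>)) \<longlongrightarrow> 0) (at_right 0)"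

definition bd_trace :: "pt set \<Rightarrow> cfun \<Rightarrow> pt \<Rightarrow> complex" where
  "bd_trace \<Omega> v x = (if \<exists>c. has_trace \<Omega> v x c then THE c. has_trace \<Omega> v x c else 0)"

definition V_space :: "helmholtz_data \<Rightarrow> cfun set" where
  "V_space P = {v \<in> H1 (Omega P). \<forall>(a, b)\<in>sidesD P.
     AE t in lborel. t \<in> {0..1} \<longrightarrow> has_trace (Omega P) v (a + t *\<^sub>R (b - a)) 0}"

text \<open>Arc-length integral over the points of the sides \<open>S\<close> that lie in \<open>A\<close>.\<close>

definition boundary_integral :: "(pt \<times> pt) set \<Rightarrow> pt set \<Rightarrow> cfun \<Rightarrow> complex" where
  "boundary_integral S A f = (\<Sum>(a, b)\<in>S. of_real (dist a b) *
     (LINT t:{t \<in> {0..1}. a + t *\<^sub>R (b - a) \<in> A}|lborel. f (a + t *\<^sub>R (b - a))))"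

section \<open>Forms and norms\<close>

definition ip_L2 :: "helmholtz_data \<Rightarrow> pt set \<Rightarrow> cfun \<Rightarrow> cfun \<Rightarrow> complex" where
  "ip_L2 P S v w = (LINT x:Omega P \<inter> S|lborel. v x * cnj (w x))"

definition ip_grad :: "helmholtz_data \<Rightarrow> pt set \<Rightarrow> cfun \<Rightarrow> cfun \<Rightarrow> complex" where
  "ip_grad P S v w = (LINT x:Omega P \<inter> S|lborel. \<Sum>i\<in>UNIV. grad P v x $ i * cnj (grad P w x $ i))"

definition ip_robin :: "helmholtz_data \<Rightarrow> pt set \<Rightarrow> cfun \<Rightarrow> cfun \<Rightarrow> complex" where
  "ip_robin P S v w =
     boundary_integral (sidesR P) S (\<lambda>x. bd_trace (Omega P) v x * cnj (bd_trace (Omega P) w x))"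

definition norm_L2 :: "helmholtz_data \<Rightarrow> pt set \<Rightarrow> cfun \<Rightarrow> real" where
  "norm_L2 P S v = sqrt (Re (ip_L2 P S v v))"

definition norm_grad :: "helmholtz_data \<Rightarrow> pt set \<Rightarrow> cfun \<Rightarrow> real" where
  "norm_grad P S v = sqrt (Re (ip_grad P S v v))"

definition bform :: "helmholtz_data \<Rightarrow> cfun \<Rightarrow> cfun \<Rightarrow> complex" where
  "bform P v w = ip_grad P UNIV v w + of_real ((wavenumber P)\<^sup>2) * ip_L2 P UNIV v w"

definition norm_k :: "helmholtz_data \<Rightarrow> cfun \<Rightarrow> real" where
  "norm_k P v = sqrt (Re (bform P v v))"

definition aform_on :: "helmholtz_data \<Rightarrow> pt set \<Rightarrow> cfun \<Rightarrow> cfun \<Rightarrow> complex" where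
  "aform_on P S v w = ip_grad P S v w - of_real ((wavenumber P)\<^sup>2) * ip_L2 P S v w
     - \<i> * of_real (wavenumber P) * ip_robin P S v w"

definition aform :: "helmholtz_data \<Rightarrow> cfun \<Rightarrow> cfun \<Rightarrow> complex" where
  "aform P v w = aform_on P UNIV v w"

definition continuity_constant :: "helmholtz_data \<Rightarrow> real \<Rightarrow> bool" where
  "continuity_constant P Ca \<longleftrightarrow> 0 \<le> Ca \<and>
     (\<forall>v\<in>V_space P. \<forall>w\<in>V_space P. cmod (aform P v w) \<le> Ca * norm_k P v * norm_k P w)"

definition antidual :: "helmholtz_data \<Rightarrow> cfun set \<Rightarrow> (cfun \<Rightarrow> complex) set" where
  "antidual P X = {F.
     (\<forall>v\<in>X. \<forall>w\<in>X. F (v + w) = F v + F w) \<and>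
     (\<forall>c. \<forall>v\<in>X. F (fscale c v) = cnj c * F v) \<and>
     (\<exists>C. \<forall>v\<in>X. cmod (F v) \<le> C * norm_k P v)}"

section \<open>Finite element spaces and quasi-interpolation\<close>

definition affine_fun :: "cfun \<Rightarrow> bool" where
  "affine_fun q \<longleftrightarrow> (\<exists>c d e. \<forall>x. q x = c + d * of_real (x $ 1) + e * of_real (x $ 2))"

text \<open>Finite element functions are canonical representatives: continuous on the closed domain
  and zero outside it.\<close>

definition P1_space :: "helmholtz_data \<Rightarrow> pt set set \<Rightarrow> cfun set" where
  "P1_space P \<T> = {v. continuous_on (closure (Omega P)) v \<and>
     (\<forall>T\<in>\<T>. \<exists>q. affine_fun q \<and> (\<forall>x\<in>T. v x = q x)) \<and>
     (\<forall>x\<in>closure (boundary_part (sidesD P)). v x = 0) \<and>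
     (\<forall>x. x \<notin> closure (Omega P) \<longrightarrow> v x = 0)}"

definition V_H :: "helmholtz_data \<Rightarrow> cfun set" where
  "V_H P = P1_space P (mesh_H P)"

definition V_h :: "helmholtz_data \<Rightarrow> cfun set" where
  "V_h P = P1_space P (mesh_h P)"

definition dg_proj :: "helmholtz_data \<Rightarrow> cfun \<Rightarrow> pt set \<Rightarrow> cfun" where
  "dg_proj P v T = (THE q. affine_fun q \<and>
     (\<forall>p. affine_fun p \<longrightarrow> (LINT x:Omega P \<inter> T|lborel. (v x - q x) * cnj (p x)) = 0))"

definition averaging :: "helmholtz_data \<Rightarrow> (pt set \<Rightarrow> cfun) \<Rightarrow> cfun" where
  "averaging P q = (THE v. v \<in> V_H P \<and> (\<forall>z\<in>coarse_vertices P.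
     v z = (if z \<in> closure (boundary_part (sidesD P)) then 0
            else (\<Sum>T\<in>{T \<in> mesh_H P. z \<in> T}. q T z * of_real (measure lborel T)) /
                 of_real (\<Sum>T\<in>{T \<in> mesh_H P. z \<in> T}. measure lborel T))))"

definition I_H :: "helmholtz_data \<Rightarrow> cfun \<Rightarrow> cfun" where
  "I_H P v = averaging P (dg_proj P v)"

definition ker_I :: "helmholtz_data \<Rightarrow> cfun set" where
  "ker_I P = {v \<in> V_space P. I_H P v = 0}"

definition W_h :: "helmholtz_data \<Rightarrow> cfun set" where
  "W_h P = ker_I P \<inter> V_h P"

definition approximation_constant :: "helmholtz_data \<Rightarrow> real \<Rightarrow> bool" where
  "approximation_constant P Capp \<longleftrightarrow> 0 \<le> Capp \<and>
     (\<forall>v\<in>V_space P. \<forall>T\<in>mesh_H P.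
        norm_L2 P T (v - I_H P v) / diameter T \<le> Capp * norm_grad P (patch P 1 T) v)"

definition stability_constant :: "helmholtz_data \<Rightarrow> real \<Rightarrow> bool" where
  "stability_constant P CI \<longleftrightarrow> 0 \<le> CI \<and>
     (\<forall>v\<in>V_space P. norm_k P (I_H P v) \<le> CI * norm_k P v \<and>
                     norm_k P (v - I_H P v) \<le> (1 + CI) * norm_k P v)"

text \<open>\<open>H\<close> is constant on each element, so the \<open>L\<^sup>\<infinity>\<close> norm of \<open>k H\<close> is a maximum over the elements.\<close>

definition chi_res :: "helmholtz_data \<Rightarrow> real \<Rightarrow> real" where
  "chi_res P Capp = Capp * sqrt (real (C_patch P 1)) *
     Max ((\<lambda>T. wavenumber P * diameter T) ` mesh_H P)"

definition c_W :: "helmholtz_data \<Rightarrow> real \<Rightarrow> real" where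
  "c_W P Capp = (1 - (chi_res P Capp)\<^sup>2) / (1 + (chi_res P Capp)\<^sup>2)"

definition C_F :: "helmholtz_data \<Rightarrow> real \<Rightarrow> real \<Rightarrow> real" where
  "C_F P Capp Ca = 1 + Ca / c_W P Capp"

definition lambda_W :: "helmholtz_data \<Rightarrow> real \<Rightarrow> real \<Rightarrow> real" where
  "lambda_W P Capp Ca = Ca / c_W P Capp"

text \<open>Inf-sup constants are extended reals, so that the infimum over the nonzero elements of a
  trivial space is \<open>\<infinity>\<close>.\<close>

definition infsup :: "helmholtz_data \<Rightarrow> cfun set \<Rightarrow> cfun set \<Rightarrow> ereal" where
  "infsup P X Y = (INF v\<in>X - {0}. SUP y\<in>Y - {0}.
     ereal (cmod (aform P v y) / (norm_k P v * norm_k P y)))"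

definition gamma_h :: "helmholtz_data \<Rightarrow> ereal" where
  "gamma_h P = infsup P (V_h P) (V_h P)"

section \<open>Correctors\<close>

definition solve_primal :: "helmholtz_data \<Rightarrow> cfun set \<Rightarrow> (cfun \<Rightarrow> complex) \<Rightarrow> cfun" where
  "solve_primal P W f = (THE u. u \<in> W \<and> (\<forall>w\<in>W. aform P u w = f w))"

definition solve_adjoint :: "helmholtz_data \<Rightarrow> cfun set \<Rightarrow> (cfun \<Rightarrow> complex) \<Rightarrow> cfun" where
  "solve_adjoint P W f = (THE u. u \<in> W \<and> (\<forall>w\<in>W. aform P w u = f w))"

definition Q_ideal :: "helmholtz_data \<Rightarrow> cfun \<Rightarrow> cfun" where
  "Q_ideal P v = solve_primal P (W_h P) (\<lambda>w. aform P v w)"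

definition Q_ideal_adj :: "helmholtz_data \<Rightarrow> cfun \<Rightarrow> cfun" where
  "Q_ideal_adj P v = solve_adjoint P (W_h P) (\<lambda>w. aform P w v)"

definition W_loc :: "helmholtz_data \<Rightarrow> pt set \<Rightarrow> cfun set" where
  "W_loc P S = {w \<in> W_h P. closure {x. w x \<noteq> 0} \<subseteq> closure S}"

definition Q_loc :: "helmholtz_data \<Rightarrow> enat \<Rightarrow> cfun \<Rightarrow> cfun" where
  "Q_loc P l v = (\<Sum>T\<in>mesh_H P.
     solve_primal P (W_loc P (elem_patch P l T)) (\<lambda>w. aform_on P T v w))"

definition Q_loc_adj :: "helmholtz_data \<Rightarrow> enat \<Rightarrow> cfun \<Rightarrow> cfun" where
  "Q_loc_adj P l v = (\<Sum>T\<in>mesh_H P.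
     solve_adjoint P (W_loc P (elem_patch P l T)) (\<lambda>w. aform_on P T w v))"

definition T_op :: "helmholtz_data \<Rightarrow> enat \<Rightarrow> cfun \<Rightarrow> cfun" where
  "T_op P l v = v - Q_loc P l v"

definition T_op_adj :: "helmholtz_data \<Rightarrow> enat \<Rightarrow> cfun \<Rightarrow> cfun" where
  "T_op_adj P l v = v - Q_loc_adj P l v"

definition X0 :: "helmholtz_data \<Rightarrow> enat \<Rightarrow> cfun set" where
  "X0 P l = T_op P l ` V_H P"

definition Y0 :: "helmholtz_data \<Rightarrow> enat \<Rightarrow> cfun set" where
  "Y0 P l = T_op_adj P l ` V_H P"

text \<open>As in \<^const>\<open>onorm\<close>, the quotient at \<open>v = 0\<close> is \<open>0 / 0 = 0\<close>, so \<open>v \<noteq> 0\<close> need not be required.\<close>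

definition defect :: "helmholtz_data \<Rightarrow> enat \<Rightarrow> real" where
  "defect P l = (SUP v\<in>V_H P. norm_k P (Q_ideal P v - Q_loc P l v) / norm_k P v)"

definition alpha_ideal :: "helmholtz_data \<Rightarrow> ereal" where
  "alpha_ideal P = (INF p\<in>V_H P - {0}. SUP q\<in>V_H P - {0}.
     ereal (cmod (aform P (T_op P \<infinity> p) (T_op_adj P \<infinity> q)) / (norm_k P p * norm_k P q)))"

definition L_stab :: "helmholtz_data \<Rightarrow> real \<Rightarrow> real \<Rightarrow> enat \<Rightarrow> real" where
  "L_stab P Capp Ca l = C_F P Capp Ca + lambda_W P Capp Ca * defect P l"

definition m_stab :: "helmholtz_data \<Rightarrow> real \<Rightarrow> real \<Rightarrow> enat \<Rightarrow> ereal" where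
  "m_stab P Capp Ca l = alpha_ideal P - ereal (Ca\<^sup>2 / c_W P Capp * (defect P l)\<^sup>2)"

section \<open>The computable quantity\<close>

definition W_vertex :: "helmholtz_data \<Rightarrow> pt \<Rightarrow> cfun set" where
  "W_vertex P z = W_loc P (patch P 2 {z})"

definition decomposition_constant :: "helmholtz_data \<Rightarrow> real \<Rightarrow> bool" where
  "decomposition_constant P Csd \<longleftrightarrow> 0 \<le> Csd \<and>
     (\<forall>w\<in>W_h P. \<exists>ws. (\<forall>z\<in>coarse_vertices P. ws z \<in> W_vertex P z) \<and>
        w = (\<Sum>z\<in>coarse_vertices P. ws z) \<and>
        (\<Sum>z\<in>coarse_vertices P. (norm_k P (ws z))\<^sup>2) \<le> Csd\<^sup>2 * (norm_k P w)\<^sup>2)"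

definition xi :: "helmholtz_data \<Rightarrow> (cfun \<Rightarrow> complex) \<Rightarrow> pt \<Rightarrow> cfun" where
  "xi P G z = (THE u. u \<in> W_vertex P z \<and> (\<forall>w\<in>W_vertex P z. bform P u w = G w))"

definition eta :: "helmholtz_data \<Rightarrow> (cfun \<Rightarrow> complex) \<Rightarrow> real" where
  "eta P G = sqrt (\<Sum>z\<in>coarse_vertices P. (norm_k P (xi P G z))\<^sup>2)"

definition G_res :: "helmholtz_data \<Rightarrow> enat \<Rightarrow> cfun \<Rightarrow> cfun \<Rightarrow> complex" where
  "G_res P l v w = cnj (aform P w (T_op_adj P l v))"

text \<open>The term at \<open>v = 0\<close> is again \<open>0\<close>.\<close>

definition Theta :: "helmholtz_data \<Rightarrow> enat \<Rightarrow> real" where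
  "Theta P l = (SUP v\<in>V_H P. eta P (G_res P l v) / norm_k P v)"

section \<open>Enriched spaces\<close>

definition fin_dim_subspace :: "cfun set \<Rightarrow> bool" where
  "fin_dim_subspace E \<longleftrightarrow> cvs.subspace E \<and> (\<exists>B. finite B \<and> E = cvs.span B)"

definition X0_perp :: "helmholtz_data \<Rightarrow> enat \<Rightarrow> cfun set" where
  "X0_perp P l = {v \<in> V_h P. \<forall>x\<in>X0 P l. bform P v x = 0}"

definition J_op :: "helmholtz_data \<Rightarrow> enat \<Rightarrow> cfun \<Rightarrow> cfun" where
  "J_op P l v = v - T_op P l (I_H P v)"

definition X_enr :: "helmholtz_data \<Rightarrow> enat \<Rightarrow> cfun set \<Rightarrow> cfun set" where
  "X_enr P l E = {x + e | x e. x \<in> X0 P l \<and> e \<in> E}"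

definition Y_enr :: "helmholtz_data \<Rightarrow> enat \<Rightarrow> cfun set \<Rightarrow> cfun set" where
  "Y_enr P l E = {y + e | y e. y \<in> Y0 P l \<and> e \<in> J_op P l ` E}"

definition coupled_solution ::
  "helmholtz_data \<Rightarrow> enat \<Rightarrow> cfun set \<Rightarrow> (cfun \<Rightarrow> complex) \<Rightarrow> cfun \<Rightarrow> bool" where
  "coupled_solution P l E F U \<longleftrightarrow>
     U \<in> X_enr P l E \<and> (\<forall>y\<in>Y_enr P l E. aform P U y = F y)"

end

theory Submission
  imports Defs
begin

text \<open>
  The kernel \<open>W\<close> of the quasi-interpolation splits the fine space into coarse functions and a fine-scale
  remainder on which the form \<open>a\<close> is coercive with constant \<open>c\<^sub>W\<close>: kernel functions are bounded by their
  gradient times \<open>H\<close>, so a small \<open>k H\<close> makes the gradient dominate (\<open>kernel_coercive\<close>). Ideal correctors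
  therefore exist, and \<open>T\<^sub>\<infinity> p = p - Q\<^sub>\<infinity> p\<close> and \<open>T\<^sub>\<infinity>\<^sup>* q = q - Q\<^sub>\<infinity>\<^sup>* q\<close> are \<open>a\<close>-orthogonal to \<open>W\<close>, from the left
  and from the right.

  Every trial function of the enriched method is \<open>T\<^sub>\<ell> p + w\<close> with coarse \<open>p\<close> and \<open>w\<close> in the space
  \<open>Ehat \<subseteq> W\<close> onto which the enrichment is projected, and test functions are \<open>T\<^sub>\<ell>\<^sup>* q + w'\<close>. Localization
  perturbs \<open>T\<^sub>\<infinity> p\<close> by the defect \<open>D p \<in> W\<close>. The idea that makes the bound independent of the enrichment is
  to move the Galerkin projection of \<open>D p\<close> onto \<open>Ehat\<close> into \<open>w\<close>; what is left of \<open>D p\<close> is a residual \<open>r\<^sub>p\<close>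
  that is orthogonal to \<open>Ehat\<close>. The same is done on the test side. With equal \<open>w\<close> on both sides all mixed
  terms vanish and
  \<open>a (T\<^sub>\<infinity> p + r\<^sub>p + w) (T\<^sub>\<infinity>\<^sup>* q + r\<^sub>q + w) = a (T\<^sub>\<infinity> p) (T\<^sub>\<infinity>\<^sup>* q) + a r\<^sub>p r\<^sub>q + a w w\<close>.
  The first term is controlled by the ideal coarse inf-sup constant, the last by coercivity, and the middle
  one is quadratic in the defect, which gives \<open>min m\<^sub>\<ell> c\<^sub>W\<close>; the factor \<open>1 + L\<^sub>\<ell>\<^sup>2\<close> compares the coordinates
  \<open>(p, w)\<close> with the energy norm (\<open>inf_sup_test_function\<close>). Trial and test space have the same dimension, so
  the inf-sup bound yields unique solvability (\<open>galerkin_solvable\<close>) and quasi-optimality.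

  The sufficient condition for \<open>m\<^sub>\<ell> > 0\<close> combines two estimates: the ideal coarse inf-sup constant is at least
  \<open>\<gamma>\<^sub>h / (C\<^sub>F C\<^sub>I\<^sup>2)\<close>, because test functions may be replaced by their corrected quasi-interpolants
  (\<open>alpha_ideal_lower_bound\<close>), and the defect is at most \<open>C\<^sub>s\<^sub>d \<Theta>\<^sub>\<ell> / c\<^sub>W\<close>, because the residual of the localized
  adjoint problem can be tested vertex by vertex (\<open>defect_le_Theta\<close>).

  Before this argument applies, the concrete spaces have to be shown to behave as expected. The gradient of a
  function is a choice among its weak gradients, and the trace is a limit of averages. Sesquilinearity of the
  forms thus rests on the uniqueness of weak gradients (\<open>weak_gradient_unique\<close>), on the weak differentiability of
  continuous piecewise affine functions (\<open>P1_weak_gradient\<close>), and on the agreement of traces with point values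
  for continuous functions (\<open>has_trace_continuous_iff\<close>). The localized correctors with \<open>\<ell> = \<infinity>\<close> are the ideal
  ones because the integrals over the elements add up to the integral over the domain; for the Robin term
  this uses that in a Lipschitz domain a boundary edge belongs to a single triangle (\<open>common_edge_interior\<close>).
\<close>

section \<open>Finite-dimensional variational problems\<close>

lemma fscale_apply [simp]: "fscale c f x = c * f x"
  by (simp add: fscale_def)

lemma sum_fun_apply: "(\<Sum>i\<in>A. f i) x = (\<Sum>i\<in>A. f i x)"
  by (induction A rule: infinite_finite_induct) auto

lemma fscale_neg1: "fscale (-1) v = - v"
  by (auto simp: fun_eq_iff)

definition linear_map_on :: "cfun set \<Rightarrow> (cfun \<Rightarrow> cfun) \<Rightarrow> bool" where
  "linear_map_on V L \<longleftrightarrow> (\<forall>v\<in>V. \<forall>w\<in>V. L (v + w) = L v + L w) \<and>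
     (\<forall>c. \<forall>v\<in>V. L (fscale c v) = fscale c (L v))"

definition linear_form_on :: "cfun set \<Rightarrow> (cfun \<Rightarrow> complex) \<Rightarrow> bool" where
  "linear_form_on V f \<longleftrightarrow> (\<forall>v\<in>V. \<forall>w\<in>V. f (v + w) = f v + f w) \<and>
     (\<forall>c. \<forall>v\<in>V. f (fscale c v) = c * f v)"

definition antilinear_form_on :: "cfun set \<Rightarrow> (cfun \<Rightarrow> complex) \<Rightarrow> bool" where
  "antilinear_form_on V f \<longleftrightarrow> (\<forall>v\<in>V. \<forall>w\<in>V. f (v + w) = f v + f w) \<and>
     (\<forall>c. \<forall>v\<in>V. f (fscale c v) = cnj c * f v)"

definition sesquilinear_on :: "cfun set \<Rightarrow> (cfun \<Rightarrow> cfun \<Rightarrow> complex) \<Rightarrow> bool" where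
  "sesquilinear_on V a \<longleftrightarrow>
     (\<forall>w\<in>V. linear_form_on V (\<lambda>v. a v w)) \<and> (\<forall>v\<in>V. antilinear_form_on V (a v))"

lemma linear_form_on_subset: "linear_form_on V f \<Longrightarrow> S \<subseteq> V \<Longrightarrow> linear_form_on S f"
  unfolding linear_form_on_def by blast

lemma antilinear_form_on_subset: "antilinear_form_on V f \<Longrightarrow> S \<subseteq> V \<Longrightarrow> antilinear_form_on S f"
  unfolding antilinear_form_on_def by blast

lemma sesquilinear_on_subset: "sesquilinear_on V a \<Longrightarrow> S \<subseteq> V \<Longrightarrow> sesquilinear_on S a"
  unfolding sesquilinear_on_def using linear_form_on_subset antilinear_form_on_subset by blast

lemma sesq_add_left:
  "sesquilinear_on V a \<Longrightarrow> u \<in> V \<Longrightarrow> v \<in> V \<Longrightarrow> w \<in> V \<Longrightarrow> a (u + v) w = a u w + a v w"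
  by (auto simp: sesquilinear_on_def linear_form_on_def)

lemma sesq_add_right:
  "sesquilinear_on V a \<Longrightarrow> u \<in> V \<Longrightarrow> v \<in> V \<Longrightarrow> w \<in> V \<Longrightarrow> a w (u + v) = a w u + a w v"
  by (auto simp: sesquilinear_on_def antilinear_form_on_def)

lemma sesq_scale_left:
  "sesquilinear_on V a \<Longrightarrow> v \<in> V \<Longrightarrow> w \<in> V \<Longrightarrow> a (fscale c v) w = c * a v w"
  by (auto simp: sesquilinear_on_def linear_form_on_def)

lemma sesq_scale_right:
  "sesquilinear_on V a \<Longrightarrow> v \<in> V \<Longrightarrow> w \<in> V \<Longrightarrow> a v (fscale c w) = cnj c * a v w"
  by (auto simp: sesquilinear_on_def antilinear_form_on_def)

lemma sesq_neg_left:
  "sesquilinear_on V a \<Longrightarrow> v \<in> V \<Longrightarrow> w \<in> V \<Longrightarrow> a (- v) w = - a v w"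
  using sesq_scale_left[of V a v w "-1"] by (simp add: fscale_neg1)

lemma sesq_neg_right:
  "sesquilinear_on V a \<Longrightarrow> v \<in> V \<Longrightarrow> w \<in> V \<Longrightarrow> a v (- w) = - a v w"
  using sesq_scale_right[of V a v w "-1"] by (simp add: fscale_neg1)

lemma sesq_diff_left:
  assumes "sesquilinear_on V a" "cvs.subspace V" "u \<in> V" "v \<in> V" "w \<in> V"
  shows "a (u - v) w = a u w - a v w"
  using sesq_add_left[OF assms(1,3) cvs.subspace_neg[OF assms(2,4)] assms(5)]
    sesq_neg_left[OF assms(1,4,5)] by simp

lemma sesq_diff_right:
  assumes "sesquilinear_on V a" "cvs.subspace V" "u \<in> V" "v \<in> V" "w \<in> V"
  shows "a w (u - v) = a w u - a w v"
  using sesq_add_right[OF assms(1,3) cvs.subspace_neg[OF assms(2,4)] assms(5)]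
    sesq_neg_right[OF assms(1,5,4)] by simp

lemma sesq_zero_left: "sesquilinear_on V a \<Longrightarrow> w \<in> V \<Longrightarrow> 0 \<in> V \<Longrightarrow> a 0 w = 0"
  using sesq_scale_left[of V a 0 w 0] by simp

lemma sesq_zero_right: "sesquilinear_on V a \<Longrightarrow> w \<in> V \<Longrightarrow> 0 \<in> V \<Longrightarrow> a w 0 = 0"
  using sesq_scale_right[of V a w 0 0] by simp

lemma linear_form_sum:
  assumes "linear_form_on V f" "cvs.subspace V" "finite A" "\<And>i. i \<in> A \<Longrightarrow> g i \<in> V"
  shows "f (\<Sum>i\<in>A. g i) = (\<Sum>i\<in>A. f (g i))"
  using assms(3,4)
proof (induction A)
  case empty
  have "0 \<in> V" by (simp add: assms(2) cvs.subspace_0)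
  then have "f (fscale 0 0) = 0 * f 0" using assms(1) unfolding linear_form_on_def by blast
  then show ?case by (simp only: sum.empty mult_zero_left cvs.scale_zero_left)
next
  case (insert x A)
  then have "sum g A \<in> V" using cvs.subspace_sum[OF assms(2)] by blast
  then have "f (g x + sum g A) = f (g x) + f (sum g A)"
    using insert.prems assms(1) unfolding linear_form_on_def by blast
  then show ?case using insert by (simp only: sum.insert insert_iff simp_thms)
qed

lemma antilinear_form_sum:
  assumes "antilinear_form_on V f" "cvs.subspace V" "finite A" "\<And>i. i \<in> A \<Longrightarrow> g i \<in> V"
  shows "f (\<Sum>i\<in>A. g i) = (\<Sum>i\<in>A. f (g i))"
  using assms(3,4)
proof (induction A)
  case empty
  have "0 \<in> V" by (simp add: assms(2) cvs.subspace_0)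
  then have "f (fscale 0 0) = 0 * f 0" using assms(1) unfolding antilinear_form_on_def
    by (metis complex_cnj_zero)
  then show ?case by (simp only: sum.empty mult_zero_left cvs.scale_zero_left)
next
  case (insert x A)
  then have "sum g A \<in> V" using cvs.subspace_sum[OF assms(2)] by blast
  then have "f (g x + sum g A) = f (g x) + f (sum g A)"
    using insert.prems assms(1) unfolding antilinear_form_on_def by blast
  then show ?case using insert by (simp only: sum.insert insert_iff simp_thms)
qed

lemma fin_dim_subspace_basis:
  assumes "fin_dim_subspace S"
  obtains B where "finite B" "cvs.independent B" "S = cvs.span B" "card B = cvs.dim S"
proof -
  obtain C where C: "finite C" "S = cvs.span C" and sub: "cvs.subspace S"
    using assms unfolding fin_dim_subspace_def by blast
  obtain B where B: "B \<subseteq> S" "cvs.independent B" "S \<subseteq> cvs.span B" "card B = cvs.dim S"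
    using cvs.basis_exists[of S] by metis
  have "finite B" using cvs.independent_span_bound[OF C(1) B(2)] B(1) C(2) by blast
  moreover have "S = cvs.span B" using B sub by (simp add: cvs.span_minimal subset_antisym)
  ultimately show ?thesis using that B by blast
qed

lemma fin_dim_subspace_subset:
  assumes "fin_dim_subspace V" "cvs.subspace S" "S \<subseteq> V"
  shows "fin_dim_subspace S"
proof -
  obtain C where C: "finite C" "V = cvs.span C"
    using assms unfolding fin_dim_subspace_def by blast
  obtain B where B: "B \<subseteq> S" "cvs.independent B" "S \<subseteq> cvs.span B"
    using cvs.basis_exists[of S] by metis
  have "finite B" using cvs.independent_span_bound[OF C(1) B(2)] B(1) C(2) assms(3) by blast
  moreover have "S = cvs.span B" using B assms(2) by (simp add: cvs.span_minimal subset_antisym)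
  ultimately show ?thesis unfolding fin_dim_subspace_def using assms by blast
qed

lemma fin_dim_subspaceD: "fin_dim_subspace S \<Longrightarrow> cvs.subspace S"
  by (simp add: fin_dim_subspace_def)

text \<open>
  A square linear system with trivial kernel is solvable: the functionals \<open>a x\<close>, restricted to a
  basis of the test space, are as many independent vectors as that basis has elements, so they
  span all functionals on it.
\<close>

lemma galerkin_solvable:
  assumes fX: "fin_dim_subspace X" and fY: "fin_dim_subspace Y"
    and dim: "cvs.dim Y \<le> cvs.dim X"
    and lin: "\<And>y. y \<in> Y \<Longrightarrow> linear_form_on X (\<lambda>x. a x y)"
    and anti: "\<And>x. x \<in> X \<Longrightarrow> antilinear_form_on Y (a x)"
    and inj: "\<And>x. x \<in> X \<Longrightarrow> (\<And>y. y \<in> Y \<Longrightarrow> a x y = 0) \<Longrightarrow> x = 0"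
    and F: "antilinear_form_on Y F"
  shows "\<exists>!x. x \<in> X \<and> (\<forall>y\<in>Y. a x y = F y)"
proof -
  obtain BX where BX: "finite BX" "cvs.independent BX" "X = cvs.span BX" "card BX = cvs.dim X"
    using fin_dim_subspace_basis[OF fX] by blast
  obtain BY where BY: "finite BY" "cvs.independent BY" "Y = cvs.span BY" "card BY = cvs.dim Y"
    using fin_dim_subspace_basis[OF fY] by blast
  have sX: "cvs.subspace X" and sY: "cvs.subspace Y" using fX fY fin_dim_subspaceD by auto
  define sc :: "complex \<Rightarrow> (cfun \<Rightarrow> complex) \<Rightarrow> cfun \<Rightarrow> complex" where "sc = (\<lambda>c f x. c * f x)"
  interpret fs: vector_space sc
    by unfold_locales (auto simp: sc_def fun_eq_iff algebra_simps)
  define \<Phi> where "\<Phi> = (\<lambda>g::cfun \<Rightarrow> complex. \<lambda>y. if y \<in> BY then g y else 0)"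
  define e :: "cfun \<Rightarrow> cfun \<Rightarrow> complex" where "e = (\<lambda>z y. if y = z then 1 else 0)"
  have vanish: "\<forall>y\<in>Y. f y = 0" if f: "antilinear_form_on Y f" and z: "\<And>y. y \<in> BY \<Longrightarrow> f y = 0" for f
  proof -
    have "cvs.subspace {y \<in> Y. f y = 0}"
      unfolding cvs.subspace_def
      using sY f antilinear_form_sum[OF f sY, of "{}"]
      by (auto simp: antilinear_form_on_def cvs.subspace_0 cvs.subspace_add cvs.subspace_scale)
    moreover have "BY \<subseteq> {y \<in> Y. f y = 0}" using z BY(3) cvs.span_base by auto
    ultimately show ?thesis using cvs.span_minimal[of BY "{y \<in> Y. f y = 0}"] BY(3) by auto
  qed
  have comb: "(\<Sum>x\<in>BX. sc (r x) (\<Phi> (a x))) = \<Phi> (a (\<Sum>x\<in>BX. fscale (r x) x))" for r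
  proof
    fix y
    show "(\<Sum>x\<in>BX. sc (r x) (\<Phi> (a x))) y = \<Phi> (a (\<Sum>x\<in>BX. fscale (r x) x)) y"
    proof (cases "y \<in> BY")
      case True
      then have yY: "y \<in> Y" using BY(3) cvs.span_base by blast
      have mem: "\<And>x. x \<in> BX \<Longrightarrow> x \<in> X" using BX(3) cvs.span_base by blast
      have "a (\<Sum>x\<in>BX. fscale (r x) x) y = (\<Sum>x\<in>BX. a (fscale (r x) x) y)"
        using linear_form_sum[OF lin[OF yY] sX BX(1), of "\<lambda>x. fscale (r x) x"] mem
          cvs.subspace_scale[OF sX] by blast
      also have "\<dots> = (\<Sum>x\<in>BX. r x * a x y)"
        using lin[OF yY] mem unfolding linear_form_on_def by simp
      finally show ?thesis using True by (simp add: \<Phi>_def sc_def sum_fun_apply)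
    qed (simp add: \<Phi>_def sc_def sum_fun_apply)
  qed
  have zero: "x = 0" if "x \<in> X" "\<Phi> (a x) = 0" for x
  proof (rule inj[OF that(1)])
    fix y assume "y \<in> Y"
    moreover have "a x y = 0" if "y \<in> BY" for y
      using \<open>\<Phi> (a x) = 0\<close> that unfolding \<Phi>_def fun_eq_iff by (auto split: if_splits)
    ultimately show "a x y = 0" using vanish[OF anti[OF \<open>x \<in> X\<close>]] by blast
  qed
  have inX: "(\<Sum>x\<in>BX. fscale (r x) x) \<in> X" for r
    by (rule cvs.subspace_sum[OF sX]) (use BX(3) cvs.span_base cvs.subspace_scale[OF sX] in blast)
  have indc: "r x = 0" if "(\<Sum>x\<in>BX. fscale (r x) x) = 0" "x \<in> BX" for r x
    using BX(1,2) that cvs.independent_explicit_finite_subsets by blast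
  have injPhi: "inj_on (\<lambda>x. \<Phi> (a x)) BX"
  proof (rule inj_onI, rule ccontr)
    fix x x' assume x: "x \<in> BX" "x' \<in> BX" "\<Phi> (a x) = \<Phi> (a x')" "x \<noteq> x'"
    let ?r = "\<lambda>z. if z = x then 1 else if z = x' then - 1 else (0::complex)"
    have "(\<Sum>z\<in>BX. sc (?r z) (\<Phi> (a z))) = (\<Sum>z\<in>{x, x'}. sc (?r z) (\<Phi> (a z)))"
      by (rule sum.mono_neutral_right) (use BX x in \<open>auto simp: sc_def fun_eq_iff\<close>)
    also have "\<dots> = 0" using x by (auto simp: sc_def fun_eq_iff)
    finally have "\<Phi> (a (\<Sum>z\<in>BX. fscale (?r z) z)) = 0" unfolding comb .
    then have "(\<Sum>z\<in>BX. fscale (?r z) z) = 0" by (rule zero[OF inX])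
    from indc[OF this x(1)] show False by simp
  qed
  have indPhi: "fs.independent ((\<lambda>x. \<Phi> (a x)) ` BX)"
  proof -
    have "f g = 0" if s: "(\<Sum>g\<in>(\<lambda>x. \<Phi> (a x)) ` BX. sc (f g) g) = 0"
      and g: "g \<in> (\<lambda>x. \<Phi> (a x)) ` BX" for f g
    proof -
    have "(\<Sum>x\<in>BX. sc (f (\<Phi> (a x))) (\<Phi> (a x))) = 0"
      using s unfolding sum.reindex[OF injPhi] comp_def .
    then have "\<Phi> (a (\<Sum>x\<in>BX. fscale (f (\<Phi> (a x))) x)) = 0" unfolding comb .
    then have "(\<Sum>x\<in>BX. fscale (f (\<Phi> (a x))) x) = 0" by (rule zero[OF inX])
    moreover obtain x where "x \<in> BX" "g = \<Phi> (a x)" using g by blast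
    ultimately show "f g = 0" using indc[where r = "\<lambda>x. f (\<Phi> (a x))" and x = x] by simp
    qed
    then show ?thesis
      using fs.independent_if_scalars_zero[OF finite_imageI[OF BX(1)], of "\<lambda>x. \<Phi> (a x)"] by blast
  qed
  have espan: "\<Phi> g \<in> fs.span (e ` BY)" for g
  proof -
    have "\<Phi> g = (\<Sum>y\<in>BY. sc (g y) (e y))"
    proof
      fix z
      have "(\<Sum>y\<in>BY. sc (g y) (e y)) z = (\<Sum>y\<in>BY. if y = z then g y else 0)"
        by (auto simp: sum_fun_apply sc_def e_def intro!: sum.cong)
      then show "\<Phi> g z = (\<Sum>y\<in>BY. sc (g y) (e y)) z"
        using BY(1) by (simp add: \<Phi>_def)
    qed
    moreover have "(\<Sum>y\<in>BY. sc (g y) (e y)) \<in> fs.span (e ` BY)"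
      by (intro fs.span_sum fs.span_scale fs.span_base imageI)
    ultimately show ?thesis by simp
  qed
  have "\<Phi> F \<in> fs.span ((\<lambda>x. \<Phi> (a x)) ` BX)"
  proof (rule ccontr)
    assume n: "\<Phi> F \<notin> fs.span ((\<lambda>x. \<Phi> (a x)) ` BX)"
    then have "fs.independent (insert (\<Phi> F) ((\<lambda>x. \<Phi> (a x)) ` BX))"
      using indPhi fs.independent_insertI by blast
    moreover have "insert (\<Phi> F) ((\<lambda>x. \<Phi> (a x)) ` BX) \<subseteq> fs.span (e ` BY)" using espan by auto
    ultimately have "card (insert (\<Phi> F) ((\<lambda>x. \<Phi> (a x)) ` BX)) \<le> card (e ` BY)"
      using fs.independent_span_bound BY(1) by blast
    moreover have "\<Phi> F \<notin> (\<lambda>x. \<Phi> (a x)) ` BX"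
      by (rule notI, rule notE[OF n], rule fs.span_base)
    ultimately have "Suc (card BX) \<le> card (e ` BY)"
      using BX(1) by (simp add: card_image[OF injPhi])
    then show False using card_image_le[OF BY(1), of e] BX BY dim by simp
  qed
  then have "\<Phi> F \<in> range (\<lambda>r. \<Sum>g\<in>(\<lambda>x. \<Phi> (a x)) ` BX. sc (r g) g)"
    unfolding fs.span_finite[OF finite_imageI[OF BX(1)]] .
  then obtain r where r: "\<Phi> F = (\<Sum>g\<in>(\<lambda>x. \<Phi> (a x)) ` BX. sc (r g) g)"
    by (rule rangeE)
  define x where "x = (\<Sum>x\<in>BX. fscale (r (\<Phi> (a x))) x)"
  have xX: "x \<in> X" unfolding x_def by (rule inX)
  have "\<Phi> F = \<Phi> (a x)"
    using r comb[of "\<lambda>x. r (\<Phi> (a x))"] unfolding sum.reindex[OF injPhi] comp_def x_def by (rule trans)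
  then have eq: "a x y - F y = 0" if "y \<in> BY" for y
    using fun_cong[of "\<Phi> F" "\<Phi> (a x)" y] that unfolding \<Phi>_def by simp
  have anti': "antilinear_form_on Y (\<lambda>y. a x y - F y)"
    using anti[OF xX] F unfolding antilinear_form_on_def by (simp add: algebra_simps)
  have sol: "\<forall>y\<in>Y. a x y = F y" using vanish[OF anti' eq] by simp
  show ?thesis
  proof (rule ex1I[of _ x])
    show "x \<in> X \<and> (\<forall>y\<in>Y. a x y = F y)" using sol xX by blast
    fix x' assume x': "x' \<in> X \<and> (\<forall>y\<in>Y. a x' y = F y)"
    have "x' - x = 0"
    proof (rule inj)
      show "x' - x \<in> X" using x' xX sX cvs.subspace_diff by blast
      fix y assume y: "y \<in> Y"
      have "fscale (-1) x \<in> X" by (rule cvs.subspace_scale[OF sX xX])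
      then have "a (x' + fscale (-1) x) y = a x' y + a (fscale (-1) x) y"
        using lin[OF y] x' unfolding linear_form_on_def by blast
      moreover have "a (fscale (-1) x) y = (-1) * a x y"
        using lin[OF y] xX unfolding linear_form_on_def by blast
      moreover have "x' + fscale (-1) x = x' - x" by (auto simp: fun_eq_iff)
      ultimately show "a (x' - x) y = 0" using x' sol y by simp
    qed
    then show "x' = x" by simp
  qed
qed

lemma galerkin_solvable_adjoint:
  assumes fX: "fin_dim_subspace X" and fY: "fin_dim_subspace Y"
    and dim: "cvs.dim Y \<le> cvs.dim X"
    and lin: "\<And>x. x \<in> X \<Longrightarrow> linear_form_on Y (\<lambda>y. a y x)"
    and anti: "\<And>y. y \<in> Y \<Longrightarrow> antilinear_form_on X (a y)"
    and inj: "\<And>x. x \<in> X \<Longrightarrow> (\<And>y. y \<in> Y \<Longrightarrow> a y x = 0) \<Longrightarrow> x = 0"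
    and F: "linear_form_on Y F"
  shows "\<exists>!x. x \<in> X \<and> (\<forall>y\<in>Y. a y x = F y)"
proof -
  have "\<exists>!x. x \<in> X \<and> (\<forall>y\<in>Y. cnj (a y x) = cnj (F y))"
  proof (rule galerkin_solvable[OF fX fY dim])
    show "linear_form_on X (\<lambda>x. cnj (a y x))" if "y \<in> Y" for y
      using anti[OF that] by (simp add: linear_form_on_def antilinear_form_on_def)
    show "antilinear_form_on Y (\<lambda>y. cnj (a y x))" if "x \<in> X" for x
      using lin[OF that] by (simp add: linear_form_on_def antilinear_form_on_def)
    show "antilinear_form_on Y (\<lambda>y. cnj (F y))"
      using F by (simp add: linear_form_on_def antilinear_form_on_def)
  qed (use inj in auto)
  then show ?thesis by (simp only: complex_cnj_cancel_iff)
qed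

text \<open>
  Definiteness makes the kernel trivial, so this covers coercive forms as well as inner products, on any
  finite-dimensional space.
\<close>

lemma definite_solvable:
  assumes S: "fin_dim_subspace S" and a: "sesquilinear_on S a"
    and definite: "\<And>v. v \<in> S \<Longrightarrow> a v v = 0 \<Longrightarrow> v = 0" and F: "antilinear_form_on S F"
  shows "\<exists>!x. x \<in> S \<and> (\<forall>y\<in>S. a x y = F y)"
proof (rule galerkin_solvable[OF S S order_refl])
  show "linear_form_on S (\<lambda>x. a x y)" if "y \<in> S" for y
    using a that unfolding sesquilinear_on_def by blast
  show "antilinear_form_on S (a x)" if "x \<in> S" for x
    using a that unfolding sesquilinear_on_def by blast
  show "x = 0" if "x \<in> S" "\<And>y. y \<in> S \<Longrightarrow> a x y = 0" for x
    by (rule definite[OF that(1) that(2)[OF that(1)]])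
qed (rule F)

lemma definite_solvable_adjoint:
  assumes S: "fin_dim_subspace S" and a: "sesquilinear_on S a"
    and definite: "\<And>v. v \<in> S \<Longrightarrow> a v v = 0 \<Longrightarrow> v = 0" and F: "linear_form_on S F"
  shows "\<exists>!x. x \<in> S \<and> (\<forall>y\<in>S. a y x = F y)"
proof (rule galerkin_solvable_adjoint[OF S S order_refl])
  show "linear_form_on S (\<lambda>x. a x y)" if "y \<in> S" for y
    using a that unfolding sesquilinear_on_def by blast
  show "antilinear_form_on S (a x)" if "x \<in> S" for x
    using a that unfolding sesquilinear_on_def by blast
  show "x = 0" if "x \<in> S" "\<And>y. y \<in> S \<Longrightarrow> a y x = 0" for x
    by (rule definite[OF that(1) that(2)[OF that(1)]])
qed (rule F)

section \<open>Linear maps and dimension counting\<close>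

lemma linear_map_on_cong:
  assumes V: "cvs.subspace V" and L: "linear_map_on V L" and eq: "\<And>v. v \<in> V \<Longrightarrow> K v = L v"
  shows "linear_map_on V K"
  unfolding linear_map_on_def
proof (intro conjI ballI allI)
  fix v w assume v: "v \<in> V" and w: "w \<in> V"
  have "L (v + w) = L v + L w" using L v w unfolding linear_map_on_def by blast
  then show "K (v + w) = K v + K w" unfolding eq[OF v] eq[OF w] eq[OF cvs.subspace_add[OF V v w]] .
next
  fix c v assume v: "v \<in> V"
  have "L (fscale c v) = fscale c (L v)" using L v unfolding linear_map_on_def by blast
  then show "K (fscale c v) = fscale c (K v)" unfolding eq[OF v] eq[OF cvs.subspace_scale[OF V v]] .
qed

lemma linear_map_diff:
  assumes L: "linear_map_on V L" and K: "linear_map_on V K"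
  shows "linear_map_on V (\<lambda>v. L v - K v)"
  unfolding linear_map_on_def
proof (intro conjI ballI allI)
  fix v w assume v: "v \<in> V" and w: "w \<in> V"
  have "L (v + w) = L v + L w" "K (v + w) = K v + K w" using L K v w unfolding linear_map_on_def by blast+
  then show "L (v + w) - K (v + w) = (L v - K v) + (L w - K w)" by (simp only: add_diff_add)
next
  fix c v assume v: "v \<in> V"
  have "L (fscale c v) = fscale c (L v)" "K (fscale c v) = fscale c (K v)"
    using L K v unfolding linear_map_on_def by blast+
  then show "L (fscale c v) - K (fscale c v) = fscale c (L v - K v)" by (simp only: cvs.scale_right_diff_distrib)
qed

lemma linear_map_id: "linear_map_on V (\<lambda>v. v)"
  unfolding linear_map_on_def by simp

lemma linear_map_on_subset: "linear_map_on V L \<Longrightarrow> S \<subseteq> V \<Longrightarrow> linear_map_on S L"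
  unfolding linear_map_on_def by (meson subsetD)

lemma linear_map_sum:
  assumes "linear_map_on V L" "cvs.subspace V" "finite A" "\<And>i. i \<in> A \<Longrightarrow> g i \<in> V"
  shows "L (\<Sum>i\<in>A. g i) = (\<Sum>i\<in>A. L (g i))"
  using assms(3,4)
proof (induction A)
  case empty
  have "0 \<in> V" by (simp add: assms(2) cvs.subspace_0)
  then have "L (fscale 0 0) = fscale 0 (L 0)" using assms(1) unfolding linear_map_on_def by blast
  then show ?case by (simp only: sum.empty cvs.scale_zero_left)
next
  case (insert x A)
  then have "sum g A \<in> V" using cvs.subspace_sum[OF assms(2)] by blast
  then have "L (g x + sum g A) = L (g x) + L (sum g A)"
    using insert.prems assms(1) unfolding linear_map_on_def by blast
  then show ?case using insert by (simp only: sum.insert insert_iff simp_thms)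
qed

lemma linear_map_combination:
  assumes L: "linear_map_on V L" and V: "cvs.subspace V" and B: "finite B" "B \<subseteq> V"
  shows "L (\<Sum>x\<in>B. fscale (r x) x) = (\<Sum>x\<in>B. fscale (r x) (L x))"
proof -
  have "L (\<Sum>x\<in>B. fscale (r x) x) = (\<Sum>x\<in>B. L (fscale (r x) x))"
    by (rule linear_map_sum[OF L V B(1)]) (use B(2) cvs.subspace_scale[OF V] in blast)
  also have "\<dots> = (\<Sum>x\<in>B. fscale (r x) (L x))"
    using L B(2) unfolding linear_map_on_def by (intro sum.cong refl) blast
  finally show ?thesis .
qed

lemma linear_map_image_subspace:
  assumes L: "linear_map_on S L" and S: "cvs.subspace S"
  shows "cvs.subspace (L ` S)"
  unfolding cvs.subspace_def
proof (intro conjI ballI allI)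
  have "L 0 = 0" using linear_map_sum[OF L S, of "{}"] by simp
  then show "0 \<in> L ` S" using cvs.subspace_0[OF S] by (metis imageI)
  fix x y assume "x \<in> L ` S" "y \<in> L ` S"
  then obtain v w where vw: "v \<in> S" "w \<in> S" "x = L v" "y = L w" by (elim imageE)
  then have "L (v + w) = x + y" using L unfolding linear_map_on_def by simp
  moreover have "v + w \<in> S" using cvs.subspace_add[OF S] vw by simp
  ultimately show "x + y \<in> L ` S" by (metis imageI)
next
  fix c x assume "x \<in> L ` S"
  then obtain v where v: "v \<in> S" "x = L v" by (elim imageE)
  then have "L (fscale c v) = fscale c x" using L unfolding linear_map_on_def by simp
  moreover have "fscale c v \<in> S" using cvs.subspace_scale[OF S] v by simp
  ultimately show "fscale c x \<in> L ` S" by (metis imageI)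
qed

lemma injective_image_dim:
  assumes S: "fin_dim_subspace S" and L: "linear_map_on S L"
    and inj: "\<And>v. v \<in> S \<Longrightarrow> L v = 0 \<Longrightarrow> v = 0"
  shows "fin_dim_subspace (L ` S)" "cvs.dim (L ` S) = cvs.dim S"
proof -
  obtain B where B: "finite B" "cvs.independent B" "S = cvs.span B" "card B = cvs.dim S"
    using fin_dim_subspace_basis[OF S] by metis
  have sS: "cvs.subspace S" by (rule fin_dim_subspaceD[OF S])
  have BS: "B \<subseteq> S" unfolding B(3) by (rule cvs.span_superset)
  note comb = linear_map_combination[OF L sS B(1) BS]
  have inS: "(\<Sum>x\<in>B. fscale (r x) x) \<in> S" for r
    by (rule cvs.subspace_sum[OF sS]) (use BS cvs.subspace_scale[OF sS] in blast)
  have indc: "r x = 0" if "(\<Sum>x\<in>B. fscale (r x) x) = 0" "x \<in> B" for r x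
    using B(1,2) that cvs.independent_explicit_finite_subsets by blast
  have injB: "inj_on L B"
  proof (rule inj_onI)
    fix x y assume xy: "x \<in> B" "y \<in> B" "L x = L y"
    have mem: "x \<in> S" "fscale (- 1) y \<in> S" using xy BS cvs.subspace_scale[OF sS] by blast+
    have "L (x + fscale (- 1) y) = L x + fscale (- 1) (L y)"
      using L mem xy BS unfolding linear_map_on_def by (metis subsetD)
    then have "L (x + fscale (- 1) y) = 0" using xy(3) by (simp add: fscale_neg1)
    then have "x + fscale (- 1) y = 0" by (rule inj[OF cvs.subspace_add[OF sS mem]])
    then show "x = y" by (simp add: fscale_neg1)
  qed
  have "f g = 0" if s: "(\<Sum>g\<in>L ` B. fscale (f g) g) = 0" and g: "g \<in> L ` B" for f g
  proof -
    have "(\<Sum>x\<in>B. fscale (f (L x)) (L x)) = 0" using s unfolding sum.reindex[OF injB] comp_def .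
    then have "L (\<Sum>x\<in>B. fscale (f (L x)) x) = 0" unfolding comb .
    then have z: "(\<Sum>x\<in>B. fscale (f (L x)) x) = 0" by (rule inj[OF inS])
    obtain x where "x \<in> B" "g = L x" using g by (elim imageE)
    then show "f g = 0" using indc[where r = "\<lambda>x. f (L x)" and x = x, OF z] by simp
  qed
  then have ind: "cvs.independent (L ` B)"
    using cvs.independent_if_scalars_zero[OF finite_imageI[OF B(1)], of L] by blast
  have span: "L ` S = cvs.span (L ` B)"
  proof (rule subset_antisym)
    show "cvs.span (L ` B) \<subseteq> L ` S"
      by (rule cvs.span_minimal[OF image_mono[OF BS] linear_map_image_subspace[OF L sS]])
    show "L ` S \<subseteq> cvs.span (L ` B)"
    proof (rule image_subsetI)
      fix v assume "v \<in> S"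
      then have "v \<in> range (\<lambda>r. \<Sum>x\<in>B. fscale (r x) x)" unfolding B(3) cvs.span_finite[OF B(1)] .
      then obtain r where r: "v = (\<Sum>x\<in>B. fscale (r x) x)" by (rule rangeE)
      show "L v \<in> cvs.span (L ` B)"
        unfolding r comb by (intro cvs.span_sum cvs.span_scale cvs.span_base imageI)
    qed
  qed
  show "fin_dim_subspace (L ` S)"
    unfolding fin_dim_subspace_def
    using linear_map_image_subspace[OF L sS] span finite_imageI[OF B(1), of L] by (intro conjI exI[of _ "L ` B"])
  show "cvs.dim (L ` S) = cvs.dim S"
    unfolding span cvs.dim_span_eq_card_independent[OF ind] card_image[OF injB] by (rule B(4))
qed

lemma direct_sum_dim:
  assumes S: "fin_dim_subspace S" and T: "fin_dim_subspace T"
    and disj: "\<And>v. v \<in> S \<Longrightarrow> v \<in> T \<Longrightarrow> v = 0"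
  shows "fin_dim_subspace {x + y |x y. x \<in> S \<and> y \<in> T}"
    "cvs.dim {x + y |x y. x \<in> S \<and> y \<in> T} = cvs.dim S + cvs.dim T"
proof -
  obtain B where B: "finite B" "cvs.independent B" "S = cvs.span B" "card B = cvs.dim S"
    using fin_dim_subspace_basis[OF S] by metis
  obtain C where C: "finite C" "cvs.independent C" "T = cvs.span C" "card C = cvs.dim T"
    using fin_dim_subspace_basis[OF T] by metis
  have sS: "cvs.subspace S" and sT: "cvs.subspace T" using S T fin_dim_subspaceD by auto
  have BS: "B \<subseteq> S" unfolding B(3) by (rule cvs.span_superset)
  have CT: "C \<subseteq> T" unfolding C(3) by (rule cvs.span_superset)
  have BC: "B \<inter> C = {}"
  proof (rule ccontr)
    assume "B \<inter> C \<noteq> {}"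
    then obtain v where "v \<in> B" "v \<in> C" by blast
    then have "0 \<in> B" using disj[of v] BS CT by (metis subsetD)
    then show False using B(2) cvs.dependent_zero by blast
  qed
  have span: "{x + y |x y. x \<in> S \<and> y \<in> T} = cvs.span (B \<union> C)"
    unfolding B(3) C(3) cvs.span_Un by blast
  have "f v = 0" if s: "(\<Sum>v\<in>B \<union> C. fscale (f v) v) = 0" and v: "v \<in> B \<union> C" for f v
  proof -
    let ?b = "\<Sum>v\<in>B. fscale (f v) v" and ?c = "\<Sum>v\<in>C. fscale (f v) v"
    have "?b + ?c = 0" using s unfolding sum.union_disjoint[OF B(1) C(1) BC] .
    then have bc: "?b = - ?c" by (simp add: eq_neg_iff_add_eq_0)
    have "?b \<in> S" by (rule cvs.subspace_sum[OF sS]) (use BS cvs.subspace_scale[OF sS] in blast)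
    moreover have c: "?c \<in> T" by (rule cvs.subspace_sum[OF sT]) (use CT cvs.subspace_scale[OF sT] in blast)
    moreover have "?b \<in> T" unfolding bc by (rule cvs.subspace_neg[OF sT c])
    ultimately have b0: "?b = 0" using disj by blast
    then have c0: "?c = 0" using bc by simp
    have "f x = 0" if "x \<in> B" for x
      using B(1,2) b0 that cvs.independent_explicit_finite_subsets by blast
    moreover have "f x = 0" if "x \<in> C" for x
      using C(1,2) c0 that cvs.independent_explicit_finite_subsets by blast
    ultimately show ?thesis using v by (elim UnE)
  qed
  then have ind: "cvs.independent (B \<union> C)"
    using cvs.independent_if_scalars_zero[of "B \<union> C"] B(1) C(1) by blast
  show "fin_dim_subspace {x + y |x y. x \<in> S \<and> y \<in> T}"
    unfolding span fin_dim_subspace_def using B(1) C(1) cvs.subspace_span by (intro conjI exI[of _ "B \<union> C"]) auto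
  show "cvs.dim {x + y |x y. x \<in> S \<and> y \<in> T} = cvs.dim S + cvs.dim T"
    unfolding span cvs.dim_span_eq_card_independent[OF ind] card_Un_disjoint[OF B(1) C(1) BC] B(4) C(4) ..
qed

section \<open>Affine functions and continuous piecewise affine functions\<close>

text \<open>
  Conjugation exchanges the primal and the adjoint problem, so adjoint statements are obtained from primal ones
  by transport along this map.
\<close>

definition conj_fun :: "cfun \<Rightarrow> cfun" where
  "conj_fun v = (\<lambda>x. cnj (v x))"

lemma conj_fun_apply [simp]: "conj_fun v x = cnj (v x)"
  by (simp add: conj_fun_def)

lemma conj_fun_conj_fun [simp]: "conj_fun (conj_fun v) = v"
  by (simp add: conj_fun_def)

lemma conj_fun_zero [simp]: "conj_fun 0 = 0"
  by (rule ext) simp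

lemma conj_fun_add: "conj_fun (v + w) = conj_fun v + conj_fun w"
  by (rule ext) simp

lemma conj_fun_diff: "conj_fun (v - w) = conj_fun v - conj_fun w"
  by (rule ext) simp

lemma conj_fun_scale: "conj_fun (fscale c v) = fscale (cnj c) (conj_fun v)"
  by (rule ext) simp

lemma conj_fun_sum: "conj_fun (\<Sum>i\<in>A. f i) = (\<Sum>i\<in>A. conj_fun (f i))"
  by (rule ext) (simp add: sum_fun_apply)

lemma affine_fun_add: "affine_fun p \<Longrightarrow> affine_fun q \<Longrightarrow> affine_fun (p + q)"
proof -
  assume "affine_fun p" "affine_fun q"
  then obtain c d e c' d' e' where
    "\<And>x. p x = c + d * of_real (x $ 1) + e * of_real (x $ 2)"
    "\<And>x. q x = c' + d' * of_real (x $ 1) + e' * of_real (x $ 2)"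
    unfolding affine_fun_def by metis
  then have "\<forall>x. (p + q) x = (c + c') + (d + d') * of_real (x $ 1) + (e + e') * of_real (x $ 2)"
    by (simp add: algebra_simps)
  then show ?thesis unfolding affine_fun_def by blast
qed

lemma affine_fun_scale: "affine_fun p \<Longrightarrow> affine_fun (fscale a p)"
proof -
  assume "affine_fun p"
  then obtain c d e where "\<And>x. p x = c + d * of_real (x $ 1) + e * of_real (x $ 2)"
    unfolding affine_fun_def by metis
  then have "\<forall>x. (fscale a p) x = a * c + a * d * of_real (x $ 1) + a * e * of_real (x $ 2)"
    by (simp add: algebra_simps)
  then show ?thesis unfolding affine_fun_def by blast
qed

lemma affine_fun_zero [simp]: "affine_fun 0"
  unfolding affine_fun_def by (rule exI[of _ 0], rule exI[of _ 0], rule exI[of _ 0]) simp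

lemma affine_fun_conj: "affine_fun p \<Longrightarrow> affine_fun (conj_fun p)"
proof -
  assume "affine_fun p"
  then obtain c d e where "\<And>x. p x = c + d * of_real (x $ 1) + e * of_real (x $ 2)"
    unfolding affine_fun_def by metis
  then have "\<forall>x. (conj_fun p) x = cnj c + cnj d * of_real (x $ 1) + cnj e * of_real (x $ 2)"
    by simp
  then show ?thesis unfolding affine_fun_def by blast
qed

lemma affine_fun_continuous: "affine_fun p \<Longrightarrow> continuous_on S p"
proof -
  assume "affine_fun p"
  then obtain c d e where "\<And>x. p x = c + d * of_real (x $ 1) + e * of_real (x $ 2)"
    unfolding affine_fun_def by metis
  then have "p = (\<lambda>x. c + d * of_real (x $ 1) + e * of_real (x $ 2))" by auto
  then show ?thesis by (auto intro!: continuous_intros)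
qed

lemma affine_fun_subspace: "cvs.subspace {p. affine_fun p}"
  unfolding cvs.subspace_def using affine_fun_add affine_fun_scale by auto

lemma affine_fun_fin_dim: "fin_dim_subspace {p. affine_fun p}"
proof -
  let ?B = "{(\<lambda>x. 1), (\<lambda>x. of_real (x $ 1)), (\<lambda>x. of_real (x $ 2))} :: cfun set"
  have "affine_fun (\<lambda>x. 1)"
    unfolding affine_fun_def by (rule exI[of _ 1], rule exI[of _ 0], rule exI[of _ 0]) simp
  moreover have "affine_fun (\<lambda>x. of_real (x $ 1))"
    unfolding affine_fun_def by (rule exI[of _ 0], rule exI[of _ 1], rule exI[of _ 0]) simp
  moreover have "affine_fun (\<lambda>x. of_real (x $ 2))"
    unfolding affine_fun_def by (rule exI[of _ 0], rule exI[of _ 0], rule exI[of _ 1]) simp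
  ultimately have sub: "cvs.span ?B \<subseteq> {p. affine_fun p}"
    using affine_fun_subspace by (intro cvs.span_minimal) auto
  have "p \<in> cvs.span ?B" if "affine_fun p" for p
  proof -
    obtain c d e where "\<And>x. p x = c + d * of_real (x $ 1) + e * of_real (x $ 2)"
      using \<open>affine_fun p\<close> unfolding affine_fun_def by metis
    then have "p = fscale c (\<lambda>x. 1) + fscale d (\<lambda>x. of_real (x $ 1)) + fscale e (\<lambda>x. of_real (x $ 2))"
      by auto
    moreover have "fscale c (\<lambda>x. 1) + fscale d (\<lambda>x. of_real (x $ 1)) + fscale e (\<lambda>x. of_real (x $ 2))
        \<in> cvs.span ?B"
      by (intro cvs.span_add cvs.span_scale cvs.span_base) auto
    ultimately show ?thesis by simp
  qed
  then have "{p. affine_fun p} = cvs.span ?B" using sub by (intro subset_antisym subsetI) (simp_all only: mem_Collect_eq subset_iff)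
  with affine_fun_subspace show ?thesis
    unfolding fin_dim_subspace_def by (intro conjI exI[of _ ?B]) simp_all
qed

lemma affine_fun_convex_sum:
  assumes q: "affine_fun q" and C: "finite C" and u: "sum u C = 1"
  shows "q (\<Sum>z\<in>C. u z *\<^sub>R z) = (\<Sum>z\<in>C. of_real (u z) * q z)"
proof -
  obtain c d e where e: "\<And>x. q x = c + d * of_real (x $ 1) + e * of_real (x $ 2)"
    using q unfolding affine_fun_def by metis
  have "(\<Sum>z\<in>C. of_real (u z) * q z) = of_real (sum u C) * c
      + d * of_real (\<Sum>z\<in>C. u z * z $ 1) + e * of_real (\<Sum>z\<in>C. u z * z $ 2)"
    unfolding e by (simp add: algebra_simps sum.distrib sum_distrib_left sum_distrib_right)
  then show ?thesis unfolding e u by (simp add: sum_component)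
qed

lemma affine_fun_eq_on_hull:
  assumes "affine_fun p" "affine_fun q" "finite C" "\<And>z. z \<in> C \<Longrightarrow> p z = q z" "x \<in> convex hull C"
  shows "p x = q x"
proof -
  obtain u where u: "sum u C = 1" "(\<Sum>z\<in>C. u z *\<^sub>R z) = x"
    using assms(5) convex_hull_finite[OF assms(3)] by auto
  show ?thesis
    using affine_fun_convex_sum[OF assms(1,3) u(1)] affine_fun_convex_sum[OF assms(2,3) u(1)]
      assms(4) u(2) by simp
qed

lemma pt_expansion: "x = (x $ 1) *\<^sub>R axis 1 1 + (x $ 2) *\<^sub>R (axis 2 1 :: pt)"
  by (simp add: vec_eq_iff forall_2 axis_def)

lemma affine_fun_of_linear:
  fixes g :: "pt \<Rightarrow> complex"
  assumes "linear g"
  shows "affine_fun (\<lambda>x. c + g (x - a))"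
proof -
  have g: "g x = of_real (x $ 1) * g (axis 1 1) + of_real (x $ 2) * g (axis 2 1)" for x
  proof -
    have "g x = g ((x $ 1) *\<^sub>R axis 1 1 + (x $ 2) *\<^sub>R axis 2 1)" using pt_expansion[of x] by simp
    also have "\<dots> = of_real (x $ 1) * g (axis 1 1) + of_real (x $ 2) * g (axis 2 1)"
      by (simp only: linear_add[OF assms] linear_scale[OF assms] scaleR_conv_of_real[of _ "g _"])
    finally show ?thesis .
  qed
  have "\<forall>x. c + g (x - a) = (c - g a) + g (axis 1 1) * of_real (x $ 1) + g (axis 2 1) * of_real (x $ 2)"
  proof
    fix x
    show "c + g (x - a) = (c - g a) + g (axis 1 1) * of_real (x $ 1) + g (axis 2 1) * of_real (x $ 2)"
      unfolding linear_diff[OF assms] g[of x] by simp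
  qed
  then show ?thesis unfolding affine_fun_def by blast
qed

text \<open>
  The differences to one of the points are linearly independent, so a linear map may be prescribed on them.
\<close>

lemma affine_interpolation:
  fixes C :: "pt set"
  assumes "\<not> affine_dependent C"
  shows "\<exists>q. affine_fun q \<and> (\<forall>z\<in>C. q z = d z)"
proof (cases "C = {}")
  case True
  then show ?thesis using affine_fun_zero by blast
next
  case False
  then obtain a where a: "a \<in> C" by blast
  have "independent ((\<lambda>x. -a + x) ` (C - {a}))"
    using assms affine_dependent_iff_dependent2[OF a] by blast
  from linear_independent_extend[OF this, of "\<lambda>y. d (a + y) - d a"]
  obtain g where g: "linear g" "\<forall>x\<in>(\<lambda>x. -a + x) ` (C - {a}). g x = d (a + x) - d a" by metis
  have "\<forall>z\<in>C. d a + g (z - a) = d z"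
  proof
    fix z assume z: "z \<in> C"
    show "d a + g (z - a) = d z"
    proof (cases "z = a")
      case True then show ?thesis using linear_0[OF g(1)] by simp
    next
      case False
      then have "-a + z \<in> (\<lambda>x. -a + x) ` (C - {a})" using z by blast
      then have "g (-a + z) = d (a + (-a + z)) - d a" using g(2) by blast
      then show ?thesis by simp
    qed
  qed
  then show ?thesis using affine_fun_of_linear[OF g(1)] by (intro exI[of _ "\<lambda>x. d a + g (x - a)"]) auto
qed

definition vertices :: "pt set \<Rightarrow> pt set" where
  "vertices T = {z. z extreme_point_of T}"

definition mesh_vertices :: "pt set set \<Rightarrow> pt set" where
  "mesh_vertices \<T> = (\<Union>T\<in>\<T>. vertices T)"

lemma coarse_vertices_eq: "coarse_vertices P = mesh_vertices (mesh_H P)"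
  by (auto simp: coarse_vertices_def mesh_vertices_def vertices_def)

lemma triangle_vertices:
  assumes "2 simplex (T :: pt set)"
  shows "\<not> affine_dependent (vertices T)" "card (vertices T) = 3" "finite (vertices T)"
    "T = convex hull vertices T"
proof -
  obtain C where C: "\<not> affine_dependent C" "int (card C) = 3" "T = convex hull C"
    using assms unfolding simplex_def by auto
  then have "vertices T = C"
    using extreme_point_of_convex_hull_affine_independent by (auto simp: vertices_def)
  then show "\<not> affine_dependent (vertices T)" "card (vertices T) = 3" "finite (vertices T)"
    "T = convex hull vertices T" using C by (auto simp: aff_independent_finite)
qed

text \<open>
  Faces of a simplex are the convex hulls of subsets of its vertices.
\<close>

lemma face_vertices:
  assumes "2 simplex (T :: pt set)" "F face_of T"
  shows "vertices F \<subseteq> vertices T" "F = convex hull vertices F"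
proof -
  obtain c where c: "c \<subseteq> vertices T" "F = convex hull c"
    using assms triangle_vertices[OF assms(1)] face_of_convex_hull_affine_independent by metis
  then have "\<not> affine_dependent c" using triangle_vertices(1)[OF assms(1)] affine_dependent_subset by blast
  then have "vertices F = c"
    using extreme_point_of_convex_hull_affine_independent c by (auto simp: vertices_def)
  then show "vertices F \<subseteq> vertices T" "F = convex hull vertices F" using c by auto
qed

lemma triangle_compact: "2 simplex (T :: pt set) \<Longrightarrow> compact T"
  using triangle_vertices[of T] by (metis finite_imp_compact_convex_hull)

lemma triangle_convex: "2 simplex (T :: pt set) \<Longrightarrow> convex T"
  using triangle_vertices[of T] by (metis convex_convex_hull)

lemma triangle_interior: "2 simplex (T :: pt set) \<Longrightarrow> interior T \<noteq> {}"
  using triangle_vertices[of T] interior_convex_hull_eq_empty[of "vertices T"] by simp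

definition dirichlet :: "helmholtz_data \<Rightarrow> pt set" where
  "dirichlet P = closure (boundary_part (sidesD P))"

locale mesh =
  fixes P :: helmholtz_data and \<T> :: "pt set set"
  assumes polygonal: "polygonal_partition P" and conforming: "conforming_mesh P \<T>"
begin

lemma open_Omega: "open (Omega P)"
  and bounded_Omega: "bounded (Omega P)"
  and Omega_nonempty: "Omega P \<noteq> {}"
  using polygonal unfolding polygonal_partition_def lipschitz_domain_def by blast+

lemma finite_mesh: "finite \<T>"
  and triangle: "T \<in> \<T> \<Longrightarrow> 2 simplex T"
  and inter_face: "T \<in> \<T> \<Longrightarrow> T' \<in> \<T> \<Longrightarrow> T \<inter> T' face_of T"
  and covers: "\<Union>\<T> = closure (Omega P)"
  using conforming unfolding conforming_mesh_def triangulation_def by auto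

lemma triangle_subset: "T \<in> \<T> \<Longrightarrow> T \<subseteq> closure (Omega P)"
  using covers by blast

lemma finite_mesh_vertices: "finite (mesh_vertices \<T>)"
  unfolding mesh_vertices_def using finite_mesh triangle triangle_vertices(3) by auto

lemma dirichlet_edges:
  obtains F where "\<And>e. e \<in> F \<Longrightarrow> \<exists>T\<in>\<T>. e edge_of T" "dirichlet P = \<Union>F"
proof -
  have "\<exists>F. (\<forall>e\<in>F. \<exists>T\<in>\<T>. e edge_of T) \<and> closure (boundary_part (sidesD P)) = \<Union>F"
    using conforming unfolding conforming_mesh_def by blast
  then show ?thesis using that unfolding dirichlet_def by metis
qed

text \<open>
  Two triangles of a conforming mesh meet in the convex hull of their common vertices, so the
  affine interpolants of nodal data on the single triangles agree wherever they meet.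
\<close>

lemma nodal_interpolant:
  assumes d: "\<And>z. z \<in> mesh_vertices \<T> \<Longrightarrow> z \<in> dirichlet P \<Longrightarrow> d z = 0"
  shows "\<exists>v\<in>P1_space P \<T>. \<forall>z\<in>mesh_vertices \<T>. v z = d z"
proof -
  have "\<forall>T\<in>\<T>. \<exists>q. affine_fun q \<and> (\<forall>z\<in>vertices T. q z = d z)"
    using affine_interpolation triangle triangle_vertices(1) by blast
  then obtain q where q: "\<And>T. T \<in> \<T> \<Longrightarrow> affine_fun (q T)"
    "\<And>T z. T \<in> \<T> \<Longrightarrow> z \<in> vertices T \<Longrightarrow> q T z = d z" by metis
  have agree: "q T x = q T' x" if "T \<in> \<T>" "T' \<in> \<T>" "x \<in> T" "x \<in> T'" for T T' x
  proof -
    note f = face_vertices[OF triangle[OF that(1)] inter_face[OF that(1,2)]]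
    have f': "vertices (T \<inter> T') \<subseteq> vertices T'"
      using face_vertices(1)[OF triangle[OF that(2)] inter_face[OF that(2,1)]] by (simp add: Int_commute)
    show ?thesis
    proof (rule affine_fun_eq_on_hull[OF q(1)[OF that(1)] q(1)[OF that(2)]])
      show "finite (vertices (T \<inter> T'))"
        using f(1) triangle_vertices(3)[OF triangle[OF that(1)]] finite_subset by blast
      show "x \<in> convex hull vertices (T \<inter> T')" using f(2) that by simp
      fix z assume "z \<in> vertices (T \<inter> T')"
      then show "q T z = q T' z" using f(1) f' q(2) that by (metis subsetD)
    qed
  qed
  define v where "v = (\<lambda>x. if x \<in> \<Union>\<T> then q (SOME T. T \<in> \<T> \<and> x \<in> T) x else 0)"
  have vT: "v x = q T x" if "T \<in> \<T>" "x \<in> T" for T x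
  proof -
    have "(SOME T. T \<in> \<T> \<and> x \<in> T) \<in> \<T> \<and> x \<in> (SOME T. T \<in> \<T> \<and> x \<in> T)"
      by (rule someI[of "\<lambda>T. T \<in> \<T> \<and> x \<in> T" T]) (use that in simp)
    then have "q (SOME T. T \<in> \<T> \<and> x \<in> T) x = q T x"
      using agree[OF _ that(1) _ that(2)] by blast
    moreover have "x \<in> \<Union>\<T>" using that by blast
    ultimately show ?thesis unfolding v_def by simp
  qed
  have "continuous_on (\<Union>T\<in>\<T>. T) v"
  proof (rule continuous_on_closed_Union)
    fix T assume T: "T \<in> \<T>"
    show "closed T" using triangle[OF T] triangle_compact compact_imp_closed by blast
    show "continuous_on T v"
      using affine_fun_continuous[OF q(1)[OF T], of T] vT[OF T] by (simp cong: continuous_on_cong)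
  qed (rule finite_mesh)
  then have "continuous_on (closure (Omega P)) v" using covers by simp
  moreover have "\<forall>T\<in>\<T>. \<exists>q. affine_fun q \<and> (\<forall>x\<in>T. v x = q x)" using vT q(1) by blast
  moreover have "v x = 0" if x: "x \<in> dirichlet P" for x
  proof -
    obtain F where F: "\<And>e. e \<in> F \<Longrightarrow> \<exists>T\<in>\<T>. e edge_of T" "dirichlet P = \<Union>F"
      using dirichlet_edges by metis
    obtain e T where e: "e \<in> F" "x \<in> e" "T \<in> \<T>" "e face_of T" using x F unfolding edge_of_def by blast
    note f = face_vertices[OF triangle[OF e(3)] e(4)]
    have xT: "x \<in> T" using e face_of_imp_subset by blast
    have "q T x = 0 x"
    proof (rule affine_fun_eq_on_hull[OF q(1)[OF e(3)] affine_fun_zero])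
      show "finite (vertices e)"
        using f(1) triangle_vertices(3)[OF triangle[OF e(3)]] finite_subset by blast
      show "x \<in> convex hull vertices e" using f(2) e by simp
      fix z assume z: "z \<in> vertices e"
      then have "z \<in> e" by (auto simp: vertices_def extreme_point_of_def)
      then have "z \<in> dirichlet P" "z \<in> mesh_vertices \<T>"
        using F(2) e z f(1) by (auto simp: mesh_vertices_def)
      then show "q T z = 0 z" using d q(2)[OF e(3)] z f(1) by auto
    qed
    then show ?thesis using vT[OF e(3) xT] by simp
  qed
  moreover have "v x = 0" if "x \<notin> closure (Omega P)" for x
    using that covers unfolding v_def by simp
  ultimately have "v \<in> P1_space P \<T>" unfolding P1_space_def dirichlet_def by auto
  moreover have "v z = d z" if "z \<in> mesh_vertices \<T>" for z
  proof -
    from that obtain T where "T \<in> \<T>" "z \<in> vertices T" unfolding mesh_vertices_def by blast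
    moreover from this have "z \<in> T" by (auto simp: vertices_def extreme_point_of_def)
    ultimately show ?thesis using vT q(2) by simp
  qed
  ultimately show ?thesis by blast
qed

lemma P1_affine_on:
  assumes "v \<in> P1_space P \<T>" "T \<in> \<T>"
  shows "\<exists>q. affine_fun q \<and> (\<forall>x\<in>T. v x = q x)"
  using assms unfolding P1_space_def by blast

lemma P1_eqI:
  assumes v: "v \<in> P1_space P \<T>" and w: "w \<in> P1_space P \<T>"
    and eq: "\<And>z. z \<in> mesh_vertices \<T> \<Longrightarrow> v z = w z"
  shows "v = w"
proof
  fix x
  show "v x = w x"
  proof (cases "x \<in> closure (Omega P)")
    case True
    then obtain T where T: "T \<in> \<T>" "x \<in> T" using covers by blast
    obtain p q where p: "affine_fun p" "\<And>x. x \<in> T \<Longrightarrow> v x = p x"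
      and q: "affine_fun q" "\<And>x. x \<in> T \<Longrightarrow> w x = q x"
      using P1_affine_on[OF v T(1)] P1_affine_on[OF w T(1)] by metis
    note t = triangle_vertices[OF triangle[OF T(1)]]
    have "p x = q x"
    proof (rule affine_fun_eq_on_hull[OF p(1) q(1) t(3)])
      show "x \<in> convex hull vertices T" using t(4) T(2) by simp
      fix z assume z: "z \<in> vertices T"
      then have "z \<in> T" by (auto simp: vertices_def extreme_point_of_def)
      moreover have "v z = w z" using eq z T(1) by (auto simp: mesh_vertices_def)
      ultimately show "p z = q z" using p q by simp
    qed
    then show ?thesis using p q T by simp
  next
    case False
    then show ?thesis using v w unfolding P1_space_def by simp
  qed
qed

lemma P1_subspace: "cvs.subspace (P1_space P \<T>)"
  unfolding cvs.subspace_def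
proof (intro conjI ballI allI)
  have "(0::cfun) = (\<lambda>x. 0)" by auto
  then show "0 \<in> P1_space P \<T>" unfolding P1_space_def using affine_fun_zero
    by (auto intro!: exI[of _ "0::cfun"])
  fix v w assume v: "v \<in> P1_space P \<T>" and w: "w \<in> P1_space P \<T>"
  have "v + w = (\<lambda>x. v x + w x)" by auto
  moreover have "\<exists>q. affine_fun q \<and> (\<forall>x\<in>T. (v + w) x = q x)" if T: "T \<in> \<T>" for T
  proof -
    obtain p q where "affine_fun p" "\<And>x. x \<in> T \<Longrightarrow> v x = p x"
      "affine_fun q" "\<And>x. x \<in> T \<Longrightarrow> w x = q x"
      using P1_affine_on[OF v T] P1_affine_on[OF w T] by metis
    then show ?thesis using affine_fun_add by (intro exI[of _ "p + q"]) auto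
  qed
  ultimately show "v + w \<in> P1_space P \<T>"
    using v w unfolding P1_space_def by (auto intro: continuous_on_add)
next
  fix c v assume v: "v \<in> P1_space P \<T>"
  have "fscale c v = (\<lambda>x. c * v x)" by auto
  moreover have "\<exists>q. affine_fun q \<and> (\<forall>x\<in>T. (fscale c v) x = q x)" if T: "T \<in> \<T>" for T
  proof -
    obtain p where "affine_fun p" "\<And>x. x \<in> T \<Longrightarrow> v x = p x"
      using P1_affine_on[OF v T] by metis
    then show ?thesis using affine_fun_scale by (intro exI[of _ "fscale c p"]) auto
  qed
  ultimately show "fscale c v \<in> P1_space P \<T>"
    using v unfolding P1_space_def by (auto intro: continuous_intros)
qed

lemma P1_conj: "v \<in> P1_space P \<T> \<Longrightarrow> conj_fun v \<in> P1_space P \<T>"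
proof -
  assume v: "v \<in> P1_space P \<T>"
  have "\<exists>q. affine_fun q \<and> (\<forall>x\<in>T. (conj_fun v) x = q x)" if T: "T \<in> \<T>" for T
  proof -
    obtain p where "affine_fun p" "\<And>x. x \<in> T \<Longrightarrow> v x = p x"
      using P1_affine_on[OF v T] by metis
    then show ?thesis using affine_fun_conj by (intro exI[of _ "conj_fun p"]) auto
  qed
  then show ?thesis
    using v unfolding P1_space_def by (auto simp: conj_fun_def intro: continuous_intros)
qed

text \<open>
  The nodal functions of the vertices off the Dirichlet boundary form a basis.
\<close>

lemma P1_fin_dim: "fin_dim_subspace (P1_space P \<T>)"
proof -
  define N where "N = mesh_vertices \<T> - dirichlet P"
  have "\<forall>z\<in>N. \<exists>v\<in>P1_space P \<T>. \<forall>z'\<in>mesh_vertices \<T>. v z' = (if z' = z then 1 else 0)"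
    by (intro ballI nodal_interpolant) (auto simp: N_def)
  then obtain \<phi> where \<phi>: "\<And>z. z \<in> N \<Longrightarrow> \<phi> z \<in> P1_space P \<T>"
    "\<And>z z'. z \<in> N \<Longrightarrow> z' \<in> mesh_vertices \<T> \<Longrightarrow> \<phi> z z' = (if z' = z then 1 else 0)" by metis
  have fN: "finite N" using finite_mesh_vertices by (simp add: N_def)
  have "v \<in> cvs.span (\<phi> ` N)" if v: "v \<in> P1_space P \<T>" for v
  proof -
    let ?s = "\<Sum>z\<in>N. fscale (v z) (\<phi> z)"
    have "?s \<in> P1_space P \<T>"
      by (intro cvs.subspace_sum[OF P1_subspace] cvs.subspace_scale[OF P1_subspace] \<phi>(1))
    moreover have "v z = ?s z" if z: "z \<in> mesh_vertices \<T>" for z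
    proof -
      have "?s z = (\<Sum>y\<in>N. if y = z then v y else 0)"
        using \<phi>(2) z by (auto simp: sum_fun_apply intro!: sum.cong)
      also have "\<dots> = v z"
        using fN z v by (auto simp: N_def P1_space_def dirichlet_def)
      finally show ?thesis by simp
    qed
    ultimately have "v = ?s" using P1_eqI[OF v] by blast
    moreover have "?s \<in> cvs.span (\<phi> ` N)"
      by (intro cvs.span_sum cvs.span_scale cvs.span_base imageI)
    ultimately show ?thesis by simp
  qed
  moreover have "cvs.span (\<phi> ` N) \<subseteq> P1_space P \<T>"
    using \<phi>(1) P1_subspace by (intro cvs.span_minimal) auto
  ultimately have "P1_space P \<T> = cvs.span (\<phi> ` N)" by blast
  then show ?thesis unfolding fin_dim_subspace_def using P1_subspace fN by blast
qed

end

lemma P1_space_refines: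
  assumes "refines \<T>' \<T>"
  shows "P1_space P \<T> \<subseteq> P1_space P \<T>'"
proof
  fix v assume v: "v \<in> P1_space P \<T>"
  have "\<exists>q. affine_fun q \<and> (\<forall>x\<in>T'. v x = q x)" if T': "T' \<in> \<T>'" for T'
  proof -
    obtain T where "T \<in> \<T>" "T' \<subseteq> T" using assms T' unfolding refines_def by blast
    then show ?thesis using v unfolding P1_space_def by blast
  qed
  then show "v \<in> P1_space P \<T>'" using v unfolding P1_space_def by blast
qed

section \<open>Integration over the elements of a mesh\<close>

lemma null_sets_lborelI: "S \<in> sets borel \<Longrightarrow> negligible S \<Longrightarrow> S \<in> null_sets lborel"
  using negligible_iff_null_sets null_sets_completion_iff[of S lborel] by auto

lemma open_null_set_empty:
  assumes "open (U :: pt set)" "U \<in> null_sets lborel"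
  shows "U = {}"
proof (rule ccontr)
  assume "U \<noteq> {}"
  then have "\<not> negligible U" using open_not_negligible assms(1) by blast
  moreover have "U \<in> null_sets lebesgue"
    using assms null_sets_completion_iff[of U lborel] by (auto simp: null_sets_def)
  ultimately show False using negligible_iff_null_sets by blast
qed

text \<open>
  The points of \<open>U\<close> at which \<open>f\<close> is positive form an open null set, and open null sets are empty.
\<close>

lemma continuous_nonneg_integral_eq_0:
  fixes f :: "pt \<Rightarrow> real"
  assumes S: "S \<in> sets lborel" and U: "open U" "U \<subseteq> S" and f: "continuous_on U f"
    and int: "set_integrable lborel S f" and nn: "\<And>x. x \<in> S \<Longrightarrow> f x \<ge> 0"
    and zero: "(LINT x:S|lborel. f x) = 0" and x: "x \<in> U"
  shows "f x = 0"
proof -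
  have "AE x in lborel. indicator S x *\<^sub>R f x = 0"
    using integral_nonneg_eq_0_iff_AE[of lborel "\<lambda>x. indicator S x *\<^sub>R f x"] int zero nn
    unfolding set_integrable_def set_lebesgue_integral_def
    by (auto simp: indicator_def)
  then have ae: "AE x in lborel. \<not> (x \<in> U \<inter> f -` {0<..})"
    by eventually_elim (use U in \<open>auto simp: indicator_def split: if_splits\<close>)
  have op: "open (U \<inter> f -` {0<..})"
    using continuous_open_preimage[OF f U(1) open_greaterThan] .
  then have "U \<inter> f -` {0<..} \<in> sets lborel" by simp
  then have "U \<inter> f -` {0<..} \<in> null_sets lborel"
    using AE_iff_null_sets[of "U \<inter> f -` {0<..}" lborel] ae by blast
  then have "U \<inter> f -` {0<..} = {}" using open_null_set_empty op by blast
  then show ?thesis using nn[of x] U(2) x by force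
qed

lemma triangle_frontier_null: "2 simplex (T :: pt set) \<Longrightarrow> frontier T \<in> null_sets lborel"
  by (intro null_sets_lborelI negligible_convex_frontier triangle_convex) auto

lemma triangle_measure_pos:
  assumes "2 simplex (T :: pt set)"
  shows "measure lborel T > 0"
proof (rule ccontr)
  assume "\<not> measure lborel T > 0"
  then have "measure lborel T = 0" by (simp add: measure_nonneg order_antisym)
  moreover have "emeasure lborel T < \<infinity>"
    using emeasure_compact_finite[OF triangle_compact[OF assms]] by simp
  ultimately have "emeasure lborel T = 0" by (simp add: emeasure_eq_ennreal_measure less_top)
  moreover have "T \<in> sets lborel" using triangle_compact[OF assms] by (simp add: compact_imp_closed)
  ultimately have "T \<in> null_sets lborel" by auto
  then have "interior T \<in> null_sets lborel"
    by (rule null_sets_subset) (auto simp: interior_subset)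
  then show False using open_null_set_empty triangle_interior[OF assms] by blast
qed

context mesh
begin

lemma triangle_sets: "T \<in> \<T> \<Longrightarrow> T \<in> sets borel"
  using triangle triangle_compact by (simp add: compact_imp_closed)

lemma proper_face_null:
  assumes "T \<in> \<T>" "F face_of T" "F \<noteq> T" "F \<in> sets borel"
  shows "F \<in> null_sets lborel"
proof (rule null_sets_subset[OF triangle_frontier_null[OF triangle[OF assms(1)]]])
  have "F \<inter> interior T = {}" using face_of_disjoint_interior[OF assms(2,3)] .
  moreover have "F \<subseteq> closure T" using face_of_imp_subset[OF assms(2)] closure_subset by blast
  ultimately show "F \<subseteq> frontier T" unfolding frontier_def by blast
qed (use assms in simp)

lemma distinct_face:
  assumes "T \<in> \<T>" "T' \<in> \<T>" "T \<noteq> T'"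
  shows "(T \<inter> T' face_of T \<and> T \<inter> T' \<noteq> T) \<or> (T \<inter> T' face_of T' \<and> T \<inter> T' \<noteq> T')"
  using inter_face[OF assms(1,2)] inter_face[OF assms(2,1)] assms(3) by (metis Int_commute)

text \<open>
  The intersection is a proper face of at least one of the two elements, hence part of the frontier of a convex set.
\<close>

lemma element_inter_null:
  assumes "T \<in> \<T>" "T' \<in> \<T>" "T \<noteq> T'"
  shows "T \<inter> T' \<in> null_sets lborel"
  using distinct_face[OF assms] proper_face_null triangle_sets assms by (metis sets.Int)

lemma Omega_borel: "Omega P \<in> sets borel"
  using open_Omega by simp

lemma integral_over_elements:
  fixes f :: "pt \<Rightarrow> 'b :: {banach, second_countable_topology}"
  assumes f: "set_integrable lborel (Omega P) f"
  shows "(\<Sum>T\<in>\<T>. LINT x:Omega P \<inter> T|lborel. f x) = (LINT x:Omega P|lborel. f x)"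
proof -
  have "(LINT x:(\<Union>T\<in>\<T>. Omega P \<inter> T)|lborel. f x) = (\<Sum>T\<in>\<T>. LINT x:Omega P \<inter> T|lborel. f x)"
  proof (rule set_integral_finite_UN_AE[OF finite_mesh])
    fix T T' assume T: "T \<in> \<T>" "T' \<in> \<T>"
    show "AE x in lborel. x \<in> Omega P \<inter> T \<and> x \<in> Omega P \<inter> T' \<longrightarrow> T = T'"
    proof (cases "T = T'")
      case False
      then show ?thesis using AE_not_in[OF element_inter_null[OF T False]] by eventually_elim auto
    qed simp
  next
    fix T assume T: "T \<in> \<T>"
    show "Omega P \<inter> T \<in> sets lborel" using T triangle_sets Omega_borel by simp
    then show "set_integrable lborel (Omega P \<inter> T) f"
      by (rule set_integrable_subset[OF f]) simp
  qed
  moreover have "(\<Union>T\<in>\<T>. Omega P \<inter> T) = Omega P" using covers closure_subset by fastforce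
  ultimately show ?thesis by simp
qed

lemma element_interior: "T \<in> \<T> \<Longrightarrow> interior T \<inter> Omega P \<noteq> {}"
proof
  assume T: "T \<in> \<T>" "interior T \<inter> Omega P = {}"
  then have "interior T \<inter> closure (Omega P) = {}"
    by (simp add: open_Int_closure_eq_empty)
  then show False
    using T triangle_interior[OF triangle[OF T(1)]] triangle_subset[OF T(1)] interior_subset by blast
qed

end

section \<open>Square-integrable functions\<close>

lemma L2_on_mult:
  assumes "L2_on S v" "L2_on S w"
  shows "set_integrable lborel S (\<lambda>x. v x * cnj (w x))"
proof -
  let ?v = "\<lambda>x. indicat_real S x *\<^sub>R v x" and ?w = "\<lambda>x. indicat_real S x *\<^sub>R w x"
  have m: "?v \<in> borel_measurable lborel" "?w \<in> borel_measurable lborel"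
    using assms unfolding L2_on_def set_borel_measurable_def by auto
  have "integrable lborel (\<lambda>x. indicat_real S x *\<^sub>R (cmod (v x))\<^sup>2 + indicat_real S x *\<^sub>R (cmod (w x))\<^sup>2)"
    using assms unfolding L2_on_def set_integrable_def by (intro Bochner_Integration.integrable_add) auto
  then have "integrable lborel (\<lambda>x. ?v x * cnj (?w x))"
  proof (rule Bochner_Integration.integrable_bound)
    have "cnj \<in> borel_measurable borel" by (intro borel_measurable_continuous_onI continuous_intros)
    then have "(\<lambda>x. cnj (?w x)) \<in> borel_measurable lborel"
      using measurable_compose[OF m(2)] by blast
    then show "(\<lambda>x. ?v x * cnj (?w x)) \<in> borel_measurable lborel" using m(1) by (intro borel_measurable_times)
    have "cmod a * cmod b \<le> (cmod a)\<^sup>2 + (cmod b)\<^sup>2" for a b :: complex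
      using sum_squares_bound[of "cmod a" "cmod b", unfolded mult.assoc]
        mult_nonneg_nonneg[of "cmod a" "cmod b", OF norm_ge_zero norm_ge_zero] by linarith
    then show "AE x in lborel. norm (?v x * cnj (?w x))
        \<le> norm (indicat_real S x *\<^sub>R (cmod (v x))\<^sup>2 + indicat_real S x *\<^sub>R (cmod (w x))\<^sup>2)"
      by (intro AE_I2) (auto simp: indicator_def norm_mult)
  qed
  then show ?thesis unfolding set_integrable_def
    by (rule Bochner_Integration.integrable_cong[THEN iffD1, rotated 2]) (auto simp: indicator_def)
qed

lemma L2_on_conj: "L2_on S v \<Longrightarrow> L2_on S (conj_fun v)"
proof -
  assume v: "L2_on S v"
  have "cnj \<in> borel_measurable borel" by (intro borel_measurable_continuous_onI continuous_intros)
  then have "(\<lambda>x. cnj (indicat_real S x *\<^sub>R v x)) \<in> borel_measurable lborel"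
    using v measurable_compose unfolding L2_on_def set_borel_measurable_def by blast
  then show ?thesis using v unfolding L2_on_def set_borel_measurable_def conj_fun_def by simp
qed

lemma L2_on_scale: "L2_on S v \<Longrightarrow> L2_on S (fscale c v)"
proof -
  assume v: "L2_on S v"
  have "(\<lambda>x. c * (indicat_real S x *\<^sub>R v x)) \<in> borel_measurable lborel"
    using v unfolding L2_on_def set_borel_measurable_def by (intro borel_measurable_times) auto
  moreover have "set_integrable lborel S (\<lambda>x. (cmod c)\<^sup>2 * (cmod (v x))\<^sup>2)"
    using v unfolding L2_on_def by (intro set_integrable_mult_right) auto
  ultimately show ?thesis
    unfolding L2_on_def set_borel_measurable_def by (simp add: norm_mult power_mult_distrib)
qed

lemma L2_on_add:
  assumes v: "L2_on S v" and w: "L2_on S w"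
  shows "L2_on S (v + w)"
proof -
  have m[measurable]: "(\<lambda>x. indicat_real S x *\<^sub>R v x + indicat_real S x *\<^sub>R w x) \<in> borel_measurable lborel"
    using assms unfolding L2_on_def set_borel_measurable_def by (intro borel_measurable_add) auto
  have "integrable lborel (\<lambda>x. 2 * (indicat_real S x *\<^sub>R (cmod (v x))\<^sup>2) + 2 * (indicat_real S x *\<^sub>R (cmod (w x))\<^sup>2))"
    using assms unfolding L2_on_def set_integrable_def by (intro Bochner_Integration.integrable_add Bochner_Integration.integrable_mult_right) auto
  then have "integrable lborel (\<lambda>x. (cmod (indicat_real S x *\<^sub>R v x + indicat_real S x *\<^sub>R w x))\<^sup>2)"
  proof (rule Bochner_Integration.integrable_bound)
    show "(\<lambda>x. (cmod (indicat_real S x *\<^sub>R v x + indicat_real S x *\<^sub>R w x))\<^sup>2) \<in> borel_measurable lborel"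
      by measurable
    have "(cmod (a + b))\<^sup>2 \<le> 2 * (cmod a)\<^sup>2 + 2 * (cmod b)\<^sup>2" for a b :: complex
    proof -
      have "(cmod (a + b))\<^sup>2 \<le> (cmod a + cmod b)\<^sup>2" by (intro power_mono norm_triangle_ineq) simp
      also have "\<dots> \<le> 2 * (cmod a)\<^sup>2 + 2 * (cmod b)\<^sup>2"
        using sum_squares_bound[of "cmod a" "cmod b"] by (simp add: power2_sum)
      finally show ?thesis .
    qed
    then show "AE x in lborel. norm ((cmod (indicat_real S x *\<^sub>R v x + indicat_real S x *\<^sub>R w x))\<^sup>2)
        \<le> norm (2 * (indicat_real S x *\<^sub>R (cmod (v x))\<^sup>2) + 2 * (indicat_real S x *\<^sub>R (cmod (w x))\<^sup>2))"
      by (intro AE_I2) (auto simp: indicator_def)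
  qed
  moreover have "(\<lambda>x. (cmod (indicat_real S x *\<^sub>R v x + indicat_real S x *\<^sub>R w x))\<^sup>2)
      = (\<lambda>x. indicat_real S x *\<^sub>R (cmod ((v + w) x))\<^sup>2)"
    by (auto simp: indicator_def)
  ultimately show ?thesis
    using m unfolding L2_on_def set_borel_measurable_def set_integrable_def by (simp add: scaleR_add_right)
qed

lemma set_integrable_bounded_measurable:
  fixes f :: "pt \<Rightarrow> 'b :: {banach, second_countable_topology}"
  assumes S: "bounded S" "S \<in> sets borel" and f: "set_borel_measurable lborel S f"
    and B: "\<And>x. x \<in> S \<Longrightarrow> norm (f x) \<le> B"
  shows "set_integrable lborel S f"
  unfolding set_integrable_def
proof (rule integrableI_bounded_set[where A = S and B = B])
  show "(\<lambda>x. indicat_real S x *\<^sub>R f x) \<in> borel_measurable lborel"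
    using f unfolding set_borel_measurable_def .
  show "emeasure lborel S < \<infinity>" using emeasure_bounded_finite[OF S(1)] .
  show "AE x in lborel. x \<in> S \<longrightarrow> norm (indicat_real S x *\<^sub>R f x) \<le> B"
    using B by (intro AE_I2) (auto simp: indicator_def)
qed (use S in auto)

lemma L2_on_bounded_measurable:
  assumes S: "bounded S" "S \<in> sets borel" and f: "set_borel_measurable lborel S v"
    and B: "\<And>x. x \<in> S \<Longrightarrow> norm (v x) \<le> B"
  shows "L2_on S v"
proof -
  have "set_borel_measurable lborel S (\<lambda>x. (cmod (v x))\<^sup>2)"
  proof -
    have [measurable]: "(\<lambda>x. indicat_real S x *\<^sub>R v x) \<in> borel_measurable lborel"
      using f unfolding set_borel_measurable_def .
    have "(\<lambda>x. (cmod (indicat_real S x *\<^sub>R v x))\<^sup>2) \<in> borel_measurable lborel"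
      by measurable
    moreover have "(\<lambda>x. (cmod (indicat_real S x *\<^sub>R v x))\<^sup>2) = (\<lambda>x. indicat_real S x *\<^sub>R (cmod (v x))\<^sup>2)"
      by (auto simp: indicator_def)
    ultimately show ?thesis unfolding set_borel_measurable_def by simp
  qed
  moreover have "norm ((cmod (v x))\<^sup>2) \<le> B\<^sup>2" if "x \<in> S" for x
    using B[OF that] by (simp add: power_mono)
  ultimately have "set_integrable lborel S (\<lambda>x. (cmod (v x))\<^sup>2)"
    by (rule set_integrable_bounded_measurable[OF S])
  then show ?thesis unfolding L2_on_def using f by simp
qed

lemma set_borel_measurable_continuous_on:
  fixes f :: "pt \<Rightarrow> 'b :: {banach, second_countable_topology}"
  assumes "S \<in> sets borel" "continuous_on S f"
  shows "set_borel_measurable lborel S f"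
  using borel_measurable_continuous_on_indicator[OF assms] unfolding set_borel_measurable_def by simp

lemma continuous_bounded_on_closure:
  fixes v :: "pt \<Rightarrow> 'b :: real_normed_vector"
  assumes "bounded S" "continuous_on (closure S) v"
  obtains B where "B > 0" "\<And>x. x \<in> closure S \<Longrightarrow> norm (v x) \<le> B"
proof -
  have "compact (closure S)" using assms(1) by (simp add: compact_closure)
  then have "bounded (v ` closure S)" using assms(2) compact_continuous_image compact_imp_bounded by blast
  then show ?thesis using that unfolding bounded_pos by auto
qed

lemma L2_on_continuous:
  assumes "bounded S" "open S" "continuous_on (closure S) v"
  shows "L2_on S v"
proof -
  obtain B where B: "\<And>x. x \<in> closure S \<Longrightarrow> norm (v x) \<le> B"
    using continuous_bounded_on_closure[OF assms(1,3)] by metis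
  have "S \<subseteq> closure S" by (rule closure_subset)
  then show ?thesis
    using assms B by (intro L2_on_bounded_measurable[of S v B] set_borel_measurable_continuous_on)
      (auto intro: continuous_on_subset)
qed

lemma L2_on_integrable:
  assumes "bounded S" "S \<in> sets borel" "L2_on S v"
  shows "set_integrable lborel S v"
proof -
  have "L2_on S (\<lambda>x. 1)"
    by (rule L2_on_bounded_measurable[OF assms(1,2), where B = 1])
      (use assms(2) in \<open>auto intro: set_borel_measurable_continuous_on\<close>)
  from L2_on_mult[OF assms(3) this] show ?thesis by simp
qed

section \<open>Test functions and uniqueness of weak gradients\<close>

definition C1_fun :: "(pt \<Rightarrow> real) \<Rightarrow> bool" where
  "C1_fun f \<longleftrightarrow> (\<forall>x. f differentiable (at x)) \<and> (\<forall>i. continuous_on UNIV (partial i f))"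

lemma partial_eq: "(f has_derivative f') (at x) \<Longrightarrow> partial i f x = f' (axis i 1)"
  unfolding partial_def using frechet_derivative_at by metis

lemma C1_funI:
  assumes "\<And>x. (f has_derivative f' x) (at x)" "\<And>i. continuous_on UNIV (\<lambda>x. f' x (axis i 1))"
  shows "C1_fun f"
proof -
  have "partial i f = (\<lambda>x. f' x (axis i 1))" for i using partial_eq[OF assms(1)] by auto
  then show ?thesis unfolding C1_fun_def using assms differentiable_def by metis
qed

lemma C1_fun_deriv: "C1_fun f \<Longrightarrow> (f has_derivative frechet_derivative f (at x)) (at x)"
  unfolding C1_fun_def using frechet_derivative_works by blast

lemma C1_fun_continuous: "C1_fun f \<Longrightarrow> continuous_on S f"
  unfolding C1_fun_def
  using differentiable_imp_continuous_within by (metis continuous_at_imp_continuous_on)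

lemma C1_fun_mult:
  assumes f: "C1_fun f" and g: "C1_fun g"
  shows "C1_fun (\<lambda>x. f x * g x)"
proof (rule C1_funI)
  show "((\<lambda>x. f x * g x) has_derivative
      (\<lambda>h. f x * frechet_derivative g (at x) h + frechet_derivative f (at x) h * g x)) (at x)" for x
    using has_derivative_mult[OF C1_fun_deriv[OF f] C1_fun_deriv[OF g]] .
  show "continuous_on UNIV (\<lambda>x. f x * frechet_derivative g (at x) (axis i 1)
      + frechet_derivative f (at x) (axis i 1) * g x)" for i
    using f g C1_fun_continuous[OF f] C1_fun_continuous[OF g]
    unfolding C1_fun_def partial_def by (auto intro!: continuous_intros)
qed

lemma C1_fun_compose:
  assumes f: "C1_fun f" and h: "\<And>t. (h has_real_derivative h' t) (at t)" "continuous_on UNIV h'"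
  shows "C1_fun (\<lambda>x. h (f x))"
proof (rule C1_funI)
  show "((\<lambda>x. h (f x)) has_derivative (\<lambda>y. frechet_derivative f (at x) y * h' (f x))) (at x)" for x
    using has_derivative_compose[OF C1_fun_deriv[OF f] h(1)[unfolded has_field_derivative_def]]
    by (simp add: mult.commute)
  show "continuous_on UNIV (\<lambda>x. frechet_derivative f (at x) (axis i 1) * h' (f x))" for i
    using f continuous_on_compose2[OF h(2) C1_fun_continuous[OF f]]
    unfolding C1_fun_def partial_def by (auto intro!: continuous_intros)
qed

lemma C1_fun_coordinate: "C1_fun (\<lambda>x. x $ i - c)" "C1_fun (\<lambda>x. c - x $ i)"
proof -
  have d: "((\<lambda>x::pt. x $ i) has_derivative (\<lambda>h. h $ i)) (at x)" for x
    by (intro bounded_linear_imp_has_derivative bounded_linear_vec_nth)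
  show "C1_fun (\<lambda>x. x $ i - c)"
    by (rule C1_funI[where f' = "\<lambda>x h. h $ i - 0"]) (intro has_derivative_diff d has_derivative_const, simp)
  show "C1_fun (\<lambda>x. c - x $ i)"
    by (rule C1_funI[where f' = "\<lambda>x h. 0 - h $ i"]) (intro has_derivative_diff d has_derivative_const, simp)
qed

text \<open>
  Squaring the positive part makes it continuously differentiable.
\<close>

definition pos_sq :: "real \<Rightarrow> real" where "pos_sq t = (max 0 t)\<^sup>2"

lemma pos_sq_deriv: "(pos_sq has_real_derivative 2 * max 0 t) (at t)"
proof (cases t "0 :: real" rule: linorder_cases)
  case less
  have "((\<lambda>t. 0) has_real_derivative 2 * max 0 t) (at t)" using less by simp
  then show ?thesis
    by (rule has_field_derivative_transform_within_open[of _ _ _ "{..<0}"]) (use less in \<open>auto simp: pos_sq_def\<close>)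
next
  case greater
  have "((\<lambda>t. t\<^sup>2) has_real_derivative 2 * max 0 t) (at t)"
    using greater by (auto intro!: derivative_eq_intros)
  then show ?thesis
    by (rule has_field_derivative_transform_within_open[of _ _ _ "{0<..}"]) (use greater in \<open>auto simp: pos_sq_def\<close>)
next
  case equal
  have "((\<lambda>h. pos_sq h / h) \<longlongrightarrow> 0) (at 0)"
  proof (rule Lim_null_comparison)
    show "\<forall>\<^sub>F h in at 0. norm (pos_sq h / h) \<le> \<bar>h\<bar>"
      by (intro always_eventually allI) (auto simp: pos_sq_def max_def power2_eq_square abs_if)
    show "((\<lambda>h::real. \<bar>h\<bar>) \<longlongrightarrow> 0) (at 0)" by (rule tendsto_eq_intros | simp)+
  qed
  then show ?thesis using equal unfolding DERIV_def by (simp add: pos_sq_def)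
qed

lemma pos_sq_nonneg: "0 \<le> pos_sq t" and pos_sq_pos_iff: "0 < pos_sq t \<longleftrightarrow> 0 < t"
  by (auto simp: pos_sq_def max_def)

text \<open>
  The functions \<open>1 - exp (- n \<psi>)\<close>, where \<open>\<psi>\<close> is a continuously differentiable function that is
  positive exactly on an open box, are test functions which increase to the indicator of the box.
\<close>

lemma box_test_functions:
  fixes a b :: pt
  assumes "cbox a b \<subseteq> S"
  obtains \<phi> :: "nat \<Rightarrow> pt \<Rightarrow> real" where "\<And>n. C1_compact S (\<phi> n)" "\<And>n x. \<bar>\<phi> n x\<bar> \<le> 1"
    "\<And>x. (\<lambda>n. \<phi> n x) \<longlonglongrightarrow> indicat_real (box a b) x"
proof -
  define \<psi> where "\<psi> = (\<lambda>x::pt. pos_sq (x $ 1 - a $ 1) * pos_sq (b $ 1 - x $ 1) *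
     (pos_sq (x $ 2 - a $ 2) * pos_sq (b $ 2 - x $ 2)))"
  have c: "continuous_on UNIV (\<lambda>t::real. 2 * max 0 t)" by (intro continuous_intros)
  have C1: "C1_fun \<psi>" unfolding \<psi>_def
    by (intro C1_fun_mult C1_fun_compose[OF _ pos_sq_deriv c] C1_fun_coordinate)
  have nn: "\<psi> x \<ge> 0" for x unfolding \<psi>_def by (intro mult_nonneg_nonneg pos_sq_nonneg)
  have pos: "\<psi> x > 0 \<longleftrightarrow> x \<in> box a b" for x
  proof -
    have "\<psi> x > 0 \<longleftrightarrow> 0 < pos_sq (x $ 1 - a $ 1) \<and> 0 < pos_sq (b $ 1 - x $ 1) \<and>
        0 < pos_sq (x $ 2 - a $ 2) \<and> 0 < pos_sq (b $ 2 - x $ 2)"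
    proof -
      have "0 < p * q * (r * s) \<longleftrightarrow> 0 < p \<and> 0 < q \<and> 0 < r \<and> 0 < s"
        if "0 \<le> p" "0 \<le> q" "0 \<le> r" "0 \<le> s" for p q r s :: real
        using that by (auto simp: zero_less_mult_iff mult_less_0_iff)
      then show ?thesis unfolding \<psi>_def using pos_sq_nonneg by simp
    qed
    then show ?thesis unfolding pos_sq_pos_iff by (auto simp: mem_box_cart forall_2)
  qed
  define \<phi> where "\<phi> = (\<lambda>n x. 1 - exp (- (real n * \<psi> x)))"
  have "C1_fun (\<phi> n)" for n
  proof -
    have "((\<lambda>t. 1 - exp (- (real n * t))) has_real_derivative real n * exp (- (real n * t))) (at t)" for t
      by (auto intro!: derivative_eq_intros)
    moreover have "continuous_on UNIV (\<lambda>t. real n * exp (- (real n * t)))" by (intro continuous_intros)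
    ultimately show ?thesis unfolding \<phi>_def by (rule C1_fun_compose[OF C1])
  qed
  moreover have "closure {x. \<phi> n x \<noteq> 0} \<subseteq> cbox a b" for n
  proof (rule closure_minimal)
    show "{x. \<phi> n x \<noteq> 0} \<subseteq> cbox a b"
    proof
      fix x assume "x \<in> {x. \<phi> n x \<noteq> 0}"
      then have "\<psi> x \<noteq> 0" unfolding \<phi>_def by auto
      then have "x \<in> box a b" using nn[of x] pos by fastforce
      then show "x \<in> cbox a b" using box_subset_cbox by blast
    qed
  qed (rule closed_cbox)
  moreover then have "compact (closure {x. \<phi> n x \<noteq> 0})" for n
    using compact_cbox[of a b] compact_Int_closed[of "cbox a b" "closure {x. \<phi> n x \<noteq> 0}"]
    by (simp add: Int_absorb1)
  ultimately have "C1_compact S (\<phi> n)" for n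
    unfolding C1_compact_def C1_fun_def using assms by (meson subset_trans)
  moreover have "\<bar>\<phi> n x\<bar> \<le> 1" for n x unfolding \<phi>_def using nn[of x] by simp
  moreover have "(\<lambda>n. \<phi> n x) \<longlonglongrightarrow> indicat_real (box a b) x" for x
  proof (cases "x \<in> box a b")
    case True
    then have p: "\<psi> x > 0" using pos by simp
    have "(\<lambda>n. exp (- \<psi> x) ^ n) \<longlonglongrightarrow> 0" by (rule LIMSEQ_realpow_zero) (use p in auto)
    then have "(\<lambda>n. 1 - exp (- \<psi> x) ^ n) \<longlonglongrightarrow> 1 - 0" by (intro tendsto_diff tendsto_const)
    moreover have "exp (- \<psi> x) ^ n = exp (- (real n * \<psi> x))" for n
      by (simp add: exp_of_nat_mult[symmetric])
    ultimately show ?thesis using True unfolding \<phi>_def by simp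
  next
    case False
    then have "\<psi> x = 0" using nn[of x] pos[of x] by simp
    then show ?thesis using False unfolding \<phi>_def by simp
  qed
  ultimately show ?thesis by (rule that)
qed

text \<open>
  The densities of the positive and the negative part of \<open>f\<close> agree on boxes, which generate the
  Borel sets.
\<close>

lemma AE_zero_of_box_integrals:
  fixes f :: "pt \<Rightarrow> real"
  assumes f: "integrable lborel f" and box: "\<And>a b. (LINT x:box a b|lborel. f x) = 0"
  shows "AE x in lborel. f x = 0"
proof -
  have m[measurable]: "f \<in> borel_measurable borel" using f by auto
  \<comment> \<open>\<open>ennreal\<close> cuts off negative values, so these are the positive and the negative part\<close>
  define M where "M = density lborel (\<lambda>x. ennreal (f x))"
  define N where "N = density lborel (\<lambda>x. ennreal (- f x))"
  have fin: "(\<integral>\<^sup>+x\<in>A. ennreal (g x) \<partial>lborel) < \<infinity>" if "integrable lborel g" for g :: "pt \<Rightarrow> real" and A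
  proof -
    have "(\<integral>\<^sup>+x\<in>A. ennreal (g x) \<partial>lborel) \<le> (\<integral>\<^sup>+x. ennreal (norm (g x)) \<partial>lborel)"
      by (intro nn_integral_mono) (auto simp: indicator_def ennreal_leI)
    also have "\<dots> < \<infinity>" using that by (simp add: integrable_iff_bounded)
    finally show ?thesis .
  qed
  have eqbox: "emeasure M (box a b) = emeasure N (box a b)" for a b
  proof -
    have i: "integrable lborel (\<lambda>x. indicator (box a b) x * f x)"
      using integrable_mult_indicator[OF _ f, of "box a b"] by simp
    have e: "(\<integral>\<^sup>+x. ennreal (indicator (box a b) x * g x) \<partial>lborel) = (\<integral>\<^sup>+x\<in>box a b. ennreal (g x) \<partial>lborel)"
      for g :: "pt \<Rightarrow> real"
      by (intro nn_integral_cong) (auto simp: indicator_def)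
    have "0 = enn2real (\<integral>\<^sup>+x\<in>box a b. ennreal (f x) \<partial>lborel) - enn2real (\<integral>\<^sup>+x\<in>box a b. ennreal (- f x) \<partial>lborel)"
      using real_lebesgue_integral_def[OF i] box[of a b] e[of f] e[of "\<lambda>x. - f x"]
      by (simp add: set_lebesgue_integral_def)
    then have "(\<integral>\<^sup>+x\<in>box a b. ennreal (f x) \<partial>lborel) = (\<integral>\<^sup>+x\<in>box a b. ennreal (- f x) \<partial>lborel)"
    proof -
      have *: "A = B" if "0 = enn2real A - enn2real B" "A < \<infinity>" "B < \<infinity>" for A B
        using that by (cases A; cases B) (auto simp: enn2real_eq_0_iff)
      have f': "integrable lborel (\<lambda>x. - f x)" using f by simp
      show ?thesis
        by (rule *) (fact, rule fin[OF f], rule fin[OF f'])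
    qed
    then show ?thesis unfolding M_def N_def by (simp add: emeasure_density)
  qed
  have "M = N"
  proof (rule measure_eqI_generator_eq[where E = "range (\<lambda>(a, b). box a b)" and \<Omega> = UNIV
        and A = "\<lambda>n. box (- (real n *\<^sub>R One)) (real n *\<^sub>R One)"])
    show "Int_stable (range (\<lambda>(a, b). box a b :: pt set))"
      by (auto simp: Int_stable_def box_Int_box)
    show "sets M = sigma_sets UNIV (range (\<lambda>(a, b). box a b))"
      unfolding M_def by (simp add: borel_eq_box)
    show "sets N = sigma_sets UNIV (range (\<lambda>(a, b). box a b))"
      unfolding N_def by (simp add: borel_eq_box)
    show "emeasure M X = emeasure N X" if "X \<in> range (\<lambda>(a, b). box a b)" for X
      using that eqbox by auto
    show "emeasure M (box (- (real n *\<^sub>R One)) (real n *\<^sub>R One)) \<noteq> \<infinity>" for n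
      using fin[OF f, of "box (- (real n *\<^sub>R One)) (real n *\<^sub>R One)"] unfolding M_def by (simp add: emeasure_density)
  qed (auto simp: UN_box_eq_UNIV)
  then have "AE x in lborel. ennreal (f x) = ennreal (- f x)"
    unfolding M_def N_def by (intro sigma_finite_measure.density_unique[OF sigma_finite_lborel]) auto
  then show ?thesis
  proof eventually_elim
    case (elim x)
    then show ?case by (cases "f x" "0 :: real" rule: linorder_cases) (auto simp: ennreal_neg)
  qed
qed

text \<open>
  Dominated convergence along the test functions above shows that the integrals over all boxes whose closure lies in
  the domain vanish, and the domain is a countable union of such boxes.
\<close>

lemma AE_zero_of_test_integrals_real:
  fixes f :: "pt \<Rightarrow> real"
  assumes op: "open \<Omega>" and f: "set_integrable lborel \<Omega> f"
    and test: "\<And>\<phi>. C1_compact \<Omega> \<phi> \<Longrightarrow> (LINT x:\<Omega>|lborel. f x * \<phi> x) = 0"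
  shows "AE x in lborel. x \<in> \<Omega> \<longrightarrow> f x = 0"
proof -
  have box0: "(LINT x:box a b|lborel. f x) = 0" if sub: "cbox a b \<subseteq> \<Omega>" for a b
  proof -
    obtain \<phi> :: "nat \<Rightarrow> pt \<Rightarrow> real" where \<phi>: "\<And>n. C1_compact \<Omega> (\<phi> n)" "\<And>n x. \<bar>\<phi> n x\<bar> \<le> 1"
      "\<And>x. (\<lambda>n. \<phi> n x) \<longlonglongrightarrow> indicat_real (box a b) x"
      using box_test_functions[OF sub] by metis
    let ?s = "\<lambda>n x. indicat_real \<Omega> x *\<^sub>R (f x * \<phi> n x)"
    have mf[measurable]: "(\<lambda>x. indicat_real \<Omega> x * f x) \<in> borel_measurable lborel"
      using f unfolding set_integrable_def by simp
    have ms: "?s n \<in> borel_measurable lborel" for n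
    proof -
      have "continuous_on UNIV (\<phi> n)"
        using \<phi>(1)[of n] C1_fun_continuous[of "\<phi> n" UNIV] unfolding C1_compact_def C1_fun_def by simp
      then have [measurable]: "\<phi> n \<in> borel_measurable lborel"
        by (simp add: borel_measurable_continuous_onI)
      have "(\<lambda>x. (indicat_real \<Omega> x * f x) * \<phi> n x) \<in> borel_measurable lborel" by measurable
      then show ?thesis by (simp add: mult.assoc)
    qed
    have "(\<lambda>n. LINT x|lborel. ?s n x) \<longlonglongrightarrow> (LINT x|lborel. indicat_real (box a b) x *\<^sub>R f x)"
    proof (rule integral_dominated_convergence[where w = "\<lambda>x. norm (indicat_real \<Omega> x *\<^sub>R f x)"])
      have "box a b \<subseteq> \<Omega>" using sub box_subset_cbox by blast
      then have eq: "indicat_real (box a b) x *\<^sub>R f x = (indicat_real \<Omega> x * f x) * indicat_real (box a b) x" for x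
        by (auto simp: indicator_def)
      show "(\<lambda>x. indicat_real (box a b) x *\<^sub>R f x) \<in> borel_measurable lborel" unfolding eq by measurable
      show "integrable lborel (\<lambda>x. norm (indicat_real \<Omega> x *\<^sub>R f x))"
        using f unfolding set_integrable_def by (rule integrable_norm)
      show "AE x in lborel. (\<lambda>n. ?s n x) \<longlonglongrightarrow> indicat_real (box a b) x *\<^sub>R f x"
      proof (rule AE_I2)
        fix x
        have "(\<lambda>n. indicat_real \<Omega> x * f x * \<phi> n x) \<longlonglongrightarrow> indicat_real \<Omega> x * f x * indicat_real (box a b) x"
          by (intro tendsto_mult tendsto_const \<phi>(3))
        then show "(\<lambda>n. ?s n x) \<longlonglongrightarrow> indicat_real (box a b) x *\<^sub>R f x"
          unfolding eq by (simp add: mult.assoc)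
      qed
      show "AE x in lborel. norm (?s n x) \<le> norm (indicat_real \<Omega> x *\<^sub>R f x)" for n
        using \<phi>(2)[of n] by (intro AE_I2) (auto simp: indicator_def abs_mult intro: mult_left_le)
    qed (rule ms)
    moreover have "(LINT x|lborel. ?s n x) = 0" for n
      using test[OF \<phi>(1)[of n]] unfolding set_lebesgue_integral_def .
    ultimately show ?thesis unfolding set_lebesgue_integral_def using LIMSEQ_unique[OF _ tendsto_const] by simp
  qed
  have ae: "AE x in lborel. x \<in> cbox c d \<longrightarrow> f x = 0" if sub: "cbox c d \<subseteq> \<Omega>" for c d
  proof -
    let ?F = "\<lambda>x. indicat_real (box c d) x *\<^sub>R f x"
    have "box c d \<subseteq> \<Omega>" using sub box_subset_cbox by blast
    then have i: "integrable lborel ?F"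
      using set_integrable_subset[OF f, of "box c d"] unfolding set_integrable_def by simp
    have "(LINT x:box a b|lborel. ?F x) = 0" for a b
    proof -
      obtain a' b' where ab: "box a b \<inter> box c d = box a' b'" unfolding box_Int_box by blast
      have "(LINT x:box a b|lborel. ?F x) = (LINT x:box a' b'|lborel. f x)"
        unfolding set_lebesgue_integral_def ab[symmetric]
        by (intro Bochner_Integration.integral_cong) (auto simp: indicator_def)
      also have "\<dots> = 0"
      proof (cases "box a' b' = {}")
        case True
        then show ?thesis unfolding set_lebesgue_integral_def by simp
      next
        case False
        have "cbox a' b' = closure (box a' b')" using closure_box[OF False] by simp
        also have "\<dots> \<subseteq> cbox c d"
          by (rule closure_minimal) (use ab box_subset_cbox in auto)
        finally show ?thesis using box0 sub by blast
      qed
      finally show ?thesis .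
    qed
    from AE_zero_of_box_integrals[OF i this] have 1: "AE x in lborel. ?F x = 0" .
    have "cbox c d - box c d \<in> null_sets lborel"
      by (intro null_sets_lborelI negligible_frontier_interval) auto
    from AE_not_in[OF this] 1 show ?thesis
      by eventually_elim (auto simp: indicator_def split: if_splits)
  qed
  obtain \<D> where D: "countable \<D>" "\<And>X. X \<in> \<D> \<Longrightarrow> \<exists>a b. X = cbox a b" "\<Union>\<D> = \<Omega>"
    using open_countable_Union_open_cbox[OF op] by metis
  have "AE x in lborel. \<forall>X\<in>\<D>. x \<in> X \<longrightarrow> f x = 0"
  proof (subst AE_ball_countable[OF D(1)], intro ballI)
    fix X assume X: "X \<in> \<D>"
    then obtain a b where ab: "X = cbox a b" using D(2) by metis
    moreover have "X \<subseteq> \<Omega>" using X D(3) by blast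
    ultimately show "AE x in lborel. x \<in> X \<longrightarrow> f x = 0" using ae by simp
  qed
  then show ?thesis by eventually_elim (use D(3) in blast)
qed

lemma C1_compact_bounded:
  assumes "C1_compact \<Omega> \<phi>"
  shows "continuous_on UNIV \<phi>" "\<exists>B>0. \<forall>x. \<bar>\<phi> x\<bar> \<le> B" "\<exists>B>0. \<forall>x. \<bar>partial i \<phi> x\<bar> \<le> B"
    "\<And>x. x \<notin> closure {x. \<phi> x \<noteq> 0} \<Longrightarrow> partial i \<phi> x = 0"
    "\<And>x. x \<notin> closure {x. \<phi> x \<noteq> 0} \<Longrightarrow> \<phi> x = 0"
proof -
  let ?K = "closure {x. \<phi> x \<noteq> 0}"
  have C1: "C1_fun \<phi>" using assms unfolding C1_compact_def C1_fun_def by simp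
  then show c: "continuous_on UNIV \<phi>" by (rule C1_fun_continuous)
  show z: "\<phi> x = 0" if "x \<notin> ?K" for x
  proof (rule ccontr)
    assume "\<phi> x \<noteq> 0"
    then have "x \<in> {x. \<phi> x \<noteq> 0}" by simp
    then show False using closure_subset[THEN subsetD] that by metis
  qed
  show pz: "partial i \<phi> x = 0" if "x \<notin> ?K" for x
  proof -
    have "((\<lambda>x. 0::real) has_derivative (\<lambda>h. 0)) (at x)" by simp
    then have "(\<phi> has_derivative (\<lambda>h. 0)) (at x)"
    proof (rule has_derivative_transform_within_open)
      show "open (- ?K)" by (rule open_Compl[OF closed_closure])
      show "x \<in> - ?K" using that by simp
      show "0 = \<phi> y" if "y \<in> - ?K" for y
        by (rule z[symmetric]) (use that in simp)
    qed
    then show ?thesis using partial_eq by blast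
  qed
  have bnd: "\<exists>B>0. \<forall>x. \<bar>g x\<bar> \<le> B" if g: "continuous_on UNIV g" "\<And>x. x \<notin> ?K \<Longrightarrow> g x = 0" for g :: "pt \<Rightarrow> real"
  proof -
    have "compact ?K" using assms unfolding C1_compact_def by simp
    then have "bounded (g ` ?K)"
      using g(1) by (intro compact_imp_bounded compact_continuous_image) (auto intro: continuous_on_subset)
    then obtain B where B: "B > 0" "\<forall>y\<in>g ` ?K. norm y \<le> B" unfolding bounded_pos by metis
    have "\<bar>g x\<bar> \<le> B" for x
    proof (cases "x \<in> ?K")
      case True
      then show ?thesis using B(2) by simp
    next
      case False
      then show ?thesis using B(1) g(2) by simp
    qed
    then show ?thesis using B(1) by (intro exI[of _ B]) simp
  qed
  show "\<exists>B>0. \<forall>x. \<bar>\<phi> x\<bar> \<le> B" using bnd[OF c z] .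
  show "\<exists>B>0. \<forall>x. \<bar>partial i \<phi> x\<bar> \<le> B"
    by (rule bnd[OF _ pz]) (use C1 in \<open>auto simp: C1_fun_def\<close>)
qed

lemma set_integrable_mult_bounded:
  fixes f :: "pt \<Rightarrow> complex" and g :: "pt \<Rightarrow> real"
  assumes f: "set_integrable lborel S f" and g: "continuous_on UNIV g" "\<And>x. \<bar>g x\<bar> \<le> B"
  shows "set_integrable lborel S (\<lambda>x. f x * of_real (g x))"
proof -
  have B: "B \<ge> 0" using g(2)[of undefined] by linarith
  have [measurable]: "(\<lambda>x. indicat_real S x *\<^sub>R f x) \<in> borel_measurable lborel"
    using f unfolding set_integrable_def by auto
  have [measurable]: "g \<in> borel_measurable lborel" using g(1) by (simp add: borel_measurable_continuous_onI)
  have "integrable lborel (\<lambda>x. (indicat_real S x *\<^sub>R f x) * of_real (g x))"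
  proof (rule Bochner_Integration.integrable_bound[of lborel "\<lambda>x. B * norm (indicat_real S x *\<^sub>R f x)"])
    show "integrable lborel (\<lambda>x. B * norm (indicat_real S x *\<^sub>R f x))"
      using f unfolding set_integrable_def by (intro Bochner_Integration.integrable_mult_right integrable_norm)
    show "AE x in lborel. norm ((indicat_real S x *\<^sub>R f x) * of_real (g x)) \<le> norm (B * norm (indicat_real S x *\<^sub>R f x))"
    proof (rule AE_I2)
      fix x
      have "norm (indicat_real S x *\<^sub>R f x) * \<bar>g x\<bar> \<le> norm (indicat_real S x *\<^sub>R f x) * B"
        by (intro mult_left_mono g(2) norm_ge_zero)
      then show "norm ((indicat_real S x *\<^sub>R f x) * of_real (g x)) \<le> norm (B * norm (indicat_real S x *\<^sub>R f x))"
        using B by (simp add: norm_mult abs_mult mult_ac)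
    qed
  qed measurable
  then show ?thesis unfolding set_integrable_def by simp
qed

lemma set_integral_Re:
  assumes "set_integrable lborel S (f :: pt \<Rightarrow> complex)"
  shows "set_integrable lborel S (\<lambda>x. Re (f x))" "(LINT x:S|lborel. Re (f x)) = Re (LINT x:S|lborel. f x)"
proof -
  have "integrable lborel (\<lambda>x. Re (indicat_real S x *\<^sub>R f x))"
    using assms unfolding set_integrable_def by (rule integrable_Re)
  then show "set_integrable lborel S (\<lambda>x. Re (f x))" unfolding set_integrable_def by simp
  show "(LINT x:S|lborel. Re (f x)) = Re (LINT x:S|lborel. f x)"
    using integral_Re[OF assms[unfolded set_integrable_def]] unfolding set_lebesgue_integral_def by simp
qed

lemma set_integral_Im:
  assumes "set_integrable lborel S (f :: pt \<Rightarrow> complex)"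
  shows "set_integrable lborel S (\<lambda>x. Im (f x))" "(LINT x:S|lborel. Im (f x)) = Im (LINT x:S|lborel. f x)"
proof -
  have "integrable lborel (\<lambda>x. Im (indicat_real S x *\<^sub>R f x))"
    using assms unfolding set_integrable_def by (rule integrable_Im)
  then show "set_integrable lborel S (\<lambda>x. Im (f x))" unfolding set_integrable_def by simp
  show "(LINT x:S|lborel. Im (f x)) = Im (LINT x:S|lborel. f x)"
    using integral_Im[OF assms[unfolded set_integrable_def]] unfolding set_lebesgue_integral_def by simp
qed

lemma AE_zero_of_test_integrals:
  fixes f :: "pt \<Rightarrow> complex"
  assumes op: "open \<Omega>" and f: "set_integrable lborel \<Omega> f"
    and test: "\<And>\<phi>. C1_compact \<Omega> \<phi> \<Longrightarrow> (LINT x:\<Omega>|lborel. f x * of_real (\<phi> x)) = 0"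
  shows "AE x in lborel. x \<in> \<Omega> \<longrightarrow> f x = 0"
proof -
  have i: "set_integrable lborel \<Omega> (\<lambda>x. f x * of_real (\<phi> x))" if "C1_compact \<Omega> \<phi>" for \<phi>
    using C1_compact_bounded(1,2)[OF that] set_integrable_mult_bounded[OF f] by metis
  have "AE x in lborel. x \<in> \<Omega> \<longrightarrow> Re (f x) = 0"
  proof (rule AE_zero_of_test_integrals_real[OF op set_integral_Re(1)[OF f]])
    fix \<phi> assume \<phi>: "C1_compact \<Omega> \<phi>"
    show "(LINT x:\<Omega>|lborel. Re (f x) * \<phi> x) = 0"
      using set_integral_Re(2)[OF i[OF \<phi>]] test[OF \<phi>] by simp
  qed
  moreover have "AE x in lborel. x \<in> \<Omega> \<longrightarrow> Im (f x) = 0"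
  proof (rule AE_zero_of_test_integrals_real[OF op set_integral_Im(1)[OF f]])
    fix \<phi> assume \<phi>: "C1_compact \<Omega> \<phi>"
    show "(LINT x:\<Omega>|lborel. Im (f x) * \<phi> x) = 0"
      using set_integral_Im(2)[OF i[OF \<phi>]] test[OF \<phi>] by simp
  qed
  ultimately show ?thesis by eventually_elim (auto simp: complex_eq_iff)
qed

lemma weak_gradient_component_L2: "weak_gradient \<Omega> v g \<Longrightarrow> L2_on \<Omega> (\<lambda>x. g x $ i)"
  unfolding weak_gradient_def by (drule conjunct1) (erule spec)

lemma weak_gradient_test:
  assumes g: "weak_gradient \<Omega> v g" and \<phi>: "C1_compact \<Omega> \<phi>"
  shows "(LINT x:\<Omega>|lborel. v x * of_real (partial i \<phi> x)) = - (LINT x:\<Omega>|lborel. g x $ i * of_real (\<phi> x))"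
  by (rule conjunct2[OF g[unfolded weak_gradient_def], rule_format, OF \<phi>])

text \<open>
  All linearity properties of the chosen gradient follow from this: the gradient of a sum and the sum of the
  gradients are both weak gradients.
\<close>

lemma weak_gradient_unique:
  assumes op: "open \<Omega>" and bd: "bounded \<Omega>" and g: "weak_gradient \<Omega> v g" and h: "weak_gradient \<Omega> v h"
  shows "AE x in lborel. x \<in> \<Omega> \<longrightarrow> g x = h x"
proof -
  have \<Omega>: "\<Omega> \<in> sets borel" using op by simp
  have "AE x in lborel. x \<in> \<Omega> \<longrightarrow> g x $ i - h x $ i = 0" for i
  proof (rule AE_zero_of_test_integrals[OF op])
    note gi = L2_on_integrable[OF bd \<Omega> weak_gradient_component_L2[OF g, of i]]
    note hi = L2_on_integrable[OF bd \<Omega> weak_gradient_component_L2[OF h, of i]]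
    show "set_integrable lborel \<Omega> (\<lambda>x. g x $ i - h x $ i)"
      using gi hi by (rule set_integral_diff(1))
    fix \<phi> assume \<phi>: "C1_compact \<Omega> \<phi>"
    obtain B where B: "\<And>x. \<bar>\<phi> x\<bar> \<le> B" using C1_compact_bounded(2)[OF \<phi>] by metis
    note c = C1_compact_bounded(1)[OF \<phi>]
    have "(LINT x:\<Omega>|lborel. g x $ i * of_real (\<phi> x)) = (LINT x:\<Omega>|lborel. h x $ i * of_real (\<phi> x))"
      using weak_gradient_test[OF g \<phi>, of i] weak_gradient_test[OF h \<phi>, of i] by simp
    then show "(LINT x:\<Omega>|lborel. (g x $ i - h x $ i) * of_real (\<phi> x)) = 0"
      using set_integral_diff(2)[OF set_integrable_mult_bounded[OF gi c B] set_integrable_mult_bounded[OF hi c B]]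
      by (simp add: left_diff_distrib)
  qed
  note this[of 1] this[of 2]
  then show ?thesis by eventually_elim (auto simp: vec_eq_iff forall_2)
qed

lemma weak_gradient_add:
  assumes bd: "bounded \<Omega>" "\<Omega> \<in> sets borel" and v: "L2_on \<Omega> v" "weak_gradient \<Omega> v g"
    and w: "L2_on \<Omega> w" "weak_gradient \<Omega> w h"
  shows "weak_gradient \<Omega> (v + w) (\<lambda>x. g x + h x)"
  unfolding weak_gradient_def
proof (intro conjI allI impI)
  fix i
  show "L2_on \<Omega> (\<lambda>x. (g x + h x) $ i)"
  proof -
    have "(\<lambda>x. (g x + h x) $ i) = (\<lambda>x. g x $ i) + (\<lambda>x. h x $ i)" by (rule ext) simp
    then show ?thesis
      using L2_on_add[OF weak_gradient_component_L2[OF v(2), of i] weak_gradient_component_L2[OF w(2), of i]]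
      by (simp only:)
  qed
  fix \<phi> assume \<phi>: "C1_compact \<Omega> \<phi>"
  obtain B where B: "\<And>x. \<bar>\<phi> x\<bar> \<le> B" using C1_compact_bounded(2)[OF \<phi>] by metis
  obtain B' where B': "\<And>x. \<bar>partial i \<phi> x\<bar> \<le> B'" using C1_compact_bounded(3)[OF \<phi>] by metis
  note c = C1_compact_bounded(1)[OF \<phi>]
  have c': "continuous_on UNIV (partial i \<phi>)" using \<phi> by (simp add: C1_compact_def)
  have i: "set_integrable lborel \<Omega> f" if "L2_on \<Omega> f" for f using L2_on_integrable[OF bd that] .
  have 1: "(LINT x:\<Omega>|lborel. v x * of_real (partial i \<phi> x)) = - (LINT x:\<Omega>|lborel. g x $ i * of_real (\<phi> x))"
    "(LINT x:\<Omega>|lborel. w x * of_real (partial i \<phi> x)) = - (LINT x:\<Omega>|lborel. h x $ i * of_real (\<phi> x))"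
    by (rule weak_gradient_test[OF v(2) \<phi>], rule weak_gradient_test[OF w(2) \<phi>])
  have "(LINT x:\<Omega>|lborel. (v + w) x * of_real (partial i \<phi> x))
      = (LINT x:\<Omega>|lborel. v x * of_real (partial i \<phi> x)) + (LINT x:\<Omega>|lborel. w x * of_real (partial i \<phi> x))"
    using set_integral_add(2)[OF set_integrable_mult_bounded[OF i[OF v(1)] c' B'] set_integrable_mult_bounded[OF i[OF w(1)] c' B']]
    by (simp add: distrib_right)
  moreover have "(LINT x:\<Omega>|lborel. (g x + h x) $ i * of_real (\<phi> x))
      = (LINT x:\<Omega>|lborel. g x $ i * of_real (\<phi> x)) + (LINT x:\<Omega>|lborel. h x $ i * of_real (\<phi> x))"
    using set_integral_add(2)[OF set_integrable_mult_bounded[OF i[OF weak_gradient_component_L2[OF v(2), of i]] c B]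
        set_integrable_mult_bounded[OF i[OF weak_gradient_component_L2[OF w(2), of i]] c B]]
    by (simp add: distrib_right)
  ultimately show "(LINT x:\<Omega>|lborel. (v + w) x * of_real (partial i \<phi> x))
      = - (LINT x:\<Omega>|lborel. (g x + h x) $ i * of_real (\<phi> x))"
    using 1 by simp
qed

lemma weak_gradient_scale:
  assumes "weak_gradient \<Omega> v g"
  shows "weak_gradient \<Omega> (fscale c v) (\<lambda>x. c *s g x)"
  unfolding weak_gradient_def
proof (intro conjI allI impI)
  fix i
  show "L2_on \<Omega> (\<lambda>x. (c *s g x) $ i)"
    using L2_on_scale[OF weak_gradient_component_L2[OF assms, of i], of c] by (simp add: fscale_def[abs_def])
  fix \<phi> assume \<phi>: "C1_compact \<Omega> \<phi>"
  have "(LINT x:\<Omega>|lborel. v x * of_real (partial i \<phi> x)) = - (LINT x:\<Omega>|lborel. g x $ i * of_real (\<phi> x))"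
    by (rule weak_gradient_test[OF assms \<phi>])
  then show "(LINT x:\<Omega>|lborel. fscale c v x * of_real (partial i \<phi> x))
      = - (LINT x:\<Omega>|lborel. (c *s g x) $ i * of_real (\<phi> x))"
    by (simp add: mult.assoc)
qed

lemma set_integral_cnj: "(LINT x:S|lborel. cnj (f x)) = cnj (LINT x:S|lborel. f x)"
  unfolding set_lebesgue_integral_def by (subst Bochner_Integration.integral_cnj[symmetric]) simp

lemma weak_gradient_conj:
  assumes "weak_gradient \<Omega> v g"
  shows "weak_gradient \<Omega> (conj_fun v) (\<lambda>x. \<chi> i. cnj (g x $ i))"
  unfolding weak_gradient_def
proof (intro conjI allI impI)
  fix i
  show "L2_on \<Omega> (\<lambda>x. (\<chi> i. cnj (g x $ i)) $ i)"
    using L2_on_conj[OF weak_gradient_component_L2[OF assms, of i]] by (simp add: conj_fun_def)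
  fix \<phi> assume \<phi>: "C1_compact \<Omega> \<phi>"
  have "(LINT x:\<Omega>|lborel. v x * of_real (partial i \<phi> x)) = - (LINT x:\<Omega>|lborel. g x $ i * of_real (\<phi> x))"
    by (rule weak_gradient_test[OF assms \<phi>])
  then have "cnj (LINT x:\<Omega>|lborel. v x * of_real (partial i \<phi> x)) = - cnj (LINT x:\<Omega>|lborel. g x $ i * of_real (\<phi> x))"
    by simp
  then show "(LINT x:\<Omega>|lborel. conj_fun v x * of_real (partial i \<phi> x))
      = - (LINT x:\<Omega>|lborel. (\<chi> i. cnj (g x $ i)) $ i * of_real (\<phi> x))"
    by (simp add: set_integral_cnj[symmetric])
qed

section \<open>Piecewise affine functions are weakly differentiable\<close>

lemma lborel_integral_translation:
  fixes f :: "pt \<Rightarrow> complex"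
  assumes "f \<in> borel_measurable borel"
  shows "(LINT x|lborel. f (x + c)) = (LINT x|lborel. f x)"
proof -
  have "(LINT x|lborel. f x) = (LINT x|distr lborel borel ((+) c). f x)"
    by (simp add: lborel_distr_plus)
  also have "\<dots> = (LINT x|lborel. f (c + x))"
    by (rule integral_distr) (use assms in auto)
  finally show ?thesis by (simp add: add.commute)
qed

lemma lborel_integrable_translation:
  fixes f :: "pt \<Rightarrow> complex"
  assumes "f \<in> borel_measurable borel" "integrable lborel f"
  shows "integrable lborel (\<lambda>x. f (x + c))"
proof -
  have "integrable (distr lborel borel ((+) c)) f" using assms by (simp add: lborel_distr_plus)
  then have "integrable lborel (\<lambda>x. f (c + x))"
    by (subst (asm) integrable_distr_eq) (use assms in auto)
  then show ?thesis by (simp add: add.commute)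
qed

lemma C1_fun_directional:
  assumes "C1_fun \<phi>"
  shows "((\<lambda>t. \<phi> (x + t *\<^sub>R axis i 1)) has_real_derivative partial i \<phi> (x + s *\<^sub>R axis i 1)) (at s)"
proof -
  let ?y = "x + s *\<^sub>R axis i 1 :: pt"
  have 1: "((\<lambda>t::real. x + t *\<^sub>R (axis i 1 :: pt)) has_derivative (\<lambda>h. h *\<^sub>R axis i 1)) (at s)"
    by (auto intro!: derivative_eq_intros)
  have 2: "(\<phi> has_derivative frechet_derivative \<phi> (at ?y)) (at ?y)" by (rule C1_fun_deriv[OF assms])
  have lin: "linear (frechet_derivative \<phi> (at ?y))" using has_derivative_linear[OF 2] .
  have "((\<lambda>t. \<phi> (x + t *\<^sub>R axis i 1)) has_derivative
      (\<lambda>h. frechet_derivative \<phi> (at ?y) (h *\<^sub>R axis i 1))) (at s)"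
    by (rule has_derivative_compose[OF 1 2])
  moreover have "(\<lambda>h. frechet_derivative \<phi> (at ?y) (h *\<^sub>R axis i 1)) = (*) (partial i \<phi> ?y)"
    by (rule ext) (simp add: linear_scale[OF lin] partial_def)
  ultimately show ?thesis unfolding has_field_derivative_def by simp
qed

lemma C1_compact_Lipschitz:
  assumes \<phi>: "C1_fun \<phi>" and B: "\<And>x. \<bar>partial i \<phi> x\<bar> \<le> B" and t: "0 \<le> t"
  shows "\<bar>\<phi> (x + t *\<^sub>R axis i 1) - \<phi> x\<bar> \<le> B * t"
proof -
  have "norm (\<phi> (x + t *\<^sub>R axis i 1) - \<phi> (x + 0 *\<^sub>R axis i 1)) \<le> B * norm (t - 0)"
  proof (rule field_differentiable_bound[where S = UNIV and f' = "\<lambda>s. partial i \<phi> (x + s *\<^sub>R axis i 1)"])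
    show "((\<lambda>t. \<phi> (x + t *\<^sub>R axis i 1)) has_field_derivative partial i \<phi> (x + z *\<^sub>R axis i 1)) (at z within UNIV)" for z
      using C1_fun_directional[OF \<phi>] by simp
    show "norm (partial i \<phi> (x + z *\<^sub>R axis i 1)) \<le> B" for z using B by simp
  qed auto
  then show ?thesis using t by simp
qed

text \<open>
  The partial derivative of an affine function.
\<close>

definition slope :: "2 \<Rightarrow> cfun \<Rightarrow> complex" where
  "slope i q = q (axis i 1) - q 0"

lemma affine_fun_slope:
  assumes "affine_fun q"
  shows "q (x + t *\<^sub>R axis i 1) = q x + of_real t * slope i q"
proof -
  obtain c d e where e: "\<And>x. q x = c + d * of_real (x $ 1) + e * of_real (x $ 2)"
    using assms unfolding affine_fun_def by metis
  have "i = 1 \<or> i = 2" using exhaust_2 by blast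
  then show ?thesis unfolding e slope_def by (auto simp: axis_def algebra_simps)
qed

context mesh
begin

definition piece :: "cfun \<Rightarrow> pt set \<Rightarrow> cfun" where
  "piece v T = (SOME q. affine_fun q \<and> (\<forall>x\<in>T. v x = q x))"

lemma piece:
  assumes "v \<in> P1_space P \<T>" "T \<in> \<T>"
  shows "affine_fun (piece v T)" "x \<in> T \<Longrightarrow> v x = piece v T x"
proof -
  have "affine_fun (piece v T) \<and> (\<forall>x\<in>T. v x = piece v T x)"
    unfolding piece_def by (rule someI_ex[OF P1_affine_on[OF assms]])
  then show "affine_fun (piece v T)" "x \<in> T \<Longrightarrow> v x = piece v T x" by auto
qed

text \<open>
  On the skeleton of the mesh, a null set, the value is zero.
\<close>

definition piecewise_gradient :: "cfun \<Rightarrow> pt \<Rightarrow> complex^2" where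
  "piecewise_gradient v x = (\<chi> i. \<Sum>T\<in>\<T>. indicator (interior T) x * slope i (piece v T))"

lemma interiors_disjoint:
  assumes "T \<in> \<T>" "T' \<in> \<T>" "T \<noteq> T'"
  shows "interior T \<inter> interior T' = {}"
proof (rule open_null_set_empty)
  show "interior T \<inter> interior T' \<in> null_sets lborel"
    by (rule null_sets_subset[OF element_inter_null[OF assms]]) (auto simp: interior_subset[THEN subsetD])
qed auto

lemma piecewise_gradient_interior:
  assumes "T \<in> \<T>" "x \<in> interior T"
  shows "piecewise_gradient v x $ i = slope i (piece v T)"
proof -
  have "(\<Sum>T'\<in>\<T>. indicator (interior T') x * slope i (piece v T'))
      = (\<Sum>T'\<in>\<T>. if T' = T then slope i (piece v T') else 0)"
    using interiors_disjoint[OF _ assms(1)] assms(2) by (intro sum.cong) (auto simp: indicator_def)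
  then show ?thesis using finite_mesh assms(1) by (simp add: piecewise_gradient_def)
qed

lemma AE_interior: "AE x in lborel. x \<in> Omega P \<longrightarrow> (\<exists>T\<in>\<T>. x \<in> interior T)"
proof -
  have "(\<Union>T\<in>\<T>. frontier T) \<in> null_sets lborel"
    using finite_mesh triangle_frontier_null[OF triangle] by (intro null_sets.finite_UN) auto
  from AE_not_in[OF this] show ?thesis
  proof eventually_elim
    case (elim x)
    show ?case
    proof
      assume "x \<in> Omega P"
      then obtain T where T: "T \<in> \<T>" "x \<in> T" using covers closure_subset by blast
      then have "x \<notin> frontier T" using elim by blast
      then have "x \<in> interior T" using T closure_subset[of T] unfolding frontier_def by blast
      then show "\<exists>T\<in>\<T>. x \<in> interior T" using T by blast
    qed
  qed
qed

lemma P1_continuous: "v \<in> P1_space P \<T> \<Longrightarrow> continuous_on (closure (Omega P)) v"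
  and P1_zero_outside: "v \<in> P1_space P \<T> \<Longrightarrow> x \<notin> closure (Omega P) \<Longrightarrow> v x = 0"
  and P1_dirichlet: "v \<in> P1_space P \<T> \<Longrightarrow> x \<in> dirichlet P \<Longrightarrow> v x = 0"
  unfolding P1_space_def dirichlet_def by simp_all

lemma P1_L2: "v \<in> P1_space P \<T> \<Longrightarrow> L2_on (Omega P) v"
  by (rule L2_on_continuous[OF bounded_Omega open_Omega P1_continuous])

text \<open>
  Along a segment, \<open>v\<close> is affine on each of the finitely many closed sets of parameters that belong to one element.
\<close>

lemma P1_Lipschitz:
  assumes v: "v \<in> P1_space P \<T>" and t: "0 \<le> t"
    and seg: "\<And>s. 0 \<le> s \<Longrightarrow> s \<le> t \<Longrightarrow> x + s *\<^sub>R axis i 1 \<in> Omega P"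
  shows "cmod (v (x + t *\<^sub>R axis i 1) - v x) \<le> (\<Sum>T\<in>\<T>. cmod (slope i (piece v T))) * t"
proof -
  let ?M = "\<Sum>T\<in>\<T>. cmod (slope i (piece v T))"
  have "?M-lipschitz_on {0..t} (\<lambda>s. v (x + s *\<^sub>R axis i 1))"
  proof (rule lipschitz_on_closed_Union[where I = \<T> and U = "\<lambda>T. {s. x + s *\<^sub>R axis i 1 \<in> T}"])
    fix T assume T: "T \<in> \<T>"
    show "?M-lipschitz_on {s. x + s *\<^sub>R axis i 1 \<in> T} (\<lambda>s. v (x + s *\<^sub>R axis i 1))"
    proof (rule lipschitz_onI)
      fix s s' assume "s \<in> {s. x + s *\<^sub>R axis i 1 \<in> T}" "s' \<in> {s. x + s *\<^sub>R axis i 1 \<in> T}"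
      then have "v (x + s *\<^sub>R axis i 1) - v (x + s' *\<^sub>R axis i 1) = of_real (s - s') * slope i (piece v T)"
        using piece[OF v T] affine_fun_slope[OF piece(1)[OF v T]] by (simp add: algebra_simps)
      then have "dist (v (x + s *\<^sub>R axis i 1)) (v (x + s' *\<^sub>R axis i 1)) = \<bar>s - s'\<bar> * cmod (slope i (piece v T))"
        by (simp only: dist_norm norm_mult norm_of_real)
      also have "\<dots> \<le> \<bar>s - s'\<bar> * ?M"
        using T finite_mesh by (intro mult_left_mono member_le_sum) auto
      finally show "dist (v (x + s *\<^sub>R axis i 1)) (v (x + s' *\<^sub>R axis i 1)) \<le> ?M * dist s s'"
        by (simp add: dist_real_def mult.commute)
    qed (simp add: sum_nonneg)
    have "closed T" using triangle_compact[OF triangle[OF T]] compact_imp_closed by blast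
    moreover have "continuous_on UNIV (\<lambda>s::real. x + s *\<^sub>R (axis i 1 :: pt))" by (intro continuous_intros)
    ultimately have "closed ((\<lambda>s::real. x + s *\<^sub>R (axis i 1 :: pt)) -` T)"
      using continuous_closed_vimage[of T] continuous_on_eq_continuous_at[of UNIV] by auto
    then show "closed {s. x + s *\<^sub>R axis i 1 \<in> T}" by (simp add: vimage_def)
  next
    show "{0..t} \<subseteq> (\<Union>T\<in>\<T>. {s. x + s *\<^sub>R axis i 1 \<in> T})"
    proof
      fix s assume "s \<in> {0..t}"
      then have "x + s *\<^sub>R axis i 1 \<in> \<Union>\<T>" using seg[of s] covers closure_subset by auto
      then show "s \<in> (\<Union>T\<in>\<T>. {s. x + s *\<^sub>R axis i 1 \<in> T})" by blast
    qed
  qed (use finite_mesh in \<open>auto simp: sum_nonneg\<close>)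
  from lipschitz_onD[OF this, of t 0] t show ?thesis by (simp add: dist_norm)
qed

text \<open>
  The difference quotients in direction \<open>i\<close> of \<open>v \<phi>\<close> have integral zero by translation invariance.
  They are bounded, since \<open>v\<close> is Lipschitz continuous along every segment inside the domain, and
  they converge at every interior point of an element.
\<close>

lemma P1_weak_gradient:
  assumes v: "v \<in> P1_space P \<T>"
  shows "weak_gradient (Omega P) v (piecewise_gradient v)"
  unfolding weak_gradient_def
proof (intro conjI allI impI)
  fix i
  have m: "(\<lambda>x. piecewise_gradient v x $ i) \<in> borel_measurable borel"
    unfolding piecewise_gradient_def by simp
  show "L2_on (Omega P) (\<lambda>x. piecewise_gradient v x $ i)"
  proof (rule L2_on_bounded_measurable[OF bounded_Omega Omega_borel])
    show "set_borel_measurable lborel (Omega P) (\<lambda>x. piecewise_gradient v x $ i)"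
      unfolding set_borel_measurable_def
      using Omega_borel m by (intro borel_measurable_scaleR borel_measurable_indicator) auto
    show "cmod (piecewise_gradient v x $ i) \<le> (\<Sum>T\<in>\<T>. cmod (slope i (piece v T)))" for x
      unfolding piecewise_gradient_def
      by (auto intro!: order.trans[OF norm_sum] sum_mono simp: indicator_def)
  qed
  fix \<phi> assume \<phi>: "C1_compact (Omega P) \<phi>"
  define K where "K = closure {x. \<phi> x \<noteq> 0}"
  have K: "compact K" "K \<subseteq> Omega P" using \<phi> by (auto simp: C1_compact_def K_def)
  have C1: "C1_fun \<phi>" using \<phi> by (simp add: C1_compact_def C1_fun_def)
  note c = C1_compact_bounded(1)[OF \<phi>]
  have c': "continuous_on UNIV (partial i \<phi>)" using \<phi> by (simp add: C1_compact_def)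
  obtain B where B: "\<And>x. \<bar>\<phi> x\<bar> \<le> B" "B > 0" using C1_compact_bounded(2)[OF \<phi>] by metis
  obtain B' where B': "\<And>x. \<bar>partial i \<phi> x\<bar> \<le> B'" "B' > 0" using C1_compact_bounded(3)[OF \<phi>] by metis
  have z: "\<phi> x = 0" "partial i \<phi> x = 0" if "x \<notin> K" for x
    using C1_compact_bounded(4,5)[OF \<phi>, of x] that unfolding K_def by auto
  obtain Bv where Bv: "Bv > 0" "\<And>x. x \<in> closure (Omega P) \<Longrightarrow> norm (v x) \<le> Bv"
    using continuous_bounded_on_closure[OF bounded_Omega P1_continuous[OF v]] by metis
  obtain \<delta> where \<delta>: "\<delta> > 0" "(\<Union>x\<in>K. ball x \<delta>) \<subseteq> Omega P"
    using compact_subset_open_imp_ball_epsilon_subset[OF K(1) open_Omega K(2)] by metis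
  obtain R where R: "\<And>x. x \<in> K \<Longrightarrow> norm x \<le> R" using compact_imp_bounded[OF K(1)] bounded_iff by metis
  define e :: pt where "e = axis i 1"
  have ne: "norm e = 1" by (simp add: e_def norm_axis_1)
  define M where "M = (\<Sum>T\<in>\<T>. cmod (slope i (piece v T)))"
  have M: "M \<ge> 0" by (simp add: M_def sum_nonneg)
  define L where "L = M * B + Bv * B'"
  have L: "L \<ge> 0" using M B(2) B'(2) Bv(1) by (simp add: L_def)
  define f where "f = (\<lambda>x. v x * of_real (\<phi> x))"
  define h where "h = (\<lambda>x. indicat_real (Omega P) x *\<^sub>R (piecewise_gradient v x $ i * of_real (\<phi> x) + v x * of_real (partial i \<phi> x)))"
  have f0: "f x = 0" if "x \<notin> K" for x using z(1)[OF that] by (simp add: f_def)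
  have iv: "set_integrable lborel (Omega P) v"
    by (rule L2_on_integrable[OF bounded_Omega Omega_borel P1_L2[OF v]])
  have fi: "integrable lborel f"
  proof -
    have "set_integrable lborel (Omega P) f" unfolding f_def
      by (rule set_integrable_mult_bounded[OF iv c B(1)])
    moreover have "(\<lambda>x. indicat_real (Omega P) x *\<^sub>R f x) = f"
    proof
      fix x show "indicat_real (Omega P) x *\<^sub>R f x = f x"
        using f0[of x] K(2) by (cases "x \<in> K") (auto simp: indicator_def)
    qed
    ultimately show ?thesis unfolding set_integrable_def by simp
  qed
  have fm[measurable]: "f \<in> borel_measurable borel" using fi by auto
  have Lip: "cmod (f (x + t *\<^sub>R e) - f x) \<le> L * t" if t: "0 \<le> t" "t < \<delta>" and x: "x \<in> K \<or> x + t *\<^sub>R e \<in> K" for x t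
  proof -
    have seg: "x + s *\<^sub>R e \<in> Omega P" if s: "0 \<le> s" "s \<le> t" for s
    proof -
      have "dist x (x + s *\<^sub>R e) < \<delta>" using s t ne by (simp add: dist_norm)
      moreover have "dist (x + t *\<^sub>R e) (x + s *\<^sub>R e) < \<delta>"
      proof -
        have "(x + t *\<^sub>R e) - (x + s *\<^sub>R e) = (t - s) *\<^sub>R e" by (simp add: scaleR_diff_left)
        then show ?thesis using s t ne by (simp add: dist_norm)
      qed
      ultimately have "x + s *\<^sub>R e \<in> (\<Union>x\<in>K. ball x \<delta>)"
        using x unfolding UN_iff mem_ball by metis
      then show ?thesis using \<delta>(2) by blast
    qed
    have 1: "cmod (v (x + t *\<^sub>R e) - v x) \<le> M * t"
      using P1_Lipschitz[OF v t(1), of x i] seg unfolding e_def M_def by blast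
    have 2: "\<bar>\<phi> (x + t *\<^sub>R e) - \<phi> x\<bar> \<le> B' * t"
      using C1_compact_Lipschitz[OF C1 B'(1) t(1)] unfolding e_def by blast
    have 3: "cmod (v x) \<le> Bv" using Bv(2) seg[of 0] t closure_subset by auto
    have "f (x + t *\<^sub>R e) - f x = (v (x + t *\<^sub>R e) - v x) * of_real (\<phi> (x + t *\<^sub>R e))
        + v x * of_real (\<phi> (x + t *\<^sub>R e) - \<phi> x)"
      by (simp add: f_def algebra_simps)
    then have "cmod (f (x + t *\<^sub>R e) - f x) \<le> cmod (v (x + t *\<^sub>R e) - v x) * \<bar>\<phi> (x + t *\<^sub>R e)\<bar>
        + cmod (v x) * \<bar>\<phi> (x + t *\<^sub>R e) - \<phi> x\<bar>"
      using norm_triangle_ineq[of "(v (x + t *\<^sub>R e) - v x) * of_real (\<phi> (x + t *\<^sub>R e))"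
          "v x * of_real (\<phi> (x + t *\<^sub>R e) - \<phi> x)"] by (simp only: norm_mult norm_of_real)
    also have "\<dots> \<le> (M * t) * B + Bv * (B' * t)"
      using 1 2 3 B Bv(1) M t by (intro add_mono mult_mono) auto
    finally show ?thesis by (simp add: L_def algebra_simps)
  qed
  \<comment> \<open>step sizes of the difference quotients; every step stays inside the domain\<close>
  define \<tau> where "\<tau> = (\<lambda>n. \<delta> / (real n + 2))"
  have \<tau>: "0 < \<tau> n" "\<tau> n < \<delta>" for n using \<delta>(1) by (auto simp: \<tau>_def field_simps add_pos_nonneg)
  have "(\<lambda>n. \<delta> / real n) \<longlonglongrightarrow> 0" by (rule lim_const_over_n)
  then have "(\<lambda>n. \<delta> / real (n + 2)) \<longlonglongrightarrow> 0" by (rule LIMSEQ_ignore_initial_segment)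
  then have \<tau>0: "\<tau> \<longlonglongrightarrow> 0" by (simp add: \<tau>_def add.commute)
  then have \<tau>at: "filterlim \<tau> (at 0) sequentially"
    using \<tau>(1) by (auto simp: filterlim_at less_imp_neq[symmetric] intro!: always_eventually)
  define s where "s = (\<lambda>n x. (f (x + \<tau> n *\<^sub>R e) - f x) / of_real (\<tau> n))"
  have "(\<lambda>n. LINT x|lborel. s n x) \<longlonglongrightarrow> (LINT x|lborel. h x)"
  proof (rule integral_dominated_convergence[where w = "\<lambda>x. L * indicat_real (cball 0 (R + \<delta>)) x"])
    have [measurable]: "(\<lambda>x. indicat_real (Omega P) x *\<^sub>R v x) \<in> borel_measurable borel"
      using iv unfolding set_integrable_def by auto
    have [measurable]: "\<phi> \<in> borel_measurable borel" "partial i \<phi> \<in> borel_measurable borel"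
      using c c' by (auto intro: borel_measurable_continuous_onI)
    note [measurable] = m Omega_borel
    have "h = (\<lambda>x. indicat_real (Omega P) x *\<^sub>R (piecewise_gradient v x $ i * of_real (\<phi> x))
        + (indicat_real (Omega P) x *\<^sub>R v x) * of_real (partial i \<phi> x))"
      by (auto simp: h_def scaleR_add_right)
    moreover have "(\<lambda>x. indicat_real (Omega P) x *\<^sub>R (piecewise_gradient v x $ i * of_real (\<phi> x))
        + (indicat_real (Omega P) x *\<^sub>R v x) * of_real (partial i \<phi> x)) \<in> borel_measurable lborel"
      by measurable
    ultimately show "h \<in> borel_measurable lborel" by (simp only:)
    show "s n \<in> borel_measurable lborel" for n unfolding s_def by measurable
    show "integrable lborel (\<lambda>x::pt. L * indicat_real (cball 0 (R + \<delta>)) x)"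
      using emeasure_bounded_finite[OF bounded_cball[of "0 :: pt" "R + \<delta>"]]
      by (intro Bochner_Integration.integrable_mult_right integrable_real_indicator) auto
    show "AE x in lborel. norm (s n x) \<le> L * indicat_real (cball 0 (R + \<delta>)) x" for n
    proof (rule AE_I2)
      fix x
      show "norm (s n x) \<le> L * indicat_real (cball 0 (R + \<delta>)) x"
      proof (cases "x \<in> K \<or> x + \<tau> n *\<^sub>R e \<in> K")
        case True
        have "norm x \<le> R + \<delta>"
        proof (cases "x \<in> K")
          case True then show ?thesis using R[OF True] \<delta>(1) by simp
        next
          case False
          then have "norm (x + \<tau> n *\<^sub>R e) \<le> R" using True R by blast
          moreover have "norm x \<le> norm (x + \<tau> n *\<^sub>R e) + norm (\<tau> n *\<^sub>R e)"
            using norm_triangle_ineq4[of "x + \<tau> n *\<^sub>R e" "\<tau> n *\<^sub>R e"] by simp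
          ultimately show ?thesis using \<tau>[of n] ne by simp
        qed
        moreover have "norm (s n x) \<le> L"
          using Lip[of "\<tau> n" x] \<tau>[of n] True by (simp add: s_def norm_divide divide_le_eq)
        ultimately show ?thesis by simp
      next
        case False
        then have "s n x = 0" using f0 by (simp add: s_def)
        then show ?thesis using L by simp
      qed
    qed
    show "AE x in lborel. (\<lambda>n. s n x) \<longlonglongrightarrow> h x"
      using AE_interior
    proof eventually_elim
      case (elim x)
      show ?case
      proof (cases "x \<in> K")
        case True
        then have x: "x \<in> Omega P" using K(2) by blast
        then obtain T where T: "T \<in> \<T>" "x \<in> interior T" using elim by blast
        let ?D = "slope i (piece v T)"
        have lim: "(\<lambda>n. x + \<tau> n *\<^sub>R e) \<longlonglongrightarrow> x + 0 *\<^sub>R e" by (intro tendsto_intros \<tau>0)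
        have "eventually (\<lambda>n. x + \<tau> n *\<^sub>R e \<in> interior T) sequentially"
          by (rule topological_tendstoD[OF lim]) (use T in auto)
        then have ev: "eventually (\<lambda>n. v x * of_real ((\<phi> (x + \<tau> n *\<^sub>R e) - \<phi> x) / \<tau> n) + ?D * of_real (\<phi> (x + \<tau> n *\<^sub>R e)) = s n x) sequentially"
        proof eventually_elim
          case (elim n)
          then have xT: "x + \<tau> n *\<^sub>R e \<in> T" "x \<in> T" using T(2) interior_subset by blast+
          have "v (x + \<tau> n *\<^sub>R e) = v x + of_real (\<tau> n) * ?D"
            using piece(2)[OF v T(1)] xT affine_fun_slope[OF piece(1)[OF v T(1)]] unfolding e_def by simp
          then show ?case using \<tau>(1)[of n] by (simp add: s_def f_def field_simps)
        qed
        have "((\<lambda>t. (\<phi> (x + (0 + t) *\<^sub>R e) - \<phi> (x + 0 *\<^sub>R e)) / t) \<longlongrightarrow> partial i \<phi> (x + 0 *\<^sub>R e)) (at 0)"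
          using C1_fun_directional[OF C1, of x i 0] unfolding DERIV_def e_def .
        then have "((\<lambda>t. (\<phi> (x + t *\<^sub>R e) - \<phi> x) / t) \<longlongrightarrow> partial i \<phi> x) (at 0)" by simp
        from filterlim_compose[OF this \<tau>at]
        have l1: "(\<lambda>n. (\<phi> (x + \<tau> n *\<^sub>R e) - \<phi> x) / \<tau> n) \<longlonglongrightarrow> partial i \<phi> x" .
        have "isCont \<phi> x" using c by (simp add: continuous_on_eq_continuous_at)
        then have l2: "(\<lambda>n. \<phi> (x + \<tau> n *\<^sub>R e)) \<longlonglongrightarrow> \<phi> x"
          using isCont_tendsto_compose lim by force
        have "(\<lambda>n. v x * of_real ((\<phi> (x + \<tau> n *\<^sub>R e) - \<phi> x) / \<tau> n) + ?D * of_real (\<phi> (x + \<tau> n *\<^sub>R e)))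
            \<longlonglongrightarrow> v x * of_real (partial i \<phi> x) + ?D * of_real (\<phi> x)"
          by (intro tendsto_add tendsto_mult tendsto_const tendsto_of_real l1 l2)
        then have "(\<lambda>n. s n x) \<longlonglongrightarrow> v x * of_real (partial i \<phi> x) + ?D * of_real (\<phi> x)"
          by (rule Lim_transform_eventually[OF _ ev])
        then show ?thesis using x piecewise_gradient_interior[OF T] by (simp add: h_def add.commute)
      next
        case False
        have "open (- K)" using compact_imp_closed[OF K(1)] by (rule open_Compl)
        moreover have lim: "(\<lambda>n. x + \<tau> n *\<^sub>R e) \<longlonglongrightarrow> x + 0 *\<^sub>R e" by (intro tendsto_intros \<tau>0)
        ultimately have "eventually (\<lambda>n. x + \<tau> n *\<^sub>R e \<in> - K) sequentially"
          using topological_tendstoD[OF lim, of "- K"] False by simp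
        then have ev: "eventually (\<lambda>n. 0 = s n x) sequentially"
          by eventually_elim (use f0 False in \<open>auto simp: s_def\<close>)
        have "(\<lambda>n. s n x) \<longlonglongrightarrow> 0" by (rule Lim_transform_eventually[OF tendsto_const ev])
        moreover have "h x = 0" using z[OF False] by (simp add: h_def)
        ultimately show ?thesis by simp
      qed
    qed
  qed
  moreover have "(LINT x|lborel. s n x) = 0" for n
  proof -
    have "(LINT x|lborel. f (x + \<tau> n *\<^sub>R e) - f x) = (LINT x|lborel. f (x + \<tau> n *\<^sub>R e)) - (LINT x|lborel. f x)"
      by (rule Bochner_Integration.integral_diff[OF lborel_integrable_translation[OF fm fi] fi])
    then show ?thesis unfolding s_def by (simp add: lborel_integral_translation[OF fm])
  qed
  ultimately have "(LINT x|lborel. h x) = 0" using LIMSEQ_unique[OF _ tendsto_const] by simp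
  moreover have "(LINT x|lborel. h x) = (LINT x:Omega P|lborel. piecewise_gradient v x $ i * of_real (\<phi> x))
      + (LINT x:Omega P|lborel. v x * of_real (partial i \<phi> x))"
  proof -
    have "L2_on (Omega P) (\<lambda>x. piecewise_gradient v x $ i)" by fact
    from L2_on_integrable[OF bounded_Omega Omega_borel this]
    have "set_integrable lborel (Omega P) (\<lambda>x. piecewise_gradient v x $ i * of_real (\<phi> x))"
      by (rule set_integrable_mult_bounded[OF _ c B(1)])
    from set_integral_add(2)[OF this set_integrable_mult_bounded[OF iv c' B'(1)]]
    show ?thesis by (simp add: h_def set_lebesgue_integral_def)
  qed
  ultimately show "(LINT x:Omega P|lborel. v x * of_real (partial i \<phi> x))
      = - (LINT x:Omega P|lborel. piecewise_gradient v x $ i * of_real (\<phi> x))"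
    by (simp add: eq_neg_iff_add_eq_0 add.commute)
qed

lemma P1_H1: "v \<in> P1_space P \<T> \<Longrightarrow> v \<in> H1 (Omega P)"
  unfolding H1_def using P1_L2 P1_weak_gradient by blast

end

section \<open>Traces of continuous functions\<close>

text \<open>
  By continuity the averages of \<open>\<bar>v - v x\<bar>\<close> tend to zero, so the averages of \<open>\<bar>v - c\<bar>\<close> can do so only for \<open>c = v x\<close>.
\<close>

lemma has_trace_continuous_iff:
  assumes op: "open \<Omega>" and bd: "bounded \<Omega>" and v: "continuous_on (closure \<Omega>) v" and x: "x \<in> closure \<Omega>"
  shows "has_trace \<Omega> v x c \<longleftrightarrow> c = v x"
proof -
  define D where "D = (\<lambda>r. ball x r \<inter> \<Omega>)"
  define m where "m = (\<lambda>r. measure lborel (D r))"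
  define avg where "avg = (\<lambda>c r. (LINT y:D r|lborel. cmod (v y - c)) / m r)"
  obtain B where B: "\<And>y. y \<in> closure \<Omega> \<Longrightarrow> cmod (v y) \<le> B"
    using continuous_bounded_on_closure[OF bd v] by metis
  have Dsub: "D r \<subseteq> closure \<Omega>" for r unfolding D_def using closure_subset by blast
  have Dop: "open (D r)" and Dbd: "bounded (D r)" for r
    unfolding D_def using op bd by (auto intro: bounded_subset)
  have mpos: "m r > 0" if "r > 0" for r
  proof (rule ccontr)
    assume "\<not> m r > 0"
    then have "m r = 0" using measure_nonneg[of lborel "D r"] unfolding m_def by linarith
    moreover have "emeasure lborel (D r) < \<infinity>" by (rule emeasure_bounded_finite[OF Dbd])
    ultimately have "emeasure lborel (D r) = 0" unfolding m_def by (simp add: emeasure_eq_ennreal_measure less_top)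
    then have "D r \<in> null_sets lborel" using Dop[of r] by (auto simp: null_sets_def)
    then have "D r = {}" using open_null_set_empty Dop by blast
    then have "ball x r \<inter> closure \<Omega> = {}" unfolding D_def by (simp add: open_Int_closure_eq_empty)
    moreover have "x \<in> ball x r" using that by simp
    ultimately show False using x by blast
  qed
  have int: "set_integrable lborel (D r) (\<lambda>y. cmod (v y - c))" for r c
  proof (rule set_integrable_bounded_measurable[OF Dbd])
    show "D r \<in> sets borel" using Dop by simp
    then show "set_borel_measurable lborel (D r) (\<lambda>y. cmod (v y - c))"
      by (intro set_borel_measurable_continuous_on continuous_intros continuous_on_subset[OF v Dsub])
    show "norm (cmod (v y - c)) \<le> B + cmod c" if "y \<in> D r" for y
      using B[of y] Dsub that norm_triangle_ineq4[of "v y" c] by force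
  qed
  have fin: "emeasure lborel (D r) < \<infinity>" for r by (rule emeasure_bounded_finite[OF Dbd])
  have const: "set_integrable lborel (D r) (\<lambda>y. k)" "(LINT y:D r|lborel. k) = k * m r" for r and k :: real
  proof -
    show "set_integrable lborel (D r) (\<lambda>y. k)"
      unfolding set_integrable_def using fin[of r] Dop[of r]
      by (intro integrable_scaleR_left integrable_real_indicator) auto
    show "(LINT y:D r|lborel. k) = k * m r"
      unfolding set_lebesgue_integral_def m_def using Dop[of r] by simp
  qed
  have lim: "(avg (v x) \<longlongrightarrow> 0) (at_right 0)"
  proof (rule tendstoI)
    fix \<epsilon> :: real assume \<epsilon>: "\<epsilon> > 0"
    obtain d where d: "d > 0" "\<And>y. y \<in> closure \<Omega> \<Longrightarrow> dist y x < d \<Longrightarrow> dist (v y) (v x) < \<epsilon> / 2"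
      using v x \<epsilon> unfolding continuous_on_iff by (metis half_gt_zero)
    have "dist (avg (v x) r) 0 < \<epsilon>" if r: "0 < r" "r < d" for r
    proof -
      have "(LINT y:D r|lborel. cmod (v y - v x)) \<le> (LINT y:D r|lborel. \<epsilon> / 2)"
      proof (rule set_integral_mono[OF int const(1)])
        fix y assume "y \<in> D r"
        then have "y \<in> closure \<Omega>" "y \<in> ball x r" using Dsub[of r] by (auto simp: D_def)
        then have "y \<in> closure \<Omega>" "dist y x < d" using r by (simp_all add: dist_commute)
        then show "cmod (v y - v x) \<le> \<epsilon> / 2" using d(2) by (force simp: dist_norm)
      qed
      then have "avg (v x) r \<le> \<epsilon> / 2"
        unfolding avg_def const(2) using mpos[OF r(1)] by (simp add: divide_le_eq)
      moreover have "avg (v x) r \<ge> 0"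
        unfolding avg_def set_lebesgue_integral_def using mpos[OF r(1)]
        by (intro divide_nonneg_pos Bochner_Integration.integral_nonneg) auto
      ultimately show ?thesis using \<epsilon> by (simp add: dist_real_def)
    qed
    then show "\<forall>\<^sub>F r in at_right 0. dist (avg (v x) r) 0 < \<epsilon>"
      using d(1) by (intro eventually_at_rightI[of 0 d]) auto
  qed
  have tr: "has_trace \<Omega> v x c \<longleftrightarrow> (avg c \<longlongrightarrow> 0) (at_right 0)" for c
    unfolding has_trace_def avg_def m_def D_def by simp
  show ?thesis
  proof
    assume "c = v x"
    then show "has_trace \<Omega> v x c" using lim tr by simp
  next
    assume "has_trace \<Omega> v x c"
    then have "((\<lambda>r. avg (v x) r + avg c r) \<longlongrightarrow> 0 + 0) (at_right 0)"
      using lim tr by (intro tendsto_add) auto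
    moreover have "\<forall>\<^sub>F r in at_right 0. cmod (v x - c) \<le> avg (v x) r + avg c r"
    proof (rule eventually_at_rightI[of 0 1])
      fix r :: real assume "r \<in> {0<..<1}"
      then have r: "r > 0" by simp
      have "cmod (v x - c) * m r = (LINT y:D r|lborel. cmod (v x - c))" by (simp add: const(2))
      also have "\<dots> \<le> (LINT y:D r|lborel. cmod (v y - v x) + cmod (v y - c))"
      proof (rule set_integral_mono[OF const(1) set_integral_add(1)[OF int int]])
        fix y
        have "v x - c = (v y - c) - (v y - v x)" by simp
        then show "cmod (v x - c) \<le> cmod (v y - v x) + cmod (v y - c)"
          using norm_triangle_ineq4[of "v y - c" "v y - v x"] by simp
      qed
      also have "\<dots> = (LINT y:D r|lborel. cmod (v y - v x)) + (LINT y:D r|lborel. cmod (v y - c))"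
        by (rule set_integral_add(2)[OF int int])
      finally have "cmod (v x - c) \<le> ((LINT y:D r|lborel. cmod (v y - v x)) + (LINT y:D r|lborel. cmod (v y - c))) / m r"
        using mpos[OF r] by (simp add: pos_le_divide_eq)
      then show "cmod (v x - c) \<le> avg (v x) r + avg c r"
        unfolding avg_def by (simp add: add_divide_distrib)
    qed simp
    ultimately have "cmod (v x - c) \<le> 0 + 0"
      by (intro tendsto_lowerbound) auto
    then show "c = v x" by simp
  qed
qed

lemma bd_trace_continuous:
  assumes "open \<Omega>" "bounded \<Omega>" "continuous_on (closure \<Omega>) v" "x \<in> closure \<Omega>"
  shows "bd_trace \<Omega> v x = v x"
  unfolding bd_trace_def has_trace_continuous_iff[OF assms] by simp

section \<open>The boundary seen from the mesh\<close>

lemma orthonormal_expansion: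
  fixes u v x :: pt
  assumes "norm u = 1" "norm v = 1" "u \<bullet> v = 0"
  shows "x = (x \<bullet> u) *\<^sub>R u + (x \<bullet> v) *\<^sub>R v"
proof -
  have ne: "u \<noteq> v" "u \<noteq> 0" "v \<noteq> 0" using assms by (auto simp: dot_square_norm)
  have "independent {u, v}"
    by (rule pairwise_orthogonal_independent) (use assms ne in \<open>auto simp: pairwise_def orthogonal_def inner_commute\<close>)
  then have "UNIV \<subseteq> span {u, v}"
    by (intro card_ge_dim_independent) (use ne in auto)
  then have "x \<in> span {u, v}" by blast
  then obtain k where "x - k *\<^sub>R u \<in> span {v}" using span_breakdown_eq by blast
  then obtain j where "x - k *\<^sub>R u = j *\<^sub>R v" using span_breakdown_eq[of _ v "{}"] by auto
  then have x: "x = k *\<^sub>R u + j *\<^sub>R v" by (simp add: algebra_simps)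
  have "x \<bullet> u = k" "x \<bullet> v = j"
    unfolding x using assms by (simp_all add: inner_add_left dot_square_norm inner_commute[of v u])
  then show ?thesis using x by simp
qed

text \<open>
  Near a boundary point the part of the plane below the describing graph is open and contains no points of the
  domain, hence none of its closure.
\<close>

lemma lipschitz_frontier_not_interior:
  assumes "lipschitz_domain \<Omega>" "p \<in> frontier \<Omega>"
  shows "p \<notin> interior (closure \<Omega>)"
proof
  assume "p \<in> interior (closure \<Omega>)"
  then obtain e where e: "e > 0" "ball p e \<subseteq> closure \<Omega>" unfolding mem_interior by blast
  obtain u v \<gamma> L r h where uv: "norm u = 1" "norm v = 1" "u \<bullet> v = 0" "0 < r" "0 < h"
    "L-lipschitz_on UNIV \<gamma>" "\<gamma> 0 = (0::real)"
    "\<And>s t. \<bar>s\<bar> < r \<Longrightarrow> \<bar>t\<bar> < h \<Longrightarrow> (p + s *\<^sub>R u + t *\<^sub>R v \<in> \<Omega> \<longleftrightarrow> \<gamma> s < t)"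
    using assms unfolding lipschitz_domain_def by meson
  have L: "L \<ge> 0" using uv(6) lipschitz_on_nonneg by blast
  define \<tau> where "\<tau> = min (e / 2) (h / 2)"
  have \<tau>: "0 < \<tau>" "\<tau> < e" "\<tau> \<le> h / 2" using e uv(5) by (auto simp: \<tau>_def min_def)
  \<comment> \<open>for \<open>\<bar>s\<bar> < \<rho>\<close> the graph stays above height \<open>- \<tau> / 2\<close>, and \<open>U\<close> lies below it\<close>
  define \<rho> where "\<rho> = min r (\<tau> / (2 * (L + 1)))"
  have \<rho>: "0 < \<rho>" "\<rho> \<le> r" "\<rho> \<le> \<tau> / (2 * (L + 1))" using uv(4) \<tau> L by (auto simp: \<rho>_def)
  define U where "U = {y. \<bar>(y - p) \<bullet> u\<bar> < \<rho>} \<inter> {y. \<bar>(y - p) \<bullet> v + \<tau>\<bar> < \<tau> / 2}"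
  have "open U" unfolding U_def by (intro open_Int open_Collect_less continuous_intros)
  moreover have y0: "p - \<tau> *\<^sub>R v \<in> U"
    unfolding U_def using \<rho> \<tau> uv(2,3) by (simp add: dot_square_norm inner_commute[of v u])
  moreover have "p - \<tau> *\<^sub>R v \<in> closure \<Omega>"
    using e(2) \<tau> uv(2) by (intro subsetD[OF e(2)]) (simp add: dist_norm)
  ultimately have "U \<inter> \<Omega> \<noteq> {}" using open_Int_closure_eq_empty[of U \<Omega>] by blast
  then obtain y where y: "y \<in> U" "y \<in> \<Omega>" by blast
  define s where "s = (y - p) \<bullet> u"
  define t where "t = (y - p) \<bullet> v"
  have st: "\<bar>s\<bar> < \<rho>" "\<bar>t + \<tau>\<bar> < \<tau> / 2" using y(1) by (auto simp: U_def s_def t_def)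
  have "y = p + s *\<^sub>R u + t *\<^sub>R v"
    using orthonormal_expansion[OF uv(1-3), of "y - p"] unfolding s_def t_def by (simp add: algebra_simps)
  moreover have "\<bar>s\<bar> < r" "\<bar>t\<bar> < h" using st \<rho> \<tau> by linarith+
  ultimately have "\<gamma> s < t" using uv(8) y(2) by blast
  moreover have "\<bar>\<gamma> s\<bar> \<le> L * \<bar>s\<bar>" using lipschitz_onD[OF uv(6), of s 0] uv(7) by (simp add: dist_real_def)
  moreover have "L * \<bar>s\<bar> \<le> L * (\<tau> / (2 * (L + 1)))" using st(1) \<rho>(3) L by (intro mult_left_mono) auto
  moreover have "L * (\<tau> / (2 * (L + 1))) \<le> \<tau> / 2"
  proof -
    have "L * (\<tau> / (2 * (L + 1))) = (L / (L + 1)) * (\<tau> / 2)" using L by (simp add: field_simps)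
    also have "\<dots> \<le> 1 * (\<tau> / 2)" using L \<tau>(1) by (intro mult_right_mono) auto
    finally show ?thesis by simp
  qed
  ultimately show False using st(2) by linarith
qed

lemma side_point_segment:
  assumes "t \<in> {0..1}"
  shows "a + t *\<^sub>R (b - a :: pt) \<in> closed_segment a b"
proof -
  have "a + t *\<^sub>R (b - a) = (1 - t) *\<^sub>R a + t *\<^sub>R b" by (simp add: algebra_simps)
  then show ?thesis unfolding in_segment using assms by (intro exI[of _ t] conjI) auto
qed

text \<open>
  Three affinely independent points span the plane, so the affine functions that interpolate the Kronecker symbol
  at the vertices represent every point. They take complex values by the definition of affine functions; their real
  parts are the barycentric coordinates.
\<close>

lemma barycentric_coordinates:
  assumes T: "2 simplex (T :: pt set)"
  obtains q :: "pt \<Rightarrow> cfun" where "\<And>z. z \<in> vertices T \<Longrightarrow> affine_fun (q z)"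
    "\<And>z z'. z \<in> vertices T \<Longrightarrow> z' \<in> vertices T \<Longrightarrow> q z z' = (if z' = z then 1 else 0)"
    "\<And>y. (\<Sum>z\<in>vertices T. Re (q z y)) = 1" "\<And>y. (\<Sum>z\<in>vertices T. Re (q z y) *\<^sub>R z) = y"
    "\<And>y. (\<And>z. z \<in> vertices T \<Longrightarrow> Re (q z y) \<ge> 0) \<Longrightarrow> y \<in> T"
proof -
  note t = triangle_vertices[OF T]
  have "\<forall>z. \<exists>q. affine_fun q \<and> (\<forall>z'\<in>vertices T. q z' = (if z' = z then 1 else 0))"
    by (intro allI affine_interpolation t(1))
  then obtain q where q: "\<And>z. affine_fun (q z)" "\<And>z z'. z' \<in> vertices T \<Longrightarrow> q z z' = (if z' = z then 1 else 0)"
    by metis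
  have hull: "affine hull (vertices T) = UNIV"
    by (rule affine_independent_span_eq[OF t(1)]) (simp add: t(2))
  have bary: "(\<Sum>z\<in>vertices T. Re (q z y)) = 1 \<and> (\<Sum>z\<in>vertices T. Re (q z y) *\<^sub>R z) = y" for y
  proof -
    obtain u where u: "sum u (vertices T) = 1" "(\<Sum>z\<in>vertices T. u z *\<^sub>R z) = y"
    proof -
      have "y \<in> affine hull (vertices T)" using hull by simp
      then show ?thesis using that unfolding affine_hull_finite[OF t(3)] by auto
    qed
    have "Re (q z y) = u z" if z: "z \<in> vertices T" for z
    proof -
      have "q z y = (\<Sum>z'\<in>vertices T. of_real (u z') * q z z')"
        using affine_fun_convex_sum[OF q(1) t(3) u(1)] u(2) by simp
      also have "\<dots> = (\<Sum>z'\<in>vertices T. if z' = z then of_real (u z') else 0)"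
        using q(2) by (intro sum.cong) auto
      also have "\<dots> = of_real (u z)" using z t(3) by simp
      finally show ?thesis by simp
    qed
    then show ?thesis using u by simp
  qed
  show ?thesis
  proof (rule that)
    fix y assume nn: "\<And>z. z \<in> vertices T \<Longrightarrow> Re (q z y) \<ge> 0"
    have "y \<in> convex hull vertices T"
      unfolding convex_hull_finite[OF t(3)] using bary[of y] nn by (intro CollectI exI[of _ "\<lambda>z. Re (q z y)"]) auto
    then show "y \<in> T" using t(4) by simp
  qed (use q bary in auto)
qed

context mesh
begin

text \<open>
  Barycentric coordinates with respect to the two vertices opposite to a common edge are
  proportional. A positive factor would make the triangles overlap near the edge, so it is not positive.
  Hence every point near a relatively interior point of the edge lies in one of the two triangles.
\<close>

lemma common_edge_interior:
  assumes T: "T \<in> \<T>" "T' \<in> \<T>" "T \<noteq> T'" and x: "x \<in> T \<inter> T'" "x \<notin> vertices (T \<inter> T')"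
  shows "x \<in> interior (T \<union> T')"
proof -
  define C where "C = vertices (T \<inter> T')"
  note f = face_vertices[OF triangle[OF T(1)] inter_face[OF T(1,2)], folded C_def]
  have f': "C \<subseteq> vertices T'"
    using face_vertices(1)[OF triangle[OF T(2)] inter_face[OF T(2,1)]] by (simp add: C_def Int_commute)
  note t = triangle_vertices[OF triangle[OF T(1)]]
  note t' = triangle_vertices[OF triangle[OF T(2)]]
  have fC: "finite C" using f(1) t(3) finite_subset by blast
  have xC: "x \<in> convex hull C" "x \<notin> C"
    using x(1) unfolding f(2) by assumption (use x(2) in \<open>simp add: C_def\<close>)
  have "C \<noteq> vertices T"
  proof
    assume "C = vertices T"
    then have "vertices T = vertices T'" using f' t(2) t'(2,3) by (metis card_subset_eq)
    then show False using t(4) t'(4) T(3) by simp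
  qed
  then have "C \<subset> vertices T" using f(1) by blast
  then have "card C < 3" using psubset_card_mono[OF t(3)] t(2) by metis
  moreover have "card C \<noteq> 0" using xC fC by auto
  moreover have "card C \<noteq> 1" using xC by (auto simp: card_1_singleton_iff)
  ultimately have cC: "card C = 2" by linarith
  have "card (vertices T - C) = 1" using card_Diff_subset[OF fC f(1)] t(2) cC by simp
  then obtain c where "vertices T - C = {c}" by (auto simp: card_1_singleton_iff)
  then have c: "vertices T = insert c C" "c \<notin> C" using f(1) by auto
  have "card (vertices T' - C) = 1" using card_Diff_subset[OF fC f'] t'(2) cC by simp
  then obtain c' where "vertices T' - C = {c'}" by (auto simp: card_1_singleton_iff)
  then have c': "vertices T' = insert c' C" "c' \<notin> C" using f' by auto
  obtain q where q: "\<And>z. z \<in> vertices T \<Longrightarrow> affine_fun (q z)"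
    "\<And>z z'. z \<in> vertices T \<Longrightarrow> z' \<in> vertices T \<Longrightarrow> q z z' = (if z' = z then 1 else 0)"
    "\<And>y. (\<Sum>z\<in>vertices T. Re (q z y)) = 1" "\<And>y. (\<Sum>z\<in>vertices T. Re (q z y) *\<^sub>R z) = y"
    "\<And>y. (\<And>z. z \<in> vertices T \<Longrightarrow> Re (q z y) \<ge> 0) \<Longrightarrow> y \<in> T"
    by (rule barycentric_coordinates[OF triangle[OF T(1)]]) blast
  obtain q' where q': "\<And>z. z \<in> vertices T' \<Longrightarrow> affine_fun (q' z)"
    "\<And>z z'. z \<in> vertices T' \<Longrightarrow> z' \<in> vertices T' \<Longrightarrow> q' z z' = (if z' = z then 1 else 0)"
    "\<And>y. (\<Sum>z\<in>vertices T'. Re (q' z y)) = 1" "\<And>y. (\<Sum>z\<in>vertices T'. Re (q' z y) *\<^sub>R z) = y"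
    "\<And>y. (\<And>z. z \<in> vertices T' \<Longrightarrow> Re (q' z y) \<ge> 0) \<Longrightarrow> y \<in> T'"
    by (rule barycentric_coordinates[OF triangle[OF T(2)]]) blast
  obtain u where u: "\<And>z. z \<in> C \<Longrightarrow> u z \<ge> 0" "sum u C = 1" "(\<Sum>z\<in>C. u z *\<^sub>R z) = x"
    using xC(1) convex_hull_finite[OF fC] by auto
  have upos: "u z > 0" if z: "z \<in> C" for z
  proof (rule ccontr)
    assume "\<not> u z > 0"
    then have uz: "u z = 0" using u(1)[OF z] by simp
    obtain p r where pr: "C = {p, r}" "p \<noteq> r" using cC unfolding card_2_iff by metis
    obtain z' where z': "C = {z, z'}" "z \<noteq> z'"
    proof (cases "z = p")
      case True
      then show ?thesis using pr that[of r] by simp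
    next
      case False
      then have "z = r" using pr z by simp
      then show ?thesis using pr that[of p] by (simp add: insert_commute)
    qed
    have "u z' = 1" using u(2) uz z'(2) unfolding z'(1) by simp
    moreover have "x = u z' *\<^sub>R z'" using u(3) uz z'(2) unfolding z'(1) by simp
    ultimately show False using xC(2) unfolding z'(1) by simp
  qed
  have val: "g x = (\<Sum>z\<in>C. of_real (u z) * g z)" if "affine_fun g" for g
    using affine_fun_convex_sum[OF that fC u(2)] u(3) by simp
  have qx: "Re (q z x) = u z" "Re (q' z x) = u z" if z: "z \<in> C" for z
  proof -
    have "q z x = (\<Sum>y\<in>C. if y = z then of_real (u y) else 0)"
      using val[OF q(1), of z] q(2) c(1) z by (auto intro!: sum.cong)
    then show "Re (q z x) = u z" using z fC by simp
    have "q' z x = (\<Sum>y\<in>C. if y = z then of_real (u y) else 0)"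
      using val[OF q'(1), of z] q'(2) c'(1) z by (auto intro!: sum.cong)
    then show "Re (q' z x) = u z" using z fC by simp
  qed
  have qcF: "q c y = 0" if "y \<in> T \<inter> T'" for y
  proof -
    have "q c y = 0 y"
    proof (rule affine_fun_eq_on_hull[OF _ affine_fun_zero fC])
      show "affine_fun (q c)" using q(1) c(1) by simp
      show "y \<in> convex hull C" using that unfolding f(2) .
      show "q c z = 0 z" if "z \<in> C" for z
      proof -
        have "z \<noteq> c" using c(2) that by metis
        then show ?thesis using q(2)[of c z] c(1) that by simp
      qed
    qed
    then show ?thesis by simp
  qed
  define \<kappa> where "\<kappa> = Re (q' c' c)"
  have ratio: "Re (q' c' y) = Re (q c y) * \<kappa>" for y
  proof -
    have "q' c' y = (\<Sum>z\<in>vertices T. of_real (Re (q z y)) * q' c' z)"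
      using affine_fun_convex_sum[OF q'(1) t(3) q(3)[of y], of c'] q(4)[of y] c'(1) by simp
    also have "\<dots> = of_real (Re (q c y)) * q' c' c + (\<Sum>z\<in>C. of_real (Re (q z y)) * q' c' z)"
      unfolding c(1) using fC c(2) by simp
    also have "(\<Sum>z\<in>C. of_real (Re (q z y)) * q' c' z) = 0"
      using q'(2)[of c'] c' by (intro sum.neutral) auto
    finally show ?thesis by (simp add: \<kappa>_def)
  qed
  define U where "U = (\<Inter>z\<in>C. {y. 0 < Re (q z y)} \<inter> {y. 0 < Re (q' z y)})"
  have opU: "open U"
  proof -
    have "open {y. 0 < Re (g y)}" if "affine_fun g" for g
      by (intro open_Collect_less continuous_intros affine_fun_continuous[OF that])
    then show ?thesis unfolding U_def using fC q(1) q'(1) c(1) c'(1) by (intro open_INT open_Int ballI) auto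
  qed
  have xU: "x \<in> U" using qx upos by (simp add: U_def)
  have inT: "y \<in> T" if "y \<in> U" "Re (q c y) \<ge> 0" for y
    by (rule q(5)) (use that c(1) in \<open>auto simp: U_def less_imp_le\<close>)
  have inT': "y \<in> T'" if "y \<in> U" "Re (q' c' y) \<ge> 0" for y
    by (rule q'(5)) (use that c'(1) in \<open>auto simp: U_def less_imp_le\<close>)
  show ?thesis
  proof (cases "\<kappa> \<le> 0")
    case True
    have "U \<subseteq> T \<union> T'"
    proof
      fix y assume y: "y \<in> U"
      show "y \<in> T \<union> T'"
      proof (cases "Re (q c y) \<ge> 0")
        case False
        then have "Re (q' c' y) \<ge> 0" using ratio[of y] True by (simp add: mult_nonpos_nonpos)
        then show ?thesis using inT' y by blast
      qed (use inT y in blast)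
    qed
    then show ?thesis using interior_maximal[OF _ opU] xU by blast
  next
    case False
    have "((\<lambda>s::real. x + s *\<^sub>R (c - x)) \<longlongrightarrow> x + 0 *\<^sub>R (c - x)) (at_right 0)" by (intro tendsto_intros)
    then have "\<forall>\<^sub>F s in at_right 0. x + s *\<^sub>R (c - x) \<in> U"
      using topological_tendstoD[OF _ opU] xU by force
    then have "\<forall>\<^sub>F s::real in at_right 0. x + s *\<^sub>R (c - x) \<in> U \<and> s > 0"
      using eventually_at_right_less[of "0::real"] by eventually_elim simp
    then obtain s :: real where s: "x + s *\<^sub>R (c - x) \<in> U" "s > 0"
      using eventually_happens'[OF trivial_limit_at_right_real] by blast
    define y where "y = x + s *\<^sub>R (c - x)"
    have "q c y = of_real s"
    proof -
      obtain c0 d e where e: "\<And>x. q c x = c0 + d * of_real (x $ 1) + e * of_real (x $ 2)"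
        using q(1)[of c] c(1) unfolding affine_fun_def by auto
      have "q c y = q c x + of_real s * (q c c - q c x)"
        unfolding y_def e by (simp add: algebra_simps)
      then show ?thesis using qcF[OF x(1)] q(2)[of c c] c(1) by simp
    qed
    moreover have "y \<in> T" "y \<in> T'"
      using inT inT' s ratio[of y] False \<open>q c y = of_real s\<close> by (auto simp: y_def[symmetric])
    ultimately show ?thesis using qcF[of y] s(2) by simp
  qed
qed

text \<open>
  A relatively interior point of a common edge would be interior to the closure of the domain, which is impossible
  on the boundary of a Lipschitz domain.
\<close>

lemma frontier_common_vertices:
  assumes "T \<in> \<T>" "T' \<in> \<T>" "T \<noteq> T'"
  shows "T \<inter> T' \<inter> frontier (Omega P) \<subseteq> vertices (T \<inter> T')"
proof (rule subsetI, rule ccontr)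
  fix x assume x: "x \<in> T \<inter> T' \<inter> frontier (Omega P)" "x \<notin> vertices (T \<inter> T')"
  then have "x \<in> interior (T \<union> T')" using common_edge_interior[OF assms] by blast
  moreover have "T \<union> T' \<subseteq> closure (Omega P)" using triangle_subset assms by blast
  ultimately have "x \<in> interior (closure (Omega P))" using interior_mono by blast
  moreover have "lipschitz_domain (Omega P)" using polygonal unfolding polygonal_partition_def by blast
  ultimately show False using lipschitz_frontier_not_interior x by blast
qed

lemma sides_frontier:
  assumes "(a, b) \<in> sidesD P \<union> sidesN P \<union> sidesR P"
  shows "a \<noteq> b" "closed_segment a b \<subseteq> frontier (Omega P)"
proof -
  let ?S = "sidesD P \<union> sidesN P \<union> sidesR P"
  have 1: "\<forall>(a, b)\<in>?S. a \<noteq> b"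
    using polygonal unfolding polygonal_partition_def Let_def by (elim conjE)
  have 2: "frontier (Omega P) = (\<Union>(a, b)\<in>?S. closed_segment a b)"
    using polygonal unfolding polygonal_partition_def Let_def by (elim conjE)
  show "a \<noteq> b" using bspec[OF 1 assms] by simp
  show "closed_segment a b \<subseteq> frontier (Omega P)"
    unfolding 2 using UN_upper[OF assms, of "\<lambda>(a, b). closed_segment a b"] by simp
qed

lemma side_point:
  assumes "(a, b) \<in> sidesD P \<union> sidesN P \<union> sidesR P" "t \<in> {0..1}"
  shows "a + t *\<^sub>R (b - a) \<in> frontier (Omega P)" "a + t *\<^sub>R (b - a) \<in> closure (Omega P)"
proof -
  have "a + t *\<^sub>R (b - a) \<in> closed_segment a b" by (rule side_point_segment[OF assms(2)])
  then show "a + t *\<^sub>R (b - a) \<in> frontier (Omega P)" using sides_frontier(2)[OF assms(1)] by blast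
  then show "a + t *\<^sub>R (b - a) \<in> closure (Omega P)" by (simp add: frontier_def)
qed

lemma side_parameter_closed:
  assumes "closed A"
  shows "closed {t \<in> {0..1}. a + t *\<^sub>R (b - a :: pt) \<in> A}"
proof -
  have "continuous_on UNIV (\<lambda>t::real. a + t *\<^sub>R (b - a))" by (intro continuous_intros)
  then have "closed ((\<lambda>t::real. a + t *\<^sub>R (b - a)) -` A)"
    using assms continuous_closed_vimage[of A] continuous_on_eq_continuous_at[of UNIV] by auto
  then have "closed ({0..1} \<inter> (\<lambda>t::real. a + t *\<^sub>R (b - a)) -` A)" by (intro closed_Int) auto
  moreover have "{0..1} \<inter> (\<lambda>t::real. a + t *\<^sub>R (b - a)) -` A = {t \<in> {0..1}. a + t *\<^sub>R (b - a) \<in> A}" by auto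
  ultimately show ?thesis by simp
qed

lemma side_integrable:
  fixes g :: "real \<Rightarrow> complex"
  assumes "closed A" "continuous_on {0..1} g"
  shows "set_integrable lborel {t \<in> {0..1}. a + t *\<^sub>R (b - a :: pt) \<in> A} g"
proof -
  have "set_integrable lborel {0..1} g"
    unfolding set_integrable_def by (rule borel_integrable_compact[OF compact_Icc assms(2)])
  then show ?thesis
    by (rule set_integrable_subset) (use side_parameter_closed[OF assms(1), of a b] in auto)
qed

text \<open>
  Two elements share only finitely many points of a side, so the parts of a side that lie in the single elements
  are disjoint up to null sets.
\<close>

lemma boundary_integral_over_elements:
  assumes S: "S \<subseteq> sidesD P \<union> sidesN P \<union> sidesR P"
    and f: "\<And>a b. (a, b) \<in> S \<Longrightarrow> continuous_on {0..1} (\<lambda>t. f (a + t *\<^sub>R (b - a)))"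
  shows "(\<Sum>T\<in>\<T>. boundary_integral S T f) = boundary_integral S UNIV f"
proof -
  have side: "(\<Sum>T\<in>\<T>. LINT t:{t \<in> {0..1}. a + t *\<^sub>R (b - a) \<in> T}|lborel. f (a + t *\<^sub>R (b - a)))
      = (LINT t:{t \<in> {0..1}. a + t *\<^sub>R (b - a) \<in> UNIV}|lborel. f (a + t *\<^sub>R (b - a)))" if ab: "(a, b) \<in> S" for a b
  proof -
    let ?A = "\<lambda>T. {t \<in> {0..1}. a + t *\<^sub>R (b - a) \<in> T}"
    have ab': "(a, b) \<in> sidesD P \<union> sidesN P \<union> sidesR P" using ab S by blast
    have cl: "closed T" if "T \<in> \<T>" for T using triangle_compact[OF triangle[OF that]] compact_imp_closed by blast
    have "(LINT t:(\<Union>T\<in>\<T>. ?A T)|lborel. f (a + t *\<^sub>R (b - a))) = (\<Sum>T\<in>\<T>. LINT t:?A T|lborel. f (a + t *\<^sub>R (b - a)))"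
    proof (rule set_integral_finite_UN_AE[OF finite_mesh])
      fix T T' assume T: "T \<in> \<T>" "T' \<in> \<T>"
      show "AE t in lborel. t \<in> ?A T \<and> t \<in> ?A T' \<longrightarrow> T = T'"
      proof (cases "T = T'")
        case False
        have "finite (vertices (T \<inter> T'))"
          using face_vertices(1)[OF triangle[OF T(1)] inter_face[OF T]] triangle_vertices(3)[OF triangle[OF T(1)]]
          by (rule finite_subset)
        moreover have "inj (\<lambda>t::real. a + t *\<^sub>R (b - a))"
          using sides_frontier(1)[OF ab'] by (auto simp: inj_on_def)
        ultimately have "finite ((\<lambda>t::real. a + t *\<^sub>R (b - a)) -` vertices (T \<inter> T'))"
          by (rule finite_vimageI)
        moreover have "?A T \<inter> ?A T' \<subseteq> (\<lambda>t::real. a + t *\<^sub>R (b - a)) -` vertices (T \<inter> T')"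
          using frontier_common_vertices[OF T False] side_point(1)[OF ab'] by auto
        ultimately have "finite (?A T \<inter> ?A T')" by (rule finite_subset[rotated])
        then have "?A T \<inter> ?A T' \<in> null_sets lborel" by (rule finite_imp_null_set_lborel)
        from AE_not_in[OF this] show ?thesis by eventually_elim blast
      qed simp
    next
      fix T assume T: "T \<in> \<T>"
      show "?A T \<in> sets lborel" using side_parameter_closed[OF cl[OF T]] by simp
      show "set_integrable lborel (?A T) (\<lambda>t. f (a + t *\<^sub>R (b - a)))"
        by (rule side_integrable[OF cl[OF T] f[OF ab]])
    qed
    moreover have "(\<Union>T\<in>\<T>. ?A T) = ?A UNIV"
      using side_point(2)[OF ab'] covers by auto
    ultimately show ?thesis by simp
  qed
  have "(\<Sum>T\<in>\<T>. boundary_integral S T f)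
      = (\<Sum>p\<in>S. \<Sum>T\<in>\<T>. of_real (dist (fst p) (snd p)) *
          (LINT t:{t \<in> {0..1}. fst p + t *\<^sub>R (snd p - fst p) \<in> T}|lborel. f (fst p + t *\<^sub>R (snd p - fst p))))"
    unfolding boundary_integral_def by (subst sum.swap) (simp add: case_prod_beta)
  also have "\<dots> = boundary_integral S UNIV f"
    unfolding boundary_integral_def case_prod_beta sum_distrib_left[symmetric]
    using side by (intro sum.cong) auto
  finally show ?thesis .
qed

lemma P1_subset_V_space: "P1_space P \<T> \<subseteq> V_space P"
proof
  fix v assume v: "v \<in> P1_space P \<T>"
  have "AE t in lborel. t \<in> {0..1} \<longrightarrow> has_trace (Omega P) v (a + t *\<^sub>R (b - a)) 0" if ab: "(a, b) \<in> sidesD P" for a b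
  proof (intro AE_I2 impI)
    fix t :: real assume t: "t \<in> {0..1}"
    have ab': "(a, b) \<in> sidesD P \<union> sidesN P \<union> sidesR P" using ab by blast
    have "a + t *\<^sub>R (b - a) \<in> closed_segment a b" by (rule side_point_segment[OF t])
    moreover have "closed_segment a b = closure (open_segment a b)"
      using sides_frontier(1)[OF ab'] by simp
    moreover have "open_segment a b \<subseteq> boundary_part (sidesD P)"
      using ab unfolding boundary_part_def by auto
    ultimately have "a + t *\<^sub>R (b - a) \<in> dirichlet P"
      unfolding dirichlet_def using closure_mono by blast
    then show "has_trace (Omega P) v (a + t *\<^sub>R (b - a)) 0"
      using has_trace_continuous_iff[OF open_Omega bounded_Omega P1_continuous[OF v] side_point(2)[OF ab' t]]
        P1_dirichlet[OF v] by simp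
  qed
  then show "v \<in> V_space P" unfolding V_space_def using P1_H1[OF v] by auto
qed

end

section \<open>The forms of the Helmholtz problem\<close>

lemma set_integral_cong_AE:
  fixes f g :: "pt \<Rightarrow> complex"
  assumes "set_integrable lborel A f" "set_integrable lborel A g" "AE x in lborel. x \<in> A \<longrightarrow> f x = g x"
  shows "(LINT x:A|lborel. f x) = (LINT x:A|lborel. g x)"
  unfolding set_lebesgue_integral_def
proof (rule integral_cong_AE)
  show "AE x in lborel. indicat_real A x *\<^sub>R f x = indicat_real A x *\<^sub>R g x"
    using assms(3) by eventually_elim (auto simp: indicator_def)
qed (use assms in \<open>auto simp: set_integrable_def\<close>)

lemma sesquilinear_of_hermitian:
  assumes add: "\<And>u v w. u \<in> V \<Longrightarrow> v \<in> V \<Longrightarrow> w \<in> V \<Longrightarrow> a (u + v) w = a u w + a v w"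
    and scale: "\<And>c v w. v \<in> V \<Longrightarrow> w \<in> V \<Longrightarrow> a (fscale c v) w = c * a v w"
    and herm: "\<And>v w. a w v = cnj (a v w)"
  shows "sesquilinear_on V a"
  unfolding sesquilinear_on_def linear_form_on_def antilinear_form_on_def
proof (intro conjI ballI allI)
  fix u v w c assume *: "u \<in> V" "v \<in> V" "w \<in> V"
  have "a u (v + w) = cnj (a (v + w) u)" by (rule herm)
  also have "\<dots> = cnj (a v u) + cnj (a w u)" using add[OF *(2,3,1)] by simp
  also have "\<dots> = a u v + a u w" using herm[of u v] herm[of u w] by simp
  finally show "a u (v + w) = a u v + a u w" .
next
  fix v w c assume *: "v \<in> V" "w \<in> V"
  have "a v (fscale c w) = cnj (a (fscale c w) v)" by (rule herm)
  also have "\<dots> = cnj c * cnj (a w v)" using scale[OF *(2,1)] by simp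
  also have "\<dots> = cnj c * a v w" using herm[of v w] by simp
  finally show "a v (fscale c w) = cnj c * a v w" .
qed (use add scale in simp_all)

lemma sesquilinear_combination:
  assumes "sesquilinear_on V a" "sesquilinear_on V b"
  shows "sesquilinear_on V (\<lambda>v w. a v w + c * b v w)"
  using assms unfolding sesquilinear_on_def linear_form_on_def antilinear_form_on_def
  by (simp add: algebra_simps)

lemma weak_gradient_grad: "v \<in> H1 (Omega P) \<Longrightarrow> weak_gradient (Omega P) v (grad P v)"
  unfolding H1_def grad_def mem_Collect_eq by (elim conjE) (erule someI_ex)

lemma H1_L2: "v \<in> H1 \<Omega> \<Longrightarrow> L2_on \<Omega> v"
  unfolding H1_def by simp

lemma ip_grad_hermitian: "ip_grad P S w v = cnj (ip_grad P S v w)"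
  unfolding ip_grad_def by (subst set_integral_cnj[symmetric]) (simp add: cnj_sum mult.commute)

lemma ip_L2_hermitian: "ip_L2 P S w v = cnj (ip_L2 P S v w)"
  unfolding ip_L2_def by (subst set_integral_cnj[symmetric]) (simp add: mult.commute)

lemma boundary_integral_cnj: "boundary_integral S A (\<lambda>x. cnj (f x)) = cnj (boundary_integral S A f)"
  unfolding boundary_integral_def cnj_sum case_prod_beta set_integral_cnj by simp

lemma ip_robin_hermitian: "ip_robin P S w v = cnj (ip_robin P S v w)"
  unfolding ip_robin_def by (subst boundary_integral_cnj[symmetric]) (simp add: mult.commute)

lemma ip_robin_real: "Im (ip_robin P S w w) = 0"
  using ip_robin_hermitian[of P S w w] by (simp add: complex_eq_iff)

lemma ip_L2_scale: "ip_L2 P S (fscale c v) w = c * ip_L2 P S v w"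
  unfolding ip_L2_def by (simp add: mult.assoc)

lemma ip_L2_conj: "ip_L2 P S (conj_fun v) (conj_fun w) = ip_L2 P S w v"
  unfolding ip_L2_def by (simp add: mult.commute)

lemma ip_L2_self: "ip_L2 P S v v = of_real (LINT x:Omega P \<inter> S|lborel. (cmod (v x))\<^sup>2)"
  unfolding ip_L2_def set_integral_complex_of_real[symmetric] complex_norm_square ..

lemma ip_grad_self:
  "ip_grad P S v v = of_real (LINT x:Omega P \<inter> S|lborel. (\<Sum>i\<in>UNIV. (cmod (grad P v x $ i))\<^sup>2))"
  unfolding ip_grad_def set_integral_complex_of_real[symmetric] of_real_sum complex_norm_square ..

lemma set_integral_nonneg:
  fixes f :: "pt \<Rightarrow> real"
  assumes "\<And>x. f x \<ge> 0"
  shows "(LINT x:A|lborel. f x) \<ge> 0"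
  unfolding set_lebesgue_integral_def by (intro Bochner_Integration.integral_nonneg) (simp add: assms)

lemma ip_L2_nonneg: "Re (ip_L2 P S v v) \<ge> 0" "Im (ip_L2 P S v v) = 0"
  unfolding ip_L2_self using set_integral_nonneg[of "\<lambda>x. (cmod (v x))\<^sup>2"] by simp_all

lemma ip_grad_nonneg: "Re (ip_grad P S v v) \<ge> 0" "Im (ip_grad P S v v) = 0"
  unfolding ip_grad_self using set_integral_nonneg[of "\<lambda>x. \<Sum>i\<in>UNIV. (cmod (grad P v x $ i))\<^sup>2"]
  by (simp_all add: sum_nonneg)

lemma bform_self: "bform P v v = of_real ((norm_k P v)\<^sup>2)"
proof -
  have "Re (bform P v v) \<ge> 0" unfolding bform_def using ip_L2_nonneg(1)[of P UNIV v] ip_grad_nonneg(1)[of P UNIV v] by simp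
  moreover have "Im (bform P v v) = 0" unfolding bform_def using ip_L2_nonneg(2)[of P UNIV v] ip_grad_nonneg(2)[of P UNIV v] by simp
  ultimately show ?thesis unfolding norm_k_def by (simp add: complex_eq_iff)
qed

lemma norm_k_nonneg: "norm_k P v \<ge> 0"
proof -
  have "Re (bform P v v) \<ge> 0" unfolding bform_def using ip_L2_nonneg(1)[of P UNIV v] ip_grad_nonneg(1)[of P UNIV v] by simp
  then show ?thesis unfolding norm_k_def by simp
qed

context mesh
begin

lemma ip_grad_integrable:
  assumes "v \<in> H1 (Omega P)" "w \<in> H1 (Omega P)" "S \<in> sets borel"
  shows "set_integrable lborel (Omega P \<inter> S) (\<lambda>x. \<Sum>i\<in>UNIV. grad P v x $ i * cnj (grad P w x $ i))"
proof -
  have "set_integrable lborel (Omega P) (\<lambda>x. grad P v x $ i * cnj (grad P w x $ i))" for i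
    by (rule L2_on_mult[OF weak_gradient_component_L2[OF weak_gradient_grad[OF assms(1)]]
          weak_gradient_component_L2[OF weak_gradient_grad[OF assms(2)]]])
  then have "set_integrable lborel (Omega P) (\<lambda>x. grad P v x $ 1 * cnj (grad P w x $ 1) + grad P v x $ 2 * cnj (grad P w x $ 2))"
    by (intro set_integral_add(1))
  then have "set_integrable lborel (Omega P \<inter> S) (\<lambda>x. grad P v x $ 1 * cnj (grad P w x $ 1) + grad P v x $ 2 * cnj (grad P w x $ 2))"
    by (rule set_integrable_subset) (use assms(3) Omega_borel in auto)
  then show ?thesis by (simp add: UNIV_2)
qed

lemma ip_L2_integrable:
  assumes "L2_on (Omega P) v" "L2_on (Omega P) w" "S \<in> sets borel"
  shows "set_integrable lborel (Omega P \<inter> S) (\<lambda>x. v x * cnj (w x))"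
  by (rule set_integrable_subset[OF L2_on_mult[OF assms(1,2)]]) (use assms(3) Omega_borel in auto)

lemma H1_add: "v \<in> H1 (Omega P) \<Longrightarrow> w \<in> H1 (Omega P) \<Longrightarrow> v + w \<in> H1 (Omega P)"
  using weak_gradient_add[OF bounded_Omega Omega_borel H1_L2 weak_gradient_grad H1_L2 weak_gradient_grad, of v w]
    L2_on_add[OF H1_L2 H1_L2, of v "Omega P" w]
  unfolding H1_def by (intro CollectI conjI exI)

lemma H1_scale: "v \<in> H1 (Omega P) \<Longrightarrow> fscale c v \<in> H1 (Omega P)"
  using L2_on_scale[OF H1_L2, of v "Omega P" c] weak_gradient_scale[OF weak_gradient_grad, of v P c]
  unfolding H1_def by (intro CollectI conjI exI)

lemma H1_conj: "v \<in> H1 (Omega P) \<Longrightarrow> conj_fun v \<in> H1 (Omega P)"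
  using L2_on_conj[OF H1_L2, of v "Omega P"] weak_gradient_conj[OF weak_gradient_grad, of v P]
  unfolding H1_def by (intro CollectI conjI exI)

lemma grad_add:
  assumes "v \<in> H1 (Omega P)" "w \<in> H1 (Omega P)"
  shows "AE x in lborel. x \<in> Omega P \<longrightarrow> grad P (v + w) x = grad P v x + grad P w x"
  by (rule weak_gradient_unique[OF open_Omega bounded_Omega weak_gradient_grad[OF H1_add[OF assms]]
        weak_gradient_add[OF bounded_Omega Omega_borel H1_L2[OF assms(1)] weak_gradient_grad[OF assms(1)]
          H1_L2[OF assms(2)] weak_gradient_grad[OF assms(2)]]])

lemma grad_scale:
  assumes "v \<in> H1 (Omega P)"
  shows "AE x in lborel. x \<in> Omega P \<longrightarrow> grad P (fscale c v) x = c *s grad P v x"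
  by (rule weak_gradient_unique[OF open_Omega bounded_Omega weak_gradient_grad[OF H1_scale[OF assms]]
        weak_gradient_scale[OF weak_gradient_grad[OF assms]]])

lemma grad_conj:
  assumes "v \<in> H1 (Omega P)"
  shows "AE x in lborel. x \<in> Omega P \<longrightarrow> grad P (conj_fun v) x = (\<chi> i. cnj (grad P v x $ i))"
  by (rule weak_gradient_unique[OF open_Omega bounded_Omega weak_gradient_grad[OF H1_conj[OF assms]]
        weak_gradient_conj[OF weak_gradient_grad[OF assms]]])

lemma ip_grad_add:
  assumes u: "u \<in> H1 (Omega P)" and v: "v \<in> H1 (Omega P)" and w: "w \<in> H1 (Omega P)" and S: "S \<in> sets borel"
  shows "ip_grad P S (u + v) w = ip_grad P S u w + ip_grad P S v w"
proof -
  have "ip_grad P S (u + v) w = (LINT x:Omega P \<inter> S|lborel. (\<Sum>i\<in>UNIV. grad P u x $ i * cnj (grad P w x $ i))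
      + (\<Sum>i\<in>UNIV. grad P v x $ i * cnj (grad P w x $ i)))"
    unfolding ip_grad_def
  proof (rule set_integral_cong_AE)
    show "AE x in lborel. x \<in> Omega P \<inter> S \<longrightarrow> (\<Sum>i\<in>UNIV. grad P (u + v) x $ i * cnj (grad P w x $ i)) =
        (\<Sum>i\<in>UNIV. grad P u x $ i * cnj (grad P w x $ i)) + (\<Sum>i\<in>UNIV. grad P v x $ i * cnj (grad P w x $ i))"
      using grad_add[OF u v] by eventually_elim (simp add: sum.distrib[symmetric] distrib_right)
  qed (intro ip_grad_integrable set_integral_add(1) H1_add u v w S)+
  also have "\<dots> = ip_grad P S u w + ip_grad P S v w"
    unfolding ip_grad_def by (rule set_integral_add(2)[OF ip_grad_integrable[OF u w S] ip_grad_integrable[OF v w S]])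
  finally show ?thesis .
qed

lemma ip_grad_scale:
  assumes v: "v \<in> H1 (Omega P)" and w: "w \<in> H1 (Omega P)" and S: "S \<in> sets borel"
  shows "ip_grad P S (fscale c v) w = c * ip_grad P S v w"
proof -
  have "ip_grad P S (fscale c v) w = (LINT x:Omega P \<inter> S|lborel. c * (\<Sum>i\<in>UNIV. grad P v x $ i * cnj (grad P w x $ i)))"
    unfolding ip_grad_def
  proof (rule set_integral_cong_AE)
    show "AE x in lborel. x \<in> Omega P \<inter> S \<longrightarrow> (\<Sum>i\<in>UNIV. grad P (fscale c v) x $ i * cnj (grad P w x $ i)) =
        c * (\<Sum>i\<in>UNIV. grad P v x $ i * cnj (grad P w x $ i))"
      using grad_scale[OF v, of c] by eventually_elim (simp add: sum_distrib_left mult.assoc)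
  qed (intro ip_grad_integrable set_integrable_mult_right impI H1_scale v w S)+
  then show ?thesis unfolding ip_grad_def by simp
qed

lemma ip_grad_conj:
  assumes v: "v \<in> H1 (Omega P)" and w: "w \<in> H1 (Omega P)" and S: "S \<in> sets borel"
  shows "ip_grad P S (conj_fun v) (conj_fun w) = ip_grad P S w v"
  unfolding ip_grad_def
proof (rule set_integral_cong_AE)
  show "AE x in lborel. x \<in> Omega P \<inter> S \<longrightarrow>
      (\<Sum>i\<in>UNIV. grad P (conj_fun v) x $ i * cnj (grad P (conj_fun w) x $ i))
      = (\<Sum>i\<in>UNIV. grad P w x $ i * cnj (grad P v x $ i))"
    using grad_conj[OF v] grad_conj[OF w] by eventually_elim (simp add: mult.commute)
qed (intro ip_grad_integrable H1_conj v w S)+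

lemma ip_L2_add:
  assumes "L2_on (Omega P) u" "L2_on (Omega P) v" "L2_on (Omega P) w" "S \<in> sets borel"
  shows "ip_L2 P S (u + v) w = ip_L2 P S u w + ip_L2 P S v w"
  unfolding ip_L2_def
  using set_integral_add(2)[OF ip_L2_integrable[OF assms(1,3,4)] ip_L2_integrable[OF assms(2,3,4)]]
  by (simp add: distrib_right)

lemma P1_continuous_side:
  assumes "v \<in> P1_space P \<T>" "(a, b) \<in> sidesR P"
  shows "continuous_on {0..1} (\<lambda>t. v (a + t *\<^sub>R (b - a)))"
proof (rule continuous_on_compose2[OF P1_continuous[OF assms(1)]])
  show "continuous_on {0..1} (\<lambda>t. a + t *\<^sub>R (b - a))" by (intro continuous_intros)
  show "(\<lambda>t. a + t *\<^sub>R (b - a)) ` {0..1} \<subseteq> closure (Omega P)"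
    using side_point(2)[of a b] assms(2) by blast
qed

text \<open>
  Functions that are continuous up to the boundary equal their traces, so the Robin term integrates continuous
  functions over the sides. Its additivity rests on this integrability.
\<close>

lemma ip_robin_P1:
  assumes v: "v \<in> P1_space P \<T>" and w: "w \<in> P1_space P \<T>"
  shows "ip_robin P S v w = boundary_integral (sidesR P) S (\<lambda>x. v x * cnj (w x))"
  unfolding ip_robin_def boundary_integral_def
proof (intro sum.cong refl)
  fix p assume p: "p \<in> sidesR P"
  obtain a b where ab: "p = (a, b)" by (cases p)
  have "bd_trace (Omega P) v (a + t *\<^sub>R (b - a)) = v (a + t *\<^sub>R (b - a))"
    "bd_trace (Omega P) w (a + t *\<^sub>R (b - a)) = w (a + t *\<^sub>R (b - a))" if t: "t \<in> {0..1}" for t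
    using side_point(2)[of a b t] p ab t
    by (simp_all add: bd_trace_continuous[OF open_Omega bounded_Omega P1_continuous[OF v]]
        bd_trace_continuous[OF open_Omega bounded_Omega P1_continuous[OF w]])
  then have "(LINT t:{t \<in> {0..1}. a + t *\<^sub>R (b - a) \<in> S}|lborel.
        bd_trace (Omega P) v (a + t *\<^sub>R (b - a)) * cnj (bd_trace (Omega P) w (a + t *\<^sub>R (b - a))))
      = (LINT t:{t \<in> {0..1}. a + t *\<^sub>R (b - a) \<in> S}|lborel. v (a + t *\<^sub>R (b - a)) * cnj (w (a + t *\<^sub>R (b - a))))"
    unfolding set_lebesgue_integral_def
    by (intro Bochner_Integration.integral_cong) (auto simp: indicator_def)
  then show "(case p of (a, b) \<Rightarrow> of_real (dist a b) * (LINT t:{t \<in> {0..1}. a + t *\<^sub>R (b - a) \<in> S}|lborel.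
        bd_trace (Omega P) v (a + t *\<^sub>R (b - a)) * cnj (bd_trace (Omega P) w (a + t *\<^sub>R (b - a)))))
      = (case p of (a, b) \<Rightarrow> of_real (dist a b) * (LINT t:{t \<in> {0..1}. a + t *\<^sub>R (b - a) \<in> S}|lborel.
        v (a + t *\<^sub>R (b - a)) * cnj (w (a + t *\<^sub>R (b - a)))))"
    by (simp only: ab prod.case)
qed

lemma ip_robin_add:
  assumes u: "u \<in> P1_space P \<T>" and v: "v \<in> P1_space P \<T>" and w: "w \<in> P1_space P \<T>" and S: "closed S"
  shows "ip_robin P S (u + v) w = ip_robin P S u w + ip_robin P S v w"
proof -
  have uv: "u + v \<in> P1_space P \<T>" using P1_subspace u v by (rule cvs.subspace_add)
  have i: "set_integrable lborel {t \<in> {0..1}. a + t *\<^sub>R (b - a) \<in> S} (\<lambda>t. f (a + t *\<^sub>R (b - a)) * cnj (w (a + t *\<^sub>R (b - a))))"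
    if f: "f \<in> P1_space P \<T>" and ab: "(a, b) \<in> sidesR P" for f a b
    by (rule side_integrable[OF S]) (intro continuous_intros P1_continuous_side f w ab)
  have "boundary_integral (sidesR P) S (\<lambda>x. (u + v) x * cnj (w x))
      = boundary_integral (sidesR P) S (\<lambda>x. u x * cnj (w x)) + boundary_integral (sidesR P) S (\<lambda>x. v x * cnj (w x))"
    unfolding boundary_integral_def sum.distrib[symmetric]
  proof (intro sum.cong refl)
    fix p assume p: "p \<in> sidesR P"
    obtain a b where ab: "p = (a, b)" by (cases p)
    from set_integral_add(2)[OF i[OF u p[unfolded ab]] i[OF v p[unfolded ab]]]
    show "(case p of (a, b) \<Rightarrow> of_real (dist a b) * (LINT t:{t \<in> {0..1}. a + t *\<^sub>R (b - a) \<in> S}|lborel.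
          (u + v) (a + t *\<^sub>R (b - a)) * cnj (w (a + t *\<^sub>R (b - a)))))
        = (case p of (a, b) \<Rightarrow> of_real (dist a b) * (LINT t:{t \<in> {0..1}. a + t *\<^sub>R (b - a) \<in> S}|lborel.
          u (a + t *\<^sub>R (b - a)) * cnj (w (a + t *\<^sub>R (b - a)))))
        + (case p of (a, b) \<Rightarrow> of_real (dist a b) * (LINT t:{t \<in> {0..1}. a + t *\<^sub>R (b - a) \<in> S}|lborel.
          v (a + t *\<^sub>R (b - a)) * cnj (w (a + t *\<^sub>R (b - a)))))"
      unfolding ab prod.case plus_fun_apply distrib_right distrib_left[symmetric] by (simp only:)
  qed
  then show ?thesis unfolding ip_robin_P1[OF uv w] ip_robin_P1[OF u w] ip_robin_P1[OF v w] .
qed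

lemma ip_robin_scale:
  assumes v: "v \<in> P1_space P \<T>" and w: "w \<in> P1_space P \<T>"
  shows "ip_robin P S (fscale c v) w = c * ip_robin P S v w"
proof -
  have cv: "fscale c v \<in> P1_space P \<T>" using P1_subspace v by (rule cvs.subspace_scale)
  show ?thesis unfolding ip_robin_P1[OF cv w] ip_robin_P1[OF v w] boundary_integral_def
    by (simp add: sum_distrib_left case_prod_beta mult_ac)
qed

lemma ip_robin_conj:
  assumes v: "v \<in> P1_space P \<T>" and w: "w \<in> P1_space P \<T>"
  shows "ip_robin P S (conj_fun v) (conj_fun w) = ip_robin P S w v"
  unfolding ip_robin_P1[OF P1_conj[OF v] P1_conj[OF w]] ip_robin_P1[OF w v] by (simp add: mult.commute)

lemma ip_grad_sesquilinear: "S \<in> sets borel \<Longrightarrow> sesquilinear_on (P1_space P \<T>) (ip_grad P S)"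
  by (rule sesquilinear_of_hermitian) (simp_all add: ip_grad_add ip_grad_scale P1_H1, rule ip_grad_hermitian)

lemma ip_L2_sesquilinear: "S \<in> sets borel \<Longrightarrow> sesquilinear_on (P1_space P \<T>) (ip_L2 P S)"
  by (rule sesquilinear_of_hermitian) (simp_all add: ip_L2_add ip_L2_scale P1_L2, rule ip_L2_hermitian)

lemma ip_robin_sesquilinear: "closed S \<Longrightarrow> sesquilinear_on (P1_space P \<T>) (ip_robin P S)"
  by (rule sesquilinear_of_hermitian) (simp_all add: ip_robin_add ip_robin_scale, rule ip_robin_hermitian)

lemma aform_on_sesquilinear:
  assumes "closed S"
  shows "sesquilinear_on (P1_space P \<T>) (aform_on P S)"
proof -
  have S: "S \<in> sets borel" using assms by simp
  have "sesquilinear_on (P1_space P \<T>) (\<lambda>v w. (ip_grad P S v w + (- of_real ((wavenumber P)\<^sup>2)) * ip_L2 P S v w)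
      + (- \<i> * of_real (wavenumber P)) * ip_robin P S v w)"
    by (intro sesquilinear_combination ip_grad_sesquilinear ip_L2_sesquilinear ip_robin_sesquilinear S assms)
  then show ?thesis by (simp add: aform_on_def[abs_def])
qed

lemma aform_sesquilinear: "sesquilinear_on (P1_space P \<T>) (aform P)"
proof -
  have "aform P = aform_on P UNIV" by (intro ext) (simp add: aform_def)
  then show ?thesis using aform_on_sesquilinear[OF closed_UNIV] by simp
qed

lemma bform_sesquilinear: "sesquilinear_on (P1_space P \<T>) (bform P)"
proof -
  have "sesquilinear_on (P1_space P \<T>) (\<lambda>v w. ip_grad P UNIV v w + of_real ((wavenumber P)\<^sup>2) * ip_L2 P UNIV v w)"
    by (intro sesquilinear_combination ip_grad_sesquilinear ip_L2_sesquilinear) auto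
  then show ?thesis by (simp add: bform_def[abs_def])
qed

text \<open>
  The factor \<open>\<i>\<close> in the Robin term is not conjugated, which is why the arguments are swapped.
\<close>

lemma aform_on_conj:
  assumes v: "v \<in> P1_space P \<T>" and w: "w \<in> P1_space P \<T>" and S: "closed S"
  shows "aform_on P S (conj_fun v) (conj_fun w) = aform_on P S w v"
  unfolding aform_on_def using S by (simp add: ip_grad_conj ip_L2_conj ip_robin_conj v w P1_H1)

lemma bform_conj:
  assumes v: "v \<in> P1_space P \<T>" and w: "w \<in> P1_space P \<T>"
  shows "bform P (conj_fun v) (conj_fun w) = bform P w v"
  unfolding bform_def by (simp add: ip_grad_conj ip_L2_conj v w P1_H1)

lemma aform_over_elements:
  assumes v: "v \<in> P1_space P \<T>'" and w: "w \<in> P1_space P \<T>'" and m: "mesh P \<T>'"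
  shows "(\<Sum>T\<in>\<T>. aform_on P T v w) = aform P v w"
proof -
  interpret fine: mesh P \<T>' by (rule m)
  have g: "(\<Sum>T\<in>\<T>. ip_grad P T v w) = ip_grad P UNIV v w"
    unfolding ip_grad_def using integral_over_elements[OF ip_grad_integrable[OF fine.P1_H1[OF v] fine.P1_H1[OF w], of UNIV, simplified]] by simp
  have l: "(\<Sum>T\<in>\<T>. ip_L2 P T v w) = ip_L2 P UNIV v w"
    unfolding ip_L2_def using integral_over_elements[OF L2_on_mult[OF fine.P1_L2[OF v] fine.P1_L2[OF w]]] by simp
  have r: "(\<Sum>T\<in>\<T>. ip_robin P T v w) = ip_robin P UNIV v w"
    unfolding fine.ip_robin_P1[OF v w]
  proof (rule boundary_integral_over_elements)
    show "continuous_on {0..1} (\<lambda>t. v (a + t *\<^sub>R (b - a)) * cnj (w (a + t *\<^sub>R (b - a))))" if "(a, b) \<in> sidesR P" for a b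
      by (intro continuous_intros fine.P1_continuous_side v w that)
  qed blast
  show ?thesis unfolding aform_def aform_on_def sum_subtractf sum_distrib_left[symmetric] g l r by simp
qed

lemma P1_definite:
  assumes v: "v \<in> P1_space P \<T>" and k: "wavenumber P > 0" and zero: "norm_k P v = 0"
  shows "v = 0"
proof -
  have "bform P v v = 0" using zero by (simp add: bform_self)
  then have "Re (ip_grad P UNIV v v) + (wavenumber P)\<^sup>2 * Re (ip_L2 P UNIV v v) = 0"
    unfolding bform_def by (simp add: complex_eq_iff)
  then have "(wavenumber P)\<^sup>2 * Re (ip_L2 P UNIV v v) = 0"
    using ip_grad_nonneg(1)[of P UNIV v] ip_L2_nonneg(1)[of P UNIV v] by (smt (verit) mult_nonneg_nonneg zero_le_power2)
  then have int0: "(LINT x:Omega P|lborel. (cmod (v x))\<^sup>2) = 0" using k by (simp add: ip_L2_self)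
  have int: "set_integrable lborel (Omega P) (\<lambda>x. (cmod (v x))\<^sup>2)" using P1_L2[OF v] by (simp add: L2_on_def)
  have cont: "continuous_on (Omega P) (\<lambda>x. (cmod (v x))\<^sup>2)"
    by (intro continuous_intros continuous_on_subset[OF P1_continuous[OF v] closure_subset])
  have sets: "Omega P \<in> sets lborel" using Omega_borel by simp
  have "(cmod (v x))\<^sup>2 = 0" if "x \<in> Omega P" for x
    by (rule continuous_nonneg_integral_eq_0[OF sets open_Omega order_refl cont int _ int0 that]) simp
  then have "v x = 0" if "x \<in> Omega P" for x using that by simp
  then have "v x = 0" if "x \<in> closure (Omega P)" for x
    by (rule continuous_constant_on_closure[OF P1_continuous[OF v] _ that])
  then show ?thesis using P1_zero_outside[OF v] by (intro ext) (metis zero_fun_apply)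
qed

end

section \<open>Quasi-interpolation\<close>

lemma affine_fun_zero_on_open:
  assumes q: "affine_fun q" and U: "open U" "U \<noteq> {}" and zero: "\<And>x. x \<in> U \<Longrightarrow> q x = 0"
  shows "q = 0"
proof -
  obtain c d e where e: "\<And>x. q x = c + d * of_real (x $ 1) + e * of_real (x $ 2)"
    using q unfolding affine_fun_def by metis
  obtain x0 where x0: "x0 \<in> U" using U(2) by blast
  obtain r where r: "r > 0" "ball x0 r \<subseteq> U" using U(1) x0 unfolding open_contains_ball by metis
  have "slope i q = 0" for i
  proof -
    have "x0 + (r / 2) *\<^sub>R axis i 1 \<in> ball x0 r" using r(1) by (simp add: dist_norm norm_axis_1)
    then have "q (x0 + (r / 2) *\<^sub>R axis i 1) = 0" using zero r(2) by blast
    then have "of_real (r / 2) * slope i q = 0" unfolding affine_fun_slope[OF q] using zero[OF x0] by simp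
    then show ?thesis using r(1) by simp
  qed
  from this[of 1] this[of 2] have "d = 0" "e = 0" unfolding slope_def e by (simp_all add: axis_def)
  moreover have "c = 0" using zero[OF x0] calculation unfolding e by simp
  ultimately show ?thesis using e by (intro ext) simp
qed

lemma quotient_integral_le:
  fixes a b c d :: real
  assumes "sqrt a / d \<le> c * sqrt b" "0 < d" "0 \<le> c" "0 \<le> a" "0 \<le> b"
  shows "a \<le> c\<^sup>2 * d\<^sup>2 * b"
proof -
  have "sqrt a \<le> c * sqrt b * d" using assms(1,2) by (simp add: divide_le_eq)
  then have "(sqrt a)\<^sup>2 \<le> (c * sqrt b * d)\<^sup>2" using assms by (intro power_mono) auto
  then show ?thesis using assms by (simp add: power_mult_distrib mult_ac)
qed

lemma set_integral_subset_UN_le: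
  fixes f :: "pt \<Rightarrow> real"
  assumes fin: "finite I" and A: "\<And>i. i \<in> I \<Longrightarrow> A i \<in> sets borel" and S: "S \<in> sets borel" "S \<subseteq> (\<Union>i\<in>I. A i)"
    and f: "set_integrable lborel S f" "\<And>i. i \<in> I \<Longrightarrow> set_integrable lborel (A i) f" and nn: "\<And>x. f x \<ge> 0"
  shows "(LINT x:S|lborel. f x) \<le> (\<Sum>i\<in>I. LINT x:A i|lborel. f x)"
proof -
  have "(LINT x|lborel. indicat_real S x *\<^sub>R f x) \<le> (LINT x|lborel. (\<Sum>i\<in>I. indicat_real (A i) x *\<^sub>R f x))"
  proof (rule integral_mono)
    show "integrable lborel (\<lambda>x. indicat_real S x *\<^sub>R f x)" using f(1) unfolding set_integrable_def .
    show "integrable lborel (\<lambda>x. \<Sum>i\<in>I. indicat_real (A i) x *\<^sub>R f x)"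
      using f(2) unfolding set_integrable_def by (intro Bochner_Integration.integrable_sum)
    fix x
    show "indicat_real S x *\<^sub>R f x \<le> (\<Sum>i\<in>I. indicat_real (A i) x *\<^sub>R f x)"
    proof (cases "x \<in> S")
      case True
      then obtain i where i: "i \<in> I" "x \<in> A i" using S(2) by blast
      have "indicat_real (A i) x *\<^sub>R f x \<le> (\<Sum>i\<in>I. indicat_real (A i) x *\<^sub>R f x)"
        by (rule member_le_sum[OF i(1)]) (use nn fin in auto)
      then show ?thesis using True i by simp
    next
      case False
      then show ?thesis using nn by (simp add: sum_nonneg)
    qed
  qed
  also have "\<dots> = (\<Sum>i\<in>I. LINT x|lborel. indicat_real (A i) x *\<^sub>R f x)"
    using f(2) unfolding set_integrable_def by (intro Bochner_Integration.integral_sum)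
  finally show ?thesis unfolding set_lebesgue_integral_def .
qed

locale helmholtz =
  fixes P :: helmholtz_data and \<kappa> :: real
  assumes setting: "helmholtz_setting \<kappa> P" and k_pos: "0 < wavenumber P"
begin

lemma coarse_mesh: "mesh P (mesh_H P)"
  by unfold_locales (use setting in \<open>simp_all add: helmholtz_setting_def\<close>)

lemma fine_mesh: "mesh P (mesh_h P)"
  by unfold_locales (use setting in \<open>simp_all add: helmholtz_setting_def\<close>)

end

sublocale helmholtz \<subseteq> coarse: mesh P "mesh_H P"
  by (rule coarse_mesh)

sublocale helmholtz \<subseteq> fine: mesh P "mesh_h P"
  by (rule fine_mesh)

context helmholtz
begin

lemmas V_H_subspace = coarse.P1_subspace[folded V_H_def]
lemmas V_h_subspace = fine.P1_subspace[folded V_h_def]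
lemmas V_H_fin_dim = coarse.P1_fin_dim[folded V_H_def]
lemmas V_h_fin_dim = fine.P1_fin_dim[folded V_h_def]
lemmas V_H_conj = coarse.P1_conj[folded V_H_def]
lemmas V_h_conj = fine.P1_conj[folded V_h_def]
lemmas V_h_subset_V_space = fine.P1_subset_V_space[folded V_h_def]

lemma V_H_subset_V_h: "V_H P \<subseteq> V_h P"
  unfolding V_H_def V_h_def by (rule P1_space_refines) (use setting in \<open>simp add: helmholtz_setting_def\<close>)

lemma V_h_L2: "v \<in> V_h P \<Longrightarrow> L2_on (Omega P) v"
  unfolding V_h_def by (rule fine.P1_L2)

lemma affine_fun_L2: "affine_fun q \<Longrightarrow> L2_on (Omega P) q"
  by (rule L2_on_continuous[OF coarse.bounded_Omega coarse.open_Omega affine_fun_continuous])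

lemma triangle_borel: "T \<in> mesh_H P \<Longrightarrow> T \<in> sets borel"
  by (rule coarse.triangle_sets)

lemma ip_L2_zero_on_element:
  assumes T: "T \<in> mesh_H P" and v: "continuous_on (closure (Omega P)) v" and zero: "ip_L2 P T v v = 0"
  shows "\<And>x. x \<in> interior T \<inter> Omega P \<Longrightarrow> v x = 0"
proof -
  fix x assume x: "x \<in> interior T \<inter> Omega P"
  have int0: "(LINT x:Omega P \<inter> T|lborel. (cmod (v x))\<^sup>2) = 0"
    using zero unfolding ip_L2_self by simp
  have sets: "Omega P \<inter> T \<in> sets lborel" using triangle_borel[OF T] coarse.Omega_borel by simp
  have "L2_on (Omega P) v" by (rule L2_on_continuous[OF coarse.bounded_Omega coarse.open_Omega v])
  then have "set_integrable lborel (Omega P) (\<lambda>x. (cmod (v x))\<^sup>2)" unfolding L2_on_def by (rule conjunct2)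
  then have int: "set_integrable lborel (Omega P \<inter> T) (\<lambda>x. (cmod (v x))\<^sup>2)"
    by (rule set_integrable_subset[OF _ sets Int_lower1])
  have sub: "interior T \<inter> Omega P \<subseteq> Omega P \<inter> T" using interior_subset by blast
  have "interior T \<inter> Omega P \<subseteq> closure (Omega P)" using closure_subset by blast
  then have cont: "continuous_on (interior T \<inter> Omega P) (\<lambda>x. (cmod (v x))\<^sup>2)"
    by (intro continuous_intros continuous_on_subset[OF v])
  have op: "open (interior T \<inter> Omega P)" by (intro open_Int open_interior coarse.open_Omega)
  have "(cmod (v x))\<^sup>2 = 0"
    by (rule continuous_nonneg_integral_eq_0[OF sets op sub cont int _ int0 x]) simp
  then show "v x = 0" by simp
qed

text \<open>
  The inner product over an element is definite on affine functions, because the element contains an open part of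
  the domain.
\<close>

lemma affine_L2_projection:
  assumes T: "T \<in> mesh_H P" and v: "L2_on (Omega P) v"
  shows "\<exists>!q. affine_fun q \<and> (\<forall>p. affine_fun p \<longrightarrow> ip_L2 P T q p = ip_L2 P T v p)"
proof -
  let ?A = "{p. affine_fun p}"
  note TB = triangle_borel[OF T]
  have "\<exists>!q. q \<in> ?A \<and> (\<forall>p\<in>?A. ip_L2 P T q p = ip_L2 P T v p)"
  proof (rule definite_solvable[OF affine_fun_fin_dim])
    show "sesquilinear_on ?A (ip_L2 P T)"
    proof (rule sesquilinear_of_hermitian)
      show "ip_L2 P T (p + q) r = ip_L2 P T p r + ip_L2 P T q r" if "p \<in> ?A" "q \<in> ?A" "r \<in> ?A" for p q r
        by (rule coarse.ip_L2_add) (use that TB affine_fun_L2 in auto)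
    qed (rule ip_L2_scale, rule ip_L2_hermitian)
    show "q = 0" if q: "q \<in> ?A" and zero: "ip_L2 P T q q = 0" for q
    proof (rule affine_fun_zero_on_open)
      show "affine_fun q" using q by simp
      show "open (interior T \<inter> Omega P)" by (intro open_Int open_interior coarse.open_Omega)
      show "interior T \<inter> Omega P \<noteq> {}" by (rule coarse.element_interior[OF T])
      show "q x = 0" if "x \<in> interior T \<inter> Omega P" for x
        by (rule ip_L2_zero_on_element[OF T affine_fun_continuous zero that]) (use q in simp)
    qed
    show "antilinear_form_on ?A (ip_L2 P T v)"
      unfolding antilinear_form_on_def
    proof (intro conjI ballI allI)
      fix p q assume pq: "p \<in> ?A" "q \<in> ?A"
      have "ip_L2 P T v (p + q) = cnj (ip_L2 P T (p + q) v)" by (rule ip_L2_hermitian)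
      also have "\<dots> = cnj (ip_L2 P T p v) + cnj (ip_L2 P T q v)"
        using coarse.ip_L2_add[of p q v T] pq TB v affine_fun_L2 by simp
      also have "\<dots> = ip_L2 P T v p + ip_L2 P T v q" by (simp flip: ip_L2_hermitian)
      finally show "ip_L2 P T v (p + q) = ip_L2 P T v p + ip_L2 P T v q" .
    next
      fix c p
      have "ip_L2 P T v (fscale c p) = cnj (ip_L2 P T (fscale c p) v)" by (rule ip_L2_hermitian)
      also have "\<dots> = cnj c * cnj (ip_L2 P T p v)" by (simp add: ip_L2_scale)
      also have "\<dots> = cnj c * ip_L2 P T v p" by (simp flip: ip_L2_hermitian)
      finally show "ip_L2 P T v (fscale c p) = cnj c * ip_L2 P T v p" .
    qed
  qed
  then show ?thesis by simp
qed

lemma dg_proj_characterization: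
  assumes T: "T \<in> mesh_H P" and v: "L2_on (Omega P) v"
  shows "dg_proj P v T = (THE q. affine_fun q \<and> (\<forall>p. affine_fun p \<longrightarrow> ip_L2 P T q p = ip_L2 P T v p))"
proof -
  have "(LINT x:Omega P \<inter> T|lborel. (v x - q x) * cnj (p x)) = 0 \<longleftrightarrow> ip_L2 P T q p = ip_L2 P T v p"
    if "affine_fun q" "affine_fun p" for p q
    unfolding ip_L2_def
    using set_integral_diff(2)[OF coarse.ip_L2_integrable[OF v affine_fun_L2[OF that(2)] triangle_borel[OF T]]
        coarse.ip_L2_integrable[OF affine_fun_L2[OF that(1)] affine_fun_L2[OF that(2)] triangle_borel[OF T]]]
    by (auto simp: left_diff_distrib)
  then have "(affine_fun q \<and> (\<forall>p. affine_fun p \<longrightarrow> (LINT x:Omega P \<inter> T|lborel. (v x - q x) * cnj (p x)) = 0))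
      = (affine_fun q \<and> (\<forall>p. affine_fun p \<longrightarrow> ip_L2 P T q p = ip_L2 P T v p))" for q by meson
  then show ?thesis unfolding dg_proj_def by simp
qed

lemma dg_proj_affine:
  assumes T: "T \<in> mesh_H P" and v: "L2_on (Omega P) v"
  shows "affine_fun (dg_proj P v T)" "affine_fun p \<Longrightarrow> ip_L2 P T (dg_proj P v T) p = ip_L2 P T v p"
proof -
  note proj = theI'[OF affine_L2_projection[OF assms], folded dg_proj_characterization[OF assms]]
  show "affine_fun (dg_proj P v T)" by (rule conjunct1[OF proj])
  show "affine_fun p \<Longrightarrow> ip_L2 P T (dg_proj P v T) p = ip_L2 P T v p"
    by (rule mp[OF proj[THEN conjunct2, THEN spec]])
qed

lemma dg_proj_eqI:
  assumes T: "T \<in> mesh_H P" and v: "L2_on (Omega P) v"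
    and q: "affine_fun q" "\<And>p. affine_fun p \<Longrightarrow> ip_L2 P T q p = ip_L2 P T v p"
  shows "dg_proj P v T = q"
  unfolding dg_proj_characterization[OF T v]
  by (rule the1_equality[OF affine_L2_projection[OF T v]]) (use q in simp)

lemma dg_proj_add:
  assumes T: "T \<in> mesh_H P" and v: "L2_on (Omega P) v" and w: "L2_on (Omega P) w"
  shows "dg_proj P (v + w) T = dg_proj P v T + dg_proj P w T"
proof (rule dg_proj_eqI[OF T L2_on_add[OF v w]])
  note a = dg_proj_affine[OF T v] dg_proj_affine[OF T w]
  show "affine_fun (dg_proj P v T + dg_proj P w T)" using a affine_fun_add by simp
  fix p assume p: "affine_fun p"
  show "ip_L2 P T (dg_proj P v T + dg_proj P w T) p = ip_L2 P T (v + w) p"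
    using coarse.ip_L2_add[OF v w affine_fun_L2[OF p] triangle_borel[OF T]]
      coarse.ip_L2_add[OF affine_fun_L2[OF a(1)] affine_fun_L2[OF a(3)] affine_fun_L2[OF p] triangle_borel[OF T]]
      a(2,4)[OF p] by simp
qed

lemma dg_proj_scale:
  assumes T: "T \<in> mesh_H P" and v: "L2_on (Omega P) v"
  shows "dg_proj P (fscale c v) T = fscale c (dg_proj P v T)"
  by (rule dg_proj_eqI[OF T L2_on_scale[OF v]])
    (simp_all add: affine_fun_scale dg_proj_affine[OF T v] ip_L2_scale)

lemma dg_proj_conj:
  assumes T: "T \<in> mesh_H P" and v: "L2_on (Omega P) v"
  shows "dg_proj P (conj_fun v) T = conj_fun (dg_proj P v T)"
proof (rule dg_proj_eqI[OF T L2_on_conj[OF v]])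
  show "affine_fun (conj_fun (dg_proj P v T))" by (intro affine_fun_conj dg_proj_affine[OF T v])
  fix p assume p: "affine_fun p"
  have swap: "ip_L2 P T (conj_fun w) p = cnj (ip_L2 P T w (conj_fun p))" for w
  proof -
    have "ip_L2 P T (conj_fun w) p = ip_L2 P T (conj_fun w) (conj_fun (conj_fun p))" by simp
    also have "\<dots> = ip_L2 P T (conj_fun p) w" by (rule ip_L2_conj)
    also have "\<dots> = cnj (ip_L2 P T w (conj_fun p))" by (rule ip_L2_hermitian)
    finally show ?thesis .
  qed
  show "ip_L2 P T (conj_fun (dg_proj P v T)) p = ip_L2 P T (conj_fun v) p"
    unfolding swap dg_proj_affine(2)[OF T v affine_fun_conj[OF p]] ..
qed

lemma dg_proj_coarse:
  assumes T: "T \<in> mesh_H P" and v: "v \<in> V_H P" and x: "x \<in> T"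
  shows "dg_proj P v T x = v x"
proof -
  note v' = v[unfolded V_H_def]
  have "dg_proj P v T = coarse.piece v T"
  proof (rule dg_proj_eqI[OF T coarse.P1_L2[OF v'] coarse.piece(1)[OF v' T]])
    fix p
    show "ip_L2 P T (coarse.piece v T) p = ip_L2 P T v p"
      unfolding ip_L2_def set_lebesgue_integral_def
      by (intro Bochner_Integration.integral_cong) (auto simp: indicator_def coarse.piece(2)[OF v' T])
  qed
  then show ?thesis using coarse.piece(2)[OF v' T x] by simp
qed

definition nodal_average :: "(pt set \<Rightarrow> cfun) \<Rightarrow> pt \<Rightarrow> complex" where
  "nodal_average q z = (if z \<in> closure (boundary_part (sidesD P)) then 0
     else (\<Sum>T\<in>{T \<in> mesh_H P. z \<in> T}. q T z * of_real (measure lborel T)) /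
          of_real (\<Sum>T\<in>{T \<in> mesh_H P. z \<in> T}. measure lborel T))"

lemma averaging_ex1: "\<exists>!v. v \<in> V_H P \<and> (\<forall>z\<in>coarse_vertices P. v z = nodal_average q z)"
proof (rule ex_ex1I)
  have "\<exists>v\<in>P1_space P (mesh_H P). \<forall>z\<in>mesh_vertices (mesh_H P). v z = nodal_average q z"
    by (rule coarse.nodal_interpolant) (simp add: nodal_average_def dirichlet_def)
  then show "\<exists>v. v \<in> V_H P \<and> (\<forall>z\<in>coarse_vertices P. v z = nodal_average q z)"
    unfolding V_H_def coarse_vertices_eq by metis
next
  fix v w assume "v \<in> V_H P \<and> (\<forall>z\<in>coarse_vertices P. v z = nodal_average q z)"
    "w \<in> V_H P \<and> (\<forall>z\<in>coarse_vertices P. w z = nodal_average q z)"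
  then show "v = w" unfolding V_H_def coarse_vertices_eq by (intro coarse.P1_eqI) simp_all
qed

lemma averaging_eq: "averaging P q = (THE v. v \<in> V_H P \<and> (\<forall>z\<in>coarse_vertices P. v z = nodal_average q z))"
  unfolding averaging_def nodal_average_def ..

lemma averaging_in: "averaging P q \<in> V_H P"
  and averaging_nodal: "z \<in> coarse_vertices P \<Longrightarrow> averaging P q z = nodal_average q z"
  using theI'[OF averaging_ex1[of q]] unfolding averaging_eq by simp_all

lemma averaging_eqI:
  assumes "v \<in> V_H P" "\<And>z. z \<in> coarse_vertices P \<Longrightarrow> v z = nodal_average q z"
  shows "averaging P q = v"
  unfolding averaging_eq by (rule the1_equality[OF averaging_ex1]) (use assms in simp)

lemma I_H_in: "I_H P v \<in> V_H P"
  unfolding I_H_def by (rule averaging_in)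

lemma I_H_add:
  assumes v: "v \<in> V_h P" and w: "w \<in> V_h P"
  shows "I_H P (v + w) = I_H P v + I_H P w"
proof -
  have "nodal_average (dg_proj P (v + w)) z = nodal_average (dg_proj P v) z + nodal_average (dg_proj P w) z" for z
    unfolding nodal_average_def
    by (simp add: dg_proj_add[OF _ V_h_L2[OF v] V_h_L2[OF w]] distrib_right sum.distrib add_divide_distrib)
  then show ?thesis unfolding I_H_def
    by (intro averaging_eqI cvs.subspace_add[OF V_H_subspace] averaging_in) (simp add: averaging_nodal)
qed

lemma I_H_scale:
  assumes v: "v \<in> V_h P"
  shows "I_H P (fscale c v) = fscale c (I_H P v)"
proof -
  have "nodal_average (dg_proj P (fscale c v)) z = c * nodal_average (dg_proj P v) z" for z
    unfolding nodal_average_def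
    by (simp add: dg_proj_scale[OF _ V_h_L2[OF v]] mult.assoc sum_distrib_left)
  then show ?thesis unfolding I_H_def
    by (intro averaging_eqI cvs.subspace_scale[OF V_H_subspace] averaging_in) (simp add: averaging_nodal)
qed

lemma I_H_conj:
  assumes v: "v \<in> V_h P"
  shows "I_H P (conj_fun v) = conj_fun (I_H P v)"
proof -
  have "nodal_average (dg_proj P (conj_fun v)) z = cnj (nodal_average (dg_proj P v) z)" for z
    unfolding nodal_average_def by (simp add: dg_proj_conj[OF _ V_h_L2[OF v]] cnj_sum)
  then show ?thesis unfolding I_H_def
    by (intro averaging_eqI V_H_conj averaging_in) (simp add: averaging_nodal)
qed

text \<open>
  The elementwise projection reproduces a coarse function, so at each vertex the averaged values coincide. The weights
  have a positive sum since triangles have positive area.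
\<close>

lemma I_H_projection:
  assumes v: "v \<in> V_H P"
  shows "I_H P v = v"
  unfolding I_H_def
proof (rule averaging_eqI[OF v])
  fix z assume z: "z \<in> coarse_vertices P"
  show "v z = nodal_average (dg_proj P v) z"
  proof (cases "z \<in> closure (boundary_part (sidesD P))")
    case True
    then show ?thesis using coarse.P1_dirichlet[OF v[unfolded V_H_def], of z]
      by (simp add: nodal_average_def dirichlet_def)
  next
    case False
    let ?N = "{T \<in> mesh_H P. z \<in> T}"
    obtain T where T: "T \<in> mesh_H P" "z extreme_point_of T" using z unfolding coarse_vertices_def by blast
    then have "T \<in> ?N" by (simp add: extreme_point_of_def)
    have pos: "0 < (\<Sum>T\<in>?N. measure lborel T)"
    proof (rule sum_pos)
      show "0 < measure lborel T" if "T \<in> ?N" for T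
        using triangle_measure_pos[OF coarse.triangle] that by simp
    qed (use coarse.finite_mesh \<open>T \<in> ?N\<close> in auto)
    have "(\<Sum>T\<in>?N. dg_proj P v T z * of_real (measure lborel T)) = (\<Sum>T\<in>?N. v z * of_real (measure lborel T))"
      by (intro sum.cong refl) (simp add: dg_proj_coarse[OF _ v])
    also have "\<dots> = v z * of_real (\<Sum>T\<in>?N. measure lborel T)" by (simp add: sum_distrib_left)
    finally show ?thesis using False pos unfolding nodal_average_def by (simp del: of_real_sum)
  qed
qed

lemma W_h_iff: "w \<in> W_h P \<longleftrightarrow> w \<in> V_h P \<and> I_H P w = 0"
  unfolding W_h_def ker_I_def using V_h_subset_V_space by auto

lemma W_h_subset: "W_h P \<subseteq> V_h P"
  unfolding W_h_def by simp

lemma I_H_zero [simp]: "I_H P 0 = 0"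
  by (rule I_H_projection[OF cvs.subspace_0[OF V_H_subspace]])

lemma W_h_subspace: "cvs.subspace (W_h P)"
  unfolding cvs.subspace_def
proof (intro conjI ballI allI)
  show "0 \<in> W_h P" unfolding W_h_iff using cvs.subspace_0[OF V_h_subspace] by simp
  show "v + w \<in> W_h P" if "v \<in> W_h P" "w \<in> W_h P" for v w
    using that I_H_add cvs.subspace_add[OF V_h_subspace] unfolding W_h_iff by simp
  show "fscale c v \<in> W_h P" if "v \<in> W_h P" for c v
    using that I_H_scale cvs.subspace_scale[OF V_h_subspace] cvs.scale_zero_right unfolding W_h_iff by simp
qed

lemma W_h_conj: "w \<in> W_h P \<Longrightarrow> conj_fun w \<in> W_h P"
  unfolding W_h_iff using I_H_conj V_h_conj by simp

lemma I_H_diff: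
  assumes "v \<in> V_h P" "w \<in> V_h P"
  shows "I_H P (v - w) = I_H P v - I_H P w"
proof -
  have "fscale (- 1) w \<in> V_h P" using cvs.subspace_scale[OF V_h_subspace assms(2)] .
  from I_H_add[OF assms(1) this] I_H_scale[OF assms(2), of "- 1"] show ?thesis
    unfolding fscale_neg1 by simp
qed

section \<open>Coercivity on the kernel\<close>

text \<open>
  Each element occurs in at most as many first-order patches as it has neighbours, so the local
  approximation estimates add up to \<open>k \<parallel>w\<parallel> \<le> \<chi> \<parallel>\<nabla>w\<parallel>\<close>; the Robin term is imaginary on the diagonal.
\<close>

lemma kernel_coercive:
  assumes app: "approximation_constant P Capp" and w: "w \<in> ker_I P"
  shows "Re (aform P w w) \<ge> c_W P Capp * (norm_k P w)\<^sup>2"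
proof -
  let ?M = "mesh_H P" and ?k = "wavenumber P"
  define A where "A = (\<lambda>S. Re (ip_grad P S w w))"
  define B where "B = (\<lambda>S. Re (ip_L2 P S w w))"
  define m where "m = Max ((\<lambda>T. ?k * diameter T) ` ?M)"
  define \<theta> where "\<theta> = chi_res P Capp"
  define C where "C = real (C_patch P 1)"
  have wV: "w \<in> V_space P" "I_H P w = 0" using w by (auto simp: ker_I_def)
  have wH: "w \<in> H1 (Omega P)" using wV by (simp add: V_space_def)
  have Capp: "0 \<le> Capp" using app by (simp add: approximation_constant_def)
  have nnA: "A S \<ge> 0" and nnB: "B S \<ge> 0" for S
    unfolding A_def B_def by (rule ip_grad_nonneg(1), rule ip_L2_nonneg(1))
  have fin: "finite ?M" by (rule coarse.finite_mesh)
  define N where "N = (\<lambda>T. {K \<in> ?M. K \<inter> T \<noteq> {}})"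
  have cl: "closure T = T" if "T \<in> ?M" for T
    using triangle_compact[OF coarse.triangle[OF that]] by (simp add: compact_imp_closed)
  have patch1: "patch P 1 T = \<Union>(N T)" if "T \<in> ?M" for T
    unfolding patch_def layer_def N_def using cl that by auto
  have diam: "0 < diameter T" if T: "T \<in> ?M" for T
  proof -
    obtain x r where r: "0 < r" "cball x r \<subseteq> T"
      using setting T unfolding helmholtz_setting_def shape_regular_def by meson
    have "diameter (cball x r) \<le> diameter T"
      by (rule diameter_subset[OF r(2)]) (use triangle_compact[OF coarse.triangle[OF T]] compact_imp_bounded in blast)
    then show ?thesis using r(1) by (simp add: diameter_cball)
  qed
  have loc: "?k\<^sup>2 * B T \<le> Capp\<^sup>2 * m\<^sup>2 * A (patch P 1 T)" if T: "T \<in> ?M" for T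
  proof -
    have "norm_L2 P T (w - I_H P w) / diameter T \<le> Capp * norm_grad P (patch P 1 T) w"
      using app wV(1) T unfolding approximation_constant_def by blast
    then have "sqrt (B T) / diameter T \<le> Capp * sqrt (A (patch P 1 T))"
      unfolding norm_L2_def norm_grad_def A_def B_def wV(2) by simp
    from quotient_integral_le[OF this diam[OF T] Capp nnB nnA]
    have "B T \<le> Capp\<^sup>2 * (diameter T)\<^sup>2 * A (patch P 1 T)" .
    then have "?k\<^sup>2 * B T \<le> ?k\<^sup>2 * (Capp\<^sup>2 * (diameter T)\<^sup>2 * A (patch P 1 T))" by (intro mult_left_mono) auto
    also have "\<dots> = (?k * diameter T)\<^sup>2 * (Capp\<^sup>2 * A (patch P 1 T))" by (simp add: power_mult_distrib mult_ac)
    also have "\<dots> \<le> m\<^sup>2 * (Capp\<^sup>2 * A (patch P 1 T))"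
    proof (intro mult_right_mono power_mono)
      show "?k * diameter T \<le> m" unfolding m_def using fin T by (intro Max_ge) auto
      show "0 \<le> ?k * diameter T" using k_pos diam[OF T] by simp
      show "0 \<le> Capp\<^sup>2 * A (patch P 1 T)" using nnA by simp
    qed
    finally show ?thesis by (simp add: mult_ac)
  qed
  let ?f = "\<lambda>x. \<Sum>i\<in>UNIV. (cmod (grad P w x $ i))\<^sup>2"
  have fint: "set_integrable lborel (Omega P \<inter> S) ?f" if S: "S \<in> sets borel" for S
  proof -
    have "set_integrable lborel (Omega P \<inter> S) (\<lambda>x. Re (\<Sum>i\<in>UNIV. grad P w x $ i * cnj (grad P w x $ i)))"
      by (rule set_integral_Re(1)[OF coarse.ip_grad_integrable[OF wH wH S]])
    moreover have "Re (\<Sum>i\<in>UNIV. grad P w x $ i * cnj (grad P w x $ i)) = ?f x" for x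
      by (simp add: complex_norm_square[symmetric] flip: of_real_power)
    ultimately show ?thesis by simp
  qed
  have A_eq: "A S = (LINT x:Omega P \<inter> S|lborel. ?f x)" for S
    unfolding A_def ip_grad_self by simp
  have A_patch: "A (patch P 1 T) \<le> (\<Sum>K\<in>N T. A K)" if T: "T \<in> ?M" for T
    unfolding A_eq patch1[OF T]
  proof (rule set_integral_subset_UN_le)
    have Nb: "K \<in> sets borel" if "K \<in> N T" for K using that triangle_borel by (simp add: N_def)
    show "finite (N T)" using fin by (simp add: N_def)
    then have U: "\<Union>(N T) \<in> sets borel" using Nb by (intro sets.finite_Union) auto
    then show "Omega P \<inter> \<Union>(N T) \<in> sets borel" using coarse.Omega_borel by simp
    show "set_integrable lborel (Omega P \<inter> \<Union>(N T)) ?f" by (rule fint[OF U])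
    show "Omega P \<inter> K \<in> sets borel" "set_integrable lborel (Omega P \<inter> K) ?f" if "K \<in> N T" for K
      using Nb[OF that] fint coarse.Omega_borel by auto
  qed (auto simp: sum_nonneg)
  have sumA: "(\<Sum>K\<in>?M. A K) = A UNIV"
    unfolding A_eq using coarse.integral_over_elements[OF fint[of UNIV, simplified]] by simp
  have sumB: "(\<Sum>K\<in>?M. B K) = B UNIV"
  proof -
    have "(\<Sum>K\<in>?M. ip_L2 P K w w) = ip_L2 P UNIV w w"
      unfolding ip_L2_def using coarse.integral_over_elements[OF L2_on_mult[OF H1_L2[OF wH] H1_L2[OF wH]]] by simp
    then show ?thesis unfolding B_def by (metis Re_sum)
  qed
  have overlap: "real (card {T \<in> ?M. K \<in> N T}) \<le> C" if K: "K \<in> ?M" for K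
  proof -
    have "{T \<in> ?M. K \<in> N T} \<subseteq> {T \<in> ?M. T \<subseteq> patch P 1 K}"
      unfolding patch1[OF K] N_def using K by blast
    then have "card {T \<in> ?M. K \<in> N T} \<le> card {T \<in> ?M. T \<subseteq> patch P 1 K}"
      using fin by (intro card_mono) auto
    also have "\<dots> \<le> C_patch P 1" unfolding C_patch_def using fin K by (intro Max_ge) auto
    finally show ?thesis unfolding C_def by simp
  qed
  have "(\<Sum>T\<in>?M. A (patch P 1 T)) \<le> (\<Sum>T\<in>?M. \<Sum>K\<in>N T. A K)" by (intro sum_mono A_patch)
  also have "\<dots> = (\<Sum>K\<in>?M. \<Sum>T\<in>{T \<in> ?M. K \<in> N T}. A K)"
    using sum.swap_restrict[OF fin fin, of "\<lambda>T K. A K" "\<lambda>T K. K \<inter> T \<noteq> {}"] by (simp add: N_def cong: conj_cong)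
  also have "\<dots> = (\<Sum>K\<in>?M. real (card {T \<in> ?M. K \<in> N T}) * A K)" by simp
  also have "\<dots> \<le> (\<Sum>K\<in>?M. C * A K)" by (intro sum_mono mult_right_mono overlap nnA)
  also have "\<dots> = C * A UNIV" by (simp add: sum_distrib_left[symmetric] sumA)
  finally have patches: "(\<Sum>T\<in>?M. A (patch P 1 T)) \<le> C * A UNIV" .
  have "?k\<^sup>2 * B UNIV = (\<Sum>T\<in>?M. ?k\<^sup>2 * B T)" by (simp add: sumB[symmetric] sum_distrib_left)
  also have "\<dots> \<le> (\<Sum>T\<in>?M. Capp\<^sup>2 * m\<^sup>2 * A (patch P 1 T))" by (intro sum_mono loc)
  also have "\<dots> = Capp\<^sup>2 * m\<^sup>2 * (\<Sum>T\<in>?M. A (patch P 1 T))" by (simp add: sum_distrib_left)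
  also have "\<dots> \<le> Capp\<^sup>2 * m\<^sup>2 * (C * A UNIV)" by (intro mult_left_mono patches) simp
  also have "\<dots> = \<theta>\<^sup>2 * A UNIV"
    unfolding \<theta>_def chi_res_def m_def[symmetric] C_def by (simp add: power_mult_distrib mult_ac)
  finally have key: "?k\<^sup>2 * B UNIV \<le> \<theta>\<^sup>2 * A UNIV" .
  have "Re (aform P w w) = A UNIV - ?k\<^sup>2 * B UNIV"
    unfolding aform_def aform_on_def A_def B_def by (simp add: ip_robin_real)
  moreover have "(norm_k P w)\<^sup>2 = A UNIV + ?k\<^sup>2 * B UNIV"
  proof -
    have "(norm_k P w)\<^sup>2 = Re (bform P w w)" by (simp add: bform_self)
    then show ?thesis unfolding bform_def A_def B_def by simp
  qed
  moreover have "(1 - \<theta>\<^sup>2) / (1 + \<theta>\<^sup>2) * (A UNIV + ?k\<^sup>2 * B UNIV) \<le> A UNIV - ?k\<^sup>2 * B UNIV"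
  proof -
    have pos: "0 < 1 + \<theta>\<^sup>2" by (simp add: add_pos_nonneg)
    have "(1 - \<theta>\<^sup>2) * (A UNIV + ?k\<^sup>2 * B UNIV) \<le> (A UNIV - ?k\<^sup>2 * B UNIV) * (1 + \<theta>\<^sup>2)"
      using key by (simp add: algebra_simps)
    then show ?thesis using pos by (simp add: pos_divide_le_eq)
  qed
  ultimately show ?thesis unfolding c_W_def \<theta>_def by simp
qed

section \<open>The energy norm on the fine space\<close>

lemmas aform_sesq = fine.aform_sesquilinear[folded V_h_def]
lemmas bform_sesq = fine.bform_sesquilinear[folded V_h_def]
lemmas aform_on_sesq = fine.aform_on_sesquilinear[folded V_h_def]
lemmas bform_conj = fine.bform_conj[folded V_h_def]
lemmas aform_on_conj = fine.aform_on_conj[folded V_h_def]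
lemmas V_h_add = cvs.subspace_add[OF V_h_subspace]
lemmas V_h_diff = cvs.subspace_diff[OF V_h_subspace]
lemmas V_h_scale = cvs.subspace_scale[OF V_h_subspace]
lemmas V_h_zero = cvs.subspace_0[OF V_h_subspace]
lemmas W_h_add = cvs.subspace_add[OF W_h_subspace]
lemmas W_h_diff = cvs.subspace_diff[OF W_h_subspace]
lemmas W_h_scale = cvs.subspace_scale[OF W_h_subspace]
lemmas a_add_left = sesq_add_left[OF aform_sesq]
lemmas a_add_right = sesq_add_right[OF aform_sesq]
lemmas a_diff_left = sesq_diff_left[OF aform_sesq V_h_subspace]
lemmas a_diff_right = sesq_diff_right[OF aform_sesq V_h_subspace]
lemmas a_scale_left = sesq_scale_left[OF aform_sesq]
lemmas a_scale_right = sesq_scale_right[OF aform_sesq]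

lemma W_V: "w \<in> W_h P \<Longrightarrow> w \<in> V_h P"
  using W_h_subset by (rule subsetD)

lemma H_V: "v \<in> V_H P \<Longrightarrow> v \<in> V_h P"
  using V_H_subset_V_h by (rule subsetD)

lemma aform_conj:
  assumes "v \<in> V_h P" "w \<in> V_h P"
  shows "aform P (conj_fun v) (conj_fun w) = aform P w v"
  unfolding aform_def by (rule aform_on_conj[OF assms closed_UNIV])

lemma bform_hermitian: "bform P w v = cnj (bform P v w)"
  unfolding bform_def using ip_grad_hermitian[of P UNIV w v] ip_L2_hermitian[of P UNIV w v] by simp

lemma norm_k_definite: "v \<in> V_h P \<Longrightarrow> norm_k P v = 0 \<Longrightarrow> v = 0"
  unfolding V_h_def by (rule fine.P1_definite[OF _ k_pos])

lemma norm_k_pos: "v \<in> V_h P \<Longrightarrow> v \<noteq> 0 \<Longrightarrow> 0 < norm_k P v"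
  using norm_k_definite[of v] norm_k_nonneg[of P v] by (metis less_eq_real_def)

lemma norm_k_conj: "v \<in> V_h P \<Longrightarrow> norm_k P (conj_fun v) = norm_k P v"
  unfolding norm_k_def using bform_conj[of v v] by simp

lemma norm_k_scale:
  assumes "v \<in> V_h P"
  shows "norm_k P (fscale c v) = cmod c * norm_k P v"
proof -
  have "bform P (fscale c v) (fscale c v) = c * cnj c * bform P v v"
    using sesq_scale_left[OF bform_sesq assms V_h_scale[OF assms], of c c] sesq_scale_right[OF bform_sesq assms assms, of c] by simp
  also have "\<dots> = of_real ((cmod c)\<^sup>2 * (norm_k P v)\<^sup>2)" by (simp add: bform_self complex_norm_square[symmetric])
  finally have "(norm_k P (fscale c v))\<^sup>2 = (cmod c * norm_k P v)\<^sup>2"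
    unfolding bform_self of_real_eq_iff by (simp add: power_mult_distrib)
  then show ?thesis by (rule power2_eq_imp_eq) (simp_all add: norm_k_nonneg)
qed

lemma norm_k_zero: "norm_k P 0 = 0"
  using norm_k_scale[OF V_h_zero, of 0] by simp

lemma norm_k_minus: "v \<in> V_h P \<Longrightarrow> norm_k P (- v) = norm_k P v"
  using norm_k_scale[of v "- 1"] by (simp add: fscale_neg1)

text \<open>
  The square of the norm of \<open>N v - \<beta> w\<close> with \<open>N = \<parallel>w\<parallel>\<^sup>2\<close> and \<open>\<beta> = b v w\<close> is \<open>N (N \<parallel>v\<parallel>\<^sup>2 - \<bar>\<beta>\<bar>\<^sup>2)\<close>.
\<close>

lemma bform_Cauchy_Schwarz:
  assumes v: "v \<in> V_h P" and w: "w \<in> V_h P"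
  shows "cmod (bform P v w) \<le> norm_k P v * norm_k P w"
proof (cases "w = 0")
  case True
  then show ?thesis using sesq_zero_right[OF bform_sesq v V_h_zero] by (simp add: norm_k_nonneg norm_k_zero)
next
  case False
  define N where "N = (norm_k P w)\<^sup>2"
  have N: "N > 0" using norm_k_pos[OF w False] by (simp add: N_def)
  define \<beta> where "\<beta> = bform P v w"
  let ?x = "fscale (of_real N) v" and ?y = "fscale \<beta> w"
  note mem = V_h_scale[OF v, of "of_real N"] V_h_scale[OF w, of \<beta>]
  have "bform P (?x - ?y) (?x - ?y) = bform P ?x ?x - bform P ?x ?y - bform P ?y ?x + bform P ?y ?y"
    using sesq_diff_left[OF bform_sesq V_h_subspace mem V_h_diff[OF mem]]
      sesq_diff_right[OF bform_sesq V_h_subspace mem mem(1)] sesq_diff_right[OF bform_sesq V_h_subspace mem mem(2)]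
    by simp
  also have "bform P ?x ?x = of_real (N\<^sup>2 * (norm_k P v)\<^sup>2)"
    using norm_k_scale[OF v, of "of_real N"] by (simp add: bform_self power_mult_distrib)
  also have "bform P ?y ?y = of_real ((cmod \<beta>)\<^sup>2 * N)"
    using norm_k_scale[OF w, of \<beta>] by (simp add: bform_self power_mult_distrib N_def)
  also have xy: "bform P ?x ?y = of_real (N * (cmod \<beta>)\<^sup>2)"
  proof -
    have "bform P ?x ?y = of_real N * (cnj \<beta> * \<beta>)"
      using sesq_scale_left[OF bform_sesq v mem(2)] sesq_scale_right[OF bform_sesq v w, of \<beta>] by (simp add: \<beta>_def)
    then show ?thesis unfolding of_real_mult complex_norm_square by (simp add: mult_ac)
  qed
  also have "bform P ?y ?x = of_real (N * (cmod \<beta>)\<^sup>2)"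
    using bform_hermitian[of ?y ?x] xy by simp
  finally have "of_real ((norm_k P (?x - ?y))\<^sup>2) = (of_real (N\<^sup>2 * (norm_k P v)\<^sup>2 - N * (cmod \<beta>)\<^sup>2) :: complex)"
    unfolding bform_self by (simp add: algebra_simps)
  then have "(norm_k P (?x - ?y))\<^sup>2 = N\<^sup>2 * (norm_k P v)\<^sup>2 - N * (cmod \<beta>)\<^sup>2" unfolding of_real_eq_iff .
  then have "N * (cmod \<beta>)\<^sup>2 \<le> N\<^sup>2 * (norm_k P v)\<^sup>2" using zero_le_power2[of "norm_k P (?x - ?y)"] by linarith
  then have "N * (cmod \<beta>)\<^sup>2 \<le> N * (N * (norm_k P v)\<^sup>2)" by (simp add: power2_eq_square mult.assoc)
  then have "(cmod \<beta>)\<^sup>2 \<le> N * (norm_k P v)\<^sup>2" using N by simp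
  then have "(cmod \<beta>)\<^sup>2 \<le> (norm_k P v * norm_k P w)\<^sup>2" by (simp add: N_def power_mult_distrib mult.commute)
  then show ?thesis unfolding \<beta>_def by (rule power2_le_imp_le) (simp add: norm_k_nonneg)
qed

lemma norm_k_triangle:
  assumes v: "v \<in> V_h P" and w: "w \<in> V_h P"
  shows "norm_k P (v + w) \<le> norm_k P v + norm_k P w"
proof -
  have "bform P (v + w) (v + w) = bform P v v + bform P v w + (bform P w v + bform P w w)"
    using sesq_add_left[OF bform_sesq v w V_h_add[OF v w]] sesq_add_right[OF bform_sesq v w v]
      sesq_add_right[OF bform_sesq v w w] by simp
  then have "Re (bform P (v + w) (v + w)) = (norm_k P v)\<^sup>2 + 2 * Re (bform P v w) + (norm_k P w)\<^sup>2"
    using bform_hermitian[of w v] bform_self[of P v] bform_self[of P w] by simp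
  then have "(norm_k P (v + w))\<^sup>2 = (norm_k P v)\<^sup>2 + 2 * Re (bform P v w) + (norm_k P w)\<^sup>2"
    unfolding bform_self by simp
  also have "\<dots> \<le> (norm_k P v)\<^sup>2 + 2 * (norm_k P v * norm_k P w) + (norm_k P w)\<^sup>2"
    using bform_Cauchy_Schwarz[OF v w] complex_Re_le_cmod[of "bform P v w"] by linarith
  also have "\<dots> = (norm_k P v + norm_k P w)\<^sup>2" by (simp add: power2_sum)
  finally show ?thesis by (rule power2_le_imp_le) (simp add: norm_k_nonneg)
qed

lemma norm_k_triangle_diff:
  assumes v: "v \<in> V_h P" and w: "w \<in> V_h P"
  shows "norm_k P (v - w) \<le> norm_k P v + norm_k P w"
  using norm_k_triangle[OF v cvs.subspace_neg[OF V_h_subspace w]] norm_k_minus[OF w] by simp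

lemma norm_k_sum_le:
  assumes "finite A" "\<And>i. i \<in> A \<Longrightarrow> f i \<in> V_h P"
  shows "norm_k P (\<Sum>i\<in>A. f i) \<le> (\<Sum>i\<in>A. norm_k P (f i))"
  using assms
proof (induction A)
  case empty
  show ?case by (simp only: sum.empty norm_k_zero order_refl)
next
  case (insert x A)
  have s: "(\<Sum>i\<in>A. f i) \<in> V_h P" by (rule cvs.subspace_sum[OF V_h_subspace]) (use insert in blast)
  have "norm_k P (\<Sum>i\<in>insert x A. f i) = norm_k P (f x + (\<Sum>i\<in>A. f i))"
    by (subst sum.insert[OF insert.hyps(1,2)]) (rule refl)
  also have "\<dots> \<le> norm_k P (f x) + norm_k P (\<Sum>i\<in>A. f i)" by (rule norm_k_triangle[OF _ s]) (use insert in blast)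
  also have "\<dots> \<le> norm_k P (f x) + (\<Sum>i\<in>A. norm_k P (f i))" using insert by simp
  also have "\<dots> = (\<Sum>i\<in>insert x A. norm_k P (f i))"
    by (subst sum.insert[OF insert.hyps(1,2)]) (rule refl)
  finally show ?case .
qed

lemma bform_solvable:
  assumes S: "fin_dim_subspace S" "S \<subseteq> V_h P" and F: "antilinear_form_on S F"
  shows "\<exists>!x. x \<in> S \<and> (\<forall>y\<in>S. bform P x y = F y)"
proof (rule definite_solvable[OF S(1) sesquilinear_on_subset[OF bform_sesq S(2)] _ F])
  fix v assume "v \<in> S" "bform P v v = 0"
  then show "v = 0" using S(2) norm_k_definite[of v] unfolding bform_self by auto
qed

text \<open>Coordinate functionals have Riesz representatives, so they are bounded.\<close>

lemma linear_map_bounded: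
  assumes S: "fin_dim_subspace S" "S \<subseteq> V_h P" and L: "linear_map_on S L" "\<And>v. v \<in> S \<Longrightarrow> L v \<in> V_h P"
  obtains C where "0 \<le> C" "\<And>v. v \<in> S \<Longrightarrow> norm_k P (L v) \<le> C * norm_k P v"
proof -
  obtain B where B: "finite B" "cvs.independent B" "S = cvs.span B" "card B = cvs.dim S"
    using fin_dim_subspace_basis[OF S(1)] by metis
  have sS: "cvs.subspace S" by (rule fin_dim_subspaceD[OF S(1)])
  have BS: "B \<subseteq> S" unfolding B(3) by (rule cvs.span_superset)
  define rep where "rep = cvs.representation B"
  have "\<exists>g. g \<in> S \<and> (\<forall>y\<in>S. bform P g y = cnj (rep y x))" for x
  proof (rule ex1_implies_ex[OF bform_solvable[OF S]])
    show "antilinear_form_on S (\<lambda>y. cnj (rep y x))"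
      unfolding antilinear_form_on_def rep_def B(3)
      by (simp add: cvs.representation_add[OF B(2)] cvs.representation_scale[OF B(2)])
  qed
  then obtain g where g: "\<And>x. g x \<in> S" "\<And>x y. y \<in> S \<Longrightarrow> bform P (g x) y = cnj (rep y x)" by metis
  define C where "C = (\<Sum>x\<in>B. norm_k P (g x) * norm_k P (L x))"
  have "norm_k P (L v) \<le> C * norm_k P v" if v: "v \<in> S" for v
  proof -
    have "v = (\<Sum>x\<in>B. fscale (rep v x) x)"
      unfolding rep_def by (rule cvs.sum_representation_eq[symmetric, OF B(2) _ B(1) order_refl]) (use v B(3) in simp)
    then have "L v = (\<Sum>x\<in>B. fscale (rep v x) (L x))"
      using linear_map_combination[OF L(1) sS B(1) BS, of "rep v"] by simp
    then have "norm_k P (L v) \<le> (\<Sum>x\<in>B. norm_k P (fscale (rep v x) (L x)))"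
      using norm_k_sum_le[OF B(1), of "\<lambda>x. fscale (rep v x) (L x)"] L(2) BS V_h_scale by (metis subsetD)
    also have "\<dots> = (\<Sum>x\<in>B. cmod (rep v x) * norm_k P (L x))"
      by (intro sum.cong refl norm_k_scale L(2)) (use BS in blast)
    also have "\<dots> \<le> (\<Sum>x\<in>B. (norm_k P (g x) * norm_k P v) * norm_k P (L x))"
    proof (intro sum_mono mult_right_mono norm_k_nonneg)
      fix x
      have "cmod (bform P (g x) v) \<le> norm_k P (g x) * norm_k P v"
        by (rule bform_Cauchy_Schwarz) (use g(1) v S(2) in blast)+
      then show "cmod (rep v x) \<le> norm_k P (g x) * norm_k P v" unfolding g(2)[OF v] by simp
    qed
    also have "\<dots> = C * norm_k P v" unfolding C_def sum_distrib_right by (intro sum.cong) (simp_all add: mult_ac)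
    finally show ?thesis .
  qed
  moreover have "0 \<le> C" unfolding C_def by (intro sum_nonneg mult_nonneg_nonneg norm_k_nonneg)
  ultimately show ?thesis using that by metis
qed

end

section \<open>Correctors\<close>

lemma ereal_divide_pos: "0 < k \<Longrightarrow> ereal g / ereal k = ereal (g / k)"
  by simp

locale helmholtz_stable = helmholtz +
  fixes Ca Capp CI Csd :: real
  assumes Ca: "continuity_constant P Ca" and Capp: "approximation_constant P Capp"
    and CI: "stability_constant P CI" and Csd: "decomposition_constant P Csd"
    and chi: "chi_res P Capp < 1"
begin

abbreviation "cW \<equiv> c_W P Capp"
abbreviation "LW \<equiv> lambda_W P Capp Ca"

lemma Ca_nonneg: "0 \<le> Ca"
  using Ca by (simp add: continuity_constant_def)

lemma aform_bound:
  assumes "v \<in> V_h P" "w \<in> V_h P"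
  shows "cmod (aform P v w) \<le> Ca * norm_k P v * norm_k P w"
proof -
  have "v \<in> V_space P" "w \<in> V_space P" using assms V_h_subset_V_space by (auto dest: subsetD)
  then show ?thesis using Ca unfolding continuity_constant_def by simp
qed

lemma c_W_pos: "0 < cW"
proof -
  obtain T where T: "T \<in> mesh_H P"
  proof -
    have "\<Union>(mesh_H P) \<noteq> {}" using coarse.covers coarse.Omega_nonempty by simp
    then show ?thesis using that by blast
  qed
  have "0 \<le> wavenumber P * diameter T"
    using k_pos diameter_ge_0[OF compact_imp_bounded[OF triangle_compact[OF coarse.triangle[OF T]]]] by simp
  also have "\<dots> \<le> Max ((\<lambda>T. wavenumber P * diameter T) ` mesh_H P)"
    using coarse.finite_mesh T by (intro Max_ge) auto
  finally have "0 \<le> chi_res P Capp"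
    unfolding chi_res_def using Capp by (simp add: approximation_constant_def)
  then have "(chi_res P Capp)\<^sup>2 < 1" using chi by (simp add: power_less_one_iff abs_square_less_1)
  then show ?thesis unfolding c_W_def by (simp add: add_pos_nonneg)
qed

lemma lambda_W_nonneg: "0 \<le> LW"
  unfolding lambda_W_def using Ca_nonneg c_W_pos by simp

lemma W_coercive: "w \<in> W_h P \<Longrightarrow> cW * (norm_k P w)\<^sup>2 \<le> Re (aform P w w)"
  using kernel_coercive[OF Capp, of w] by (simp add: W_h_def)

lemma W_definite: "w \<in> W_h P \<Longrightarrow> aform P w w = 0 \<Longrightarrow> w = 0"
proof -
  assume w: "w \<in> W_h P" "aform P w w = 0"
  have "cW * (norm_k P w)\<^sup>2 \<le> 0" using W_coercive[OF w(1)] w(2) by simp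
  then have "norm_k P w = 0" using c_W_pos by (simp add: mult_le_0_iff)
  then show "w = 0" by (rule norm_k_definite[OF W_V[OF w(1)]])
qed

text \<open>
  The common last step of all a priori estimates for corrector problems.
\<close>

lemma coercive_bound:
  assumes w: "w \<in> W_h P" and le: "cmod (aform P w w) \<le> K * norm_k P w" and K: "0 \<le> K"
  shows "norm_k P w \<le> K / cW"
proof (cases "norm_k P w = 0")
  case True
  then show ?thesis using K c_W_pos by simp
next
  case False
  then have pos: "norm_k P w > 0" using norm_k_nonneg[of P w] by linarith
  have "cW * (norm_k P w)\<^sup>2 \<le> K * norm_k P w"
    using W_coercive[OF w] complex_Re_le_cmod[of "aform P w w"] le by linarith
  then have "cW * norm_k P w \<le> K" using pos by (simp add: power2_eq_square mult.assoc[symmetric])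
  then show ?thesis using c_W_pos by (simp add: pos_le_divide_eq mult.commute)
qed

lemma W_subspace_fin_dim: "cvs.subspace S \<Longrightarrow> S \<subseteq> W_h P \<Longrightarrow> fin_dim_subspace S"
  by (rule fin_dim_subspace_subset[OF V_h_fin_dim]) (use W_h_subset in auto)

lemma primal_ex1:
  assumes S: "cvs.subspace S" "S \<subseteq> W_h P" and f: "antilinear_form_on S f"
  shows "\<exists>!u. u \<in> S \<and> (\<forall>w\<in>S. aform P u w = f w)"
proof (rule definite_solvable[OF W_subspace_fin_dim[OF S] _ _ f])
  show "sesquilinear_on S (aform P)"
    by (rule sesquilinear_on_subset[OF aform_sesq]) (use S(2) W_h_subset in blast)
  show "v = 0" if "v \<in> S" "aform P v v = 0" for v
    using W_definite[OF subsetD[OF S(2)]] that by simp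
qed

lemma adjoint_ex1:
  assumes S: "cvs.subspace S" "S \<subseteq> W_h P" and f: "linear_form_on S f"
  shows "\<exists>!u. u \<in> S \<and> (\<forall>w\<in>S. aform P w u = f w)"
proof (rule definite_solvable_adjoint[OF W_subspace_fin_dim[OF S] _ _ f])
  show "sesquilinear_on S (aform P)"
    by (rule sesquilinear_on_subset[OF aform_sesq]) (use S(2) W_h_subset in blast)
  show "v = 0" if "v \<in> S" "aform P v v = 0" for v
    using W_definite[OF subsetD[OF S(2)]] that by simp
qed

lemma form_restrict:
  assumes "closed A" "v \<in> V_h P" "S \<subseteq> W_h P"
  shows "antilinear_form_on S (aform_on P A v)" "linear_form_on S (\<lambda>w. aform_on P A w v)"
proof -
  have s: "S \<subseteq> V_h P" using assms(3) W_h_subset by (rule subset_trans)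
  show "antilinear_form_on S (aform_on P A v)"
    by (rule antilinear_form_on_subset[OF _ s])
      (use aform_on_sesq[OF assms(1)] assms(2) in \<open>simp add: sesquilinear_on_def\<close>)
  show "linear_form_on S (\<lambda>w. aform_on P A w v)"
    by (rule linear_form_on_subset[OF _ s])
      (use aform_on_sesq[OF assms(1)] assms(2) in \<open>simp add: sesquilinear_on_def\<close>)
qed

text \<open>
  A single element with its patch space gives the summands of the localized corrector; the whole plane with the full
  kernel gives the ideal one.
\<close>

definition corrector :: "pt set \<Rightarrow> cfun set \<Rightarrow> cfun \<Rightarrow> cfun" where
  "corrector A S v = solve_primal P S (\<lambda>w. aform_on P A v w)"

lemma corrector:
  assumes S: "cvs.subspace S" "S \<subseteq> W_h P" and A: "closed A" and v: "v \<in> V_h P"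
  shows "corrector A S v \<in> S" "w \<in> S \<Longrightarrow> aform P (corrector A S v) w = aform_on P A v w"
proof -
  note sol = theI'[OF primal_ex1[OF S form_restrict(1)[OF A v S(2)]], folded solve_primal_def, folded corrector_def]
  show "corrector A S v \<in> S" by (rule conjunct1[OF sol])
  show "w \<in> S \<Longrightarrow> aform P (corrector A S v) w = aform_on P A v w" by (rule bspec[OF conjunct2[OF sol]])
qed

lemma corrector_eqI:
  assumes S: "cvs.subspace S" "S \<subseteq> W_h P" and A: "closed A" and v: "v \<in> V_h P"
    and u: "u \<in> S" "\<And>w. w \<in> S \<Longrightarrow> aform P u w = aform_on P A v w"
  shows "corrector A S v = u"
  unfolding corrector_def solve_primal_def
  by (rule the1_equality[OF primal_ex1[OF S form_restrict(1)[OF A v S(2)]]]) (use u in simp)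

lemma corrector_linear:
  assumes S: "cvs.subspace S" "S \<subseteq> W_h P" and A: "closed A"
  shows "linear_map_on (V_h P) (corrector A S)"
  unfolding linear_map_on_def
proof (intro conjI ballI allI)
  have SV: "x \<in> V_h P" if "x \<in> S" for x using that S(2) W_h_subset by blast
  note c = corrector[OF S A]
  fix v w assume v: "v \<in> V_h P" and w: "w \<in> V_h P"
  show "corrector A S (v + w) = corrector A S v + corrector A S w"
  proof (rule corrector_eqI[OF S A V_h_add[OF v w] cvs.subspace_add[OF S(1) c(1)[OF v] c(1)[OF w]]])
    fix x assume x: "x \<in> S"
    show "aform P (corrector A S v + corrector A S w) x = aform_on P A (v + w) x"
      using a_add_left[OF SV[OF c(1)[OF v]] SV[OF c(1)[OF w]] SV[OF x]] c(2)[OF v x] c(2)[OF w x]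
        sesq_add_left[OF aform_on_sesq[OF A] v w SV[OF x]] by simp
  qed
next
  have SV: "x \<in> V_h P" if "x \<in> S" for x using that S(2) W_h_subset by blast
  note c = corrector[OF S A]
  fix k v assume v: "v \<in> V_h P"
  show "corrector A S (fscale k v) = fscale k (corrector A S v)"
  proof (rule corrector_eqI[OF S A V_h_scale[OF v] cvs.subspace_scale[OF S(1) c(1)[OF v]]])
    fix x assume x: "x \<in> S"
    show "aform P (fscale k (corrector A S v)) x = aform_on P A (fscale k v) x"
      using a_scale_left[OF SV[OF c(1)[OF v]] SV[OF x]] c(2)[OF v x]
        sesq_scale_left[OF aform_on_sesq[OF A] v SV[OF x]] by simp
  qed
qed

text \<open>
  Complex conjugation turns the primal problem into the adjoint one, because
  \<open>a (cnj v) (cnj w) = a w v\<close>.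
\<close>

lemma solve_adjoint_conj:
  assumes S: "cvs.subspace S" "S \<subseteq> W_h P" "\<And>w. w \<in> S \<Longrightarrow> conj_fun w \<in> S" and A: "closed A" and v: "v \<in> V_h P"
  shows "solve_adjoint P S (\<lambda>w. aform_on P A w v) = conj_fun (corrector A S (conj_fun v))"
  unfolding solve_adjoint_def
proof (rule the1_equality[OF adjoint_ex1[OF S(1,2) form_restrict(2)[OF A v S(2)]]], intro conjI ballI)
  have SV: "x \<in> V_h P" if "x \<in> S" for x using that S(2) W_h_subset by blast
  note c = corrector[OF S(1,2) A V_h_conj[OF v]]
  show "conj_fun (corrector A S (conj_fun v)) \<in> S" by (rule S(3)[OF c(1)])
  fix w assume w: "w \<in> S"
  have "aform P w (conj_fun (corrector A S (conj_fun v)))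
      = aform P (conj_fun (conj_fun w)) (conj_fun (corrector A S (conj_fun v)))" by simp
  also have "\<dots> = aform P (corrector A S (conj_fun v)) (conj_fun w)"
    by (rule aform_conj[OF V_h_conj[OF SV[OF w]] SV[OF c(1)]])
  also have "\<dots> = aform_on P A (conj_fun v) (conj_fun w)" by (rule c(2)[OF S(3)[OF w]])
  also have "\<dots> = aform_on P A w v" by (rule aform_on_conj[OF v SV[OF w] A])
  finally show "aform P w (conj_fun (corrector A S (conj_fun v))) = aform_on P A w v" .
qed

lemma W_loc_subspace: "cvs.subspace (W_loc P S)"
  unfolding cvs.subspace_def W_loc_def
proof (intro conjI ballI allI CollectI)
  show "0 \<in> W_h P" by (rule cvs.subspace_0[OF W_h_subspace])
  show "closure {x. (0 :: cfun) x \<noteq> 0} \<subseteq> closure S" by simp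
  fix v w assume v: "v \<in> {w \<in> W_h P. closure {x. w x \<noteq> 0} \<subseteq> closure S}"
    and w: "w \<in> {w \<in> W_h P. closure {x. w x \<noteq> 0} \<subseteq> closure S}"
  show "v + w \<in> W_h P" using v w W_h_add by simp
  have "{x. (v + w) x \<noteq> 0} \<subseteq> {x. v x \<noteq> 0} \<union> {x. w x \<noteq> 0}" by auto
  then have "closure {x. (v + w) x \<noteq> 0} \<subseteq> closure {x. v x \<noteq> 0} \<union> closure {x. w x \<noteq> 0}"
    unfolding closure_Un[symmetric] by (rule closure_mono)
  then show "closure {x. (v + w) x \<noteq> 0} \<subseteq> closure S" using v w by blast
next
  fix c v assume v: "v \<in> {w \<in> W_h P. closure {x. w x \<noteq> 0} \<subseteq> closure S}"
  show "fscale c v \<in> W_h P" using v W_h_scale by simp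
  have "closure {x. fscale c v x \<noteq> 0} \<subseteq> closure {x. v x \<noteq> 0}" by (rule closure_mono) auto
  then show "closure {x. fscale c v x \<noteq> 0} \<subseteq> closure S" using v by blast
qed

lemma W_loc_subset: "W_loc P S \<subseteq> W_h P"
  unfolding W_loc_def by blast

lemma W_loc_conj: "w \<in> W_loc P S \<Longrightarrow> conj_fun w \<in> W_loc P S"
  unfolding W_loc_def using W_h_conj by simp

lemma W_loc_Omega: "W_loc P (Omega P) = W_h P"
proof -
  have "closure {x. w x \<noteq> 0} \<subseteq> closure (Omega P)" if "w \<in> W_h P" for w
  proof (rule closure_minimal)
    show "{x. w x \<noteq> 0} \<subseteq> closure (Omega P)"
      using fine.P1_zero_outside[of w] W_V[OF that] unfolding V_h_def by blast
  qed simp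
  then show ?thesis unfolding W_loc_def by blast
qed

lemma element_closed: "T \<in> mesh_H P \<Longrightarrow> closed T"
  using triangle_compact[OF coarse.triangle] by (simp add: compact_imp_closed)

lemma Q_loc_eq: "Q_loc P l v = (\<Sum>T\<in>mesh_H P. corrector T (W_loc P (elem_patch P l T)) v)"
  unfolding Q_loc_def corrector_def ..

lemma Q_ideal_eq: "Q_ideal P v = corrector UNIV (W_h P) v"
  unfolding Q_ideal_def corrector_def aform_def ..

lemma Q_loc_W: "v \<in> V_h P \<Longrightarrow> Q_loc P l v \<in> W_h P"
proof -
  assume v: "v \<in> V_h P"
  have "corrector T (W_loc P (elem_patch P l T)) v \<in> W_h P" if T: "T \<in> mesh_H P" for T
    by (rule subsetD[OF W_loc_subset corrector(1)[OF W_loc_subspace W_loc_subset element_closed[OF T] v]])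
  then show ?thesis unfolding Q_loc_eq by (intro cvs.subspace_sum[OF W_h_subspace])
qed

lemma Q_loc_linear: "linear_map_on (V_h P) (Q_loc P l)"
proof -
  let ?c = "\<lambda>T. corrector T (W_loc P (elem_patch P l T))"
  have c: "linear_map_on (V_h P) (?c T)" if "T \<in> mesh_H P" for T
    by (rule corrector_linear[OF W_loc_subspace W_loc_subset element_closed[OF that]])
  show ?thesis unfolding linear_map_on_def Q_loc_eq
  proof (intro conjI ballI allI)
    fix v w assume vw: "v \<in> V_h P" "w \<in> V_h P"
    show "(\<Sum>T\<in>mesh_H P. ?c T (v + w)) = (\<Sum>T\<in>mesh_H P. ?c T v) + (\<Sum>T\<in>mesh_H P. ?c T w)"
      unfolding sum.distrib[symmetric]
      by (intro sum.cong refl) (use c vw in \<open>unfold linear_map_on_def, blast\<close>)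
    fix k
    show "(\<Sum>T\<in>mesh_H P. ?c T (fscale k v)) = fscale k (\<Sum>T\<in>mesh_H P. ?c T v)"
      unfolding cvs.scale_sum_right
      by (intro sum.cong refl) (use c vw in \<open>unfold linear_map_on_def, blast\<close>)
  qed
qed

lemma Q_ideal_W: "v \<in> V_h P \<Longrightarrow> Q_ideal P v \<in> W_h P"
  and Q_ideal_galerkin: "v \<in> V_h P \<Longrightarrow> w \<in> W_h P \<Longrightarrow> aform P (Q_ideal P v) w = aform P v w"
  unfolding Q_ideal_eq using corrector[OF W_h_subspace order_refl closed_UNIV, of v]
  by (simp_all add: aform_def)

lemma Q_ideal_linear: "linear_map_on (V_h P) (Q_ideal P)"
proof -
  have "Q_ideal P = corrector UNIV (W_h P)" by (rule ext) (rule Q_ideal_eq)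
  then show ?thesis using corrector_linear[OF W_h_subspace order_refl closed_UNIV] by simp
qed

text \<open>
  The sum of the element solutions solves the global problem, since the elementwise forms add up to \<open>a\<close>.
\<close>

lemma Q_loc_infinity:
  assumes v: "v \<in> V_h P"
  shows "Q_loc P \<infinity> v = Q_ideal P v"
proof -
  let ?q = "\<lambda>T. corrector T (W_h P) v"
  have eq: "Q_loc P \<infinity> v = (\<Sum>T\<in>mesh_H P. ?q T)"
    unfolding Q_loc_eq elem_patch_def by (simp add: W_loc_Omega)
  note q = corrector[OF W_h_subspace order_refl element_closed v]
  have "corrector UNIV (W_h P) v = (\<Sum>T\<in>mesh_H P. ?q T)"
  proof (rule corrector_eqI[OF W_h_subspace order_refl closed_UNIV v])
    show "(\<Sum>T\<in>mesh_H P. ?q T) \<in> W_h P" by (intro cvs.subspace_sum[OF W_h_subspace] q(1))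
    fix w assume w: "w \<in> W_h P"
    have "linear_form_on (V_h P) (\<lambda>u. aform P u w)"
      using aform_sesq W_V[OF w] unfolding sesquilinear_on_def by blast
    then have "aform P (\<Sum>T\<in>mesh_H P. ?q T) w = (\<Sum>T\<in>mesh_H P. aform P (?q T) w)"
      by (rule linear_form_sum[OF _ V_h_subspace coarse.finite_mesh]) (intro W_V q(1))
    also have "\<dots> = (\<Sum>T\<in>mesh_H P. aform_on P T v w)" by (intro sum.cong refl q(2) w)
    also have "\<dots> = aform P v w"
      by (rule coarse.aform_over_elements[OF v[unfolded V_h_def] W_V[OF w, unfolded V_h_def] fine_mesh])
    finally show "aform P (\<Sum>T\<in>mesh_H P. ?q T) w = aform_on P UNIV v w" unfolding aform_def .
  qed
  then show ?thesis unfolding eq Q_ideal_eq by simp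
qed

lemma Q_loc_adj_eq:
  assumes v: "v \<in> V_h P"
  shows "Q_loc_adj P l v = conj_fun (Q_loc P l (conj_fun v))"
  unfolding Q_loc_adj_def Q_loc_eq conj_fun_sum
  by (intro sum.cong refl solve_adjoint_conj[OF W_loc_subspace W_loc_subset W_loc_conj _ v] element_closed)

text \<open>
  The ideal adjoint corrector. Defined through the primal one, it inherits existence and the norm bound.
\<close>

definition Q_adj :: "cfun \<Rightarrow> cfun" where
  "Q_adj v = conj_fun (Q_ideal P (conj_fun v))"

lemma Q_adj_W: "v \<in> V_h P \<Longrightarrow> Q_adj v \<in> W_h P"
  unfolding Q_adj_def by (intro W_h_conj Q_ideal_W V_h_conj)

lemma Q_adj_galerkin:
  assumes v: "v \<in> V_h P" and w: "w \<in> W_h P"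
  shows "aform P w (Q_adj v) = aform P w v"
proof -
  have q: "Q_ideal P (conj_fun v) \<in> V_h P" by (intro W_V Q_ideal_W V_h_conj v)
  have "aform P w (Q_adj v) = aform P (conj_fun (conj_fun w)) (conj_fun (Q_ideal P (conj_fun v)))"
    by (simp add: Q_adj_def)
  also have "\<dots> = aform P (Q_ideal P (conj_fun v)) (conj_fun w)"
    by (rule aform_conj[OF V_h_conj[OF W_V[OF w]] q])
  also have "\<dots> = aform P (conj_fun v) (conj_fun w)"
    by (rule Q_ideal_galerkin[OF V_h_conj[OF v] W_h_conj[OF w]])
  also have "\<dots> = aform P w v" by (rule aform_conj[OF v W_V[OF w]])
  finally show ?thesis .
qed

lemma Q_loc_adj_infinity: "v \<in> V_h P \<Longrightarrow> Q_loc_adj P \<infinity> v = Q_adj v"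
  unfolding Q_adj_def by (simp add: Q_loc_adj_eq Q_loc_infinity V_h_conj)

lemma Q_loc_adj_W: "v \<in> V_h P \<Longrightarrow> Q_loc_adj P l v \<in> W_h P"
  unfolding Q_loc_adj_eq by (intro W_h_conj Q_loc_W V_h_conj)

lemma linear_map_conj:
  assumes L: "linear_map_on (V_h P) L"
  shows "linear_map_on (V_h P) (\<lambda>v. conj_fun (L (conj_fun v)))"
  unfolding linear_map_on_def
proof (intro conjI ballI allI)
  fix v w assume v: "v \<in> V_h P" and w: "w \<in> V_h P"
  have "L (conj_fun v + conj_fun w) = L (conj_fun v) + L (conj_fun w)"
    using L V_h_conj[OF v] V_h_conj[OF w] unfolding linear_map_on_def by blast
  then show "conj_fun (L (conj_fun (v + w))) = conj_fun (L (conj_fun v)) + conj_fun (L (conj_fun w))"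
    unfolding conj_fun_add by (simp only: conj_fun_add)
next
  fix c v assume v: "v \<in> V_h P"
  have "L (fscale (cnj c) (conj_fun v)) = fscale (cnj c) (L (conj_fun v))"
    using L V_h_conj[OF v] unfolding linear_map_on_def by blast
  then show "conj_fun (L (conj_fun (fscale c v))) = fscale c (conj_fun (L (conj_fun v)))"
    unfolding conj_fun_scale by (simp only: conj_fun_scale complex_cnj_cnj)
qed

lemma Q_loc_adj_linear: "linear_map_on (V_h P) (Q_loc_adj P l)"
  by (rule linear_map_on_cong[OF V_h_subspace linear_map_conj[OF Q_loc_linear[of l]]]) (rule Q_loc_adj_eq)

lemma T_op_linear: "linear_map_on (V_h P) (T_op P l)"
proof -
  have "T_op P l = (\<lambda>v. v - Q_loc P l v)" by (rule ext) (rule T_op_def)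
  then show ?thesis using linear_map_diff[OF linear_map_id Q_loc_linear[of l]] by simp
qed

lemma T_op_adj_linear: "linear_map_on (V_h P) (T_op_adj P l)"
proof -
  have "T_op_adj P l = (\<lambda>v. v - Q_loc_adj P l v)" by (rule ext) (rule T_op_adj_def)
  then show ?thesis using linear_map_diff[OF linear_map_id Q_loc_adj_linear[of l]] by simp
qed

lemma T_op_V: "v \<in> V_h P \<Longrightarrow> T_op P l v \<in> V_h P"
  unfolding T_op_def by (rule V_h_diff[OF _ W_V[OF Q_loc_W]])

lemma T_op_adj_V: "v \<in> V_h P \<Longrightarrow> T_op_adj P l v \<in> V_h P"
  unfolding T_op_adj_def by (rule V_h_diff[OF _ W_V[OF Q_loc_adj_W]])

lemma I_H_T_op: "v \<in> V_H P \<Longrightarrow> I_H P (T_op P l v) = v"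
  unfolding T_op_def
  using I_H_diff[OF H_V W_V[OF Q_loc_W[OF H_V]], of v v l] Q_loc_W[OF H_V, of v l] I_H_projection[of v]
  by (simp add: W_h_iff)

lemma I_H_T_op_adj: "v \<in> V_H P \<Longrightarrow> I_H P (T_op_adj P l v) = v"
  unfolding T_op_adj_def
  using I_H_diff[OF H_V W_V[OF Q_loc_adj_W[OF H_V]], of v v l] Q_loc_adj_W[OF H_V, of v l] I_H_projection[of v]
  by (simp add: W_h_iff)

lemma Q_ideal_bound:
  assumes v: "v \<in> V_h P"
  shows "norm_k P (Q_ideal P v) \<le> LW * norm_k P v"
proof -
  have q: "Q_ideal P v \<in> W_h P" by (rule Q_ideal_W[OF v])
  have "cmod (aform P (Q_ideal P v) (Q_ideal P v)) \<le> (Ca * norm_k P v) * norm_k P (Q_ideal P v)"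
    unfolding Q_ideal_galerkin[OF v q] by (rule aform_bound[OF v W_V[OF q]])
  from coercive_bound[OF q this] show ?thesis
    using Ca_nonneg norm_k_nonneg by (simp add: lambda_W_def)
qed

lemma Q_adj_bound:
  assumes v: "v \<in> V_h P"
  shows "norm_k P (Q_adj v) \<le> LW * norm_k P v"
  unfolding Q_adj_def
  using Q_ideal_bound[OF V_h_conj[OF v]] norm_k_conj[OF v] norm_k_conj[OF W_V[OF Q_ideal_W[OF V_h_conj[OF v]]]] by simp

lemma T_inf_bound:
  assumes v: "v \<in> V_h P"
  shows "norm_k P (v - Q_ideal P v) \<le> C_F P Capp Ca * norm_k P v"
    "norm_k P (v - Q_adj v) \<le> C_F P Capp Ca * norm_k P v"
  using norm_k_triangle_diff[OF v W_V[OF Q_ideal_W[OF v]]] Q_ideal_bound[OF v]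
    norm_k_triangle_diff[OF v W_V[OF Q_adj_W[OF v]]] Q_adj_bound[OF v]
  unfolding C_F_def lambda_W_def by (simp_all add: distrib_right)

lemma T_inf_orthogonal:
  assumes v: "v \<in> V_h P" and w: "w \<in> W_h P"
  shows "aform P (v - Q_ideal P v) w = 0" "aform P w (v - Q_adj v) = 0"
  using a_diff_left[OF v W_V[OF Q_ideal_W[OF v]] W_V[OF w]] Q_ideal_galerkin[OF v w]
    a_diff_right[OF v W_V[OF Q_adj_W[OF v]] W_V[OF w]] Q_adj_galerkin[OF v w] by simp_all

lemma stability: 
  assumes v: "v \<in> V_h P"
  shows "norm_k P (I_H P v) \<le> CI * norm_k P v"
  using CI v V_h_subset_V_space unfolding stability_constant_def by blast

lemma CI_nonneg: "0 \<le> CI"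
  using CI by (simp add: stability_constant_def)

lemma C_F_ge_1: "1 \<le> C_F P Capp Ca"
  using lambda_W_nonneg unfolding C_F_def lambda_W_def by simp

text \<open>
  A test function may be replaced by the ideally corrected quasi-interpolant, since the difference
  lies in the kernel, on which \<open>a (T\<^sub>\<infinity> p) w\<close> vanishes.
\<close>

lemma alpha_ideal_lower_bound:
  assumes gam: "gamma_h P > 0"
  shows "alpha_ideal P \<ge> gamma_h P / ereal (C_F P Capp Ca * CI\<^sup>2)"
  unfolding alpha_ideal_def
proof (rule INF_greatest)
  fix p assume p: "p \<in> V_H P - {0}"
  let ?K = "C_F P Capp Ca * CI\<^sup>2"
  define S where "S = (SUP q\<in>V_H P - {0}. ereal (cmod (aform P (T_op P \<infinity> p) (T_op_adj P \<infinity> q)) / (norm_k P p * norm_k P q)))"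
  define v where "v = p - Q_ideal P p"
  have pH: "p \<in> V_H P" and pV: "p \<in> V_h P" and p0: "p \<noteq> 0" using p H_V by auto
  have Tp: "T_op P \<infinity> p = v" unfolding T_op_def v_def Q_loc_infinity[OF pV] ..
  have vV: "v \<in> V_h P" unfolding v_def by (intro V_h_diff pV W_V Q_ideal_W)
  have Iv: "I_H P v = p" using I_H_T_op[OF pH, of \<infinity>] unfolding Tp .
  have v0: "v \<noteq> 0" using Iv p0 by auto
  have np: "0 < norm_k P p" and nv: "0 < norm_k P v" using norm_k_pos pV p0 vV v0 by auto
  have pv: "norm_k P p \<le> CI * norm_k P v" using stability[OF vV] Iv by simp
  have "norm_k P p \<le> CI * norm_k P p" using stability[OF pV] I_H_projection[OF pH] by simp
  then have CI1: "1 \<le> CI" using np by simp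
  have K: "CI\<^sup>2 \<le> ?K" "0 < ?K"
    using C_F_ge_1 CI1 mult_right_mono[OF C_F_ge_1 zero_le_power2[of CI]] by (auto intro: mult_pos_pos)
  have S0: "0 \<le> S" unfolding S_def
    by (rule order_trans[OF _ SUP_upper[OF p]]) (simp add: norm_k_nonneg)
  have "gamma_h P / ereal ?K \<le> S"
  proof (cases S)
    case (real s)
    then have s: "0 \<le> s" using S0 by simp
    have "gamma_h P \<le> (SUP y\<in>V_h P - {0}. ereal (cmod (aform P v y) / (norm_k P v * norm_k P y)))"
      unfolding gamma_h_def infsup_def by (rule INF_lower) (use vV v0 in simp)
    also have "\<dots> \<le> ereal (s * ?K)"
    proof (rule SUP_least)
      fix y assume y: "y \<in> V_h P - {0}"
      then have yV: "y \<in> V_h P" and ny: "0 < norm_k P y" using norm_k_pos by auto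
      let ?q = "I_H P y"
      have qH: "?q \<in> V_H P" by (rule I_H_in)
      have qV: "?q \<in> V_h P" by (rule H_V[OF qH])
      have yW: "y - ?q \<in> W_h P"
        unfolding W_h_iff using V_h_diff[OF yV qV] I_H_diff[OF yV qV] I_H_projection[OF qH] by simp
      have "aform P v y = aform P v (?q - Q_adj ?q)"
      proof -
        have "aform P v y - aform P v ?q = 0"
          using a_diff_right[OF yV qV vV] T_inf_orthogonal(1)[OF pV yW] unfolding v_def by simp
        moreover have "aform P v (Q_adj ?q) = 0"
          unfolding v_def by (rule T_inf_orthogonal(1)[OF pV Q_adj_W[OF qV]])
        ultimately show ?thesis using a_diff_right[OF qV W_V[OF Q_adj_W[OF qV]] vV] by simp
      qed
      also have "?q - Q_adj ?q = T_op_adj P \<infinity> ?q" unfolding T_op_adj_def Q_loc_adj_infinity[OF qV] ..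
      finally have av: "aform P v y = aform P v (T_op_adj P \<infinity> ?q)" .
      have "cmod (aform P v y) \<le> s * (norm_k P p * norm_k P ?q)"
      proof (cases "?q = 0")
        case True
        have "aform P v y = 0" using T_inf_orthogonal(1)[OF pV, of y] yW True unfolding v_def by simp
        then show ?thesis using s np by (simp add: norm_k_nonneg)
      next
        case False
        then have nq: "0 < norm_k P ?q" by (rule norm_k_pos[OF qV])
        have "ereal (cmod (aform P (T_op P \<infinity> p) (T_op_adj P \<infinity> ?q)) / (norm_k P p * norm_k P ?q)) \<le> S"
          unfolding S_def by (rule SUP_upper) (use qH False in simp)
        then have "cmod (aform P v y) / (norm_k P p * norm_k P ?q) \<le> s"
          unfolding real Tp av by simp
        then show ?thesis using np nq by (simp add: pos_divide_le_eq)
      qed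
      also have "\<dots> \<le> s * ((CI * norm_k P v) * (CI * norm_k P y))"
        by (intro mult_left_mono mult_mono pv stability[OF yV] s mult_nonneg_nonneg CI_nonneg norm_k_nonneg)
      also have "\<dots> = (s * CI\<^sup>2) * (norm_k P v * norm_k P y)" by (simp add: power2_eq_square)
      also have "\<dots> \<le> (s * ?K) * (norm_k P v * norm_k P y)"
        by (intro mult_right_mono mult_left_mono K s mult_nonneg_nonneg norm_k_nonneg)
      finally show "ereal (cmod (aform P v y) / (norm_k P v * norm_k P y)) \<le> ereal (s * ?K)"
        using nv ny by (simp add: pos_divide_le_eq)
    qed
    finally have le: "gamma_h P \<le> ereal (s * ?K)" .
    then obtain g where g: "gamma_h P = ereal g" using gam by (cases "gamma_h P") auto
    have "g / ?K \<le> s" using le K(2) unfolding g by (simp add: pos_divide_le_eq)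
    then show ?thesis unfolding g real ereal_divide_pos[OF K(2)] by simp
  next
    case PInf
    then show ?thesis by simp
  next
    case MInf
    then show ?thesis using S0 by simp
  qed
  then show "gamma_h P / ereal ?K \<le> (SUP q\<in>V_H P - {0}. ereal (cmod (aform P (T_op P \<infinity> p) (T_op_adj P \<infinity> q)) / (norm_k P p * norm_k P q)))"
    unfolding S_def .
qed

section \<open>The localization defect\<close>

text \<open>
  The supremum of a set of reals is meaningful only for bounded sets; linear bounds, which finite dimension provides,
  make it an operator norm.
\<close>

lemma quotient_sup:
  assumes bound: "\<And>v. v \<in> V_H P \<Longrightarrow> f v \<le> C * norm_k P v" and nn: "\<And>v. v \<in> V_H P \<Longrightarrow> 0 \<le> f v"
  shows "bdd_above ((\<lambda>v. f v / norm_k P v) ` V_H P)"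
    "\<And>v. v \<in> V_H P \<Longrightarrow> f v \<le> (SUP v\<in>V_H P. f v / norm_k P v) * norm_k P v"
    "0 \<le> (SUP v\<in>V_H P. f v / norm_k P v)"
proof -
  have le: "f v / norm_k P v \<le> max 0 C" if v: "v \<in> V_H P" for v
  proof (cases "norm_k P v = 0")
    case False
    then have "0 < norm_k P v" using norm_k_nonneg[of P v] by linarith
    then have "f v / norm_k P v \<le> C" using bound[OF v] by (simp add: pos_divide_le_eq)
    then show ?thesis by simp
  qed simp
  show bdd: "bdd_above ((\<lambda>v. f v / norm_k P v) ` V_H P)"
    unfolding bdd_above_def using le by (intro exI[of _ "max 0 C"]) blast
  show "f v \<le> (SUP v\<in>V_H P. f v / norm_k P v) * norm_k P v" if v: "v \<in> V_H P" for v
  proof (cases "norm_k P v = 0")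
    case True
    then show ?thesis using bound[OF v] by simp
  next
    case False
    then have n: "0 < norm_k P v" using norm_k_nonneg[of P v] by linarith
    have "f v / norm_k P v \<le> (SUP v\<in>V_H P. f v / norm_k P v)" by (rule cSUP_upper[OF v bdd])
    then show ?thesis using n by (simp add: pos_divide_le_eq)
  qed
  have z: "0 \<in> V_H P" by (rule cvs.subspace_0[OF V_H_subspace])
  have "0 \<le> f 0 / norm_k P 0" by (rule divide_nonneg_nonneg[OF nn[OF z] norm_k_nonneg])
  also have "\<dots> \<le> (SUP v\<in>V_H P. f v / norm_k P v)" by (rule cSUP_upper[OF z bdd])
  finally show "0 \<le> (SUP v\<in>V_H P. f v / norm_k P v)" .
qed

lemma defect_facts:
  shows "0 \<le> defect P l"
    and "v \<in> V_H P \<Longrightarrow> norm_k P (Q_ideal P v - Q_loc P l v) \<le> defect P l * norm_k P v"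
proof -
  have "linear_map_on (V_H P) (\<lambda>v. Q_ideal P v - Q_loc P l v)"
    by (rule linear_map_on_subset[OF linear_map_diff[OF Q_ideal_linear Q_loc_linear] V_H_subset_V_h])
  note lin = this
  obtain C where C: "0 \<le> C" "\<And>v. v \<in> V_H P \<Longrightarrow> norm_k P (Q_ideal P v - Q_loc P l v) \<le> C * norm_k P v"
  proof (rule linear_map_bounded[OF V_H_fin_dim V_H_subset_V_h lin])
    show "Q_ideal P v - Q_loc P l v \<in> V_h P" if "v \<in> V_H P" for v
      by (rule W_V[OF W_h_diff[OF Q_ideal_W[OF H_V[OF that]] Q_loc_W[OF H_V[OF that]]]])
  qed blast
  note q = quotient_sup[of "\<lambda>v. norm_k P (Q_ideal P v - Q_loc P l v)", OF C(2) norm_k_nonneg, folded defect_def]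
  show "0 \<le> defect P l" by (rule q(3))
  show "v \<in> V_H P \<Longrightarrow> norm_k P (Q_ideal P v - Q_loc P l v) \<le> defect P l * norm_k P v" by (rule q(2))
qed

lemma defect_conj:
  assumes v: "v \<in> V_H P"
  shows "conj_fun (Q_adj v - Q_loc_adj P l v) = Q_ideal P (conj_fun v) - Q_loc P l (conj_fun v)"
  unfolding Q_adj_def Q_loc_adj_eq[OF H_V[OF v]] conj_fun_diff by simp

lemma defect_adj_W: "v \<in> V_h P \<Longrightarrow> Q_adj v - Q_loc_adj P l v \<in> W_h P"
  by (intro W_h_diff Q_adj_W Q_loc_adj_W)

lemma defect_adj:
  assumes v: "v \<in> V_H P"
  shows "norm_k P (Q_adj v - Q_loc_adj P l v) \<le> defect P l * norm_k P v"
proof -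
  have "norm_k P (Q_adj v - Q_loc_adj P l v) = norm_k P (conj_fun (Q_adj v - Q_loc_adj P l v))"
    by (rule norm_k_conj[symmetric, OF W_V[OF defect_adj_W[OF H_V[OF v]]]])
  also have "\<dots> \<le> defect P l * norm_k P (conj_fun v)"
    unfolding defect_conj[OF v] by (rule defect_facts(2)[OF V_H_conj[OF v]])
  also have "norm_k P (conj_fun v) = norm_k P v" by (rule norm_k_conj[OF H_V[OF v]])
  finally show ?thesis .
qed

lemma G_res_antilinear: "v \<in> V_H P \<Longrightarrow> S \<subseteq> V_h P \<Longrightarrow> antilinear_form_on S (G_res P l v)"
  unfolding antilinear_form_on_def G_res_def
proof (intro conjI ballI allI)
  assume v: "v \<in> V_H P" and S: "S \<subseteq> V_h P"
  fix x y assume "x \<in> S" "y \<in> S"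
  then show "cnj (aform P (x + y) (T_op_adj P l v)) = cnj (aform P x (T_op_adj P l v)) + cnj (aform P y (T_op_adj P l v))"
    using a_add_left[of x y "T_op_adj P l v"] S T_op_adj_V[OF H_V[OF v]] by (simp add: subsetD)
  fix c
  show "cnj (aform P (fscale c x) (T_op_adj P l v)) = cnj c * cnj (aform P x (T_op_adj P l v))"
    using a_scale_left[of x "T_op_adj P l v" c] S T_op_adj_V[OF H_V[OF v]] \<open>x \<in> S\<close> by (simp add: subsetD)
qed

lemma cmod_G_res: "cmod (G_res P l v w) = cmod (aform P w (T_op_adj P l v))"
  by (simp add: G_res_def)

lemma xi_spec:
  assumes v: "v \<in> V_H P"
  shows "xi P (G_res P l v) z \<in> W_vertex P z"
    "w \<in> W_vertex P z \<Longrightarrow> bform P (xi P (G_res P l v) z) w = G_res P l v w"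
proof -
  have S: "fin_dim_subspace (W_vertex P z)" "W_vertex P z \<subseteq> V_h P"
    unfolding W_vertex_def
    by (rule W_subspace_fin_dim[OF W_loc_subspace W_loc_subset], rule subset_trans[OF W_loc_subset W_h_subset])
  note sol = theI'[OF bform_solvable[OF S G_res_antilinear[OF v S(2), of l]], folded xi_def]
  show "xi P (G_res P l v) z \<in> W_vertex P z" by (rule conjunct1[OF sol])
  show "w \<in> W_vertex P z \<Longrightarrow> bform P (xi P (G_res P l v) z) w = G_res P l v w" by (rule bspec[OF conjunct2[OF sol]])
qed

lemma W_vertex_V: "w \<in> W_vertex P z \<Longrightarrow> w \<in> V_h P"
  unfolding W_vertex_def by (intro W_V subsetD[OF W_loc_subset])

lemma finite_coarse_vertices: "finite (coarse_vertices P)"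
  unfolding coarse_vertices_eq by (rule coarse.finite_mesh_vertices)

lemma eta_nonneg: "0 \<le> eta P G"
  unfolding eta_def by (simp add: sum_nonneg)

lemma Theta_facts:
  shows "0 \<le> Theta P l" and "v \<in> V_H P \<Longrightarrow> eta P (G_res P l v) \<le> Theta P l * norm_k P v"
proof -
  obtain C where C: "0 \<le> C" "\<And>v. v \<in> V_H P \<Longrightarrow> norm_k P (T_op_adj P l v) \<le> C * norm_k P v"
  proof (rule linear_map_bounded[OF V_H_fin_dim V_H_subset_V_h])
    show "linear_map_on (V_H P) (T_op_adj P l)" by (rule linear_map_on_subset[OF T_op_adj_linear V_H_subset_V_h])
  qed (auto intro: T_op_adj_V H_V)
  let ?n = "real (card (coarse_vertices P))"
  have bnd: "eta P (G_res P l v) \<le> (sqrt ?n * (Ca * C)) * norm_k P v" if v: "v \<in> V_H P" for v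
  proof -
    have xi: "norm_k P (xi P (G_res P l v) z) \<le> Ca * C * norm_k P v" for z
    proof (cases "norm_k P (xi P (G_res P l v) z) = 0")
      case True
      then show ?thesis using Ca_nonneg C(1) by (simp add: norm_k_nonneg)
    next
      case False
      let ?x = "xi P (G_res P l v) z"
      have pos: "0 < norm_k P ?x" using False norm_k_nonneg[of P ?x] by linarith
      have "of_real ((norm_k P ?x)\<^sup>2) = G_res P l v ?x"
        unfolding bform_self[symmetric] by (rule xi_spec(2)[OF v xi_spec(1)[OF v]])
      then have "(norm_k P ?x)\<^sup>2 = cmod (G_res P l v ?x)" by (metis norm_of_real abs_power2)
      also have "\<dots> \<le> Ca * norm_k P ?x * norm_k P (T_op_adj P l v)"
        unfolding cmod_G_res
        by (rule aform_bound[OF W_vertex_V[OF xi_spec(1)[OF v]] T_op_adj_V[OF H_V[OF v]]])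
      also have "\<dots> \<le> Ca * norm_k P ?x * (C * norm_k P v)"
        by (intro mult_left_mono C(2)[OF v] mult_nonneg_nonneg Ca_nonneg norm_k_nonneg)
      finally have "norm_k P ?x * norm_k P ?x \<le> norm_k P ?x * (Ca * C * norm_k P v)"
        by (simp add: power2_eq_square mult_ac)
      then show ?thesis using pos by simp
    qed
    have nn: "0 \<le> Ca * C * norm_k P v" by (intro mult_nonneg_nonneg Ca_nonneg C(1) norm_k_nonneg)
    have "(\<Sum>z\<in>coarse_vertices P. (norm_k P (xi P (G_res P l v) z))\<^sup>2) \<le> ?n * (Ca * C * norm_k P v)\<^sup>2"
      using sum_bounded_above[of "coarse_vertices P" "\<lambda>z. (norm_k P (xi P (G_res P l v) z))\<^sup>2" "(Ca * C * norm_k P v)\<^sup>2"]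
        power_mono[OF xi norm_k_nonneg] by simp
    then have "eta P (G_res P l v) \<le> sqrt (?n * (Ca * C * norm_k P v)\<^sup>2)" unfolding eta_def by simp
    also have "\<dots> = sqrt ?n * (Ca * C * norm_k P v)" using nn by (simp add: real_sqrt_mult)
    finally show ?thesis by (simp add: mult.assoc)
  qed
  note q = quotient_sup[of "\<lambda>v. eta P (G_res P l v)", OF bnd eta_nonneg, folded Theta_def]
  show "0 \<le> Theta P l" by (rule q(3))
  show "v \<in> V_H P \<Longrightarrow> eta P (G_res P l v) \<le> Theta P l * norm_k P v" by (rule q(2))
qed

text \<open>
  The adjoint defect \<open>d\<close> satisfies \<open>a w d = a w (T\<^sub>\<ell>\<^sup>* v)\<close> for all kernel functions \<open>w\<close>. Testing with \<open>w = d\<close>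
  and decomposing \<open>d\<close> into vertex contributions bounds it by the local residuals.
\<close>

lemma defect_le_Theta: "defect P l \<le> Csd / cW * Theta P l"
  unfolding defect_def
proof (rule cSUP_least)
  show "V_H P \<noteq> {}" using cvs.subspace_0[OF V_H_subspace] by blast
  fix v assume v: "v \<in> V_H P"
  have Csd0: "0 \<le> Csd" using Csd by (simp add: decomposition_constant_def)
  define u where "u = conj_fun v"
  have uH: "u \<in> V_H P" unfolding u_def by (rule V_H_conj[OF v])
  note uV = H_V[OF uH]
  define d where "d = Q_adj u - Q_loc_adj P l u"
  have dW: "d \<in> W_h P" unfolding d_def by (rule defect_adj_W[OF uV])
  let ?T = "T_op_adj P l u"
  note TV = T_op_adj_V[OF uV, of l]
  have ad: "aform P w d = aform P w ?T" if w: "w \<in> W_h P" for w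
    unfolding d_def T_op_adj_def
    using a_diff_right[OF W_V[OF Q_adj_W[OF uV]] W_V[OF Q_loc_adj_W[OF uV]] W_V[OF w]]
      a_diff_right[OF uV W_V[OF Q_loc_adj_W[OF uV]] W_V[OF w]] Q_adj_galerkin[OF uV w] by simp
  obtain ws where ws: "\<And>z. z \<in> coarse_vertices P \<Longrightarrow> ws z \<in> W_vertex P z"
    "d = (\<Sum>z\<in>coarse_vertices P. ws z)"
    "(\<Sum>z\<in>coarse_vertices P. (norm_k P (ws z))\<^sup>2) \<le> Csd\<^sup>2 * (norm_k P d)\<^sup>2"
    using Csd dW unfolding decomposition_constant_def by metis
  let ?x = "\<lambda>z. norm_k P (xi P (G_res P l u) z)" and ?w = "\<lambda>z. norm_k P (ws z)"
  have "linear_form_on (V_h P) (\<lambda>w. aform P w ?T)" using aform_sesq TV unfolding sesquilinear_on_def by blast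
  then have "aform P (\<Sum>z\<in>coarse_vertices P. ws z) ?T = (\<Sum>z\<in>coarse_vertices P. aform P (ws z) ?T)"
    by (rule linear_form_sum[OF _ V_h_subspace finite_coarse_vertices]) (rule W_vertex_V[OF ws(1)])
  then have "cmod (aform P d d) = cmod (\<Sum>z\<in>coarse_vertices P. aform P (ws z) ?T)"
    unfolding ad[OF dW] ws(2)[symmetric] by simp
  also have "\<dots> \<le> (\<Sum>z\<in>coarse_vertices P. cmod (aform P (ws z) ?T))" by (rule norm_sum)
  also have "\<dots> \<le> (\<Sum>z\<in>coarse_vertices P. ?x z * ?w z)"
  proof (rule sum_mono)
    fix z assume z: "z \<in> coarse_vertices P"
    have "cmod (aform P (ws z) ?T) = cmod (G_res P l u (ws z))" unfolding G_res_def complex_mod_cnj ..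
    also have "\<dots> = cmod (bform P (xi P (G_res P l u) z) (ws z))" unfolding xi_spec(2)[OF uH ws(1)[OF z]] ..
    also have "\<dots> \<le> ?x z * ?w z"
      by (rule bform_Cauchy_Schwarz[OF W_vertex_V[OF xi_spec(1)[OF uH]] W_vertex_V[OF ws(1)[OF z]]])
    finally show "cmod (aform P (ws z) ?T) \<le> ?x z * ?w z" .
  qed
  also have "\<dots> \<le> eta P (G_res P l u) * (Csd * norm_k P d)"
  proof (rule power2_le_imp_le)
    have "(\<Sum>z\<in>coarse_vertices P. ?x z * ?w z)\<^sup>2 \<le> (\<Sum>z\<in>coarse_vertices P. (?x z)\<^sup>2) * (\<Sum>z\<in>coarse_vertices P. (?w z)\<^sup>2)"
      by (rule Cauchy_Schwarz_ineq_sum)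
    also have "\<dots> \<le> (\<Sum>z\<in>coarse_vertices P. (?x z)\<^sup>2) * (Csd\<^sup>2 * (norm_k P d)\<^sup>2)"
      by (intro mult_left_mono ws(3) sum_nonneg) simp
    also have "\<dots> = (eta P (G_res P l u) * (Csd * norm_k P d))\<^sup>2"
      unfolding eta_def by (simp add: power_mult_distrib sum_nonneg)
    finally show "(\<Sum>z\<in>coarse_vertices P. ?x z * ?w z)\<^sup>2 \<le> (eta P (G_res P l u) * (Csd * norm_k P d))\<^sup>2" .
    show "0 \<le> eta P (G_res P l u) * (Csd * norm_k P d)"
      by (intro mult_nonneg_nonneg eta_nonneg Csd0 norm_k_nonneg)
  qed
  also have "\<dots> \<le> (Theta P l * norm_k P u * Csd) * norm_k P d"
    using mult_right_mono[OF Theta_facts(2)[OF uH, of l], of "Csd * norm_k P d"] Csd0 norm_k_nonneg[of P d]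
    by (simp add: mult_ac)
  finally have "norm_k P d \<le> Theta P l * norm_k P u * Csd / cW"
    by (rule coercive_bound[OF dW]) (intro mult_nonneg_nonneg Theta_facts(1) Csd0 norm_k_nonneg)
  moreover have "norm_k P (Q_ideal P v - Q_loc P l v) = norm_k P d"
  proof -
    have "conj_fun d = Q_ideal P v - Q_loc P l v" unfolding d_def defect_conj[OF uH] by (simp add: u_def)
    then show ?thesis using norm_k_conj[OF W_V[OF dW]] by simp
  qed
  moreover have "norm_k P u = norm_k P v" unfolding u_def by (rule norm_k_conj[OF H_V[OF v]])
  ultimately have le: "norm_k P (Q_ideal P v - Q_loc P l v) \<le> Csd / cW * Theta P l * norm_k P v"
    by (simp add: mult_ac)
  show "norm_k P (Q_ideal P v - Q_loc P l v) / norm_k P v \<le> Csd / cW * Theta P l"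
  proof (cases "norm_k P v = 0")
    case True
    then show ?thesis using Csd0 c_W_pos Theta_facts(1)[of l] by simp
  next
    case False
    then have "0 < norm_k P v" using norm_k_nonneg[of P v] by linarith
    then show ?thesis using le by (simp add: pos_divide_le_eq)
  qed
qed

text \<open>
  The condition bounds the quadratic defect term by the fraction \<open>\<rho>\<close> of the lower bound for the ideal inf-sup constant.
  If there are no nonzero coarse functions, that constant is an infimum over the empty set and equals \<open>\<infinity>\<close>.
\<close>

lemma m_stab_positive:
  assumes gam: "gamma_h P > 0" and \<rho>: "0 < \<rho>" "\<rho> < 1"
    and cond: "ereal (Ca\<^sup>2 / cW * (Csd / cW * Theta P l)\<^sup>2) \<le> ereal \<rho> * (gamma_h P / ereal (C_F P Capp Ca * CI\<^sup>2))"
  shows "m_stab P Capp Ca l > 0"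
proof -
  let ?K = "C_F P Capp Ca * CI\<^sup>2" and ?t = "Ca\<^sup>2 / cW * (defect P l)\<^sup>2"
  have t: "?t \<le> Ca\<^sup>2 / cW * (Csd / cW * Theta P l)\<^sup>2"
    using c_W_pos by (intro mult_left_mono power_mono defect_le_Theta defect_facts(1)) simp
  have "ereal ?t < alpha_ideal P"
  proof (cases "V_H P - {0} = {}")
    case True
    have "alpha_ideal P = \<infinity>" unfolding alpha_ideal_def True by (simp add: top_ereal_def)
    then show ?thesis by simp
  next
    case False
    then obtain p where p: "p \<in> V_H P" "p \<noteq> 0" by blast
    have "0 < norm_k P p" using norm_k_pos[OF H_V] p by simp
    moreover have "norm_k P p \<le> CI * norm_k P p" using stability[OF H_V[OF p(1)]] I_H_projection[OF p(1)] by simp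
    ultimately have "1 \<le> CI" by simp
    then have K: "0 < ?K" using C_F_ge_1 by (intro mult_pos_pos) auto
    show ?thesis
    proof (cases "gamma_h P")
      case (real g)
      then have g: "0 < g" using gam by simp
      have "?t \<le> \<rho> * (g / ?K)" using t cond unfolding real ereal_divide_pos[OF K] by simp
      also have "\<dots> < 1 * (g / ?K)" using \<rho> g K by (intro mult_strict_right_mono) simp_all
      finally have "ereal ?t < gamma_h P / ereal ?K" unfolding real ereal_divide_pos[OF K] by simp
      then show ?thesis using alpha_ideal_lower_bound[OF gam] by (rule less_le_trans)
    next
      case PInf
      then have "gamma_h P / ereal ?K = \<infinity>" using K by simp
      then have "alpha_ideal P = \<infinity>" using alpha_ideal_lower_bound[OF gam] by simp
      then show ?thesis by simp
    next
      case MInf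
      then show ?thesis using gam by simp
    qed
  qed
  then show ?thesis unfolding m_stab_def by (simp add: ereal_diff_gr0)
qed

end

section \<open>Enriched spaces\<close>

locale enrichment = helmholtz_stable +
  fixes l :: enat and E :: "cfun set"
  assumes E_fin_dim: "fin_dim_subspace E" and E_perp: "E \<subseteq> X0_perp P l"
    and m_pos: "m_stab P Capp Ca l > 0"
begin

abbreviation "\<delta> \<equiv> defect P l"
abbreviation "Lc \<equiv> L_stab P Capp Ca l"
abbreviation "Ehat \<equiv> J_op P l ` E"

lemma E_V: "e \<in> E \<Longrightarrow> e \<in> V_h P"
  using subsetD[OF E_perp, of e] by (simp add: X0_perp_def)

lemma E_orthogonal: "e \<in> E \<Longrightarrow> x \<in> X0 P l \<Longrightarrow> bform P e x = 0"
  using subsetD[OF E_perp, of e] by (simp add: X0_perp_def)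

lemma X0_inter_E: "v \<in> X0 P l \<Longrightarrow> v \<in> E \<Longrightarrow> v = 0"
  using E_orthogonal[of v v] norm_k_definite[OF E_V, of v] by (simp add: bform_self)

lemma J_op_linear: "linear_map_on (V_h P) (J_op P l)"
proof -
  have "linear_map_on (V_h P) (\<lambda>v. T_op P l (I_H P v))"
    unfolding linear_map_on_def
  proof (intro conjI ballI allI)
    fix v w assume v: "v \<in> V_h P" and w: "w \<in> V_h P"
    have "T_op P l (I_H P v + I_H P w) = T_op P l (I_H P v) + T_op P l (I_H P w)"
      using T_op_linear[of l] H_V[OF I_H_in] unfolding linear_map_on_def by blast
    then show "T_op P l (I_H P (v + w)) = T_op P l (I_H P v) + T_op P l (I_H P w)"
      unfolding I_H_add[OF v w] .
  next
    fix c v assume v: "v \<in> V_h P"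
    have "T_op P l (fscale c (I_H P v)) = fscale c (T_op P l (I_H P v))"
      using T_op_linear[of l] H_V[OF I_H_in] unfolding linear_map_on_def by blast
    then show "T_op P l (I_H P (fscale c v)) = fscale c (T_op P l (I_H P v))"
      unfolding I_H_scale[OF v] .
  qed
  from linear_map_diff[OF linear_map_id this]
  show ?thesis by (rule linear_map_on_cong[OF V_h_subspace]) (rule J_op_def)
qed

lemma J_op_W:
  assumes v: "v \<in> V_h P"
  shows "J_op P l v \<in> W_h P"
proof -
  have T: "T_op P l (I_H P v) \<in> V_h P" by (rule T_op_V[OF H_V[OF I_H_in]])
  have "I_H P (v - T_op P l (I_H P v)) = 0"
    unfolding I_H_diff[OF v T] I_H_T_op[OF I_H_in] by simp
  then show ?thesis unfolding J_op_def W_h_iff using V_h_diff[OF v T] by simp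
qed

lemma J_op_linear_E: "linear_map_on E (J_op P l)"
  by (rule linear_map_on_subset[OF J_op_linear]) (use E_V in blast)

text \<open>
  A function in the kernel of this projection lies in \<open>X\<^sup>0\<close>, to which the enrichment is orthogonal.
\<close>

lemma J_op_injective:
  assumes e: "e \<in> E" and zero: "J_op P l e = 0"
  shows "e = 0"
proof (rule X0_inter_E[OF _ e])
  have "e = T_op P l (I_H P e)" using zero unfolding J_op_def by simp
  then show "e \<in> X0 P l" unfolding X0_def using I_H_in[of e] by (rule image_eqI)
qed

lemmas Ehat_fin_dim = injective_image_dim(1)[OF E_fin_dim J_op_linear_E J_op_injective]
lemmas Ehat_dim = injective_image_dim(2)[OF E_fin_dim J_op_linear_E J_op_injective]

lemma Ehat_W: "Ehat \<subseteq> W_h P"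
  using J_op_W[OF E_V] by blast

lemma Ehat_subspace: "cvs.subspace Ehat"
  by (rule fin_dim_subspaceD[OF Ehat_fin_dim])

lemma T_op_injective: "v \<in> V_H P \<Longrightarrow> T_op P l v = 0 \<Longrightarrow> v = 0"
  using I_H_T_op[of v l] by simp

lemma T_op_adj_injective: "v \<in> V_H P \<Longrightarrow> T_op_adj P l v = 0 \<Longrightarrow> v = 0"
  using I_H_T_op_adj[of v l] by simp

lemma X0_dim: "fin_dim_subspace (X0 P l)" "cvs.dim (X0 P l) = cvs.dim (V_H P)"
proof -
  note lin = linear_map_on_subset[OF T_op_linear[of l] V_H_subset_V_h]
  show "fin_dim_subspace (X0 P l)" unfolding X0_def
    by (rule injective_image_dim(1)[OF V_H_fin_dim lin]) (rule T_op_injective)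
  show "cvs.dim (X0 P l) = cvs.dim (V_H P)" unfolding X0_def
    by (rule injective_image_dim(2)[OF V_H_fin_dim lin]) (rule T_op_injective)
qed

lemma Y0_dim: "fin_dim_subspace (Y0 P l)" "cvs.dim (Y0 P l) = cvs.dim (V_H P)"
proof -
  note lin = linear_map_on_subset[OF T_op_adj_linear[of l] V_H_subset_V_h]
  show "fin_dim_subspace (Y0 P l)" unfolding Y0_def
    by (rule injective_image_dim(1)[OF V_H_fin_dim lin]) (rule T_op_adj_injective)
  show "cvs.dim (Y0 P l) = cvs.dim (V_H P)" unfolding Y0_def
    by (rule injective_image_dim(2)[OF V_H_fin_dim lin]) (rule T_op_adj_injective)
qed

lemma Y0_inter_Ehat: "v \<in> Y0 P l \<Longrightarrow> v \<in> Ehat \<Longrightarrow> v = 0"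
proof -
  assume v: "v \<in> Y0 P l" "v \<in> Ehat"
  obtain q where q: "q \<in> V_H P" "v = T_op_adj P l q" using v(1) unfolding Y0_def by (elim imageE)
  have "I_H P v = 0" using subsetD[OF Ehat_W v(2)] by (simp add: W_h_iff)
  then have "q = 0" using I_H_T_op_adj[OF q(1), of l] q(2) by simp
  moreover have "T_op_adj P l 0 = 0"
    using linear_map_sum[OF T_op_adj_linear[of l] V_h_subspace, of "{}"] by simp
  ultimately show "v = 0" using q(2) by simp
qed

lemma X_enr_fin_dim: "fin_dim_subspace (X_enr P l E)"
  and X_enr_dim: "cvs.dim (X_enr P l E) = cvs.dim (V_H P) + cvs.dim E"
  unfolding X_enr_def
  using direct_sum_dim[OF X0_dim(1) E_fin_dim X0_inter_E] X0_dim(2) by simp_all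

lemma Y_enr_fin_dim: "fin_dim_subspace (Y_enr P l E)"
  and Y_enr_dim: "cvs.dim (Y_enr P l E) = cvs.dim (V_H P) + cvs.dim E"
  unfolding Y_enr_def
  using direct_sum_dim[OF Y0_dim(1) Ehat_fin_dim Y0_inter_Ehat] Y0_dim(2) Ehat_dim by simp_all

lemma X_enr_V: "X_enr P l E \<subseteq> V_h P"
proof
  fix v assume "v \<in> X_enr P l E"
  then obtain x e where x: "v = x + e" "x \<in> X0 P l" "e \<in> E" unfolding X_enr_def by blast
  obtain p where p: "p \<in> V_H P" "x = T_op P l p" using x(2) unfolding X0_def by (elim imageE)
  show "v \<in> V_h P" unfolding x(1) p(2) by (rule V_h_add[OF T_op_V[OF H_V[OF p(1)]] E_V[OF x(3)]])
qed

lemma Y_enr_V: "Y_enr P l E \<subseteq> V_h P"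
proof
  fix v assume "v \<in> Y_enr P l E"
  then obtain x e where x: "v = x + e" "x \<in> Y0 P l" "e \<in> Ehat" unfolding Y_enr_def by blast
  obtain p where p: "p \<in> V_H P" "x = T_op_adj P l p" using x(2) unfolding Y0_def by (elim imageE)
  show "v \<in> V_h P"
    unfolding x(1) p(2) by (rule V_h_add[OF T_op_adj_V[OF H_V[OF p(1)]] W_V[OF subsetD[OF Ehat_W x(3)]]])
qed

text \<open>
  An enrichment function differs from its image in \<open>Ehat\<close> by an element of \<open>X\<^sup>0\<close>.
\<close>

lemma X_enr_representation:
  assumes "v \<in> X_enr P l E"
  obtains p w where "p \<in> V_H P" "w \<in> Ehat" "v = T_op P l p + w"
proof -
  obtain x e where x: "v = x + e" "x \<in> X0 P l" "e \<in> E" using assms unfolding X_enr_def by blast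
  obtain p where p: "p \<in> V_H P" "x = T_op P l p" using x(2) unfolding X0_def by (elim imageE)
  have "T_op P l (p + I_H P e) = T_op P l p + T_op P l (I_H P e)"
    using T_op_linear[of l] H_V[OF p(1)] H_V[OF I_H_in] unfolding linear_map_on_def by blast
  then have "v = T_op P l (p + I_H P e) + J_op P l e" unfolding x(1) p(2) J_op_def by simp
  moreover have "p + I_H P e \<in> V_H P" by (rule cvs.subspace_add[OF V_H_subspace p(1) I_H_in])
  ultimately show ?thesis using that x(3) by (metis imageI)
qed

text \<open>Galerkin orthogonality and Cea's estimate for the projections onto \<open>Ehat\<close>.\<close>

lemma primal_residual:
  assumes d: "d \<in> W_h P"
  obtains r where "r \<in> W_h P" "d - r \<in> Ehat" "\<And>w. w \<in> Ehat \<Longrightarrow> aform P r w = 0"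
    "norm_k P r \<le> LW * norm_k P d"
proof -
  have anti: "antilinear_form_on Ehat (aform P d)"
    using form_restrict(1)[OF closed_UNIV W_V[OF d] Ehat_W] by (simp add: aform_def[abs_def])
  obtain g where g: "g \<in> Ehat" "\<And>w. w \<in> Ehat \<Longrightarrow> aform P g w = aform P d w"
    using ex1_implies_ex[OF primal_ex1[OF Ehat_subspace Ehat_W anti]] by metis
  define r where "r = d - g"
  have gW: "g \<in> W_h P" by (rule subsetD[OF Ehat_W g(1)])
  have rW: "r \<in> W_h P" unfolding r_def by (rule W_h_diff[OF d gW])
  have orth: "aform P r w = 0" if w: "w \<in> Ehat" for w
    unfolding r_def using a_diff_left[OF W_V[OF d] W_V[OF gW] W_V[OF subsetD[OF Ehat_W w]]] g(2)[OF w] by simp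
  have "aform P r r = aform P r d"
    using a_diff_right[OF W_V[OF d] W_V[OF gW] W_V[OF rW]] orth[OF g(1)] unfolding r_def by simp
  then have "cmod (aform P r r) \<le> (Ca * norm_k P d) * norm_k P r"
    using aform_bound[OF W_V[OF rW] W_V[OF d]] by (simp add: mult_ac)
  from coercive_bound[OF rW this] have "norm_k P r \<le> LW * norm_k P d"
    using Ca_nonneg norm_k_nonneg by (simp add: lambda_W_def)
  then show ?thesis using that[OF rW _ orth] g(1) unfolding r_def by simp
qed

lemma adjoint_residual:
  assumes d: "d \<in> W_h P"
  obtains r where "r \<in> W_h P" "d - r \<in> Ehat" "\<And>w. w \<in> Ehat \<Longrightarrow> aform P w r = 0"
    "norm_k P r \<le> LW * norm_k P d"
proof -
  have lin: "linear_form_on Ehat (\<lambda>w. aform P w d)"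
    using form_restrict(2)[OF closed_UNIV W_V[OF d] Ehat_W] by (simp add: aform_def)
  obtain g where g: "g \<in> Ehat" "\<And>w. w \<in> Ehat \<Longrightarrow> aform P w g = aform P w d"
    using ex1_implies_ex[OF adjoint_ex1[OF Ehat_subspace Ehat_W lin]] by metis
  define r where "r = d - g"
  have gW: "g \<in> W_h P" by (rule subsetD[OF Ehat_W g(1)])
  have rW: "r \<in> W_h P" unfolding r_def by (rule W_h_diff[OF d gW])
  have orth: "aform P w r = 0" if w: "w \<in> Ehat" for w
    unfolding r_def using a_diff_right[OF W_V[OF d] W_V[OF gW] W_V[OF subsetD[OF Ehat_W w]]] g(2)[OF w] by simp
  have "aform P r r = aform P d r"
    using a_diff_left[OF W_V[OF d] W_V[OF gW] W_V[OF rW]] orth[OF g(1)] unfolding r_def by simp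
  then have "cmod (aform P r r) \<le> (Ca * norm_k P d) * norm_k P r"
    using aform_bound[OF W_V[OF d] W_V[OF rW]] by simp
  from coercive_bound[OF rW this] have "norm_k P r \<le> LW * norm_k P d"
    using Ca_nonneg norm_k_nonneg by (simp add: lambda_W_def)
  then show ?thesis using that[OF rW _ orth] g(1) unfolding r_def by simp
qed

text \<open>
  Suprema need not be attained, so the value of the form is only close to the ideal inf-sup constant. Scaling the
  test function adapts its norm to that of the trial function.
\<close>

lemma coarse_test_function:
  assumes p: "p \<in> V_H P" and s: "0 < s" "ereal s < alpha_ideal P"
  obtains q where "q \<in> V_H P" "norm_k P q = norm_k P p"
    "s * (norm_k P p)\<^sup>2 \<le> Re (aform P (p - Q_ideal P p) (q - Q_adj q))"
proof (cases "p = 0")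
  case True
  have Q0: "Q_ideal P 0 = 0" using linear_map_sum[OF Q_ideal_linear V_h_subspace, of "{}"] by simp
  have "aform P (p - Q_ideal P p) (0 - Q_adj 0) = 0"
    unfolding True Q0 Q_adj_def using sesq_zero_left[OF aform_sesq V_h_zero V_h_zero] by (simp add: Q0)
  then show ?thesis using that[of 0] True cvs.subspace_0[OF V_H_subspace] by (simp add: norm_k_zero)
next
  case False
  have pV: "p \<in> V_h P" by (rule H_V[OF p])
  have np: "0 < norm_k P p" by (rule norm_k_pos[OF pV False])
  define tp where "tp = p - Q_ideal P p"
  have tpV: "tp \<in> V_h P" unfolding tp_def by (rule V_h_diff[OF pV W_V[OF Q_ideal_W[OF pV]]])
  have Tp: "T_op P \<infinity> p = tp" unfolding T_op_def tp_def Q_loc_infinity[OF pV] ..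
  have "alpha_ideal P \<le> (SUP q\<in>V_H P - {0}. ereal (cmod (aform P (T_op P \<infinity> p) (T_op_adj P \<infinity> q)) / (norm_k P p * norm_k P q)))"
    unfolding alpha_ideal_def by (rule INF_lower) (use p False in simp)
  with s(2) have "ereal s < (SUP q\<in>V_H P - {0}. ereal (cmod (aform P (T_op P \<infinity> p) (T_op_adj P \<infinity> q)) / (norm_k P p * norm_k P q)))"
    by (rule less_le_trans)
  then obtain q0 where q0: "q0 \<in> V_H P - {0}"
    "ereal s < ereal (cmod (aform P (T_op P \<infinity> p) (T_op_adj P \<infinity> q0)) / (norm_k P p * norm_k P q0))"
    unfolding less_SUP_iff by (elim bexE)
  have qH: "q0 \<in> V_H P" and qV: "q0 \<in> V_h P" and nq: "0 < norm_k P q0"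
    using q0(1) H_V norm_k_pos[of q0] by auto
  have Tq: "T_op_adj P \<infinity> q = q - Q_adj q" if "q \<in> V_h P" for q
    unfolding T_op_adj_def Q_loc_adj_infinity[OF that] ..
  define z where "z = aform P tp (T_op_adj P \<infinity> q0)"
  have z: "s * (norm_k P p * norm_k P q0) < cmod z"
    using q0(2) np nq unfolding Tp z_def by (simp add: pos_less_divide_eq)
  moreover have "0 < s * (norm_k P p * norm_k P q0)" by (intro mult_pos_pos s(1) np nq)
  ultimately have z0: "z \<noteq> 0" by auto
  \<comment> \<open>the phase factor makes the value of the form real\<close>
  define c where "c = of_real (norm_k P p / norm_k P q0 / cmod z) * z"
  have cn: "cmod c = norm_k P p / norm_k P q0"
    unfolding c_def norm_mult norm_of_real using np nq z0 by (simp add: abs_of_pos)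
  have "T_op_adj P \<infinity> (fscale c q0) = fscale c (T_op_adj P \<infinity> q0)"
    using T_op_adj_linear[of \<infinity>] qV unfolding linear_map_on_def by blast
  then have "aform P tp (T_op_adj P \<infinity> (fscale c q0)) = cnj c * z"
    unfolding z_def using a_scale_right[OF tpV T_op_adj_V[OF qV]] by simp
  also have "cnj c * z = of_real (norm_k P p / norm_k P q0 / cmod z) * (z * cnj z)"
    unfolding c_def by (simp add: mult_ac)
  also have "\<dots> = of_real (norm_k P p / norm_k P q0 * cmod z)"
    unfolding complex_norm_square[symmetric] using z0 by (simp add: power2_eq_square)
  finally have val: "Re (aform P tp (fscale c q0 - Q_adj (fscale c q0))) = norm_k P p / norm_k P q0 * cmod z"
    unfolding Tq[OF V_h_scale[OF qV]] by simp
  have "s * (norm_k P p)\<^sup>2 = norm_k P p / norm_k P q0 * (s * (norm_k P p * norm_k P q0))"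
    using nq by (simp add: power2_eq_square)
  also have "\<dots> \<le> norm_k P p / norm_k P q0 * cmod z"
    using z np nq by (intro mult_left_mono) auto
  finally have "s * (norm_k P p)\<^sup>2 \<le> Re (aform P tp (fscale c q0 - Q_adj (fscale c q0)))" unfolding val .
  moreover have "norm_k P (fscale c q0) = norm_k P p" unfolding norm_k_scale[OF qV] cn using nq by simp
  moreover have "fscale c q0 \<in> V_H P" by (rule cvs.subspace_scale[OF V_H_subspace qH])
  ultimately show ?thesis using that unfolding tp_def by blast
qed

lemma block_diagonal_form:
  assumes V: "tp \<in> V_h P" "tq \<in> V_h P" and W: "rp \<in> W_h P" "rq \<in> W_h P" "w \<in> W_h P"
    and orth: "\<And>g. g \<in> W_h P \<Longrightarrow> aform P tp g = 0" "\<And>g. g \<in> W_h P \<Longrightarrow> aform P g tq = 0"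
      "aform P rp w = 0" "aform P w rq = 0"
  shows "aform P (tp + (rp + w)) (tq + (rq + w)) = aform P tp tq + aform P rp rq + aform P w w"
proof -
  note m = W_V[OF W(1)] W_V[OF W(2)] W_V[OF W(3)]
  have g: "rp + w \<in> W_h P" "rq + w \<in> W_h P" using W_h_add W by auto
  have "aform P (tp + (rp + w)) (tq + (rq + w)) = aform P tp (tq + (rq + w)) + aform P (rp + w) (tq + (rq + w))"
    by (rule a_add_left[OF V(1) W_V[OF g(1)] V_h_add[OF V(2) W_V[OF g(2)]]])
  also have "\<dots> = (aform P tp tq + aform P tp (rq + w)) + (aform P (rp + w) tq + aform P (rp + w) (rq + w))"
    unfolding a_add_right[OF V(2) W_V[OF g(2)] V(1)] a_add_right[OF V(2) W_V[OF g(2)] W_V[OF g(1)]] ..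
  also have "\<dots> = aform P tp tq + aform P (rp + w) (rq + w)" using orth(1)[OF g(2)] orth(2)[OF g(1)] by simp
  also have "aform P (rp + w) (rq + w) = (aform P rp rq + aform P rp w) + (aform P w rq + aform P w w)"
    unfolding a_add_left[OF m(1,3) W_V[OF g(2)]] a_add_right[OF m(2,3,1)] a_add_right[OF m(2,3,3)] ..
  finally have eq: "aform P (tp + (rp + w)) (tq + (rq + w))
      = aform P tp tq + ((aform P rp rq + aform P rp w) + (aform P w rq + aform P w w))" .
  show ?thesis unfolding eq orth(3,4) by (simp only: add_0_left add_0_right add.assoc)
qed

text \<open>
  Trial and test functions are written as \<open>T\<^sub>\<infinity> p + r\<^sub>p + w\<close> and \<open>T\<^sub>\<infinity>\<^sup>* q + r\<^sub>q + w\<close>, where \<open>r\<^sub>p\<close> and \<open>r\<^sub>q\<close> are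
  the parts of the localization defects that are Galerkin orthogonal to \<open>Ehat\<close>. In these coordinates the form
  is block diagonal up to the product of the two residuals, which is quadratic in the defect.
\<close>

lemma inf_sup_test_function:
  assumes v: "v \<in> X_enr P l E" "v \<noteq> 0" and r: "0 < r" "ereal r < m_stab P Capp Ca l"
  obtains y where "y \<in> Y_enr P l E" "y \<noteq> 0"
    "min r cW / (1 + Lc\<^sup>2) \<le> cmod (aform P v y) / (norm_k P v * norm_k P y)"
proof -
  define t where "t = Ca\<^sup>2 / cW * \<delta>\<^sup>2"
  have t0: "0 \<le> t" unfolding t_def using c_W_pos by simp
  have alpha: "ereal (r + t) < alpha_ideal P"
    using r(2) unfolding m_stab_def t_def[symmetric] by (cases "alpha_ideal P") auto
  obtain p w where pw: "p \<in> V_H P" "w \<in> Ehat" "v = T_op P l p + w" using X_enr_representation[OF v(1)] by blast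
  have pV: "p \<in> V_h P" by (rule H_V[OF pw(1)])
  have rt: "0 < r + t" using r(1) t0 by simp
  obtain q where q: "q \<in> V_H P" "norm_k P q = norm_k P p"
    "(r + t) * (norm_k P p)\<^sup>2 \<le> Re (aform P (p - Q_ideal P p) (q - Q_adj q))"
    by (rule coarse_test_function[OF pw(1) rt alpha])
  have qV: "q \<in> V_h P" by (rule H_V[OF q(1)])
  let ?Dp = "Q_ideal P p - Q_loc P l p" and ?Dq = "Q_adj q - Q_loc_adj P l q"
  have DpW: "?Dp \<in> W_h P" by (rule W_h_diff[OF Q_ideal_W[OF pV] Q_loc_W[OF pV]])
  have DqW: "?Dq \<in> W_h P" by (rule defect_adj_W[OF qV])
  obtain rp where rp: "rp \<in> W_h P" "?Dp - rp \<in> Ehat" "\<And>w. w \<in> Ehat \<Longrightarrow> aform P rp w = 0"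
    "norm_k P rp \<le> LW * norm_k P ?Dp"
    by (rule primal_residual[OF DpW]) blast
  obtain rq where rq: "rq \<in> W_h P" "?Dq - rq \<in> Ehat" "\<And>w. w \<in> Ehat \<Longrightarrow> aform P w rq = 0"
    "norm_k P rq \<le> LW * norm_k P ?Dq"
    by (rule adjoint_residual[OF DqW]) blast
  define n where "n = norm_k P p"
  have n0: "0 \<le> n" unfolding n_def by (rule norm_k_nonneg)
  have Dp_le: "norm_k P ?Dp \<le> \<delta> * n" unfolding n_def by (rule defect_facts(2)[OF pw(1)])
  have Dq_le: "norm_k P ?Dq \<le> \<delta> * n" unfolding n_def q(2)[symmetric] by (rule defect_adj[OF q(1)])
  have rp_le: "norm_k P rp \<le> LW * (\<delta> * n)"
    by (rule order_trans[OF rp(4) mult_left_mono[OF Dp_le lambda_W_nonneg]])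
  have rq_le: "norm_k P rq \<le> LW * (\<delta> * n)"
    by (rule order_trans[OF rq(4) mult_left_mono[OF Dq_le lambda_W_nonneg]])
  \<comment> \<open>the part of the defect that can be represented in \<open>Ehat\<close> is absorbed into the enrichment coordinate\<close>
  define wt where "wt = w + (?Dp - rp)"
  have wtE: "wt \<in> Ehat" unfolding wt_def by (rule cvs.subspace_add[OF Ehat_subspace pw(2) rp(2)])
  have wtW: "wt \<in> W_h P" by (rule subsetD[OF Ehat_W wtE])
  define tp where "tp = p - Q_ideal P p"
  define tq where "tq = q - Q_adj q"
  have tpV: "tp \<in> V_h P" unfolding tp_def by (rule V_h_diff[OF pV W_V[OF Q_ideal_W[OF pV]]])
  have tqV: "tq \<in> V_h P" unfolding tq_def by (rule V_h_diff[OF qV W_V[OF Q_adj_W[OF qV]]])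
  have v_eq: "v = tp + (rp + wt)" unfolding pw(3) T_op_def tp_def wt_def by simp
  define y where "y = tq + (rq + wt)"
  have y_eq: "y = T_op_adj P l q + (wt - (?Dq - rq))" unfolding y_def T_op_adj_def tq_def by simp
  have yY: "y \<in> Y_enr P l E"
  proof -
    have "wt - (?Dq - rq) \<in> Ehat" by (rule cvs.subspace_diff[OF Ehat_subspace wtE rq(2)])
    moreover have "T_op_adj P l q \<in> Y0 P l" unfolding Y0_def by (rule imageI[OF q(1)])
    ultimately show ?thesis unfolding Y_enr_def y_eq by blast
  qed
  define k where "k = norm_k P wt"
  have k0: "0 \<le> k" unfolding k_def by (rule norm_k_nonneg)
  have form: "aform P v y = aform P tp tq + aform P rp rq + aform P wt wt"
    unfolding v_eq y_def
    by (rule block_diagonal_form[OF tpV tqV rp(1) rq(1) wtW])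
      (simp_all add: tp_def tq_def T_inf_orthogonal pV qV rp(3)[OF wtE] rq(3)[OF wtE])
  have cross: "cmod (aform P rp rq) \<le> t * n\<^sup>2"
  proof -
    have "aform P rp rq = aform P rp ?Dq"
      using a_diff_right[OF W_V[OF DqW] W_V[OF rq(1)] W_V[OF rp(1)]] rp(3)[OF rq(2)] by simp
    then have "cmod (aform P rp rq) \<le> Ca * norm_k P rp * norm_k P ?Dq"
      using aform_bound[OF W_V[OF rp(1)] W_V[OF DqW]] by simp
    also have "\<dots> \<le> Ca * (LW * (\<delta> * n)) * (\<delta> * n)"
      by (intro mult_mono rp_le Dq_le mult_nonneg_nonneg Ca_nonneg lambda_W_nonneg defect_facts(1) n0 norm_k_nonneg order_refl)
    also have "\<dots> = t * n\<^sup>2" unfolding t_def lambda_W_def by (simp add: power2_eq_square)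
    finally show ?thesis .
  qed
  define \<mu> where "\<mu> = min r cW"
  have \<mu>: "0 < \<mu>" "\<mu> \<le> r" "\<mu> \<le> cW" unfolding \<mu>_def using r(1) c_W_pos by auto
  have lower: "\<mu> * (n\<^sup>2 + k\<^sup>2) \<le> cmod (aform P v y)"
  proof -
    have "\<mu> * (n\<^sup>2 + k\<^sup>2) \<le> r * n\<^sup>2 + cW * k\<^sup>2"
      using mult_right_mono[OF \<mu>(2), of "n\<^sup>2"] mult_right_mono[OF \<mu>(3), of "k\<^sup>2"] by (simp add: distrib_left)
    also have "\<dots> \<le> Re (aform P tp tq) + Re (aform P rp rq) + Re (aform P wt wt)"
      using q(3)[folded tp_def tq_def n_def] cross abs_Re_le_cmod[of "aform P rp rq"] W_coercive[OF wtW, folded k_def]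
      by (simp add: distrib_right)
    also have "\<dots> = Re (aform P v y)" unfolding form by simp
    also have "\<dots> \<le> cmod (aform P v y)" by (rule complex_Re_le_cmod)
    finally show ?thesis .
  qed
  have L0: "0 \<le> Lc"
    unfolding L_stab_def using C_F_ge_1 lambda_W_nonneg defect_facts(1)[of l] by (simp add: add_nonneg_nonneg)
  have nv: "norm_k P v \<le> Lc * n + k"
  proof -
    have "norm_k P v \<le> norm_k P tp + (norm_k P rp + k)"
      unfolding v_eq k_def
      using norm_k_triangle[OF tpV V_h_add[OF W_V[OF rp(1)] W_V[OF wtW]]] norm_k_triangle[OF W_V[OF rp(1)] W_V[OF wtW]]
      by linarith
    also have "\<dots> \<le> C_F P Capp Ca * n + (LW * (\<delta> * n) + k)"
      using T_inf_bound(1)[OF pV, folded tp_def n_def] rp_le by linarith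
    finally show ?thesis unfolding L_stab_def by (simp add: algebra_simps)
  qed
  have ny: "norm_k P y \<le> Lc * n + k"
  proof -
    have "norm_k P y \<le> norm_k P tq + (norm_k P rq + k)"
      unfolding y_def k_def
      using norm_k_triangle[OF tqV V_h_add[OF W_V[OF rq(1)] W_V[OF wtW]]] norm_k_triangle[OF W_V[OF rq(1)] W_V[OF wtW]]
      by linarith
    also have "\<dots> \<le> C_F P Capp Ca * n + (LW * (\<delta> * n) + k)"
      using T_inf_bound(2)[OF qV, folded tq_def, unfolded q(2), folded n_def] rq_le by linarith
    finally show ?thesis unfolding L_stab_def by (simp add: algebra_simps)
  qed
  have upper: "norm_k P v * norm_k P y \<le> (1 + Lc\<^sup>2) * (n\<^sup>2 + k\<^sup>2)"
  proof -
    have "norm_k P v * norm_k P y \<le> (Lc * n + k) * (Lc * n + k)"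
      by (intro mult_mono nv ny norm_k_nonneg add_nonneg_nonneg mult_nonneg_nonneg L0 n0 k0)
    \<comment> \<open>the Cauchy-Schwarz inequality for the vectors \<open>(Lc, 1)\<close> and \<open>(n, k)\<close>\<close>
    also have "\<dots> \<le> (1 + Lc\<^sup>2) * (n\<^sup>2 + k\<^sup>2)"
    proof -
      have "(1 + Lc\<^sup>2) * (n\<^sup>2 + k\<^sup>2) - (Lc * n + k) * (Lc * n + k) = (n - Lc * k)\<^sup>2"
        by (simp add: power2_eq_square algebra_simps)
      then show ?thesis using zero_le_power2[of "n - Lc * k"] by linarith
    qed
    finally show ?thesis .
  qed
  have vV: "v \<in> V_h P" by (rule subsetD[OF X_enr_V v(1)])
  have nvpos: "0 < norm_k P v" by (rule norm_k_pos[OF vV v(2)])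
  have "n \<noteq> 0 \<or> k \<noteq> 0" using nv nvpos by auto
  then have N: "0 < n\<^sup>2 + k\<^sup>2" by (metis sum_power2_gt_zero_iff)
  have "0 < cmod (aform P v y)" using lower mult_pos_pos[OF \<mu>(1) N] by linarith
  then have y0: "y \<noteq> 0" using sesq_zero_right[OF aform_sesq vV V_h_zero] by auto
  have nypos: "0 < norm_k P y" by (rule norm_k_pos[OF subsetD[OF Y_enr_V yY] y0])
  have "\<mu> / (1 + Lc\<^sup>2) * (norm_k P v * norm_k P y) \<le> \<mu> / (1 + Lc\<^sup>2) * ((1 + Lc\<^sup>2) * (n\<^sup>2 + k\<^sup>2))"
    using \<mu>(1) by (intro mult_left_mono upper) (simp add: add_nonneg_nonneg)
  also have "\<dots> = \<mu> * (n\<^sup>2 + k\<^sup>2)"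
  proof -
    have "1 + Lc\<^sup>2 > 0" by (simp add: add_pos_nonneg)
    then show ?thesis by simp
  qed
  also have "\<dots> \<le> cmod (aform P v y)" by (rule lower)
  finally have "\<mu> / (1 + Lc\<^sup>2) \<le> cmod (aform P v y) / (norm_k P v * norm_k P y)"
    using nvpos nypos by (simp add: pos_le_divide_eq mult_pos_pos)
  then show ?thesis using that[OF yY y0] unfolding \<mu>_def by blast
qed

text \<open>
  The minimum is finite because \<open>c\<^sub>W\<close> is, even if the ideal inf-sup constant is infinite.
\<close>

lemma min_stability:
  obtains \<mu> where "min (m_stab P Capp Ca l) (ereal cW) = ereal \<mu>" "0 < \<mu>"
proof -
  have "0 < min (m_stab P Capp Ca l) (ereal cW)" using m_pos c_W_pos by simp
  moreover have "min (m_stab P Capp Ca l) (ereal cW) \<le> ereal cW" by simp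
  ultimately obtain \<mu> where "min (m_stab P Capp Ca l) (ereal cW) = ereal \<mu>"
    by (cases "min (m_stab P Capp Ca l) (ereal cW)") auto
  with \<open>0 < min (m_stab P Capp Ca l) (ereal cW)\<close> show ?thesis using that by simp
qed

text \<open>
  The test functions constructed above give the bound for every \<open>r < m\<^sub>\<ell>\<close>; it remains to let \<open>r\<close> increase to \<open>m\<^sub>\<ell>\<close>.
\<close>

lemma sup_lower_bound:
  assumes v: "v \<in> X_enr P l E" "v \<noteq> 0" and \<mu>: "min (m_stab P Capp Ca l) (ereal cW) = ereal \<mu>" "0 < \<mu>"
  shows "ereal (\<mu> / (1 + Lc\<^sup>2)) \<le> (SUP y\<in>Y_enr P l E - {0}. ereal (cmod (aform P v y) / (norm_k P v * norm_k P y)))"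
proof (rule ereal_le_real)
  fix z :: real
  assume z: "ereal z \<ge> (SUP y\<in>Y_enr P l E - {0}. ereal (cmod (aform P v y) / (norm_k P v * norm_k P y)))"
  have L: "0 < 1 + Lc\<^sup>2" by (simp add: add_pos_nonneg)
  have "\<mu> \<le> z * (1 + Lc\<^sup>2)"
  proof (rule dense_le_bounded[OF \<mu>(2)])
    fix r assume r: "0 < r" "r < \<mu>"
    have "ereal r < min (m_stab P Capp Ca l) (ereal cW)" unfolding \<mu>(1) using r(2) by simp
    then have rm: "ereal r < m_stab P Capp Ca l" and rc: "r < cW" by simp_all
    obtain y where y: "y \<in> Y_enr P l E" "y \<noteq> 0"
      "min r cW / (1 + Lc\<^sup>2) \<le> cmod (aform P v y) / (norm_k P v * norm_k P y)"
      by (rule inf_sup_test_function[OF v r(1) rm])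
    have "ereal (cmod (aform P v y) / (norm_k P v * norm_k P y)) \<le> ereal z"
      by (rule order_trans[OF SUP_upper z]) (use y in simp)
    then have "r / (1 + Lc\<^sup>2) \<le> z" using y(3) rc by simp
    then show "r \<le> z * (1 + Lc\<^sup>2)" using L by (simp add: pos_divide_le_eq)
  qed
  then show "ereal (\<mu> / (1 + Lc\<^sup>2)) \<le> ereal z" using L by (simp add: pos_divide_le_eq)
qed

text \<open>
  The inf-sup bound excludes a nontrivial kernel, and trial and test space have the same dimension.
\<close>

lemma coupled_solution_ex1:
  assumes F: "F \<in> antidual P (V_space P)"
  shows "\<exists>!U. coupled_solution P l E F U"
  unfolding coupled_solution_def
proof (rule galerkin_solvable[OF X_enr_fin_dim Y_enr_fin_dim])
  show "cvs.dim (Y_enr P l E) \<le> cvs.dim (X_enr P l E)" unfolding X_enr_dim Y_enr_dim ..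
  show "linear_form_on (X_enr P l E) (\<lambda>x. aform P x y)" if "y \<in> Y_enr P l E" for y
    by (rule linear_form_on_subset[OF _ X_enr_V])
      (use aform_sesq subsetD[OF Y_enr_V that] in \<open>simp add: sesquilinear_on_def\<close>)
  show "antilinear_form_on (Y_enr P l E) (aform P x)" if "x \<in> X_enr P l E" for x
    by (rule antilinear_form_on_subset[OF _ Y_enr_V])
      (use aform_sesq subsetD[OF X_enr_V that] in \<open>simp add: sesquilinear_on_def\<close>)
  have "antilinear_form_on (V_space P) F"
    using F unfolding antidual_def antilinear_form_on_def by blast
  then show "antilinear_form_on (Y_enr P l E) F"
    by (rule antilinear_form_on_subset[OF _ subset_trans[OF Y_enr_V V_h_subset_V_space]])
  show "x = 0" if x: "x \<in> X_enr P l E" and zero: "\<And>y. y \<in> Y_enr P l E \<Longrightarrow> aform P x y = 0" for x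
  proof (rule ccontr)
    assume x0: "x \<noteq> 0"
    obtain r where r: "0 < r" "ereal r < m_stab P Capp Ca l"
      using ereal_dense2[OF m_pos] by (auto simp: zero_ereal_def)
    obtain y where y: "y \<in> Y_enr P l E" "y \<noteq> 0"
      "min r cW / (1 + Lc\<^sup>2) \<le> cmod (aform P x y) / (norm_k P x * norm_k P y)"
      by (rule inf_sup_test_function[OF x x0 r])
    have "0 < min r cW / (1 + Lc\<^sup>2)" using r(1) c_W_pos by (simp add: add_pos_nonneg)
    then show False using y(3) zero[OF y(1)] by simp
  qed
qed

text \<open>
  For every trial function \<open>v\<close> the difference \<open>U - v\<close> is tested by the same values as \<open>u - v\<close>, by Galerkin orthogonality.
\<close>

lemma quasi_optimality:
  assumes u: "u \<in> V_h P" "\<And>v. v \<in> V_h P \<Longrightarrow> aform P u v = F v" and U: "coupled_solution P l E F U"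
    and \<mu>: "min (m_stab P Capp Ca l) (ereal cW) = ereal \<mu>" "0 < \<mu>"
  shows "norm_k P (u - U) \<le> (1 + Ca * (1 + Lc\<^sup>2) / \<mu>) * (INF v\<in>X_enr P l E. norm_k P (u - v))"
proof -
  define K where "K = 1 + Ca * (1 + Lc\<^sup>2) / \<mu>"
  have L: "0 < 1 + Lc\<^sup>2" by (simp add: add_pos_nonneg)
  have K: "1 \<le> K" unfolding K_def using Ca_nonneg \<mu>(2) L by simp
  have UX: "U \<in> X_enr P l E" and Ueq: "\<And>y. y \<in> Y_enr P l E \<Longrightarrow> aform P U y = F y"
    using U unfolding coupled_solution_def by blast+
  have UV: "U \<in> V_h P" by (rule subsetD[OF X_enr_V UX])
  have le: "norm_k P (u - U) / K \<le> norm_k P (u - v)" if v: "v \<in> X_enr P l E" for v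
  proof -
    have vV: "v \<in> V_h P" by (rule subsetD[OF X_enr_V v])
    define e where "e = U - v"
    have eX: "e \<in> X_enr P l E" unfolding e_def by (rule cvs.subspace_diff[OF fin_dim_subspaceD[OF X_enr_fin_dim] UX v])
    have eV: "e \<in> V_h P" by (rule subsetD[OF X_enr_V eX])
    have uvV: "u - v \<in> V_h P" by (rule V_h_diff[OF u(1) vV])
    have ne: "\<mu> / (1 + Lc\<^sup>2) * norm_k P e \<le> Ca * norm_k P (u - v)"
    proof (cases "e = 0")
      case True
      then show ?thesis using Ca_nonneg by (simp add: norm_k_zero norm_k_nonneg)
    next
      case False
      have epos: "0 < norm_k P e" by (rule norm_k_pos[OF eV False])
      have "ereal (\<mu> / (1 + Lc\<^sup>2)) \<le> (SUP y\<in>Y_enr P l E - {0}. ereal (cmod (aform P e y) / (norm_k P e * norm_k P y)))"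
        by (rule sup_lower_bound[OF eX False \<mu>])
      also have "\<dots> \<le> ereal (Ca * norm_k P (u - v) / norm_k P e)"
      proof (rule SUP_least)
        fix y assume y: "y \<in> Y_enr P l E - {0}"
        have yV: "y \<in> V_h P" using y Y_enr_V by blast
        have ypos: "0 < norm_k P y" using norm_k_pos[OF yV] y by simp
        have "aform P e y = aform P (u - v) y"
          unfolding e_def using a_diff_left[OF UV vV yV] a_diff_left[OF u(1) vV yV] Ueq[of y] u(2)[OF yV] y by simp
        then have "cmod (aform P e y) \<le> Ca * norm_k P (u - v) * norm_k P y" using aform_bound[OF uvV yV] by simp
        then have "cmod (aform P e y) / norm_k P y \<le> Ca * norm_k P (u - v)"
          using ypos by (simp add: pos_divide_le_eq)
        then have "cmod (aform P e y) / norm_k P y / norm_k P e \<le> Ca * norm_k P (u - v) / norm_k P e"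
          using epos by (intro divide_right_mono) auto
        then show "ereal (cmod (aform P e y) / (norm_k P e * norm_k P y)) \<le> ereal (Ca * norm_k P (u - v) / norm_k P e)"
          by (simp add: mult.commute)
      qed
      finally show ?thesis using epos by (simp add: pos_le_divide_eq)
    qed
    have "norm_k P e = ((1 + Lc\<^sup>2) / \<mu>) * (\<mu> / (1 + Lc\<^sup>2) * norm_k P e)" using \<mu>(2) L by simp
    also have "\<dots> \<le> ((1 + Lc\<^sup>2) / \<mu>) * (Ca * norm_k P (u - v))" using \<mu>(2) L by (intro mult_left_mono ne) simp
    finally have e_le: "norm_k P e \<le> Ca * (1 + Lc\<^sup>2) / \<mu> * norm_k P (u - v)" by (simp add: mult_ac)
    have eq: "u - U = (u - v) - e" unfolding e_def by simp
    have "norm_k P (u - U) \<le> norm_k P (u - v) + norm_k P e"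
      unfolding eq by (rule norm_k_triangle_diff[OF uvV eV])
    also have "\<dots> \<le> K * norm_k P (u - v)" unfolding K_def distrib_right using e_le by simp
    finally show ?thesis using K by (simp add: pos_divide_le_eq mult.commute)
  qed
  have "norm_k P (u - U) / K \<le> (INF v\<in>X_enr P l E. norm_k P (u - v))"
    by (rule cINF_greatest) (use UX le in auto)
  then have "norm_k P (u - U) \<le> K * (INF v\<in>X_enr P l E. norm_k P (u - v))"
    using K by (simp add: pos_divide_le_eq mult.commute)
  then show ?thesis unfolding K_def .
qed

end

theorem proposition4p1:
  fixes P :: helmholtz_data
    and \<kappa> kmin Ca Capp CI Csd chi0 :: real
    and l :: enat
    and F :: "'p \<Rightarrow> cfun \<Rightarrow> complex"
    and u :: "'p \<Rightarrow> cfun"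
  assumes setting: "helmholtz_setting \<kappa> P"
    and k_lower_bound: "0 < kmin" "kmin \<le> wavenumber P"
    and Ca: "continuity_constant P Ca"
    and Capp: "approximation_constant P Capp"
    and CI: "stability_constant P CI"
    and Csd: "decomposition_constant P Csd"
    and load: "\<And>\<mu>. F \<mu> \<in> antidual P (V_space P)"
    and fine_solution: "\<And>\<mu>. u \<mu> \<in> V_h P" "\<And>\<mu> v. v \<in> V_h P \<Longrightarrow> aform P (u \<mu>) v = F \<mu> v"
    and resolution: "chi_res P Capp \<le> chi0" "chi0 < 1"
    and fine_stability: "gamma_h P > 0"
  shows
    "(\<forall>w\<in>ker_I P. Re (aform P w w) \<ge> c_W P Capp * (norm_k P w)\<^sup>2) \<and>
     (\<forall>\<rho>stab Crob. 0 < \<rho>stab \<and> \<rho>stab < 1 \<and>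
       ereal (Ca\<^sup>2 / c_W P Capp * (Csd / c_W P Capp * Theta P l)\<^sup>2)
         \<le> ereal \<rho>stab * (gamma_h P / ereal (C_F P Capp Ca * CI\<^sup>2)) \<and>
       ereal (Csd / c_W P Capp * Theta P l) \<le> ereal Crob * gamma_h P
       \<longrightarrow> m_stab P Capp Ca l > 0) \<and>
     (m_stab P Capp Ca l > 0 \<longrightarrow>
       (\<forall>E. fin_dim_subspace E \<and> E \<subseteq> X0_perp P l \<longrightarrow>
          cvs.dim (X_enr P l E) = cvs.dim (V_H P) + cvs.dim E \<and>
          cvs.dim (Y_enr P l E) = cvs.dim (V_H P) + cvs.dim E \<and>
          (\<forall>\<mu>. \<exists>!U. coupled_solution P l E (F \<mu>) U) \<and>
          infsup P (X_enr P l E) (Y_enr P l E)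
            \<ge> min (m_stab P Capp Ca l) (ereal (c_W P Capp)) / ereal (1 + (L_stab P Capp Ca l)\<^sup>2) \<and>
          (\<forall>\<mu> U. coupled_solution P l E (F \<mu>) U \<longrightarrow>
             ereal (norm_k P (u \<mu> - U))
               \<le> (1 + ereal (Ca * (1 + (L_stab P Capp Ca l)\<^sup>2)) /
                        min (m_stab P Capp Ca l) (ereal (c_W P Capp))) *
                 ereal (INF v\<in>X_enr P l E. norm_k P (u \<mu> - v)))))"
proof (intro conjI impI allI ballI)
  interpret helmholtz_stable P \<kappa> Ca Capp CI Csd
    by unfold_locales (use assms in auto)
  show "c_W P Capp * (norm_k P w)\<^sup>2 \<le> Re (aform P w w)" if "w \<in> ker_I P" for w
    by (rule kernel_coercive[OF Capp that])
  show "m_stab P Capp Ca l > 0"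
    if "0 < \<rho>stab \<and> \<rho>stab < 1 \<and>
       ereal (Ca\<^sup>2 / c_W P Capp * (Csd / c_W P Capp * Theta P l)\<^sup>2)
         \<le> ereal \<rho>stab * (gamma_h P / ereal (C_F P Capp Ca * CI\<^sup>2)) \<and>
       ereal (Csd / c_W P Capp * Theta P l) \<le> ereal Crob * gamma_h P" for \<rho>stab Crob
    using m_stab_positive[OF fine_stability, of \<rho>stab l] that by blast
  fix E assume m: "m_stab P Capp Ca l > 0" and E: "fin_dim_subspace E \<and> E \<subseteq> X0_perp P l"
  interpret enrichment P \<kappa> Ca Capp CI Csd l E
    by unfold_locales (use m E in auto)
  obtain \<nu> where \<nu>: "min (m_stab P Capp Ca l) (ereal (c_W P Capp)) = ereal \<nu>" "0 < \<nu>"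
    by (rule min_stability)
  have L: "0 < 1 + (L_stab P Capp Ca l)\<^sup>2" by (simp add: add_pos_nonneg)
  show "cvs.dim (X_enr P l E) = cvs.dim (V_H P) + cvs.dim E" by (rule X_enr_dim)
  show "cvs.dim (Y_enr P l E) = cvs.dim (V_H P) + cvs.dim E" by (rule Y_enr_dim)
  show "\<exists>!U. coupled_solution P l E (F \<mu>) U" for \<mu> by (rule coupled_solution_ex1[OF load])
  show "infsup P (X_enr P l E) (Y_enr P l E)
      \<ge> min (m_stab P Capp Ca l) (ereal (c_W P Capp)) / ereal (1 + (L_stab P Capp Ca l)\<^sup>2)"
    unfolding infsup_def \<nu>(1) ereal_divide_pos[OF L]
    by (rule INF_greatest) (rule sup_lower_bound[OF _ _ \<nu>], auto)
  show "ereal (norm_k P (u \<mu> - U))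
      \<le> (1 + ereal (Ca * (1 + (L_stab P Capp Ca l)\<^sup>2)) / min (m_stab P Capp Ca l) (ereal (c_W P Capp))) *
         ereal (INF v\<in>X_enr P l E. norm_k P (u \<mu> - v))"
    if "coupled_solution P l E (F \<mu>) U" for \<mu> U
    unfolding \<nu>(1) ereal_divide_pos[OF \<nu>(2)]
    using quasi_optimality[OF fine_solution that \<nu>] by (simp add: one_ereal_def)
qed

end
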